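(* For a Waldhausen category $\mathcal{C}$, the $S_\bullet$-construction produces a symmetric spectrum of simplicial sets $K(\mathcal{C})$ which is flat but not projective cofibrant.
   Context: Symmetric spectra are symmetric spectra of (pointed) simplicial sets: $X$ consists of pointed $\Sigma_n$-simplicial sets $X_n$ and structure maps $\sigma:X_n\wedge S^1\to X_{n+1}$ whose iterates $\sigma_k:X_n\wedge S^k\to X_{n+k}$ are $\Sigma_n\times\Sigma_k$-equivariant; $S^1=\Delta^1/\partial\Delta^1$ and $S^k=(S^1)^{\wedge k}$. $\mathbb{S}$ is the sphere spectrum and $\bar{\mathbb{S}}$ is the truncated sphere spectrum: a point in degree $0$ and $S^q$ in degree $q>0$. Put $L_n^TX=(X\wedge\bar{\mathbb{S}})_n$, and let $\nu_n^T:L_n^TX\to X_n$ be induced by $\bar{\mathbb{S}}\to\mathbb{S}$. $X$ is flat (cofibrant in the stable flat model structure) if for all $n\ge 0$ the map $\nu_n^T$ is a cofibration of $\Sigma_n$-simplicial sets, i.e. a monomorphism. $X$ is projective, or projective cofibrant (cofibrant in the stable projective model structure), if for all $n\ge 0$ the map $\nu_n^T$ is a free $\Sigma_n$-cofibration, i.e. a monomorphism such that $\Sigma_n$ acts freely on the complement of its image. Waldhausen categories have a chosen (distinguished) zero object $0$; other zero objects may exist. $\mathrm{Ar}[n]$ is the poset of pairs $(i,j)$, $0\le i\le j\le n$, with $(i,j)\le(i',j')$ iff $i\le i'$ and $j\le j'$. $S_n\mathcal{C}$ is Waldhausen's category of functors $A:\mathrm{Ar}[n]\to\mathcal{C}$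 with $A(i,i)=0$ (the distinguished zero), $A(i,j)\to A(i,k)$ a cofibration, and $A(j,k)$ the pushout of $A(j,j)\leftarrow A(i,j)\to A(i,k)$ for $i\le j\le k$, with its usual Waldhausen structure. $S^{(q)}_{n_1,\dots,n_q}\mathcal{C}$ is the $q$-fold iterate, a category of functors $\mathrm{Ar}[n_1]\times\cdots\times\mathrm{Ar}[n_q]\to\mathcal{C}$ ($S^{(0)}\mathcal{C}=\mathcal{C}$). $K(\mathcal{C})_q$ is the diagonal of the multisimplicial set $(p,n_1,\dots,n_q)\mapsto N_p\,wS^{(q)}_{n_1,\dots,n_q}\mathcal{C}$ ($w$ = subcategory of weak equivalences, $N$ = nerve), pointed by the zero diagram; $\Sigma_q$ permutes the factors $\mathrm{Ar}[n_r]$. The structure map sends $(A,\delta)$, with $\delta:[m]\to[1]$ an $m$-simplex of $S^1$, to the diagram with value $A(c)$ at $(c,(i,j))$ if $\delta(i)=0,\delta(j)=1$, and $0$ otherwise (with identity and zero maps in the new direction).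
   Formalization: That K(C) is not projective cofibrant is stated only for Waldhausen categories having an object other than the distinguished zero; if the distinguished zero is the only object, K(C) is a point in every level and is projective cofibrant. *)

theory Defs
  imports "HOL-Library.FuncSet" "HOL-Combinatorics.Permutations"
begin

section \<open>Waldhausen categories\<close>

record ('o, 'm) cat =
  Obj :: "'o set"
  Arr :: "'m set"
  Dom :: "'m \<Rightarrow> 'o"
  Cod :: "'m \<Rightarrow> 'o"
  Ident :: "'o \<Rightarrow> 'm"
  Comp :: "'m \<Rightarrow> 'm \<Rightarrow> 'm"  (* Comp C g f is g after f *)

definition hom :: "('o, 'm, 'x) cat_scheme \<Rightarrow> 'o \<Rightarrow> 'o \<Rightarrow> 'm set" where
  "hom C a b = {f \<in> Arr C. Dom C f = a \<and> Cod C f = b}"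

locale category =
  fixes C :: "('o, 'm, 'x) cat_scheme"
  assumes Dom_closed: "f \<in> Arr C \<Longrightarrow> Dom C f \<in> Obj C"
    and Cod_closed: "f \<in> Arr C \<Longrightarrow> Cod C f \<in> Obj C"
    and Ident_hom: "a \<in> Obj C \<Longrightarrow> Ident C a \<in> hom C a a"
    and Comp_hom: "f \<in> hom C a b \<Longrightarrow> g \<in> hom C b c \<Longrightarrow> Comp C g f \<in> hom C a c"
    and Comp_Ident_left: "f \<in> hom C a b \<Longrightarrow> Comp C (Ident C b) f = f"
    and Comp_Ident_right: "f \<in> hom C a b \<Longrightarrow> Comp C f (Ident C a) = f"
    and Comp_assoc: "f \<in> hom C a b \<Longrightarrow> g \<in> hom C b c \<Longrightarrow> h \<in> hom C c d
      \<Longrightarrow> Comp C h (Comp C g f) = Comp C (Comp C h g) f"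

definition is_iso :: "('o, 'm, 'x) cat_scheme \<Rightarrow> 'm \<Rightarrow> bool" where
  "is_iso C f \<longleftrightarrow> f \<in> Arr C \<and> (\<exists>g \<in> hom C (Cod C f) (Dom C f).
     Comp C g f = Ident C (Dom C f) \<and> Comp C f g = Ident C (Cod C f))"

(* The square with  f : a --> b,  g : a --> c,  u : b --> p,  v : c --> p. *)
definition is_pushout :: "('o, 'm, 'x) cat_scheme \<Rightarrow> 'm \<Rightarrow> 'm \<Rightarrow> 'm \<Rightarrow> 'm \<Rightarrow> bool" where
  "is_pushout C f g u v \<longleftrightarrow>
     {f, g, u, v} \<subseteq> Arr C \<and> Dom C f = Dom C g \<and> Dom C u = Cod C f \<and> Dom C v = Cod C g \<and>
     Cod C u = Cod C v \<and> Comp C u f = Comp C v g \<and>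
     (\<forall>z \<in> Obj C. \<forall>s \<in> hom C (Cod C f) z. \<forall>t \<in> hom C (Cod C g) z. Comp C s f = Comp C t g \<longrightarrow>
        (\<exists>!h. h \<in> hom C (Cod C u) z \<and> Comp C h u = s \<and> Comp C h v = t))"

record ('o, 'm) wcat = "('o, 'm) cat" +
  Zero :: 'o
  Cofib :: "'m set"
  Weq :: "'m set"

locale waldhausen_category = category C for C :: "('o, 'm) wcat" +
  assumes Zero_Obj: "Zero C \<in> Obj C"
    and Zero_initial: "a \<in> Obj C \<Longrightarrow> \<exists>!f. f \<in> hom C (Zero C) a"
    and Zero_terminal: "a \<in> Obj C \<Longrightarrow> \<exists>!f. f \<in> hom C a (Zero C)"
    and Cofib_Arr: "Cofib C \<subseteq> Arr C"
    and Cofib_Comp: "f \<in> Cofib C \<Longrightarrow> g \<in> Cofib C \<Longrightarrow> Dom C g = Cod C f \<Longrightarrow> Comp C g f \<in> Cofib C"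
    and Cofib_iso: "is_iso C f \<Longrightarrow> f \<in> Cofib C"
    and Cofib_Zero: "a \<in> Obj C \<Longrightarrow> f \<in> hom C (Zero C) a \<Longrightarrow> f \<in> Cofib C"
    and Cofib_pushout: "f \<in> Cofib C \<Longrightarrow> g \<in> Arr C \<Longrightarrow> Dom C g = Dom C f
      \<Longrightarrow> \<exists>u v. is_pushout C f g u v \<and> v \<in> Cofib C"
    and Weq_Arr: "Weq C \<subseteq> Arr C"
    and Weq_Comp: "f \<in> Weq C \<Longrightarrow> g \<in> Weq C \<Longrightarrow> Dom C g = Cod C f \<Longrightarrow> Comp C g f \<in> Weq C"
    and Weq_iso: "is_iso C f \<Longrightarrow> f \<in> Weq C"
    and Weq_gluing: "\<lbrakk> f \<in> Cofib C; f' \<in> Cofib C; is_pushout C f g u v; is_pushout C f' g' u' v';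
        wa \<in> Weq C; wb \<in> Weq C; wc \<in> Weq C;
        wa \<in> hom C (Dom C f) (Dom C f'); wb \<in> hom C (Cod C f) (Cod C f');
        wc \<in> hom C (Cod C g) (Cod C g');
        Comp C wb f = Comp C f' wa; Comp C wc g = Comp C g' wa;
        h \<in> hom C (Cod C u) (Cod C u');
        Comp C h u = Comp C u' wb; Comp C h v = Comp C v' wc \<rbrakk> \<Longrightarrow> h \<in> Weq C"

section \<open>Diagrams\<close>

text \<open>A poset is given by its (reflexive) order relation \<open>P\<close>; its set of elements is \<open>Field P\<close>.
  A diagram consists of its values on elements and on related pairs. Functions are extensional, so
  that equality of diagrams is equality of functors. A natural transformation is a triple
  (source, components, target).\<close>

type_synonym ('j, 'o, 'm) diag = "('j \<Rightarrow> 'o) \<times> ('j \<times> 'j \<Rightarrow> 'm)"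
type_synonym ('j, 'o, 'm) diag_map = "('j, 'o, 'm) diag \<times> ('j \<Rightarrow> 'm) \<times> ('j, 'o, 'm) diag"

definition is_diag :: "('j \<times> 'j) set \<Rightarrow> ('o, 'm, 'x) cat_scheme \<Rightarrow> ('j, 'o, 'm) diag \<Rightarrow> bool" where
  "is_diag P C A \<longleftrightarrow>
     fst A \<in> Field P \<rightarrow>\<^sub>E Obj C \<and> snd A \<in> extensional P \<and>
     (\<forall>(x, y) \<in> P. snd A (x, y) \<in> hom C (fst A x) (fst A y)) \<and>
     (\<forall>x \<in> Field P. snd A (x, x) = Ident C (fst A x)) \<and>
     (\<forall>x y z. (x, y) \<in> P \<longrightarrow> (y, z) \<in> P \<longrightarrow> snd A (x, z) = Comp C (snd A (y, z)) (snd A (x, y)))"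

definition is_diag_map :: "('j \<times> 'j) set \<Rightarrow> ('o, 'm, 'x) cat_scheme \<Rightarrow> ('j, 'o, 'm) diag_map \<Rightarrow> bool"
  where
  "is_diag_map P C = (\<lambda>(A, t, B).
     is_diag P C A \<and> is_diag P C B \<and> t \<in> extensional (Field P) \<and>
     (\<forall>x \<in> Field P. t x \<in> hom C (fst A x) (fst B x)) \<and>
     (\<forall>(x, y) \<in> P. Comp C (t y) (snd A (x, y)) = Comp C (snd B (x, y)) (t x)))"

definition const_diag :: "('j \<times> 'j) set \<Rightarrow> ('o, 'm, 'x) cat_scheme \<Rightarrow> 'o \<Rightarrow> ('j, 'o, 'm) diag" where
  "const_diag P C a = ((\<lambda>x \<in> Field P. a), (\<lambda>p \<in> P. Ident C a))"

text \<open>The full subcategory, on the diagrams satisfying \<open>ok\<close>, of the functor category, with the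
  zero diagram as zero object and with the given cofibrations and weak equivalences.\<close>

definition diag_wcat ::
  "('j \<times> 'j) set \<Rightarrow> ('o, 'm) wcat \<Rightarrow> (('j, 'o, 'm) diag \<Rightarrow> bool) \<Rightarrow> (('j, 'o, 'm) diag_map \<Rightarrow> bool)
    \<Rightarrow> (('j, 'o, 'm) diag_map \<Rightarrow> bool) \<Rightarrow> (('j, 'o, 'm) diag, ('j, 'o, 'm) diag_map) wcat" where
  "diag_wcat P C ok co we =
    (let obs = {A. is_diag P C A \<and> ok A};
         maps = {(A, t, B). is_diag_map P C (A, t, B) \<and> ok A \<and> ok B}
     in \<lparr> Obj = obs, Arr = maps,
          Dom = (\<lambda>(A, t, B). A), Cod = (\<lambda>(A, t, B). B),
          Ident = (\<lambda>A. (A, (\<lambda>x \<in> Field P. Ident C (fst A x)), A)),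
          Comp = (\<lambda>(B', s, D) (A, t, B). (A, (\<lambda>x \<in> Field P. Comp C (s x) (t x)), D)),
          Zero = const_diag P C (Zero C),
          Cofib = {f \<in> maps. co f}, Weq = {f \<in> maps. we f} \<rparr>)"

section \<open>The S-construction and its iterates\<close>

definition ord :: "nat \<Rightarrow> (nat \<times> nat) set" where
  "ord n = {(i, j). i \<le> j \<and> j \<le> n}"

(* The elements of the poset Ar[n] are the elements of the relation ord n. *)
definition Ar :: "nat \<Rightarrow> ((nat \<times> nat) \<times> (nat \<times> nat)) set" where
  "Ar n = {((i, j), (i', j')). (i, j) \<in> ord n \<and> (i', j') \<in> ord n \<and> i \<le> i' \<and> j \<le> j'}"

text \<open>A map \<open>A \<rightarrow> B\<close> is a cofibration of \<open>S n C\<close> if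
  \<open>A(0,k) \<union>\<^bsub>A(0,j)\<^esub> B(0,j) \<rightarrow> B(0,k)\<close> is one for \<open>0 \<le> j \<le> k \<le> n\<close>; for \<open>j = 0\<close> this says that
  \<open>A(0,k) \<rightarrow> B(0,k)\<close> is a cofibration.\<close>

definition S :: "nat \<Rightarrow> ('o, 'm) wcat \<Rightarrow>
    ((nat \<times> nat, 'o, 'm) diag, (nat \<times> nat, 'o, 'm) diag_map) wcat" where
  "S n C = diag_wcat (Ar n) C
    (\<lambda>A. (\<forall>i \<le> n. fst A (i, i) = Zero C) \<and>
         (\<forall>i j k. i \<le> j \<longrightarrow> j \<le> k \<longrightarrow> k \<le> n \<longrightarrow>
            snd A ((i, j), (i, k)) \<in> Cofib C \<and>
            is_pushout C (snd A ((i, j), (i, k))) (snd A ((i, j), (j, j)))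
                         (snd A ((i, k), (j, k))) (snd A ((j, j), (j, k)))))
    (\<lambda>(A, f, B). \<forall>j k. j \<le> k \<longrightarrow> k \<le> n \<longrightarrow>
       (\<exists>u v. \<exists>h \<in> Cofib C. is_pushout C (snd A ((0, j), (0, k))) (f (0, j)) u v \<and>
          h \<in> hom C (Cod C u) (fst B (0, k)) \<and>
          Comp C h u = f (0, k) \<and> Comp C h v = snd B ((0, j), (0, k))))
    (\<lambda>(A, f, B). \<forall>x \<in> Field (Ar n). f x \<in> Weq C)"

text \<open>The product poset \<open>Ar[n\<^sub>1] \<times> \<dots> \<times> Ar[n\<^sub>q]\<close>; its elements are lists of length \<open>q\<close>, which
  gives all the iterates of the construction the same type.\<close>

definition Ars :: "nat list \<Rightarrow> ((nat \<times> nat) list \<times> (nat \<times> nat) list) set" where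
  "Ars ns = {(xs, ys). length xs = length ns \<and> length ys = length ns \<and>
               (\<forall>r < length ns. (xs ! r, ys ! r) \<in> Ar (ns ! r))}"

type_synonym ('o, 'm) mdiag = "((nat \<times> nat) list, 'o, 'm) diag"
type_synonym ('o, 'm) mdiag_map = "((nat \<times> nat) list, 'o, 'm) diag_map"

definition slice :: "nat list \<Rightarrow> ('o, 'm) mdiag \<Rightarrow> nat \<times> nat \<Rightarrow> ('o, 'm) mdiag" where
  "slice ns A x = ((\<lambda>xs \<in> Field (Ars ns). fst A (x # xs)),
                   (\<lambda>(xs, ys) \<in> Ars ns. snd A (x # xs, x # ys)))"

text \<open>Currying: functors on \<open>Ar[n] \<times> Ar[n\<^sub>1] \<times> \<dots> \<times> Ar[n\<^sub>q]\<close>, and maps between them, as functors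
  on \<open>Ar[n]\<close>, and maps, with values in functors on \<open>Ar[n\<^sub>1] \<times> \<dots> \<times> Ar[n\<^sub>q]\<close>.\<close>

definition curry_diag :: "nat \<Rightarrow> nat list \<Rightarrow> ('o, 'm) mdiag
    \<Rightarrow> (nat \<times> nat, ('o, 'm) mdiag, ('o, 'm) mdiag_map) diag" where
  "curry_diag n ns A =
     ((\<lambda>x \<in> Field (Ar n). slice ns A x),
      (\<lambda>(x, y) \<in> Ar n. (slice ns A x, (\<lambda>xs \<in> Field (Ars ns). snd A (x # xs, y # xs)), slice ns A y)))"

definition curry_map :: "nat \<Rightarrow> nat list \<Rightarrow> ('o, 'm) mdiag_map
    \<Rightarrow> (nat \<times> nat, ('o, 'm) mdiag, ('o, 'm) mdiag_map) diag_map" where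
  "curry_map n ns = (\<lambda>(A, f, B).
     (curry_diag n ns A,
      (\<lambda>x \<in> Field (Ar n). (slice ns A x, (\<lambda>xs \<in> Field (Ars ns). f (x # xs)), slice ns B x)),
      curry_diag n ns B))"

text \<open>\<open>S_iter C [n\<^sub>1, \<dots>, n\<^sub>q]\<close> is \<open>S n\<^sub>1 (\<dots> (S n\<^sub>q C))\<close>, uncurried. For \<open>q = 0\<close> it is \<open>C\<close>, an object of
  \<open>C\<close> being regarded as a functor on the one-point poset \<open>{[]}\<close>.\<close>

fun S_iter :: "('o, 'm) wcat \<Rightarrow> nat list \<Rightarrow> (('o, 'm) mdiag, ('o, 'm) mdiag_map) wcat" where
  "S_iter C [] = diag_wcat (Ars []) C (\<lambda>A. True)
     (\<lambda>(A, f, B). f [] \<in> Cofib C) (\<lambda>(A, f, B). f [] \<in> Weq C)"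
| "S_iter C (n # ns) = diag_wcat (Ars (n # ns)) C
     (\<lambda>A. curry_diag n ns A \<in> Obj (S n (S_iter C ns)))
     (\<lambda>f. curry_map n ns f \<in> Cofib (S n (S_iter C ns)))
     (\<lambda>f. curry_map n ns f \<in> Weq (S n (S_iter C ns)))"

section \<open>Symmetric spectra of simplicial sets\<close>

definition Delta :: "nat \<Rightarrow> nat \<Rightarrow> (nat \<Rightarrow> nat) set" where
  "Delta m n = {\<theta> \<in> {..m} \<rightarrow>\<^sub>E {..n}. mono_on {..m} \<theta>}"

definition Sym :: "nat \<Rightarrow> (nat \<Rightarrow> nat) set" where
  "Sym n = {\<pi>. \<pi> permutes {..<n}}"

(* The image of (a, b) under the inclusion of Sym p \<times> Sym q into Sym (p + q). *)
definition block_sum :: "nat \<Rightarrow> (nat \<Rightarrow> nat) \<Rightarrow> (nat \<Rightarrow> nat) \<Rightarrow> nat \<Rightarrow> nat" where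
  "block_sum p a b i = (if i < p then a i else p + b (i - p))"

(* Moves a block of length p past the following block of length q. *)
definition block_swap :: "nat \<Rightarrow> nat \<Rightarrow> nat \<Rightarrow> nat" where
  "block_swap p q i = (if i < p then i + q else if i < p + q then i - p else i)"

text \<open>The \<open>m\<close>-simplices of \<open>S\<^sup>k = (\<Delta>\<^sup>1/\<partial>\<Delta>\<^sup>1)\<^sup>\<and>\<^sup>k\<close>: the base point \<open>None\<close>, and the lists of length \<open>k\<close>
  of \<open>m\<close>-simplices of \<open>\<Delta>\<^sup>1\<close> not in \<open>\<partial>\<Delta>\<^sup>1\<close>, that is, of surjections \<open>[m] \<rightarrow> [1]\<close>. In particular
  \<open>S\<^sup>0\<close> has the two simplices \<open>None\<close> and \<open>Some []\<close> in each dimension.\<close>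

type_synonym sph = "(nat \<Rightarrow> nat) list option"

definition sphere :: "nat \<Rightarrow> nat \<Rightarrow> sph set" where
  "sphere k m = insert None (Some ` {ds. length ds = k \<and> set ds \<subseteq> {d \<in> Delta m 1. d ` {..m} = {..1}}})"

definition sphere_op :: "nat \<Rightarrow> (nat \<Rightarrow> nat) \<Rightarrow> sph \<Rightarrow> sph" where
  "sphere_op m' \<theta> s = (case s of None \<Rightarrow> None | Some ds \<Rightarrow>
     let es = map (\<lambda>d. compose {..m'} d \<theta>) ds
     in if \<forall>e \<in> set es. e ` {..m'} = {..1} then Some es else None)"

definition sphere_act :: "nat \<Rightarrow> (nat \<Rightarrow> nat) \<Rightarrow> sph \<Rightarrow> sph" where
  "sphere_act k \<pi> = map_option (\<lambda>ds. map (\<lambda>r. ds ! inv \<pi> r) [0..<k])"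

text \<open>In level \<open>n\<close> and dimension \<open>m\<close>: \<open>Spx X n m\<close> is the set of simplices, \<open>pt X n m\<close> the base point,
  \<open>op X n m' m \<theta>\<close> the simplicial operator of \<open>\<theta> : [m'] \<rightarrow> [m]\<close>, \<open>act X n m\<close> the (left) action of
  \<open>\<Sigma>\<^sub>n\<close>, and \<open>str X n m\<close> the structure map. A pointed map on a smash product is given
  as a function of two arguments that is trivial if one of them is a base point.\<close>

record 'a symspec =
  Spx :: "nat \<Rightarrow> nat \<Rightarrow> 'a set"
  pt :: "nat \<Rightarrow> nat \<Rightarrow> 'a"
  op :: "nat \<Rightarrow> nat \<Rightarrow> nat \<Rightarrow> (nat \<Rightarrow> nat) \<Rightarrow> 'a \<Rightarrow> 'a"
  act :: "nat \<Rightarrow> nat \<Rightarrow> (nat \<Rightarrow> nat) \<Rightarrow> 'a \<Rightarrow> 'a"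
  str :: "nat \<Rightarrow> nat \<Rightarrow> 'a \<Rightarrow> sph \<Rightarrow> 'a"

primrec str_list :: "'a symspec \<Rightarrow> nat \<Rightarrow> nat \<Rightarrow> 'a \<Rightarrow> (nat \<Rightarrow> nat) list \<Rightarrow> 'a" where
  "str_list X n m x [] = x"
| "str_list X n m x (d # ds) = str_list X (Suc n) m (str X n m x (Some [d])) ds"

(* The iterated structure map  X_n \<and> S^k --> X_(n+k). *)
definition sigma :: "'a symspec \<Rightarrow> nat \<Rightarrow> nat \<Rightarrow> nat \<Rightarrow> 'a \<Rightarrow> sph \<Rightarrow> 'a" where
  "sigma X n k m x s = (case s of None \<Rightarrow> pt X (n + k) m | Some ds \<Rightarrow> str_list X n m x ds)"

locale symmetric_spectrum =
  fixes X :: "'a symspec"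
  assumes pt_closed: "pt X n m \<in> Spx X n m"
    and op_closed: "\<theta> \<in> Delta m' m \<Longrightarrow> x \<in> Spx X n m \<Longrightarrow> op X n m' m \<theta> x \<in> Spx X n m'"
    and op_id: "x \<in> Spx X n m \<Longrightarrow> op X n m m (restrict id {..m}) x = x"
    and op_comp: "\<theta> \<in> Delta m' m \<Longrightarrow> \<theta>' \<in> Delta m'' m' \<Longrightarrow> x \<in> Spx X n m
      \<Longrightarrow> op X n m'' m (compose {..m''} \<theta> \<theta>') x = op X n m'' m' \<theta>' (op X n m' m \<theta> x)"
    and op_pt: "\<theta> \<in> Delta m' m \<Longrightarrow> op X n m' m \<theta> (pt X n m) = pt X n m'"
    and act_closed: "\<pi> \<in> Sym n \<Longrightarrow> x \<in> Spx X n m \<Longrightarrow> act X n m \<pi> x \<in> Spx X n m"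
    and act_id: "x \<in> Spx X n m \<Longrightarrow> act X n m id x = x"
    and act_comp: "\<pi> \<in> Sym n \<Longrightarrow> \<rho> \<in> Sym n \<Longrightarrow> x \<in> Spx X n m
      \<Longrightarrow> act X n m (\<pi> \<circ> \<rho>) x = act X n m \<pi> (act X n m \<rho> x)"
    and act_pt: "\<pi> \<in> Sym n \<Longrightarrow> act X n m \<pi> (pt X n m) = pt X n m"
    and act_op: "\<pi> \<in> Sym n \<Longrightarrow> \<theta> \<in> Delta m' m \<Longrightarrow> x \<in> Spx X n m
      \<Longrightarrow> act X n m' \<pi> (op X n m' m \<theta> x) = op X n m' m \<theta> (act X n m \<pi> x)"
    and str_closed: "x \<in> Spx X n m \<Longrightarrow> s \<in> sphere 1 m \<Longrightarrow> str X n m x s \<in> Spx X (Suc n) m"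
    and str_pt_left: "s \<in> sphere 1 m \<Longrightarrow> str X n m (pt X n m) s = pt X (Suc n) m"
    and str_pt_right: "x \<in> Spx X n m \<Longrightarrow> str X n m x None = pt X (Suc n) m"
    and str_op: "\<theta> \<in> Delta m' m \<Longrightarrow> x \<in> Spx X n m \<Longrightarrow> s \<in> sphere 1 m
      \<Longrightarrow> op X (Suc n) m' m \<theta> (str X n m x s) = str X n m' (op X n m' m \<theta> x) (sphere_op m' \<theta> s)"
    and sigma_equivariant: "a \<in> Sym n \<Longrightarrow> b \<in> Sym k \<Longrightarrow> x \<in> Spx X n m \<Longrightarrow> s \<in> sphere k m
      \<Longrightarrow> sigma X n k m (act X n m a x) (sphere_act k b s)
          = act X (n + k) m (block_sum n a b) (sigma X n k m x s)"

definition sphere_spectrum :: "sph symspec" where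
  "sphere_spectrum =
    \<lparr> Spx = sphere, pt = (\<lambda>n m. None),
      op = (\<lambda>n m' m. sphere_op m'), act = (\<lambda>n m. sphere_act n),
      str = (\<lambda>n m s t. case (s, t) of (Some ds, Some es) \<Rightarrow> Some (ds @ es) | _ \<Rightarrow> None) \<rparr>"

definition truncated_sphere_spectrum :: "sph symspec" where
  "truncated_sphere_spectrum =
     sphere_spectrum \<lparr> Spx := (\<lambda>n m. if n = 0 then {None} else sphere n m) \<rparr>"

section \<open>Smash products, flatness and projectivity\<close>

text \<open>\<open>(X \<and> Y)\<^sub>n\<close> is the coequalizer of
  \[ \bigvee_{p+k+r=n} (\Sigma_n)_+ \wedge_{\Sigma_p\times\Sigma_k\times\Sigma_r} X_p\wedge S^k\wedge Y_r
     \rightrightarrows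
     \bigvee_{p+q=n} (\Sigma_n)_+ \wedge_{\Sigma_p\times\Sigma_q} X_p\wedge Y_q. \]
  In dimension \<open>m\<close> it is the quotient of the set of tuples \<open>(p, q, \<gamma>, x, y)\<close>, with
  \<open>p + q = n\<close>, \<open>\<gamma> \<in> \<Sigma>\<^sub>n\<close>, \<open>x \<in> X\<^sub>p\<close>, \<open>y \<in> Y\<^sub>q\<close>, by the equivalence relation generated by
  \<open>smash_rel\<close>. The left action of \<open>S\<^sup>k\<close> on \<open>Y\<close> is the structure map followed by a block permutation.\<close>

type_synonym ('a, 'b) smash_tuple = "nat \<times> nat \<times> (nat \<Rightarrow> nat) \<times> 'a \<times> 'b"

definition smash_tuples :: "'a symspec \<Rightarrow> 'b symspec \<Rightarrow> nat \<Rightarrow> nat \<Rightarrow> ('a, 'b) smash_tuple set" where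
  "smash_tuples X Y n m =
     {(p, q, \<gamma>, x, y). p + q = n \<and> \<gamma> \<in> Sym n \<and> x \<in> Spx X p m \<and> y \<in> Spx Y q m}"

definition left_sigma :: "'b symspec \<Rightarrow> nat \<Rightarrow> nat \<Rightarrow> nat \<Rightarrow> sph \<Rightarrow> 'b \<Rightarrow> 'b" where
  "left_sigma Y k r m s y = act Y (k + r) m (block_swap r k) (sigma Y r k m y s)"

inductive smash_rel :: "'a symspec \<Rightarrow> 'b symspec \<Rightarrow> nat \<Rightarrow> nat
    \<Rightarrow> ('a, 'b) smash_tuple \<Rightarrow> ('a, 'b) smash_tuple \<Rightarrow> bool"
  for X Y n m where
  equivariant: "\<lbrakk> p + q = n; \<gamma> \<in> Sym n; a \<in> Sym p; b \<in> Sym q; x \<in> Spx X p m; y \<in> Spx Y q m \<rbrakk>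
    \<Longrightarrow> smash_rel X Y n m (p, q, \<gamma> \<circ> block_sum p a b, x, y) (p, q, \<gamma>, act X p m a x, act Y q m b y)"
| balanced: "\<lbrakk> p + k + r = n; \<gamma> \<in> Sym n; x \<in> Spx X p m; s \<in> sphere k m; y \<in> Spx Y r m \<rbrakk>
    \<Longrightarrow> smash_rel X Y n m (p + k, r, \<gamma>, sigma X p k m x s, y) (p, k + r, \<gamma>, x, left_sigma Y k r m s y)"
| pointed: "\<lbrakk> (p, q, \<gamma>, x, y) \<in> smash_tuples X Y n m; x = pt X p m \<or> y = pt Y q m;
      (p', q', \<gamma>', x', y') \<in> smash_tuples X Y n m; x' = pt X p' m \<or> y' = pt Y q' m \<rbrakk>
    \<Longrightarrow> smash_rel X Y n m (p, q, \<gamma>, x, y) (p', q', \<gamma>', x', y')"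

definition smash :: "'a symspec \<Rightarrow> 'b symspec \<Rightarrow> nat \<Rightarrow> nat \<Rightarrow> ('a, 'b) smash_tuple set set" where
  "smash X Y n m = smash_tuples X Y n m // {(t, t'). equivclp (smash_rel X Y n m) t t'}"

definition latching :: "'a symspec \<Rightarrow> nat \<Rightarrow> nat \<Rightarrow> ('a, sph) smash_tuple set set" where
  "latching X n m = smash X truncated_sphere_spectrum n m"

text \<open>The map induced by the inclusion of the truncated sphere spectrum, followed by the
  isomorphism \<open>X \<and> \<S> \<cong> X\<close>, which sends the class of \<open>(p, q, \<gamma>, x, s)\<close> to \<open>\<gamma> \<cdot> \<sigma>\<^sub>q(x \<and> s)\<close>.\<close>

definition latching_map :: "'a symspec \<Rightarrow> nat \<Rightarrow> nat \<Rightarrow> ('a, sph) smash_tuple set \<Rightarrow> 'a" where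
  "latching_map X n m c = the_elem ((\<lambda>(p, q, \<gamma>, x, s). act X n m \<gamma> (sigma X p q m x s)) ` c)"

definition flat :: "'a symspec \<Rightarrow> bool" where
  "flat X \<longleftrightarrow> (\<forall>n m. inj_on (latching_map X n m) (latching X n m))"

definition projective :: "'a symspec \<Rightarrow> bool" where
  "projective X \<longleftrightarrow> (\<forall>n m. inj_on (latching_map X n m) (latching X n m) \<and>
     (\<forall>x \<in> Spx X n m - latching_map X n m ` latching X n m.
        \<forall>\<pi> \<in> Sym n. act X n m \<pi> x = x \<longrightarrow> \<pi> = id))"

section \<open>The algebraic K-theory spectrum\<close>

definition w_cat :: "('o, 'm) wcat \<Rightarrow> ('o, 'm) cat" where
  "w_cat C = \<lparr> Obj = Obj C, Arr = Weq C, Dom = Dom C, Cod = Cod C, Ident = Ident C, Comp = Comp C \<rparr>"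

(* Functors [p] --> C, i.e. chains of p composable morphisms. *)
definition nerve :: "('o, 'm, 'x) cat_scheme \<Rightarrow> nat \<Rightarrow> (nat, 'o, 'm) diag set" where
  "nerve C p = {A. is_diag (ord p) C A}"

type_synonym ('o, 'm) K_simplex = "(nat, ('o, 'm) mdiag, ('o, 'm) mdiag_map) diag"

(* Precomposition of diagrams with phi; P is the poset on which the result is defined. *)
definition pull_diag :: "('i \<times> 'i) set \<Rightarrow> ('i \<Rightarrow> 'j) \<Rightarrow> ('j, 'o, 'm) diag \<Rightarrow> ('i, 'o, 'm) diag" where
  "pull_diag P \<phi> A = ((\<lambda>x \<in> Field P. fst A (\<phi> x)), (\<lambda>(x, y) \<in> P. snd A (\<phi> x, \<phi> y)))"

definition pull_map :: "('i \<times> 'i) set \<Rightarrow> ('i \<Rightarrow> 'j) \<Rightarrow> ('j, 'o, 'm) diag_map \<Rightarrow> ('i, 'o, 'm) diag_map"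
  where
  "pull_map P \<phi> = (\<lambda>(A, f, B). (pull_diag P \<phi> A, (\<lambda>x \<in> Field P. f (\<phi> x)), pull_diag P \<phi> B))"

definition map_chain :: "nat \<Rightarrow> ('a \<Rightarrow> 'c) \<Rightarrow> ('b \<Rightarrow> 'd) \<Rightarrow> (nat, 'a, 'b) diag \<Rightarrow> (nat, 'c, 'd) diag" where
  "map_chain m F G A = ((\<lambda>i \<in> {..m}. F (fst A i)), (\<lambda>p \<in> ord m. G (snd A p)))"

definition K_op :: "nat \<Rightarrow> nat \<Rightarrow> nat \<Rightarrow> (nat \<Rightarrow> nat) \<Rightarrow> ('o, 'm) K_simplex \<Rightarrow> ('o, 'm) K_simplex" where
  "K_op q m' m \<theta> A =
     (let P = Ars (replicate q m'); \<phi> = map (map_prod \<theta> \<theta>)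
      in map_chain m' (pull_diag P \<phi>) (pull_map P \<phi>) (pull_diag (ord m') \<theta> A))"

(* (\<pi> A)(x_1, ..., x_q) = A(x_\<pi>(1), ..., x_\<pi>(q)) *)
definition K_act :: "nat \<Rightarrow> nat \<Rightarrow> (nat \<Rightarrow> nat) \<Rightarrow> ('o, 'm) K_simplex \<Rightarrow> ('o, 'm) K_simplex" where
  "K_act q m \<pi> =
     (let P = Ars (replicate q m); \<phi> = (\<lambda>xs. map (\<lambda>r. xs ! \<pi> r) [0..<q])
      in map_chain m (pull_diag P \<phi>) (pull_map P \<phi>))"

definition zero_arr :: "('o, 'm) wcat \<Rightarrow> 'o \<Rightarrow> 'o \<Rightarrow> 'm" where
  "zero_arr C a b = Comp C (THE f. f \<in> hom C (Zero C) b) (THE f. f \<in> hom C a (Zero C))"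

definition jumps :: "(nat \<Rightarrow> nat) \<Rightarrow> nat \<times> nat \<Rightarrow> bool" where
  "jumps \<delta> = (\<lambda>(i, j). \<delta> i = 0 \<and> \<delta> j = 1)"

definition extend_obj :: "('o, 'm) wcat \<Rightarrow> (nat \<Rightarrow> nat) \<Rightarrow> ('o, 'm) mdiag \<Rightarrow> (nat \<times> nat) list \<Rightarrow> 'o" where
  "extend_obj C \<delta> A xs = (if jumps \<delta> (last xs) then fst A (butlast xs) else Zero C)"

definition extend_diag :: "('o, 'm) wcat \<Rightarrow> nat \<Rightarrow> nat \<Rightarrow> (nat \<Rightarrow> nat) \<Rightarrow> ('o, 'm) mdiag \<Rightarrow> ('o, 'm) mdiag"
  where
  "extend_diag C q m \<delta> A =
     ((\<lambda>xs \<in> Field (Ars (replicate (Suc q) m)). extend_obj C \<delta> A xs),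
      (\<lambda>(xs, ys) \<in> Ars (replicate (Suc q) m).
         if jumps \<delta> (last xs) \<and> jumps \<delta> (last ys) then snd A (butlast xs, butlast ys)
         else zero_arr C (extend_obj C \<delta> A xs) (extend_obj C \<delta> A ys)))"

definition extend_map :: "('o, 'm) wcat \<Rightarrow> nat \<Rightarrow> nat \<Rightarrow> (nat \<Rightarrow> nat) \<Rightarrow> ('o, 'm) mdiag_map \<Rightarrow> ('o, 'm) mdiag_map"
  where
  "extend_map C q m \<delta> = (\<lambda>(A, f, B).
     (extend_diag C q m \<delta> A,
      (\<lambda>xs \<in> Field (Ars (replicate (Suc q) m)).
         if jumps \<delta> (last xs) then f (butlast xs) else Ident C (Zero C)),
      extend_diag C q m \<delta> B))"

definition K_pt :: "('o, 'm) wcat \<Rightarrow> nat \<Rightarrow> nat \<Rightarrow> ('o, 'm) K_simplex" where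
  "K_pt C q m = const_diag (ord m) (S_iter C (replicate q m)) (Zero (S_iter C (replicate q m)))"

definition K_str :: "('o, 'm) wcat \<Rightarrow> nat \<Rightarrow> nat \<Rightarrow> ('o, 'm) K_simplex \<Rightarrow> sph \<Rightarrow> ('o, 'm) K_simplex" where
  "K_str C q m A s = (case s of None \<Rightarrow> K_pt C (Suc q) m
     | Some ds \<Rightarrow> map_chain m (extend_diag C q m (hd ds)) (extend_map C q m (hd ds)) A)"

definition K :: "('o, 'm) wcat \<Rightarrow> ('o, 'm) K_simplex symspec" where
  "K C = \<lparr> Spx = (\<lambda>q m. nerve (w_cat (S_iter C (replicate q m))) m),
           pt = K_pt C, op = K_op, act = K_act, str = K_str C \<rparr>"

end

theory Submission
  imports Defs
begin

text \<open>Why the theorem holds. Three things have to be shown; the first one takes most of the work,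
  the other two contain the ideas.

  That \<open>K C\<close> is a spectrum at all means that all its operations preserve the iterates of the
  S-construction. If \<open>D\<close> is a category with cofibrations, then so is \<open>S n D\<close>
  (\<open>cofib_category_S\<close>), and pushouts along its cofibrations are formed pointwise: the pointwise
  pushout is an object of \<open>S n D\<close>, because pushouts commute with pushouts
  (\<open>pushout_of_pushouts\<close>) and because the corner condition \<open>cofsq\<close> that defines the
  cofibrations is stable under cobase change (\<open>cofsq_cobase\<close>). It follows that the simplicial
  operators, the permutations of the directions and the extension by zero are exact functors
  (\<open>exact_pull_op\<close>, \<open>exact_pull_perm\<close>, \<open>exact_extend\<close>); since \<open>S n\<close> takes exact functors to exact
  functors (\<open>exact_S_map\<close>), currying reduces each of them to a statement about one direction or, for
  the transpositions, two. The exchange of two directions (\<open>exact_swap\<close>) is the step with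
  content: a cofibration of \<open>S n (S m D)\<close> is a condition on the corner maps of cubes, and such a
  corner map does not depend on the order in which the two directions are treated
  (\<open>cofsq_cube_swap\<close>). After this, the axioms of a symmetric spectrum are identities between explicit
  formulas for the values of diagrams.

  Flatness says that a tuple \<open>(p, q, \<gamma>, x, s)\<close> can be recovered, up to the relation defining the
  smash product, from the simplex \<open>y = \<gamma> \<cdot> \<sigma>\<^sub>q(x \<and> s)\<close>. In each of the directions \<open>\<gamma> (p + l)\<close>, this
  \<open>y\<close> is \<open>concentrated\<close>: it is zero on the intervals that do not contain the jump of the \<open>l\<close>-th
  component of \<open>s\<close> and constant on the others. Being concentrated at a position is a property of \<open>y\<close>
  alone, and a nontrivial \<open>y\<close> determines the jump (\<open>concentrated_unique\<close>). If \<open>y\<close> is concentrated at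
  a further position, belonging to \<open>x\<close>, then \<open>x\<close> itself is in the image of a structure map
  (\<open>concentrated_last\<close>), and the relation moves this position from \<open>x\<close> to \<open>s\<close> (\<open>enlarge\<close>).
  So two tuples with the same nontrivial value may be assumed to have the same set of positions,
  and then they differ by an element of \<open>\<Sigma>\<^sub>p \<times> \<Sigma>\<^sub>q\<close> only (\<open>same_positions\<close>).

  For the failure of projectivity, let \<open>c\<close> be an object other than the zero object and let \<open>G\<close> be
  the filtration \<open>0 \<rightarrow> c \<rightarrow> c \<or> c\<close>, with \<open>G(0,1) = c = G(1,2)\<close> (\<open>split_filtration\<close>). The diagram
  \<open>(x, y) \<mapsto> G(x \<inter> y)\<close> on pairs of intervals in \<open>[2]\<close> is a 2-simplex of level 2 that is fixed by
  the transposition (\<open>symmetric_simplex\<close>). As no jump lies in both \<open>(0,1)\<close> and \<open>(1,2)\<close>, it is not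
  concentrated at any position, so it is not in the image of the latching object.\<close>

section \<open>Pushouts\<close>

context category
begin

abbreviation cmp (infixr "\<odot>" 70) where "g \<odot> f \<equiv> Comp C g f"

lemma homD:
  assumes "f \<in> hom C a b"
  shows "f \<in> Arr C" "Dom C f = a" "Cod C f = b" "a \<in> Obj C" "b \<in> Obj C"
  using assms Dom_closed Cod_closed by (auto simp: hom_def)

lemma cmp_Arr:
  "\<lbrakk>f \<in> Arr C; g \<in> Arr C; Dom C g = Cod C f\<rbrakk> \<Longrightarrow> g \<odot> f \<in> Arr C"
  "\<lbrakk>f \<in> Arr C; g \<in> Arr C; Dom C g = Cod C f\<rbrakk> \<Longrightarrow> Dom C (g \<odot> f) = Dom C f"
  "\<lbrakk>f \<in> Arr C; g \<in> Arr C; Dom C g = Cod C f\<rbrakk> \<Longrightarrow> Cod C (g \<odot> f) = Cod C g"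
  using Comp_hom[of f "Dom C f" "Cod C f" g "Cod C g"] by (auto simp: hom_def)

lemma cmp_assoc:
  "\<lbrakk>f \<in> Arr C; g \<in> Arr C; h \<in> Arr C; Dom C g = Cod C f; Dom C h = Cod C g\<rbrakk>
    \<Longrightarrow> (h \<odot> g) \<odot> f = h \<odot> g \<odot> f"
  using Comp_assoc[of f "Dom C f" "Cod C f" g "Cod C g" h "Cod C h"] by (simp add: hom_def)

lemma Ident_simps:
  "a \<in> Obj C \<Longrightarrow> Ident C a \<in> Arr C" "a \<in> Obj C \<Longrightarrow> Dom C (Ident C a) = a"
  "a \<in> Obj C \<Longrightarrow> Cod C (Ident C a) = a"
  "f \<in> Arr C \<Longrightarrow> Cod C f = a \<Longrightarrow> Ident C a \<odot> f = f"
  "f \<in> Arr C \<Longrightarrow> Dom C f = a \<Longrightarrow> f \<odot> Ident C a = f"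
  using Ident_hom[of a] Comp_Ident_left[of f "Dom C f" a] Comp_Ident_right[of f a "Cod C f"]
  by (auto simp: hom_def)

text \<open>To chase a diagram, composites are nested to the right; the rule \<open>rw\<close> turns an equation
  \<open>u \<odot> f = w\<close> into one that also applies inside a longer composite.\<close>

lemmas chase = hom_def cmp_Arr cmp_assoc Ident_simps Dom_closed Cod_closed

lemma rw:
  assumes "u \<odot> f = w" "f \<in> hom C a b" "u \<in> hom C b c"
  shows "x \<in> Arr C \<Longrightarrow> Cod C x = a \<Longrightarrow> u \<odot> f \<odot> x = w \<odot> x"
  using assms by (auto simp: chase cmp_assoc[symmetric])

lemma Arr_hom: "f \<in> Arr C \<Longrightarrow> f \<in> hom C (Dom C f) (Cod C f)"
  by (simp add: hom_def)

lemma pushoutI: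
  assumes "f \<in> hom C a b" "g \<in> hom C a c" "u \<in> hom C b p" "v \<in> hom C c p" "u \<odot> f = v \<odot> g"
    and "\<And>z s t. \<lbrakk>s \<in> hom C b z; t \<in> hom C c z; s \<odot> f = t \<odot> g\<rbrakk>
      \<Longrightarrow> \<exists>h \<in> hom C p z. h \<odot> u = s \<and> h \<odot> v = t"
    and "\<And>z h h'. \<lbrakk>h \<in> hom C p z; h' \<in> hom C p z; h \<odot> u = h' \<odot> u; h \<odot> v = h' \<odot> v\<rbrakk> \<Longrightarrow> h = h'"
  shows "is_pushout C f g u v"
  unfolding is_pushout_def using assms(1-4)[THEN homD(1)] assms(1-4)[THEN homD(2)]
    assms(1-4)[THEN homD(3)]
  apply (simp add: assms(5))
  apply (intro ballI impI ex_ex1I)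
   apply (use assms(6) in blast)
  apply (elim conjE, rule assms(7); simp)
  done

lemma pushout_hom:
  assumes "is_pushout C f g u v"
  obtains a b c p where "f \<in> hom C a b" "g \<in> hom C a c" "u \<in> hom C b p" "v \<in> hom C c p"
  using assms unfolding is_pushout_def hom_def by auto

lemma pushout_hom_left:
  assumes "is_pushout C f g u v" "f \<in> hom C a b"
  obtains c p where "g \<in> hom C a c" "u \<in> hom C b p" "v \<in> hom C c p"
  using assms unfolding is_pushout_def hom_def by auto

lemma pushout_hom_u:
  assumes "is_pushout C f g u v" "u \<in> hom C b p"
  obtains a c where "f \<in> hom C a b" "g \<in> hom C a c" "v \<in> hom C c p"
  using assms unfolding is_pushout_def hom_def by auto

lemma pushout_hom_v:
  assumes "is_pushout C f g u v" "v \<in> hom C c p"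
  obtains a b where "f \<in> hom C a b" "g \<in> hom C a c" "u \<in> hom C b p"
  using assms unfolding is_pushout_def hom_def by auto

lemma pushout_commutes: "is_pushout C f g u v \<Longrightarrow> u \<odot> f = v \<odot> g"
  unfolding is_pushout_def by auto

lemma pushout_legs:
  assumes "is_pushout C f g u v" "f \<in> hom C a b" "u \<in> hom C b' p"
  shows "u \<in> hom C b p" "g \<in> hom C a (Cod C g)" "v \<in> hom C (Cod C g) p"
  using assms unfolding is_pushout_def hom_def by auto

lemma pushout_univ:
  assumes "is_pushout C f g u v" "f \<in> hom C a b" "g \<in> hom C a c" "u \<in> hom C b p"
    and st: "s \<in> hom C b z" "t \<in> hom C c z" "s \<odot> f = t \<odot> g"
  shows "\<exists>!h. h \<in> hom C p z \<and> h \<odot> u = s \<and> h \<odot> v = t"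
proof -
  have "\<forall>z \<in> Obj C. \<forall>s \<in> hom C (Cod C f) z. \<forall>t \<in> hom C (Cod C g) z. s \<odot> f = t \<odot> g \<longrightarrow>
        (\<exists>!h. h \<in> hom C (Cod C u) z \<and> h \<odot> u = s \<and> h \<odot> v = t)"
    using assms(1) unfolding is_pushout_def by blast
  from this[unfolded homD(3)[OF assms(2)] homD(3)[OF assms(3)] homD(3)[OF assms(4)],
      THEN bspec, OF homD(5)[OF st(1)], THEN bspec, OF st(1), THEN bspec, OF st(2), THEN mp, OF st(3)]
  show ?thesis .
qed

lemma pushout_ex:
  assumes "is_pushout C f g u v" "f \<in> hom C a b" "g \<in> hom C a c" "u \<in> hom C b p"
    "s \<in> hom C b z" "t \<in> hom C c z" "s \<odot> f = t \<odot> g"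
  obtains h where "h \<in> hom C p z" "h \<odot> u = s" "h \<odot> v = t"
  using pushout_univ[OF assms] by blast

lemma pushout_eq:
  assumes p: "is_pushout C f g u v" and u: "u \<in> hom C b p" and h: "h \<in> hom C p z" "h' \<in> hom C p z"
    and e: "h \<odot> u = h' \<odot> u" "h \<odot> v = h' \<odot> v"
  shows "h = h'"
proof -
  obtain a c where fg: "f \<in> hom C a b" "g \<in> hom C a c" "v \<in> hom C c p"
    using pushout_hom_u[OF p u] by blast
  have "(h \<odot> u) \<odot> f = (h \<odot> v) \<odot> g"
    using fg u h pushout_commutes[OF p] by (simp add: chase)
  then show ?thesis
    using pushout_univ[OF p fg(1,2) u Comp_hom[OF u h(1)] Comp_hom[OF fg(3) h(1)]] h e by auto
qed

lemma pushout_sym: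
  assumes "is_pushout C f g u v" shows "is_pushout C g f v u"
proof -
  obtain a b c p where h: "f \<in> hom C a b" "g \<in> hom C a c" "u \<in> hom C b p" "v \<in> hom C c p"
    using assms by (rule pushout_hom)
  show ?thesis
  proof (rule pushoutI[OF h(2) h(1) h(4) h(3)])
    show "v \<odot> g = u \<odot> f" using pushout_commutes[OF assms] by simp
    show "\<exists>k\<in>hom C p z. k \<odot> v = s \<and> k \<odot> u = t"
      if "s \<in> hom C c z" "t \<in> hom C b z" "s \<odot> g = t \<odot> f" for z s t
      using pushout_ex[OF assms h(1,2,3) that(2,1)] that(3) by metis
    show "k = k'" if "k \<in> hom C p z" "k' \<in> hom C p z" "k \<odot> v = k' \<odot> v" "k \<odot> u = k' \<odot> u" for z k k'
      using pushout_eq[OF assms h(3) that(1,2)] that(3,4) by blast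
  qed
qed

lemma pushout_paste:
  assumes 1: "is_pushout C f g u v" and 2: "is_pushout C v w s t"
  shows "is_pushout C f (w \<odot> g) (s \<odot> u) t"
proof -
  obtain a b c p where h: "f \<in> hom C a b" "g \<in> hom C a c" "u \<in> hom C b p" "v \<in> hom C c p"
    using 1 by (rule pushout_hom)
  obtain d q where k: "w \<in> hom C c d" "s \<in> hom C p q" "t \<in> hom C d q"
    using pushout_hom_left[OF 2 h(4)] by blast
  have e1: "u \<odot> f = v \<odot> g" and e2: "s \<odot> v = t \<odot> w"
    using 1 2 pushout_commutes by auto
  show ?thesis
  proof (rule pushoutI[OF h(1) Comp_hom[OF h(2) k(1)] Comp_hom[OF h(3) k(2)] k(3)])
    show "(s \<odot> u) \<odot> f = t \<odot> w \<odot> g"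
      using Comp_assoc[OF h(1,3) k(2)] Comp_assoc[OF h(2,4) k(2)] Comp_assoc[OF h(2) k(1,3)] e1 e2
      by simp
    show "\<exists>x\<in>hom C q z. x \<odot> s \<odot> u = m \<and> x \<odot> t = n"
      if m: "m \<in> hom C b z" and n: "n \<in> hom C d z" and e: "m \<odot> f = n \<odot> w \<odot> g" for z m n
    proof -
      have "m \<odot> f = (n \<odot> w) \<odot> g" using e Comp_assoc[OF h(2) k(1) n] by simp
      then obtain y where y: "y \<in> hom C p z" "y \<odot> u = m" "y \<odot> v = n \<odot> w"
        using pushout_ex[OF 1 h(1,2,3) m Comp_hom[OF k(1) n]] by blast
      obtain x where x: "x \<in> hom C q z" "x \<odot> s = y" "x \<odot> t = n"
        using pushout_ex[OF 2 h(4) k(1,2) y(1) n y(3)] by blast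
      then show ?thesis using y Comp_assoc[OF h(3) k(2) x(1)] by auto
    qed
    show "x = x'" if x: "x \<in> hom C q z" "x' \<in> hom C q z" "x \<odot> s \<odot> u = x' \<odot> s \<odot> u"
      "x \<odot> t = x' \<odot> t" for z x x'
    proof (rule pushout_eq[OF 2 k(2) x(1,2) _ x(4)])
      show "x \<odot> s = x' \<odot> s"
      proof (rule pushout_eq[OF 1 h(3) Comp_hom[OF k(2) x(1)] Comp_hom[OF k(2) x(2)]])
        show "(x \<odot> s) \<odot> u = (x' \<odot> s) \<odot> u" using h k x by (simp add: chase)
        show "(x \<odot> s) \<odot> v = (x' \<odot> s) \<odot> v"
          using h k x e2 rw[OF x(4) k(3) x(1)] by (simp add: chase)
      qed
    qed
  qed
qed

lemma pushout_cancel: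
  assumes 1: "is_pushout C f g u v" and 2: "is_pushout C f (w \<odot> g) (s \<odot> u) t"
    and k: "w \<in> hom C c d" "s \<in> hom C p q" "t \<in> hom C d q" and v: "v \<in> hom C c p"
    and e2: "s \<odot> v = t \<odot> w"
  shows "is_pushout C v w s t"
proof -
  obtain a b where h: "f \<in> hom C a b" "g \<in> hom C a c" "u \<in> hom C b p"
    using pushout_hom_v[OF 1 v] by blast
  have e1: "u \<odot> f = v \<odot> g" using 1 pushout_commutes by auto
  show ?thesis
  proof (rule pushoutI[OF v k e2])
    show "\<exists>x\<in>hom C q z. x \<odot> s = y \<and> x \<odot> t = n"
      if y: "y \<in> hom C p z" and n: "n \<in> hom C d z" and e: "y \<odot> v = n \<odot> w" for z y n
    proof -
      have "(y \<odot> u) \<odot> f = n \<odot> w \<odot> g"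
        using Comp_assoc[OF h(1,3) y] Comp_assoc[OF h(2) v y] Comp_assoc[OF h(2) k(1) n] e e1
        by simp
      then obtain x where x: "x \<in> hom C q z" "x \<odot> s \<odot> u = y \<odot> u" "x \<odot> t = n"
        using pushout_ex[OF 2 h(1) Comp_hom[OF h(2) k(1)] Comp_hom[OF h(3) k(2)] Comp_hom[OF h(3) y] n]
        by blast
      have "x \<odot> s = y"
      proof (rule pushout_eq[OF 1 h(3) Comp_hom[OF k(2) x(1)] y])
        show "(x \<odot> s) \<odot> u = y \<odot> u" using x Comp_assoc[OF h(3) k(2) x(1)] by simp
        show "(x \<odot> s) \<odot> v = y \<odot> v" by (use v k x y in \<open>simp add: chase e e2 rw[OF x(3) k(3) x(1)]\<close>)
      qed
      then show ?thesis using x by blast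
    qed
    show "x = x'" if x: "x \<in> hom C q z" "x' \<in> hom C q z" "x \<odot> s = x' \<odot> s" "x \<odot> t = x' \<odot> t"
      for z x x'
      using x h k by (intro pushout_eq[OF 2 Comp_hom[OF h(3) k(2)] x(1,2) _ x(4)])
        (simp add: chase rw[OF x(3) k(2) x(1)])
  qed
qed

lemma Ident_iso: "a \<in> Obj C \<Longrightarrow> is_iso C (Ident C a)"
  unfolding is_iso_def by (auto simp: chase)

lemma isoI:
  assumes "f \<in> hom C a b" "g \<in> hom C b a" "g \<odot> f = Ident C a" "f \<odot> g = Ident C b"
  shows "is_iso C f"
  unfolding is_iso_def using assms homD[OF assms(1)] by auto

lemma isoE:
  assumes "is_iso C f" "f \<in> hom C a b"
  obtains g where "g \<in> hom C b a" "g \<odot> f = Ident C a" "f \<odot> g = Ident C b"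
  using assms unfolding is_iso_def hom_def by auto

text \<open>A pushout may be replaced by an isomorphic one; with uniqueness this transfers properties from
  some pushout of two maps to every pushout of them.\<close>

lemma pushout_iso:
  assumes 1: "is_pushout C f g u v" and i: "is_iso C i" "i \<in> hom C p q" and u: "u \<in> hom C b p"
  shows "is_pushout C f g (i \<odot> u) (i \<odot> v)"
proof -
  obtain a c where h: "f \<in> hom C a b" "g \<in> hom C a c" "v \<in> hom C c p"
    using pushout_hom_u[OF 1 u] by blast
  obtain j where j: "j \<in> hom C q p" "j \<odot> i = Ident C p" "i \<odot> j = Ident C q"
    using isoE i by blast
  show ?thesis
  proof (rule pushoutI[OF h(1,2) Comp_hom[OF u i(2)] Comp_hom[OF h(3) i(2)]])
    show "(i \<odot> u) \<odot> f = (i \<odot> v) \<odot> g"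
      using h u i(2) pushout_commutes[OF 1] by (simp add: chase)
    show "\<exists>x\<in>hom C q z. x \<odot> i \<odot> u = s \<and> x \<odot> i \<odot> v = t"
      if st: "s \<in> hom C b z" "t \<in> hom C c z" "s \<odot> f = t \<odot> g" for z s t
    proof -
      obtain x where x: "x \<in> hom C p z" "x \<odot> u = s" "x \<odot> v = t"
        using pushout_ex[OF 1 h(1,2) u st] by blast
      have "(x \<odot> j) \<odot> i \<odot> u = s \<and> (x \<odot> j) \<odot> i \<odot> v = t"
        using x j i(2) u h rw[OF j(2) i(2) j(1)] by (simp add: chase)
      then show ?thesis using Comp_hom[OF j(1) x(1)] by blast
    qed
    show "x = x'" if x: "x \<in> hom C q z" "x' \<in> hom C q z" "x \<odot> i \<odot> u = x' \<odot> i \<odot> u"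
      "x \<odot> i \<odot> v = x' \<odot> i \<odot> v" for z x x'
    proof -
      have "x \<odot> i = x' \<odot> i"
        by (rule pushout_eq[OF 1 u Comp_hom[OF i(2) x(1)] Comp_hom[OF i(2) x(2)]])
          (use x i(2) u h in \<open>simp_all add: chase\<close>)
      then have "(x \<odot> i) \<odot> j = (x' \<odot> i) \<odot> j" by simp
      then show ?thesis using i(2) j x by (simp add: chase)
    qed
  qed
qed

lemma pushout_unique:
  assumes 1: "is_pushout C f g u v" and 2: "is_pushout C f g u' v'"
    and u: "u \<in> hom C b p" and u': "u' \<in> hom C b p'"
  obtains i where "is_iso C i" "i \<in> hom C p p'" "i \<odot> u = u'" "i \<odot> v = v'"
proof -
  obtain a c where h: "f \<in> hom C a b" "g \<in> hom C a c" "v \<in> hom C c p"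
    using pushout_hom_u[OF 1 u] by blast
  have v': "v' \<in> hom C c p'" using pushout_legs[OF 2 h(1) u'] homD[OF h(2)] by auto
  obtain i where i: "i \<in> hom C p p'" "i \<odot> u = u'" "i \<odot> v = v'"
    using pushout_ex[OF 1 h(1,2) u u' v' pushout_commutes[OF 2]] by blast
  obtain j where j: "j \<in> hom C p' p" "j \<odot> u' = u" "j \<odot> v' = v"
    using pushout_ex[OF 2 h(1,2) u' u h(3) pushout_commutes[OF 1]] by blast
  have "j \<odot> i = Ident C p"
    by (rule pushout_eq[OF 1 u Comp_hom[OF i(1) j(1)] Ident_hom[OF homD(5)[OF u]]])
      (use h i j u u' in \<open>simp_all add: chase\<close>)
  moreover have "i \<odot> j = Ident C p'"
    by (rule pushout_eq[OF 2 u' Comp_hom[OF j(1) i(1)] Ident_hom[OF homD(5)[OF u']]])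
      (use v' i j u u' in \<open>simp_all add: chase\<close>)
  ultimately show ?thesis using that isoI[OF i(1) j(1)] i by blast
qed

lemma pushout_iso_leg:
  assumes f: "is_iso C f" "f \<in> hom C a b" and g: "g \<in> hom C a c" and u: "u \<in> hom C b d"
    and v: "is_iso C v" "v \<in> hom C c d" and e: "u \<odot> f = v \<odot> g"
  shows "is_pushout C f g u v"
proof -
  obtain f' where f': "f' \<in> hom C b a" "f' \<odot> f = Ident C a" "f \<odot> f' = Ident C b"
    using isoE f by blast
  obtain v' where v': "v' \<in> hom C d c" "v' \<odot> v = Ident C c" "v \<odot> v' = Ident C d"
    using isoE v by blast
  show ?thesis
  proof (rule pushoutI[OF f(2) g u v(2) e])
    show "\<exists>h\<in>hom C d z. h \<odot> u = s \<and> h \<odot> v = t"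
      if st: "s \<in> hom C b z" "t \<in> hom C c z" "s \<odot> f = t \<odot> g" for z s t
    proof (intro bexI conjI)
      show h: "t \<odot> v' \<in> hom C d z" using Comp_hom v'(1) st(2) by blast
      show "(t \<odot> v') \<odot> v = t" using st(2) v' v(2) by (simp add: chase)
      have "((t \<odot> v') \<odot> u) \<odot> f = s \<odot> f"
        using e f(2) g st u v(2) v' rw[OF v'(2) v(2) v'(1)] by (simp add: chase)
      then have "(((t \<odot> v') \<odot> u) \<odot> f) \<odot> f' = (s \<odot> f) \<odot> f'" by simp
      moreover have "(((t \<odot> v') \<odot> u) \<odot> f) \<odot> f' = (t \<odot> v') \<odot> u"
        using f' f(2) st(2) u v' by (simp add: chase)
      moreover have "(s \<odot> f) \<odot> f' = s" using f' f(2) st(1) by (simp add: chase)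
      ultimately show "(t \<odot> v') \<odot> u = s" by simp
    qed
    show "h = h'" if h: "h \<in> hom C d z" "h' \<in> hom C d z" "h \<odot> v = h' \<odot> v" for z h h'
    proof -
      have "(h \<odot> v) \<odot> v' = (h' \<odot> v) \<odot> v'" using h by simp
      then show ?thesis using v' v(2) h(1,2) by (simp add: chase)
    qed
  qed
qed

lemma pushout_Ident: "g \<in> hom C a c \<Longrightarrow> is_pushout C (Ident C a) g g (Ident C c)"
  by (rule pushout_iso_leg[OF Ident_iso Ident_hom])
    (use homD in \<open>auto simp: Ident_iso Ident_hom Comp_Ident_left Comp_Ident_right\<close>)

text \<open>Colimits commute with colimits: a map out of \<open>P4\<close> is a pair of compatible maps out of \<open>B4\<close>
  and \<open>X4\<close>, and each of these is given by its restrictions to the corners 2 and 3.\<close>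

lemma pushout_of_pushouts:
  assumes A: "A24 \<in> hom C A2 A4" "A34 \<in> hom C A3 A4"
    and Aepi: "\<And>z h h'. \<lbrakk>h \<in> hom C A4 z; h' \<in> hom C A4 z; h \<odot> A24 = h' \<odot> A24; h \<odot> A34 = h' \<odot> A34\<rbrakk> \<Longrightarrow> h = h'"
    and B: "is_pushout C B12 B13 B24 B34" "B12 \<in> hom C B1 B2" "B13 \<in> hom C B1 B3" "B24 \<in> hom C B2 B4" "B34 \<in> hom C B3 B4"
    and X: "is_pushout C X12 X13 X24 X34" "X12 \<in> hom C X1 X2" "X13 \<in> hom C X1 X3" "X24 \<in> hom C X2 X4" "X34 \<in> hom C X3 X4"
    and a: "a2 \<in> hom C A2 B2" "a3 \<in> hom C A3 B3" "a4 \<in> hom C A4 B4"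
    and c: "c2 \<in> hom C A2 X2" "c3 \<in> hom C A3 X3" "c4 \<in> hom C A4 X4"
    and na: "a4 \<odot> A24 = B24 \<odot> a2" "a4 \<odot> A34 = B34 \<odot> a3"
    and nc: "c4 \<odot> A24 = X24 \<odot> c2" "c4 \<odot> A34 = X34 \<odot> c3"
    and P1: "is_pushout C a1 c1 u1 v1" "u1 \<in> hom C B1 P1" "v1 \<in> hom C X1 P1"
    and P2: "is_pushout C a2 c2 u2 v2" "u2 \<in> hom C B2 P2" "v2 \<in> hom C X2 P2"
    and P3: "is_pushout C a3 c3 u3 v3" "u3 \<in> hom C B3 P3" "v3 \<in> hom C X3 P3"
    and P4: "is_pushout C a4 c4 u4 v4" "u4 \<in> hom C B4 P4" "v4 \<in> hom C X4 P4"
    and P: "P12 \<in> hom C P1 P2" "P13 \<in> hom C P1 P3" "P24 \<in> hom C P2 P4" "P34 \<in> hom C P3 P4"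
    and nu: "P12 \<odot> u1 = u2 \<odot> B12" "P13 \<odot> u1 = u3 \<odot> B13" "P24 \<odot> u2 = u4 \<odot> B24" "P34 \<odot> u3 = u4 \<odot> B34"
    and nv: "P12 \<odot> v1 = v2 \<odot> X12" "P13 \<odot> v1 = v3 \<odot> X13" "P24 \<odot> v2 = v4 \<odot> X24" "P34 \<odot> v3 = v4 \<odot> X34"
  shows "is_pushout C P12 P13 P24 P34"
proof (rule pushoutI[OF P])
  note homs = A B(2-5) X(2-5) a c P1(2,3) P2(2,3) P3(2,3) P4(2,3) P
  note ch = homs[unfolded hom_def, simplified]
  have eB: "B24 \<odot> B12 = B34 \<odot> B13" and eX: "X24 \<odot> X12 = X34 \<odot> X13"
    using B(1) X(1) pushout_commutes by auto
  note rws = rw[OF nu(1) P1(2) P(1)] rw[OF nu(2) P1(2) P(2)] rw[OF nu(3) P2(2) P(3)]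
    rw[OF nu(4) P3(2) P(4)] rw[OF nv(1) P1(3) P(1)] rw[OF nv(2) P1(3) P(2)]
    rw[OF nv(3) P2(3) P(3)] rw[OF nv(4) P3(3) P(4)]
  show "P24 \<odot> P12 = P34 \<odot> P13"
    by (rule pushout_eq[OF P1(1,2) Comp_hom[OF P(1,3)] Comp_hom[OF P(2,4)]])
      (use ch in \<open>simp_all add: chase nu nv rws eB eX\<close>)
  have e: "(k \<odot> u4) \<odot> B24 = (k \<odot> P24) \<odot> u2" "(k \<odot> u4) \<odot> B34 = (k \<odot> P34) \<odot> u3"
    "(k \<odot> v4) \<odot> X24 = (k \<odot> P24) \<odot> v2" "(k \<odot> v4) \<odot> X34 = (k \<odot> P34) \<odot> v3"
    if "k \<in> hom C P4 z" for k z
    using that ch by (simp_all add: chase nu nv)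
  show "\<exists>h\<in>hom C P4 z. h \<odot> P24 = s \<and> h \<odot> P34 = t"
    if st: "s \<in> hom C P2 z" "t \<in> hom C P3 z" "s \<odot> P12 = t \<odot> P13" for z s t
  proof -
    note rst = rw[OF st(3) _ st(1), OF P(1)]
    have "(s \<odot> u2) \<odot> B12 = (s \<odot> P12) \<odot> u1" using ch st(1) by (simp add: chase nu)
    also have "\<dots> = (t \<odot> u3) \<odot> B13" unfolding st(3) using ch st(2) by (simp add: chase nu)
    finally obtain b where b: "b \<in> hom C B4 z" "b \<odot> B24 = s \<odot> u2" "b \<odot> B34 = t \<odot> u3"
      using pushout_ex[OF B(1-4) Comp_hom[OF P2(2) st(1)] Comp_hom[OF P3(2) st(2)]] by blast
    have "(s \<odot> v2) \<odot> X12 = (s \<odot> P12) \<odot> v1" using ch st(1) by (simp add: chase nv)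
    also have "\<dots> = (t \<odot> v3) \<odot> X13" unfolding st(3) using ch st(2) by (simp add: chase nv)
    finally obtain x where x: "x \<in> hom C X4 z" "x \<odot> X24 = s \<odot> v2" "x \<odot> X34 = t \<odot> v3"
      using pushout_ex[OF X(1-4) Comp_hom[OF P2(3) st(1)] Comp_hom[OF P3(3) st(2)]] by blast
    note rbx = rw[OF b(2) B(4) b(1)] rw[OF b(3) B(5) b(1)] rw[OF x(2) X(4) x(1)] rw[OF x(3) X(5) x(1)]
    have "b \<odot> a4 = x \<odot> c4"
      by (rule Aepi[OF Comp_hom[OF a(3) b(1)] Comp_hom[OF c(3) x(1)]])
        (use ch b(1) x(1) st(1,2) in \<open>simp_all add: chase na nc rbx pushout_commutes[OF P2(1)]
          pushout_commutes[OF P3(1)]\<close>)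
    then obtain h where h: "h \<in> hom C P4 z" "h \<odot> u4 = b" "h \<odot> v4 = x"
      using pushout_ex[OF P4(1) a(3) c(3) P4(2) b(1) x(1)] by blast
    have "h \<odot> P24 = s"
      by (rule pushout_eq[OF P2(1,2) Comp_hom[OF P(3) h(1)] st(1)])
        (use e[OF h(1)] h(2,3) b x in simp_all)
    moreover have "h \<odot> P34 = t"
      by (rule pushout_eq[OF P3(1,2) Comp_hom[OF P(4) h(1)] st(2)])
        (use e[OF h(1)] h(2,3) b x in simp_all)
    ultimately show ?thesis using h(1) by blast
  qed
  show "h = h'" if h: "h \<in> hom C P4 z" "h' \<in> hom C P4 z" and eq: "h \<odot> P24 = h' \<odot> P24" "h \<odot> P34 = h' \<odot> P34"
    for z h h'
  proof (rule pushout_eq[OF P4(1,2) h])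
    show "h \<odot> u4 = h' \<odot> u4"
      by (rule pushout_eq[OF B(1,4) Comp_hom[OF P4(2) h(1)] Comp_hom[OF P4(2) h(2)]])
        (simp_all add: e[OF h(1)] e[OF h(2)] eq)
    show "h \<odot> v4 = h' \<odot> v4"
      by (rule pushout_eq[OF X(1,4) Comp_hom[OF P4(3) h(1)] Comp_hom[OF P4(3) h(2)]])
        (simp_all add: e[OF h(1)] e[OF h(2)] eq)
  qed
qed

end

section \<open>Categories with cofibrations\<close>

text \<open>Waldhausen's axioms on the zero object and the cofibrations. This is the structure that passes
  from \<open>D\<close> to \<open>S n D\<close>; weak equivalences are pointwise throughout and are treated along with exact
  functors.\<close>

locale cofib_category = category D for D :: "('o, 'm) wcat" +
  assumes Zero_Obj: "Zero D \<in> Obj D"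
    and Zero_initial: "a \<in> Obj D \<Longrightarrow> \<exists>!f. f \<in> hom D (Zero D) a"
    and Zero_terminal: "a \<in> Obj D \<Longrightarrow> \<exists>!f. f \<in> hom D a (Zero D)"
    and Cofib_Arr: "Cofib D \<subseteq> Arr D"
    and Cofib_Comp: "f \<in> Cofib D \<Longrightarrow> g \<in> Cofib D \<Longrightarrow> Dom D g = Cod D f \<Longrightarrow> Comp D g f \<in> Cofib D"
    and Cofib_iso: "is_iso D f \<Longrightarrow> f \<in> Cofib D"
    and Cofib_Zero: "a \<in> Obj D \<Longrightarrow> f \<in> hom D (Zero D) a \<Longrightarrow> f \<in> Cofib D"
    and Cofib_pushout: "f \<in> Cofib D \<Longrightarrow> g \<in> Arr D \<Longrightarrow> Dom D g = Dom D f
      \<Longrightarrow> \<exists>u v. is_pushout D f g u v \<and> v \<in> Cofib D"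

text \<open>The square has the edges \<open>f : a \<rightarrow> b\<close>, \<open>g : a \<rightarrow> c\<close>, \<open>g' : b \<rightarrow> d\<close> and \<open>f' : c \<rightarrow> d\<close>, and the
  condition is that its corner map \<open>b \<union>\<^bsub>a\<^esub> c \<rightarrow> d\<close> is a cofibration. The cofibrations of \<open>S n D\<close> are
  defined by such squares.\<close>

definition cofsq :: "('o, 'm) wcat \<Rightarrow> 'm \<Rightarrow> 'm \<Rightarrow> 'm \<Rightarrow> 'm \<Rightarrow> bool" where
  "cofsq D f g g' f' \<longleftrightarrow> (\<exists>u v. \<exists>h \<in> Cofib D. is_pushout D f g u v \<and>
     h \<in> hom D (Cod D u) (Cod D f') \<and> Comp D h u = g' \<and> Comp D h v = f')"

context cofib_category
begin

notation cmp (infixr "\<odot>" 70)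

lemma Cofib_Ident: "a \<in> Obj D \<Longrightarrow> Ident D a \<in> Cofib D"
  by (simp add: Cofib_iso Ident_iso)

lemma hom_from_Zero_eq:
  "f \<in> hom D (Zero D) a \<Longrightarrow> g \<in> hom D (Zero D) a \<Longrightarrow> f = g"
  using Zero_initial[of a] homD(5)[of f] by blast

lemma hom_to_Zero_eq:
  "f \<in> hom D a (Zero D) \<Longrightarrow> g \<in> hom D a (Zero D) \<Longrightarrow> f = g"
  using Zero_terminal[of a] homD(4)[of f] by blast

text \<open>The axiom gives one pushout whose second leg is a cofibration; all others are isomorphic to it.\<close>

lemma pushout_Cofib:
  assumes p: "is_pushout D f g u v" and f: "f \<in> Cofib D" shows "v \<in> Cofib D"
proof -
  obtain a b c d where h: "f \<in> hom D a b" "g \<in> hom D a c" "u \<in> hom D b d" "v \<in> hom D c d"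
    using p by (rule pushout_hom)
  obtain u' v' where q: "is_pushout D f g u' v'" "v' \<in> Cofib D"
    using Cofib_pushout[OF f, of g] h by (auto simp: hom_def)
  obtain d' where k: "u' \<in> hom D b d'" "v' \<in> hom D c d'"
    using pushout_hom_left[OF q(1) h(1)] h(2) by (auto simp: hom_def)
  obtain i where "is_iso D i" "i \<in> hom D d' d" "i \<odot> u' = u" "i \<odot> v' = v"
    using pushout_unique[OF q(1) p k(1) h(3)] by blast
  then show ?thesis using Cofib_Comp[OF q(2) Cofib_iso[of i]] k by (auto simp: hom_def)
qed

lemma cofsq_hom:
  assumes "cofsq D f g g' f'" "f \<in> hom D a b" "g \<in> hom D a c"
  shows "\<exists>d. g' \<in> hom D b d \<and> f' \<in> hom D c d" "g' \<odot> f = f' \<odot> g"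
proof -
  obtain u v h where p: "is_pushout D f g u v" and h: "h \<in> hom D (Cod D u) (Cod D f')"
    "h \<odot> u = g'" "h \<odot> v = f'"
    using assms unfolding cofsq_def by auto
  obtain d where k: "u \<in> hom D b d" "v \<in> hom D c d"
    using pushout_hom_left[OF p assms(2)] assms(3) by (auto simp: hom_def)
  show "\<exists>d. g' \<in> hom D b d \<and> f' \<in> hom D c d" using Comp_hom k h homD(3)[OF k(1)] by blast
  show "g' \<odot> f = f' \<odot> g"
    unfolding h(2,3)[symmetric] using assms(2,3) h(1) k pushout_commutes[OF p] by (simp add: chase)
qed

lemma cofsqI:
  assumes "is_pushout D f g u v" "u \<in> hom D b p" "h \<in> hom D p d" "f' \<in> hom D c d"
    "h \<odot> u = g'" "h \<odot> v = f'" "h \<in> Cofib D"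
  shows "cofsq D f g g' f'"
  unfolding cofsq_def using assms by (auto simp: hom_def)

text \<open>The corner map does not depend on the choice of the pushout.\<close>

lemma cofsq_corner:
  assumes s: "cofsq D f g g' f'" and p: "is_pushout D f g u v" and u: "u \<in> hom D b p"
    and h: "h \<in> hom D p d" "h \<odot> u = g'" "h \<odot> v = f'"
  shows "h \<in> Cofib D"
proof -
  obtain a c where fg: "f \<in> hom D a b" "g \<in> hom D a c" "v \<in> hom D c p"
    using pushout_hom_u[OF p u] by blast
  obtain u' v' k where q: "is_pushout D f g u' v'" and k: "k \<in> hom D (Cod D u') (Cod D f')"
    "k \<odot> u' = g'" "k \<odot> v' = f'" "k \<in> Cofib D"
    using s unfolding cofsq_def by auto
  obtain p' where uv': "u' \<in> hom D b p'" "v' \<in> hom D c p'"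
    using pushout_hom_left[OF q fg(1)] fg(2) by (auto simp: hom_def)
  obtain i where i: "is_iso D i" "i \<in> hom D p p'" "i \<odot> u = u'" "i \<odot> v = v'"
    using pushout_unique[OF p q u uv'(1)] by blast
  have "Cod D f' = d" using h fg by (auto simp: chase)
  then have k': "k \<in> hom D p' d" using k uv' by (auto simp: hom_def)
  have "h = k \<odot> i"
    by (rule pushout_eq[OF p u h(1) Comp_hom[OF i(2) k']])
      (use i k k' h fg u in \<open>simp_all add: chase\<close>)
  then show ?thesis using Cofib_Comp[OF Cofib_iso[OF i(1)] k(4)] i(2) k' by (simp add: hom_def)
qed

lemma cofsqE:
  assumes "cofsq D f g g' f'"
  obtains u v h a b c p d where "is_pushout D f g u v" "f \<in> hom D a b" "g \<in> hom D a c"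
    "u \<in> hom D b p" "v \<in> hom D c p" "h \<in> hom D p d" "g' \<in> hom D b d" "f' \<in> hom D c d"
    "h \<odot> u = g'" "h \<odot> v = f'" "h \<in> Cofib D"
proof -
  obtain u v h where p: "is_pushout D f g u v" and h: "h \<in> hom D (Cod D u) (Cod D f')"
    "h \<odot> u = g'" "h \<odot> v = f'" "h \<in> Cofib D"
    using assms unfolding cofsq_def by auto
  obtain a b c q where k: "f \<in> hom D a b" "g \<in> hom D a c" "u \<in> hom D b q" "v \<in> hom D c q"
    using p by (rule pushout_hom)
  have h': "h \<in> hom D q (Cod D f')" using h(1) k(3) by (simp add: hom_def)
  show ?thesis by (rule that[OF p k h' _ _ h(2-4)]) (use h h' k Comp_hom in blast)+
qed

lemma cofsq_sym: assumes "cofsq D f g g' f'" shows "cofsq D g f f' g'"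
proof -
  obtain u v h a b c p d where p: "is_pushout D f g u v" and h: "f \<in> hom D a b" "g \<in> hom D a c"
    "u \<in> hom D b p" "v \<in> hom D c p" "h \<in> hom D p d" "g' \<in> hom D b d" "f' \<in> hom D c d"
    "h \<odot> u = g'" "h \<odot> v = f'" "h \<in> Cofib D"
    using cofsqE[OF assms] .
  show ?thesis by (rule cofsqI[OF pushout_sym[OF p] h(4,5,6,9,8,10)])
qed

lemma cofsq_right:
  assumes "cofsq D f g g' f'" "f \<in> Cofib D" shows "f' \<in> Cofib D"
proof -
  obtain u v h where p: "is_pushout D f g u v" and h: "h \<in> hom D (Cod D u) (Cod D f')"
    "h \<odot> u = g'" "h \<odot> v = f'" "h \<in> Cofib D"
    using assms unfolding cofsq_def by auto
  have "Dom D h = Cod D v" using h(1) p by (auto simp: hom_def is_pushout_def)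
  then show ?thesis using Cofib_Comp[OF pushout_Cofib[OF p assms(2)] h(4)] h(3) by simp
qed

lemma cofsq_pushout:
  assumes p: "is_pushout D f g u v" shows "cofsq D f g u v"
proof -
  obtain a b c d where h: "f \<in> hom D a b" "g \<in> hom D a c" "u \<in> hom D b d" "v \<in> hom D c d"
    using p by (rule pushout_hom)
  then show ?thesis
    by (intro cofsqI[OF p h(3) Ident_hom[OF homD(5)[OF h(3)]] h(4)])
      (auto simp: Comp_Ident_left Cofib_Ident homD(5)[OF h(3)])
qed

lemma cofsq_iso_leg:
  assumes "is_iso D g" "g \<in> hom D a c" "f \<in> hom D a b"
    "is_iso D g'" "g' \<in> hom D b d" "f' \<in> hom D c d" "g' \<odot> f = f' \<odot> g"
  shows "cofsq D f g g' f'"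
  using cofsq_pushout[OF pushout_iso_leg[OF assms(1-3,6,4,5)]] assms(7) cofsq_sym by metis

text \<open>The corner map of the composite square is that of the second square after a cobase change of
  that of the first one. This is why cofibrations of \<open>S n D\<close> compose.\<close>

lemma cofsq_paste:
  assumes 1: "cofsq D f g g' f'" and 2: "cofsq D f' k k' f''"
    and f: "f \<in> Cofib D" "f \<in> hom D a b" and g: "g \<in> hom D a c" and k: "k \<in> hom D c e"
  shows "cofsq D f (k \<odot> g) (k' \<odot> g') f''"
proof -
  obtain d where d: "g' \<in> hom D b d" "f' \<in> hom D c d" using cofsq_hom[OF 1 f(2) g] by blast
  obtain d2 where d2: "k' \<in> hom D d d2" "f'' \<in> hom D e d2" using cofsq_hom[OF 2 d(2) k] by blast
  obtain u v where p: "is_pushout D f g u v" "v \<in> Cofib D"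
    using Cofib_pushout[OF f(1), of g] f(2) g by (auto simp: hom_def)
  obtain p0 where uv: "u \<in> hom D b p0" "v \<in> hom D c p0"
    using pushout_hom_left[OF p(1) f(2)] g by (auto simp: hom_def)
  obtain h where h: "h \<in> hom D p0 d" "h \<odot> u = g'" "h \<odot> v = f'"
    using pushout_ex[OF p(1) f(2) g uv(1) d] cofsq_hom(2)[OF 1 f(2) g] by blast
  have hc: "h \<in> Cofib D" by (rule cofsq_corner[OF 1 p(1) uv(1) h])
  obtain x y where q: "is_pushout D v k x y" "y \<in> Cofib D"
    using Cofib_pushout[OF p(2), of k] uv(2) k by (auto simp: hom_def)
  obtain q0 where xy: "x \<in> hom D p0 q0" "y \<in> hom D e q0"
    using pushout_hom_left[OF q(1) uv(2)] k by (auto simp: hom_def)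
  \<comment> \<open>the pushout of \<open>f'\<close> and \<open>k\<close>\<close>
  obtain m n where r: "is_pushout D h x m n" "n \<in> Cofib D"
    using Cofib_pushout[OF hc, of x] h(1) xy by (auto simp: hom_def)
  obtain r0 where mn: "m \<in> hom D d r0" "n \<in> hom D q0 r0"
    using pushout_hom_left[OF r(1) h(1)] xy by (auto simp: hom_def)
  have s: "is_pushout D f' k m (n \<odot> y)"
    using pushout_sym[OF pushout_paste[OF pushout_sym[OF q(1)] pushout_sym[OF r(1)]]] h(3) by simp
  have e: "k' \<odot> f' = f'' \<odot> k" by (rule cofsq_hom(2)[OF 2 d(2) k])
  obtain l where l: "l \<in> hom D r0 d2" "l \<odot> m = k'" "l \<odot> n \<odot> y = f''"
    using pushout_ex[OF s d(2) k mn(1) d2 e] by blast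
  have lc: "l \<in> Cofib D" by (rule cofsq_corner[OF 2 s mn(1) l])
  show ?thesis
  proof (rule cofsqI[OF pushout_paste[OF p(1) q(1)] Comp_hom[OF uv(1) xy(1)] _ d2(2)])
    show "l \<odot> n \<in> hom D q0 d2" using mn l Comp_hom by blast
    show "l \<odot> n \<in> Cofib D" using Cofib_Comp[OF r(2) lc] mn l by (auto simp: hom_def)
    show "(l \<odot> n) \<odot> y = f''" using l mn xy by (simp add: chase)
    have "(l \<odot> n) \<odot> x \<odot> u = l \<odot> (n \<odot> x) \<odot> u" using l mn xy uv by (simp add: chase)
    also have "\<dots> = (l \<odot> m) \<odot> h \<odot> u"
      unfolding pushout_commutes[OF r(1), symmetric] using l(1) mn h(1) uv by (simp add: chase)
    finally show "(l \<odot> n) \<odot> x \<odot> u = k' \<odot> g'" using l h by simp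
  qed
qed

text \<open>Corner cofibrations are stable under cobase change: the corner map of the second square is
  the pushout of that of the first one.\<close>

lemma cofsq_cobase:
  assumes s: "cofsq D f g g' f'"
    and h1: "f \<in> hom D a b" "g \<in> hom D a c" "g' \<in> hom D b d" "f' \<in> hom D c d"
    and h2: "f2 \<in> hom D a2 b2" "g2 \<in> hom D a2 c2" "g2' \<in> hom D b2 d2" "f2' \<in> hom D c2 d2"
    and h3: "\<alpha> \<in> hom D a a2" "\<beta> \<in> hom D b b2" "\<gamma> \<in> hom D c c2" "\<delta> \<in> hom D d d2"
    and p: "is_pushout D f \<alpha> \<beta> f2" and p': "is_pushout D f' \<gamma> \<delta> f2'"
    and e: "g2 \<odot> \<alpha> = \<gamma> \<odot> g" "g2' \<odot> \<beta> = \<delta> \<odot> g'" "g2' \<odot> f2 = f2' \<odot> g2"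
    and c: "f2 \<in> Cofib D"
  shows "cofsq D f2 g2 g2' f2'"
proof -
  obtain u v h where q: "is_pushout D f g u v" and h: "h \<in> hom D (Cod D u) (Cod D f')"
    "h \<odot> u = g'" "h \<odot> v = f'" "h \<in> Cofib D"
    using s unfolding cofsq_def by auto
  obtain M where uv: "u \<in> hom D b M" "v \<in> hom D c M"
    using pushout_hom_left[OF q h1(1)] h1(2) by (auto simp: hom_def)
  have hh: "h \<in> hom D M d" using h(1) uv h1 by (auto simp: hom_def)
  obtain u2 v2 where q2: "is_pushout D f2 g2 u2 v2"
    using Cofib_pushout[OF c, of g2] h2 by (auto simp: hom_def)
  obtain N where uv2: "u2 \<in> hom D b2 N" "v2 \<in> hom D c2 N"
    using pushout_hom_left[OF q2 h2(1)] h2(2) by (auto simp: hom_def)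
  obtain k where k: "k \<in> hom D N d2" "k \<odot> u2 = g2'" "k \<odot> v2 = f2'"
    using pushout_ex[OF q2 h2(1,2) uv2(1) h2(3,4) e(3)] by blast
  have r: "is_pushout D f (\<gamma> \<odot> g) (u2 \<odot> \<beta>) v2" using pushout_paste[OF p q2] e(1) by simp
  have "(u2 \<odot> \<beta>) \<odot> f = (v2 \<odot> \<gamma>) \<odot> g"
    using pushout_commutes[OF r] h1 h3 uv2 by (simp add: chase)
  then obtain l where l: "l \<in> hom D M N" "l \<odot> u = u2 \<odot> \<beta>" "l \<odot> v = v2 \<odot> \<gamma>"
    using pushout_ex[OF q h1(1,2) uv(1) Comp_hom[OF h3(2) uv2(1)] Comp_hom[OF h3(3) uv2(2)]] by blast
  have t: "is_pushout D v \<gamma> l v2"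
    by (rule pushout_cancel[OF q _ h3(3) l(1) uv2(2) uv(2) l(3)]) (use r l in simp)
  have kl: "k \<odot> l = \<delta> \<odot> h"
    apply (rule pushout_eq[OF q uv(1) Comp_hom[OF l(1) k(1)] Comp_hom[OF hh h3(4)]])
    using l k(1) h3 hh uv uv2 h2 h1
     apply (simp_all add: chase h rw[OF k(2) uv2(1) k(1)] rw[OF k(3) uv2(2) k(1)] e)
    using pushout_commutes[OF p'] by simp
  have "is_pushout D l h k \<delta>"
    apply (rule pushout_cancel[OF pushout_sym[OF t] _ hh k(1) h3(4) l(1) kl])
    using pushout_sym[OF p'] h k by simp
  then have "k \<in> Cofib D" using pushout_sym pushout_Cofib h(4) by blast
  then show ?thesis using cofsqI[OF q2 uv2(1) k(1) h2(4) k(2,3)] by blast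
qed

text \<open>The corner map of a cube \<open>f : A \<rightarrow> B\<close> of squares can be formed by first taking the pushouts \<open>P\<close>
  and \<open>Q\<close> along the parallel edges \<open>A01\<close> and \<open>A23\<close>, or the pushouts \<open>R\<close> and \<open>T\<close> along \<open>A02\<close> and
  \<open>A13\<close>: both times it is the map to \<open>B3\<close> from the colimit of the remaining seven vertices.\<close>

lemma cofsq_cube_swap:
  assumes A: "A01 \<in> hom D A0 A1" "A02 \<in> hom D A0 A2" "A13 \<in> hom D A1 A3" "A23 \<in> hom D A2 A3"
    and B: "B01 \<in> hom D B0 B1" "B02 \<in> hom D B0 B2" "B13 \<in> hom D B1 B3" "B23 \<in> hom D B2 B3"
    and f: "f0 \<in> hom D A0 B0" "f1 \<in> hom D A1 B1" "f2 \<in> hom D A2 B2" "f3 \<in> hom D A3 B3"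
    and nA: "A13 \<odot> A01 = A23 \<odot> A02" and nB: "B13 \<odot> B01 = B23 \<odot> B02"
    and nf: "f1 \<odot> A01 = B01 \<odot> f0" "f2 \<odot> A02 = B02 \<odot> f0" "f3 \<odot> A13 = B13 \<odot> f1" "f3 \<odot> A23 = B23 \<odot> f2"
    and P: "is_pushout D A01 f0 uP vP" "uP \<in> hom D A1 P"
    and Q: "is_pushout D A23 f2 uQ vQ" "uQ \<in> hom D A3 Q"
    and p: "p \<in> hom D P Q" "p \<odot> uP = uQ \<odot> A13" "p \<odot> vP = vQ \<odot> B02"
    and hP: "hP \<in> hom D P B1" "hP \<odot> uP = f1" "hP \<odot> vP = B01"
    and hQ: "hQ \<in> hom D Q B3" "hQ \<odot> uQ = f3" "hQ \<odot> vQ = B23"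
    and s: "cofsq D p hP hQ B13"
    and R: "is_pushout D A02 f0 uR vR" "uR \<in> hom D A2 R"
    and T: "is_pushout D A13 f1 uT vT" "uT \<in> hom D A3 T"
    and r: "r \<in> hom D R T" "r \<odot> uR = uT \<odot> A23" "r \<odot> vR = vT \<odot> B01"
    and hR: "hR \<in> hom D R B2" "hR \<odot> uR = f2" "hR \<odot> vR = B02"
    and hT: "hT \<in> hom D T B3" "hT \<odot> uT = f3" "hT \<odot> vT = B13"
  shows "cofsq D r hR hT B23"
proof -
  have v: "vP \<in> hom D B0 P" "vQ \<in> hom D B2 Q" "vR \<in> hom D B0 R" "vT \<in> hom D B1 T"
    using pushout_legs(3)[OF P(1) A(1) P(2)] pushout_legs(3)[OF Q(1) A(4) Q(2)]
      pushout_legs(3)[OF R(1) A(2) R(2)] pushout_legs(3)[OF T(1) A(3) T(2)] homD(3)[OF f(1)]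
      homD(3)[OF f(2)] homD(3)[OF f(3)] by auto
  note homs = A B f P(2) Q(2) R(2) T(2) p(1) hP(1) hQ(1) r(1) hR(1) hT(1) v
  note ch = homs[unfolded hom_def, simplified]
  \<comment> \<open>\<open>W0\<close> below is the colimit of the seven vertices, presented as the pushout of \<open>Q\<close> and \<open>B1\<close>; the
    maps \<open>x1\<close> and \<open>x2\<close> present it as the pushout of \<open>T\<close> and \<open>B2\<close>\<close>
  obtain w1 w2 H where W: "is_pushout D p hP w1 w2" and H: "H \<in> hom D (Cod D w1) (Cod D B13)"
    "H \<odot> w1 = hQ" "H \<odot> w2 = B13" "H \<in> Cofib D"
    using s unfolding cofsq_def by auto
  obtain W0 where w: "w1 \<in> hom D Q W0" "w2 \<in> hom D B1 W0"
    using pushout_hom_left[OF W p(1)] hP(1) by (auto simp: hom_def)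
  have H': "H \<in> hom D W0 B3" using H w B by (auto simp: hom_def)
  note chw = ch w[unfolded hom_def, simplified] H'[unfolded hom_def, simplified]
  have eW: "w1 \<odot> p = w2 \<odot> hP" by (rule pushout_commutes[OF W])
  have "(w1 \<odot> uQ) \<odot> A13 = (w1 \<odot> p) \<odot> uP" using chw by (simp add: chase p)
  also have "\<dots> = w2 \<odot> f1" unfolding eW using chw by (simp add: chase hP)
  finally obtain x1 where x1: "x1 \<in> hom D T W0" "x1 \<odot> uT = w1 \<odot> uQ" "x1 \<odot> vT = w2"
    using pushout_ex[OF T(1) A(3) f(2) T(2) Comp_hom[OF Q(2) w(1)] w(2)] by blast
  define x2 where "x2 = w1 \<odot> vQ"
  have x2: "x2 \<in> hom D B2 W0" unfolding x2_def using Comp_hom v w by blast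
  note chx = chw x1(1)[unfolded hom_def, simplified] x2[unfolded hom_def, simplified]
  have eH: "H \<odot> x1 = hT"
    apply (rule pushout_eq[OF T(1,2) Comp_hom[OF x1(1) H'] hT(1)])
    using chx by (simp_all add: chase x1 H hT rw[OF H(2) w(1) H'] hQ)
  have eH2: "H \<odot> x2 = B23"
    unfolding x2_def using chw by (simp add: rw[OF H(2) w(1) H'] hQ)
  have ec: "x1 \<odot> r = x2 \<odot> hR"
  proof (rule pushout_eq[OF R(1,2) Comp_hom[OF r(1) x1(1)] Comp_hom[OF hR(1) x2]])
    have "(x1 \<odot> r) \<odot> uR = w1 \<odot> uQ \<odot> A23"
      using chx by (simp add: chase r rw[OF x1(2) T(2) x1(1)])
    also have "\<dots> = (x2 \<odot> hR) \<odot> uR"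
      unfolding x2_def using chx by (simp add: chase hR pushout_commutes[OF Q(1)])
    finally show "(x1 \<odot> r) \<odot> uR = (x2 \<odot> hR) \<odot> uR" .
    have "(x1 \<odot> r) \<odot> vR = w2 \<odot> B01"
      using chx by (simp add: chase r rw[OF x1(3) v(4) x1(1)])
    also have "\<dots> = (w1 \<odot> p) \<odot> vP" unfolding eW using chx by (simp add: chase hP)
    also have "\<dots> = (x2 \<odot> hR) \<odot> vR"
      unfolding x2_def using chx by (simp add: chase hR p)
    finally show "(x1 \<odot> r) \<odot> vR = (x2 \<odot> hR) \<odot> vR" .
  qed
  have "is_pushout D r hR x1 x2"
  proof (rule pushoutI[OF r(1) hR(1) x1(1) x2 ec])
    show "\<exists>h\<in>hom D W0 z. h \<odot> x1 = s \<and> h \<odot> x2 = t"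
      if st: "s \<in> hom D T z" "t \<in> hom D B2 z" "s \<odot> r = t \<odot> hR" for z s t
    proof -
      note cs = chx st(1,2)[unfolded hom_def, simplified]
      have "(s \<odot> uT) \<odot> A23 = (s \<odot> r) \<odot> uR" using cs by (simp add: chase r)
      also have "\<dots> = t \<odot> f2" unfolding st(3) using cs by (simp add: chase hR)
      finally obtain y where y: "y \<in> hom D Q z" "y \<odot> uQ = s \<odot> uT" "y \<odot> vQ = t"
        using pushout_ex[OF Q(1) A(4) f(3) Q(2) Comp_hom[OF T(2) st(1)] st(2)] by blast
      note cy = cs y(1)[unfolded hom_def, simplified]
      have "y \<odot> p = (s \<odot> vT) \<odot> hP"
      proof (rule pushout_eq[OF P Comp_hom[OF p(1) y(1)] Comp_hom[OF hP(1) Comp_hom[OF v(4) st(1)]]])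
        show "(y \<odot> p) \<odot> uP = ((s \<odot> vT) \<odot> hP) \<odot> uP"
          using cy by (simp add: chase p hP rw[OF y(2) Q(2) y(1)] pushout_commutes[OF T(1)])
        have "(y \<odot> p) \<odot> vP = t \<odot> B02" using cy by (simp add: chase p rw[OF y(3) v(2) y(1)])
        also have "\<dots> = (t \<odot> hR) \<odot> vR" using cy by (simp add: chase hR)
        also have "\<dots> = ((s \<odot> vT) \<odot> hP) \<odot> vP"
          unfolding st(3)[symmetric] using cy by (simp add: chase hP r)
        finally show "(y \<odot> p) \<odot> vP = ((s \<odot> vT) \<odot> hP) \<odot> vP" .
      qed
      then obtain e where e: "e \<in> hom D W0 z" "e \<odot> w1 = y" "e \<odot> w2 = s \<odot> vT"
        using pushout_ex[OF W p(1) hP(1) w(1) y(1) Comp_hom[OF v(4) st(1)]] by blast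
      note ce = cy e(1)[unfolded hom_def, simplified]
      have "e \<odot> x1 = s"
        apply (rule pushout_eq[OF T(1,2) Comp_hom[OF x1(1) e(1)] st(1)])
        using ce by (simp_all add: chase x1 e rw[OF e(2) w(1) e(1)] y)
      moreover have "e \<odot> x2 = t"
        unfolding x2_def using ce by (simp add: chase rw[OF e(2) w(1) e(1)] y)
      ultimately show ?thesis using e(1) by blast
    qed
    show "h = h'" if h: "h \<in> hom D W0 z" "h' \<in> hom D W0 z" and eq: "h \<odot> x1 = h' \<odot> x1" "h \<odot> x2 = h' \<odot> x2"
      for z h h'
    proof (rule pushout_eq[OF W w(1) h])
      have k: "(k \<odot> w1) \<odot> uQ = (k \<odot> x1) \<odot> uT" "(k \<odot> w1) \<odot> vQ = k \<odot> x2" "k \<odot> w2 = (k \<odot> x1) \<odot> vT"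
        if "k \<in> hom D W0 z" for k
        using that chx by (simp_all add: chase x1 x2_def)
      show "h \<odot> w1 = h' \<odot> w1"
      proof (rule pushout_eq[OF Q Comp_hom[OF w(1) h(1)] Comp_hom[OF w(1) h(2)]])
        show "(h \<odot> w1) \<odot> uQ = (h' \<odot> w1) \<odot> uQ" using k(1)[OF h(1)] k(1)[OF h(2)] eq by simp
        show "(h \<odot> w1) \<odot> vQ = (h' \<odot> w1) \<odot> vQ" using k(2)[OF h(1)] k(2)[OF h(2)] eq by simp
      qed
      show "h \<odot> w2 = h' \<odot> w2" using k(3)[OF h(1)] k(3)[OF h(2)] eq by simp
    qed
  qed
  then show ?thesis using cofsqI[OF _ x1(1) H' B(4) eH eH2 H(4)] by blast
qed

end

sublocale waldhausen_category \<subseteq> cofib_category C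
proof (intro cofib_category.intro cofib_category_axioms.intro category_axioms)
qed (fact Zero_Obj Zero_initial Zero_terminal Cofib_Arr Cofib_Comp Cofib_iso Cofib_Zero
  Cofib_pushout)+

section \<open>Categories of diagrams\<close>

definition preord :: "('j \<times> 'j) set \<Rightarrow> bool" where
  "preord P \<longleftrightarrow> (\<forall>x y. (x, y) \<in> P \<longrightarrow> (x, x) \<in> P \<and> (y, y) \<in> P) \<and>
     (\<forall>x y z. (x, y) \<in> P \<longrightarrow> (y, z) \<in> P \<longrightarrow> (x, z) \<in> P)"

lemma preord_Field: "preord P \<Longrightarrow> x \<in> Field P \<longleftrightarrow> (x, x) \<in> P"
  unfolding preord_def Field_def by blast

lemma preordD:
  "preord P \<Longrightarrow> (x, y) \<in> P \<Longrightarrow> x \<in> Field P" "preord P \<Longrightarrow> (x, y) \<in> P \<Longrightarrow> y \<in> Field P"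
  "preord P \<Longrightarrow> (x, y) \<in> P \<Longrightarrow> (y, z) \<in> P \<Longrightarrow> (x, z) \<in> P"
  "preord P \<Longrightarrow> x \<in> Field P \<Longrightarrow> (x, x) \<in> P"
  unfolding preord_def Field_def by blast+

lemma preord_Ar: "preord (Ar n)"
  unfolding preord_def Ar_def ord_def by auto

lemma preord_ord: "preord (ord n)"
  unfolding preord_def ord_def by auto

lemma preord_Ars: "preord (Ars ns)"
  using preord_Ar unfolding preord_def Ars_def by blast

abbreviation cpt :: "('j, 'o, 'm) diag_map \<Rightarrow> 'j \<Rightarrow> 'm" where
  "cpt f \<equiv> fst (snd f)"

lemma is_diagD:
  assumes "is_diag P C A"
  shows "fst A \<in> extensional (Field P)" "snd A \<in> extensional P"
    "x \<in> Field P \<Longrightarrow> fst A x \<in> Obj C"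
    "(x, y) \<in> P \<Longrightarrow> snd A (x, y) \<in> hom C (fst A x) (fst A y)"
    "x \<in> Field P \<Longrightarrow> snd A (x, x) = Ident C (fst A x)"
    "(x, y) \<in> P \<Longrightarrow> (y, z) \<in> P \<Longrightarrow> Comp C (snd A (y, z)) (snd A (x, y)) = snd A (x, z)"
  using assms unfolding is_diag_def by (auto simp: PiE_def)

lemma is_diagI:
  assumes "fst A \<in> extensional (Field P)" "snd A \<in> extensional P"
    "\<And>x. x \<in> Field P \<Longrightarrow> fst A x \<in> Obj C"
    "\<And>x y. (x, y) \<in> P \<Longrightarrow> snd A (x, y) \<in> hom C (fst A x) (fst A y)"
    "\<And>x. x \<in> Field P \<Longrightarrow> snd A (x, x) = Ident C (fst A x)"
    "\<And>x y z. (x, y) \<in> P \<Longrightarrow> (y, z) \<in> P \<Longrightarrow> Comp C (snd A (y, z)) (snd A (x, y)) = snd A (x, z)"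
  shows "is_diag P C A"
  unfolding is_diag_def by (use assms(1-5) assms(6)[symmetric] in \<open>auto simp: PiE_def\<close>)

lemma is_diag_mapD:
  assumes "is_diag_map P C f"
  shows "is_diag P C (fst f)" "is_diag P C (snd (snd f))" "cpt f \<in> extensional (Field P)"
    "x \<in> Field P \<Longrightarrow> cpt f x \<in> hom C (fst (fst f) x) (fst (snd (snd f)) x)"
    "(x, y) \<in> P \<Longrightarrow> Comp C (cpt f y) (snd (fst f) (x, y)) = Comp C (snd (snd (snd f)) (x, y)) (cpt f x)"
  using assms unfolding is_diag_map_def by (auto split: prod.splits)

lemma is_diag_mapI:
  assumes "is_diag P C A" "is_diag P C B" "t \<in> extensional (Field P)"
    "\<And>x. x \<in> Field P \<Longrightarrow> t x \<in> hom C (fst A x) (fst B x)"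
    "\<And>x y. (x, y) \<in> P \<Longrightarrow> Comp C (t y) (snd A (x, y)) = Comp C (snd B (x, y)) (t x)"
  shows "is_diag_map P C (A, t, B)"
  using assms unfolding is_diag_map_def by auto

lemma diag_eqI:
  assumes "is_diag P C A" "is_diag P C B" "\<And>x. x \<in> Field P \<Longrightarrow> fst A x = fst B x"
    "\<And>x y. (x, y) \<in> P \<Longrightarrow> snd A (x, y) = snd B (x, y)"
  shows "A = B"
proof (rule prod_eqI)
  show "fst A = fst B" by (rule extensionalityI[OF is_diagD(1)[OF assms(1)] is_diagD(1)[OF assms(2)] assms(3)])
  show "snd A = snd B"
    by (rule extensionalityI[OF is_diagD(2)[OF assms(1)] is_diagD(2)[OF assms(2)]]) (use assms(4) in auto)
qed

lemma diag_map_eqI: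
  assumes "is_diag_map P C f" "is_diag_map P C g" "fst f = fst g" "snd (snd f) = snd (snd g)"
    "\<And>x. x \<in> Field P \<Longrightarrow> cpt f x = cpt g x"
  shows "f = g"
  using extensionalityI[OF is_diag_mapD(3)[OF assms(1)] is_diag_mapD(3)[OF assms(2)] assms(5)] assms(3,4)
  by (metis prod.collapse)

lemma diag_wcat_simps:
  "Obj (diag_wcat P C ok co we) = {A. is_diag P C A \<and> ok A}"
  "Arr (diag_wcat P C ok co we) = {f. is_diag_map P C f \<and> ok (fst f) \<and> ok (snd (snd f))}"
  "Dom (diag_wcat P C ok co we) f = fst f"
  "Cod (diag_wcat P C ok co we) f = snd (snd f)"
  "Ident (diag_wcat P C ok co we) A = (A, (\<lambda>x \<in> Field P. Ident C (fst A x)), A)"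
  "Comp (diag_wcat P C ok co we) g f = (fst f, (\<lambda>x \<in> Field P. Comp C (cpt g x) (cpt f x)), snd (snd g))"
  "Zero (diag_wcat P C ok co we) = const_diag P C (Zero C)"
  "Cofib (diag_wcat P C ok co we) = {f \<in> Arr (diag_wcat P C ok co we). co f}"
  "Weq (diag_wcat P C ok co we) = {f \<in> Arr (diag_wcat P C ok co we). we f}"
  unfolding diag_wcat_def Let_def by (auto split: prod.splits)

lemma (in category) is_diag_const:
  assumes P: "preord P" and a: "a \<in> Obj C" shows "is_diag P C (const_diag P C a)"
proof (rule is_diagI)
  show "fst (const_diag P C a) x \<in> Obj C" if "x \<in> Field P" for x
    using a that by (simp add: const_diag_def)
  show "snd (const_diag P C a) (x, y) \<in> hom C (fst (const_diag P C a) x) (fst (const_diag P C a) y)"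
    if "(x, y) \<in> P" for x y
    using preordD(1,2)[OF P that] that Ident_hom[OF a] by (simp add: const_diag_def)
  show "snd (const_diag P C a) (x, x) = Ident C (fst (const_diag P C a) x)" if "x \<in> Field P" for x
    using that preordD(4)[OF P that] by (simp add: const_diag_def)
  show "Comp C (snd (const_diag P C a) (y, z)) (snd (const_diag P C a) (x, y)) = snd (const_diag P C a) (x, z)"
    if "(x, y) \<in> P" "(y, z) \<in> P" for x y z
    using preordD(3)[OF P that] that a by (simp add: const_diag_def chase)
qed (auto simp: const_diag_def)

locale diagrams = base: category C for C :: "('o, 'm) wcat" +
  fixes P :: "('j \<times> 'j) set" and ok :: "('j, 'o, 'm) diag \<Rightarrow> bool"
    and co we :: "('j, 'o, 'm) diag_map \<Rightarrow> bool"
  assumes preord: "preord P"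
begin

abbreviation E where "E \<equiv> diag_wcat P C ok co we"

notation base.cmp (infixr "\<odot>" 70)

lemma hom_E: "f \<in> hom E A B \<longleftrightarrow>
  fst f = A \<and> snd (snd f) = B \<and> is_diag_map P C f \<and> ok A \<and> ok B"
  unfolding hom_def diag_wcat_simps by auto

lemma cpt_hom: "f \<in> hom E A B \<Longrightarrow> x \<in> Field P \<Longrightarrow> cpt f x \<in> hom C (fst A x) (fst B x)"
  unfolding hom_E using is_diag_mapD(4) by metis

lemma cpt_natural: "f \<in> hom E A B \<Longrightarrow> (x, y) \<in> P \<Longrightarrow> cpt f y \<odot> snd A (x, y) = snd B (x, y) \<odot> cpt f x"
  unfolding hom_E using is_diag_mapD(5) by metis

lemma diag_of_hom: "f \<in> hom E A B \<Longrightarrow> is_diag P C A \<and> is_diag P C B"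
  unfolding hom_E using is_diag_mapD(1,2) by metis

lemma hom_EI:
  assumes "is_diag P C A" "is_diag P C B" "ok A" "ok B"
    "\<And>x. x \<in> Field P \<Longrightarrow> t x \<in> hom C (fst A x) (fst B x)"
    "\<And>x y. (x, y) \<in> P \<Longrightarrow> Comp C (t y) (snd A (x, y)) = Comp C (snd B (x, y)) (t x)"
  shows "(A, restrict t (Field P), B) \<in> hom E A B"
  unfolding hom_E using assms preordD[OF preord] by (auto intro!: is_diag_mapI)

lemma hom_eqI:
  assumes "f \<in> hom E A B" "g \<in> hom E A B" "\<And>x. x \<in> Field P \<Longrightarrow> cpt f x = cpt g x"
  shows "f = g"
  using assms diag_map_eqI[of P C f g] unfolding hom_E by auto

lemma category_E: "category E"
proof
  show "Dom E f \<in> Obj E" "Cod E f \<in> Obj E" if "f \<in> Arr E" for f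
    using that is_diag_mapD(1,2)[of P C f] by (simp_all add: diag_wcat_simps)
  show id: "Ident E A \<in> hom E A A" if "A \<in> Obj E" for A
    unfolding diag_wcat_simps
    by (rule hom_EI) (use that is_diagD[of P C A] in \<open>auto simp: diag_wcat_simps base.chase\<close>)
  show cm: "Comp E g f \<in> hom E A B'" if fg: "f \<in> hom E A B" "g \<in> hom E B B'" for f g A B B'
  proof -
    have "Comp E g f = (A, (\<lambda>x \<in> Field P. cpt g x \<odot> cpt f x), B')"
      using fg by (simp add: diag_wcat_simps hom_E)
    also have "\<dots> \<in> hom E A B'"
    proof (rule hom_EI)
      show "is_diag P C A" "is_diag P C B'" "ok A" "ok B'"
        using diag_of_hom[OF fg(1)] diag_of_hom[OF fg(2)] fg[unfolded hom_E] by auto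
      show "cpt g x \<odot> cpt f x \<in> hom C (fst A x) (fst B' x)" if "x \<in> Field P" for x
        using fg that cpt_hom base.Comp_hom by metis
      fix x y assume xy: "(x, y) \<in> P"
      then have F: "x \<in> Field P" "y \<in> Field P" using preordD[OF preord] by blast+
      note h = fg[THEN cpt_hom, OF F(1)] fg[THEN cpt_hom, OF F(2)]
      have "is_diag P C A" "is_diag P C B" "is_diag P C B'" using fg diag_of_hom by auto
      then have k: "snd A (x, y) \<in> hom C (fst A x) (fst A y)" "snd B (x, y) \<in> hom C (fst B x) (fst B y)"
         "snd B' (x, y) \<in> hom C (fst B' x) (fst B' y)"
        using is_diagD(4) xy by metis+
      show "(cpt g y \<odot> cpt f y) \<odot> snd A (x, y) = snd B' (x, y) \<odot> cpt g x \<odot> cpt f x"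
        using h k by (simp add: base.chase cpt_natural[OF fg(1) xy]
            base.rw[OF cpt_natural[OF fg(2) xy] k(2) h(4)])
    qed
    finally show ?thesis .
  qed
  have E: "is_diag P C A \<Longrightarrow> ok A \<Longrightarrow> A \<in> Obj E" for A by (simp add: diag_wcat_simps)
  have O: "A \<in> Obj E" "B \<in> Obj E" if "f \<in> hom E A B" for f A B
    using that diag_of_hom[OF that] by (auto simp: diag_wcat_simps hom_E)
  show "Comp E (Ident E B) f = f" if f: "f \<in> hom E A B" for f A B
    by (rule hom_eqI[OF cm[OF f id[OF O(2)[OF f]]] f])
      (use cpt_hom[OF f] in \<open>simp add: diag_wcat_simps base.chase\<close>)
  show "Comp E f (Ident E A) = f" if f: "f \<in> hom E A B" for f A B
    by (rule hom_eqI[OF cm[OF id[OF O(1)[OF f]] f] f])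
      (use cpt_hom[OF f] in \<open>simp add: diag_wcat_simps base.chase\<close>)
  show "Comp E h (Comp E g f) = Comp E (Comp E h g) f"
    if f: "f \<in> hom E A B" and g: "g \<in> hom E B B'" and h: "h \<in> hom E B' B''" for f g h A B B' B''
    by (rule hom_eqI[OF cm[OF cm[OF f g] h] cm[OF f cm[OF g h]]])
      (use cpt_hom[OF f] cpt_hom[OF g] cpt_hom[OF h] in \<open>simp add: diag_wcat_simps base.chase\<close>)
qed

sublocale E: category E by (rule category_E)

lemma cpt_Comp: "x \<in> Field P \<Longrightarrow> cpt (Comp E g f) x = cpt g x \<odot> cpt f x"
  by (simp add: diag_wcat_simps)

lemma cpt_Ident: "x \<in> Field P \<Longrightarrow> cpt (Ident E A) x = Ident C (fst A x)"
  by (simp add: diag_wcat_simps)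

lemma cpt_iso:
  assumes "is_iso E f" "x \<in> Field P" shows "is_iso C (cpt f x)"
proof -
  obtain A B where f: "f \<in> hom E A B" using assms unfolding is_iso_def hom_def by auto
  obtain g where g: "g \<in> hom E B A" "Comp E g f = Ident E A" "Comp E f g = Ident E B"
    using E.isoE[OF assms(1) f] .
  show ?thesis
    by (rule base.isoI[OF cpt_hom[OF f assms(2)] cpt_hom[OF g(1) assms(2)]])
      (metis cpt_Comp cpt_Ident g(2,3) assms(2))+
qed

text \<open>Pushouts of diagrams are computed pointwise, if the pointwise pushouts exist and form a diagram
  in the given full subcategory.\<close>

lemma pushout_pointwise:
  assumes h: "f \<in> hom E A B" "g \<in> hom E A X" "u \<in> hom E B Q" "v \<in> hom E X Q"
    and p: "\<And>x. x \<in> Field P \<Longrightarrow> is_pushout C (cpt f x) (cpt g x) (cpt u x) (cpt v x)"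
  shows "is_pushout E f g u v"
proof (rule E.pushoutI[OF h])
  show "Comp E u f = Comp E v g"
    by (rule hom_eqI[OF E.Comp_hom[OF h(1,3)] E.Comp_hom[OF h(2,4)]])
      (use p base.pushout_commutes in \<open>auto simp: cpt_Comp\<close>)
  show "k = k'" if k: "k \<in> hom E Q Z" "k' \<in> hom E Q Z" "Comp E k u = Comp E k' u" "Comp E k v = Comp E k' v"
    for Z k k'
  proof (rule hom_eqI[OF k(1,2)])
    fix x assume x: "x \<in> Field P"
    show "cpt k x = cpt k' x"
      by (rule base.pushout_eq[OF p[OF x] cpt_hom[OF h(3) x] cpt_hom[OF k(1) x] cpt_hom[OF k(2) x]])
        (metis k(3,4) cpt_Comp x)+
  qed
  show "\<exists>k\<in>hom E Q Z. Comp E k u = s \<and> Comp E k v = t"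
    if st: "s \<in> hom E B Z" "t \<in> hom E X Z" "Comp E s f = Comp E t g" for Z s t
  proof -
    have "\<exists>k. k \<in> hom C (fst Q x) (fst Z x) \<and> k \<odot> cpt u x = cpt s x \<and> k \<odot> cpt v x = cpt t x"
      if x: "x \<in> Field P" for x
      using base.pushout_ex[OF p[OF x] cpt_hom[OF h(1) x] cpt_hom[OF h(2) x] cpt_hom[OF h(3) x]
          cpt_hom[OF st(1) x] cpt_hom[OF st(2) x]] cpt_Comp[OF x, of s f] cpt_Comp[OF x, of t g] st(3)
      by metis
    then obtain k where k: "\<And>x. x \<in> Field P \<Longrightarrow> k x \<in> hom C (fst Q x) (fst Z x)"
      "\<And>x. x \<in> Field P \<Longrightarrow> k x \<odot> cpt u x = cpt s x" "\<And>x. x \<in> Field P \<Longrightarrow> k x \<odot> cpt v x = cpt t x"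
      by metis
    have K: "(Q, restrict k (Field P), Z) \<in> hom E Q Z"
    proof (rule hom_EI)
      show "is_diag P C Q" "is_diag P C Z" "ok Q" "ok Z"
        using diag_of_hom[OF h(3)] diag_of_hom[OF st(1)] h(3) st(1) by (auto simp: hom_E)
      fix x y assume xy: "(x, y) \<in> P"
      then have F: "x \<in> Field P" "y \<in> Field P" using preordD[OF preord] by blast+
      have D: "is_diag P C Q" "is_diag P C Z" "is_diag P C B" "is_diag P C X"
        using h st diag_of_hom by auto
      note c = is_diagD(4)[OF D(1) xy] is_diagD(4)[OF D(2) xy] is_diagD(4)[OF D(3) xy]
        is_diagD(4)[OF D(4) xy] cpt_hom[OF h(3) F(1)] cpt_hom[OF h(3) F(2)]
        cpt_hom[OF h(4) F(1)] cpt_hom[OF h(4) F(2)] k(1)[OF F(1)] k(1)[OF F(2)]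
      show "k y \<odot> snd Q (x, y) = snd Z (x, y) \<odot> k x"
      proof (rule base.pushout_eq[OF p[OF F(1)] c(5) base.Comp_hom[OF c(1) c(10)] base.Comp_hom[OF c(9) c(2)]])
        have "(k y \<odot> snd Q (x, y)) \<odot> cpt u x = (k y \<odot> cpt u y) \<odot> snd B (x, y)"
          using c by (simp add: base.chase cpt_natural[OF h(3) xy])
        also have "\<dots> = snd Z (x, y) \<odot> cpt s x" by (simp add: k(2) F cpt_natural[OF st(1) xy])
        also have "\<dots> = (snd Z (x, y) \<odot> k x) \<odot> cpt u x"
          using c by (simp add: base.chase k(2) F)
        finally show "(k y \<odot> snd Q (x, y)) \<odot> cpt u x = (snd Z (x, y) \<odot> k x) \<odot> cpt u x" .
        have "(k y \<odot> snd Q (x, y)) \<odot> cpt v x = (k y \<odot> cpt v y) \<odot> snd X (x, y)"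
          using c by (simp add: base.chase cpt_natural[OF h(4) xy])
        also have "\<dots> = snd Z (x, y) \<odot> cpt t x" by (simp add: k(3) F cpt_natural[OF st(2) xy])
        also have "\<dots> = (snd Z (x, y) \<odot> k x) \<odot> cpt v x"
          using c by (simp add: base.chase k(3) F)
        finally show "(k y \<odot> snd Q (x, y)) \<odot> cpt v x = (snd Z (x, y) \<odot> k x) \<odot> cpt v x" .
      qed
    qed (use k in auto)
    show ?thesis
    proof (intro bexI[OF _ K] conjI)
      show "Comp E (Q, restrict k (Field P), Z) u = s"
        by (rule hom_eqI[OF E.Comp_hom[OF h(3) K] st(1)]) (simp add: cpt_Comp k)
      show "Comp E (Q, restrict k (Field P), Z) v = t"
        by (rule hom_eqI[OF E.Comp_hom[OF h(4) K] st(2)]) (simp add: cpt_Comp k)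
    qed
  qed
qed

text \<open>If one pushout of two maps is pointwise, then all are, being isomorphic.\<close>

lemma pointwise_pushout:
  assumes p: "is_pushout E f g u v" and u: "u \<in> hom E B Q"
    and p': "is_pushout E f g u' v'" and u': "u' \<in> hom E B Q'"
    and pw: "\<And>x. x \<in> Field P \<Longrightarrow> is_pushout C (cpt f x) (cpt g x) (cpt u' x) (cpt v' x)"
    and x: "x \<in> Field P"
  shows "is_pushout C (cpt f x) (cpt g x) (cpt u x) (cpt v x)"
proof -
  obtain i where i: "is_iso E i" "i \<in> hom E Q' Q" "Comp E i u' = u" "Comp E i v' = v"
    using E.pushout_unique[OF p' p u' u] .
  have "is_pushout C (cpt f x) (cpt g x) (cpt i x \<odot> cpt u' x) (cpt i x \<odot> cpt v' x)"
    by (rule base.pushout_iso[OF pw[OF x] cpt_iso[OF i(1) x] cpt_hom[OF i(2) x] cpt_hom[OF u' x]])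
  then show ?thesis using i(3,4) cpt_Comp[OF x] by metis
qed

end

text \<open>The universal property makes any choice of pointwise pushouts a functor.\<close>

lemma (in category) pointwise_pushout_diag:
  fixes P :: "('j \<times> 'j) set"
  assumes P: "preord P" and f: "is_diag_map P C (A, a, B)" and g: "is_diag_map P C (A, c, X)"
    and p: "\<And>x. x \<in> Field P \<Longrightarrow> is_pushout C (a x) (c x) (U x) (V x)"
  obtains Q where "is_diag P C Q" "\<And>x. x \<in> Field P \<Longrightarrow> fst Q x = Cod C (U x)"
    "is_diag_map P C (B, restrict U (Field P), Q)" "is_diag_map P C (X, restrict V (Field P), Q)"
proof -
  have D: "is_diag P C A" "is_diag P C B" "is_diag P C X"
    using is_diag_mapD(1,2)[OF f] is_diag_mapD(2)[OF g] by auto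
  have fh: "a x \<in> hom C (fst A x) (fst B x)" "c x \<in> hom C (fst A x) (fst X x)" if "x \<in> Field P" for x
    using is_diag_mapD(4)[OF f that] is_diag_mapD(4)[OF g that] by auto
  have U: "U x \<in> hom C (fst B x) (Cod C (U x))" "V x \<in> hom C (fst X x) (Cod C (U x))" if x: "x \<in> Field P" for x
  proof -
    obtain d where "U x \<in> hom C (fst B x) d" "V x \<in> hom C (fst X x) d"
      using pushout_hom_left[OF p[OF x] fh(1)[OF x]] fh(2)[OF x] by (auto simp: hom_def)
    then show "U x \<in> hom C (fst B x) (Cod C (U x))" "V x \<in> hom C (fst X x) (Cod C (U x))"
      by (auto simp: hom_def)
  qed
  have "\<exists>h. h \<in> hom C (Cod C (U x)) (Cod C (U y)) \<and> h \<odot> U x = U y \<odot> snd B (x, y) \<and> h \<odot> V x = V y \<odot> snd X (x, y)"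
    if xy: "(x, y) \<in> P" for x y
  proof -
    have F: "x \<in> Field P" "y \<in> Field P" using xy preordD[OF P] by blast+
    note h = is_diagD(4)[OF D(1) xy] is_diagD(4)[OF D(2) xy] is_diagD(4)[OF D(3) xy]
      fh[OF F(1)] fh[OF F(2)] U[OF F(1)] U[OF F(2)]
    have n: "a y \<odot> snd A (x, y) = snd B (x, y) \<odot> a x" "c y \<odot> snd A (x, y) = snd X (x, y) \<odot> c x"
      using is_diag_mapD(5)[OF f xy] is_diag_mapD(5)[OF g xy] by auto
    have "(U y \<odot> snd B (x, y)) \<odot> a x = (U y \<odot> a y) \<odot> snd A (x, y)"
      using h by (simp add: chase n)
    also have "\<dots> = (V y \<odot> snd X (x, y)) \<odot> c x"
      unfolding pushout_commutes[OF p[OF F(2)]] using h by (simp add: chase n)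
    finally show ?thesis
      using pushout_ex[OF p[OF F(1)] h(4,5,8) Comp_hom[OF h(2) h(10)] Comp_hom[OF h(3) h(11)]] by metis
  qed
  then obtain q where q: "\<And>x y. (x, y) \<in> P \<Longrightarrow> q x y \<in> hom C (Cod C (U x)) (Cod C (U y))"
    "\<And>x y. (x, y) \<in> P \<Longrightarrow> q x y \<odot> U x = U y \<odot> snd B (x, y)"
    "\<And>x y. (x, y) \<in> P \<Longrightarrow> q x y \<odot> V x = V y \<odot> snd X (x, y)"
    by metis
  define Q where "Q = ((\<lambda>x \<in> Field P. Cod C (U x)), (\<lambda>(x, y) \<in> P. q x y))"
  have Q: "x \<in> Field P \<Longrightarrow> fst Q x = Cod C (U x)" "(x, y) \<in> P \<Longrightarrow> snd Q (x, y) = q x y" for x y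
    by (auto simp: Q_def)
  have dQ: "is_diag P C Q"
  proof (rule is_diagI)
    show "fst Q \<in> extensional (Field P)" "snd Q \<in> extensional P" by (auto simp: Q_def)
    show "fst Q x \<in> Obj C" if "x \<in> Field P" for x using U[OF that] homD(5) by (simp add: Q that)
    show "snd Q (x, y) \<in> hom C (fst Q x) (fst Q y)" if "(x, y) \<in> P" for x y
      using q(1)[OF that] that preordD(1,2)[OF P that] by (simp add: Q)
    show "snd Q (x, x) = Ident C (fst Q x)" if x: "x \<in> Field P" for x
    proof -
      have xx: "(x, x) \<in> P" using preordD(4)[OF P x] .
      have o: "Cod C (U x) \<in> Obj C" using U[OF x] homD(5) by blast
      have "q x x = Ident C (Cod C (U x))"
        by (rule pushout_eq[OF p[OF x] U(1)[OF x] q(1)[OF xx] Ident_hom[OF o]])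
          (use q(2,3)[OF xx] is_diagD(5)[OF D(2) x] is_diagD(5)[OF D(3) x] U[OF x] in
            \<open>simp_all add: Comp_Ident_left Comp_Ident_right\<close>)
      then show ?thesis using x xx by (simp add: Q)
    qed
    show "snd Q (y, z) \<odot> snd Q (x, y) = snd Q (x, z)" if xy: "(x, y) \<in> P" and yz: "(y, z) \<in> P" for x y z
    proof -
      have xz: "(x, z) \<in> P" using preordD(3)[OF P xy yz] .
      have x: "x \<in> Field P" and y: "y \<in> Field P" and z: "z \<in> Field P"
        using preordD(1,2)[OF P xy] preordD(2)[OF P yz] by auto
      note h = U[OF x] U[OF y] U[OF z] q(1)[OF xy] q(1)[OF yz] q(1)[OF xz]
        is_diagD(4)[OF D(2) xy] is_diagD(4)[OF D(3) xy] is_diagD(4)[OF D(2) yz] is_diagD(4)[OF D(3) yz]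
      have "q y z \<odot> q x y = q x z"
        by (rule pushout_eq[OF p[OF x] U(1)[OF x] Comp_hom[OF h(7,8)] h(9)])
          (use h in \<open>simp_all add: chase q(2,3)[OF xy] q(2,3)[OF xz] rw[OF q(2)[OF yz] h(3) h(8)]
              rw[OF q(3)[OF yz] h(4) h(8)] is_diagD(6)[OF D(2) xy yz] is_diagD(6)[OF D(3) xy yz]\<close>)
      then show ?thesis using xy yz xz by (simp add: Q)
    qed
  qed
  show ?thesis
  proof (rule that[OF dQ Q(1)])
    show "is_diag_map P C (B, restrict U (Field P), Q)"
      by (rule is_diag_mapI[OF D(2) dQ]) (use U q(2) preordD(1,2)[OF P] in \<open>auto simp: Q\<close>)
    show "is_diag_map P C (X, restrict V (Field P), Q)"
      by (rule is_diag_mapI[OF D(3) dQ]) (use U q(3) preordD(1,2)[OF P] in \<open>auto simp: Q\<close>)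
  qed
qed

section \<open>The S-construction of a category with cofibrations\<close>

lemma Field_Ar: "(i, j) \<in> Field (Ar n) \<longleftrightarrow> i \<le> j \<and> j \<le> n"
  unfolding preord_Field[OF preord_Ar] by (auto simp: Ar_def ord_def)

lemma Ar_iff: "((i, j), (i', j')) \<in> Ar n \<longleftrightarrow> i \<le> j \<and> j \<le> n \<and> i' \<le> j' \<and> j' \<le> n \<and> i \<le> i' \<and> j \<le> j'"
  by (auto simp: Ar_def ord_def)

text \<open>The three parameters of the diagram category that is \<open>S n C\<close>, named in order to apply the
  lemmas on \<open>diagrams\<close>.\<close>

definition S_ok :: "nat \<Rightarrow> ('o, 'm) wcat \<Rightarrow> (nat \<times> nat, 'o, 'm) diag \<Rightarrow> bool" where
  "S_ok n C = (\<lambda>A. (\<forall>i \<le> n. fst A (i, i) = Zero C) \<and>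
         (\<forall>i j k. i \<le> j \<longrightarrow> j \<le> k \<longrightarrow> k \<le> n \<longrightarrow>
            snd A ((i, j), (i, k)) \<in> Cofib C \<and>
            is_pushout C (snd A ((i, j), (i, k))) (snd A ((i, j), (j, j)))
                         (snd A ((i, k), (j, k))) (snd A ((j, j), (j, k)))))"

definition S_co :: "nat \<Rightarrow> ('o, 'm) wcat \<Rightarrow> (nat \<times> nat, 'o, 'm) diag_map \<Rightarrow> bool" where
  "S_co n C = (\<lambda>(A, f, B). \<forall>j k. j \<le> k \<longrightarrow> k \<le> n \<longrightarrow>
       (\<exists>u v. \<exists>h \<in> Cofib C. is_pushout C (snd A ((0, j), (0, k))) (f (0, j)) u v \<and>
          h \<in> hom C (Cod C u) (fst B (0, k)) \<and>
          Comp C h u = f (0, k) \<and> Comp C h v = snd B ((0, j), (0, k))))"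

definition S_we :: "nat \<Rightarrow> ('o, 'm) wcat \<Rightarrow> (nat \<times> nat, 'o, 'm) diag_map \<Rightarrow> bool" where
  "S_we n C = (\<lambda>(A, f, B). \<forall>x \<in> Field (Ar n). f x \<in> Weq C)"

lemma S_eq: "diag_wcat (Ar n) C (S_ok n C) (S_co n C) (S_we n C) = S n C"
  unfolding S_def S_ok_def S_co_def S_we_def ..

lemma S_Weq: "f \<in> Weq (S n D) \<longleftrightarrow> f \<in> Arr (S n D) \<and> (\<forall>x \<in> Field (Ar n). cpt f x \<in> Weq D)"
  unfolding S_eq[symmetric] diag_wcat_simps S_we_def by (auto split: prod.splits)

lemma S_Zero: "Zero (S n D) = const_diag (Ar n) D (Zero D)"
  unfolding S_eq[symmetric] diag_wcat_simps ..

lemma S_dom: "Dom (S n D) f = fst f" "Cod (S n D) f = snd (snd f)"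
  unfolding S_eq[symmetric] diag_wcat_simps by simp_all

lemma S_Obj: "A \<in> Obj (S n D) \<longleftrightarrow> is_diag (Ar n) D A \<and> S_ok n D A"
  unfolding S_eq[symmetric] diag_wcat_simps by simp

lemma S_hom: "f \<in> hom (S n D) A B \<longleftrightarrow>
  fst f = A \<and> snd (snd f) = B \<and> is_diag_map (Ar n) D f \<and> A \<in> Obj (S n D) \<and> B \<in> Obj (S n D)"
  unfolding hom_def S_eq[symmetric] diag_wcat_simps using is_diag_mapD(1,2) by blast

lemma S_Arr: "f \<in> Arr (S n D) \<longleftrightarrow>
  is_diag_map (Ar n) D f \<and> fst f \<in> Obj (S n D) \<and> snd (snd f) \<in> Obj (S n D)"
  unfolding S_eq[symmetric] diag_wcat_simps using is_diag_mapD(1,2) by blast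

lemma S_Cofib: "f \<in> Cofib (S n D) \<longleftrightarrow> f \<in> Arr (S n D) \<and>
    (\<forall>j k. j \<le> k \<longrightarrow> k \<le> n \<longrightarrow> cofsq D (snd (fst f) ((0, j), (0, k))) (cpt f (0, j)) (cpt f (0, k))
        (snd (snd (snd f)) ((0, j), (0, k))))"
proof -
  have "S_co n D f \<longleftrightarrow> (\<forall>j k. j \<le> k \<longrightarrow> k \<le> n \<longrightarrow> cofsq D (snd (fst f) ((0, j), (0, k))) (cpt f (0, j))
      (cpt f (0, k)) (snd (snd (snd f)) ((0, j), (0, k))))" if "f \<in> Arr (S n D)"
  proof -
    have B: "is_diag (Ar n) D (snd (snd f))" using that unfolding S_Arr S_Obj by blast
    have "Cod D (snd (snd (snd f)) ((0, j), (0, k))) = fst (snd (snd f)) (0, k)" if "j \<le> k" "k \<le> n" for j k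
      using is_diagD(4)[OF B, of "(0, j)" "(0, k)"] that by (simp add: Ar_iff hom_def)
    then show ?thesis unfolding S_co_def cofsq_def by (auto split: prod.splits)
  qed
  then show ?thesis unfolding S_eq[symmetric] diag_wcat_simps by blast
qed

lemma S_ObjD:
  assumes "A \<in> Obj (S n D)"
  shows "is_diag (Ar n) D A" "i \<le> n \<Longrightarrow> fst A (i, i) = Zero D"
    "\<lbrakk>i \<le> j; j \<le> k; k \<le> n\<rbrakk> \<Longrightarrow> snd A ((i, j), (i, k)) \<in> Cofib D"
    "\<lbrakk>i \<le> j; j \<le> k; k \<le> n\<rbrakk> \<Longrightarrow> is_pushout D (snd A ((i, j), (i, k))) (snd A ((i, j), (j, j)))
                         (snd A ((i, k), (j, k))) (snd A ((j, j), (j, k)))"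
  using assms unfolding S_Obj S_ok_def by auto

lemma S_ObjI:
  assumes "is_diag (Ar n) D A" "\<And>i. i \<le> n \<Longrightarrow> fst A (i, i) = Zero D"
    "\<And>i j k. \<lbrakk>i \<le> j; j \<le> k; k \<le> n\<rbrakk> \<Longrightarrow> snd A ((i, j), (i, k)) \<in> Cofib D"
    "\<And>i j k. \<lbrakk>i \<le> j; j \<le> k; k \<le> n\<rbrakk> \<Longrightarrow> is_pushout D (snd A ((i, j), (i, k))) (snd A ((i, j), (j, j)))
                         (snd A ((i, k), (j, k))) (snd A ((j, j), (j, k)))"
  shows "A \<in> Obj (S n D)"
  using assms unfolding S_Obj S_ok_def by auto

lemma S_arr:
  assumes "A \<in> Obj (S n D)"
  shows "\<lbrakk>i \<le> j; j \<le> n; i' \<le> j'; j' \<le> n; i \<le> i'; j \<le> j'\<rbrakk>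
      \<Longrightarrow> snd A ((i, j), (i', j')) \<in> hom D (fst A (i, j)) (fst A (i', j'))"
    "\<lbrakk>i \<le> j; i' \<le> j'; j'' \<le> n; i'' \<le> j''; i \<le> i'; j \<le> j'; i' \<le> i''; j' \<le> j''\<rbrakk>
      \<Longrightarrow> Comp D (snd A ((i', j'), (i'', j''))) (snd A ((i, j), (i', j'))) = snd A ((i, j), (i'', j''))"
  using is_diagD(4,6)[OF S_ObjD(1)[OF assms]] by (auto simp: Ar_iff)

lemma S_cpt:
  assumes "f \<in> hom (S n D) A B"
  shows "i \<le> j \<Longrightarrow> j \<le> n \<Longrightarrow> cpt f (i, j) \<in> hom D (fst A (i, j)) (fst B (i, j))"
    "\<lbrakk>i \<le> j; j \<le> n; i' \<le> j'; j' \<le> n; i \<le> i'; j \<le> j'\<rbrakk> \<Longrightarrow>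
      Comp D (cpt f (i', j')) (snd A ((i, j), (i', j'))) = Comp D (snd B ((i, j), (i', j'))) (cpt f (i, j))"
  using assms is_diag_mapD(4,5)[of "Ar n" D f] unfolding S_hom by (auto simp: Ar_iff Field_Ar)

lemma S_Comp: "Comp (S n D) g f = (fst f, (\<lambda>x \<in> Field (Ar n). Comp D (cpt g x) (cpt f x)), snd (snd g))"
  unfolding S_eq[symmetric] diag_wcat_simps ..

lemma S_Ident: "Ident (S n D) A = (A, (\<lambda>x \<in> Field (Ar n). Ident D (fst A x)), A)"
  unfolding S_eq[symmetric] diag_wcat_simps ..

lemma S_homI:
  assumes "A \<in> Obj (S n D)" "B \<in> Obj (S n D)"
    "\<And>x. x \<in> Field (Ar n) \<Longrightarrow> t x \<in> hom D (fst A x) (fst B x)"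
    "\<And>x y. (x, y) \<in> Ar n \<Longrightarrow> Comp D (t y) (snd A (x, y)) = Comp D (snd B (x, y)) (t x)"
  shows "(A, restrict t (Field (Ar n)), B) \<in> hom (S n D) A B"
  unfolding S_hom using assms preordD(1,2)[OF preord_Ar]
  by (auto intro!: is_diag_mapI dest: S_ObjD(1))

lemma S_hom_eqI:
  assumes "f \<in> hom (S n D) A B" "g \<in> hom (S n D) A B" "\<And>x. x \<in> Field (Ar n) \<Longrightarrow> cpt f x = cpt g x"
  shows "f = g"
  using assms diag_map_eqI[of "Ar n" D f g] unfolding S_hom by auto

lemma S_hom_comp:
  assumes "f \<in> hom (S n D) A B"
  shows "x \<in> Field (Ar n) \<Longrightarrow> cpt f x \<in> hom D (fst A x) (fst B x)"
    "(x, y) \<in> Ar n \<Longrightarrow> Comp D (cpt f y) (snd A (x, y)) = Comp D (snd B (x, y)) (cpt f x)"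
  using assms is_diag_mapD(4,5)[of "Ar n" D f] unfolding S_hom by auto

context cofib_category
begin

text \<open>The defining pushouts collapse \<open>A(i,i')\<close> in \<open>A(i,j)\<close> and in \<open>A(i,k)\<close>; by cancellation, the
  square between them, from row \<open>i\<close> to row \<open>i'\<close>, is a pushout as well.\<close>

lemma S_pushout:
  assumes A: "A \<in> Obj (S n D)" and "i \<le> i'" "i' \<le> j" "j \<le> k" "k \<le> n"
  shows "is_pushout D (snd A ((i, j), (i, k))) (snd A ((i, j), (i', j)))
     (snd A ((i, k), (i', k))) (snd A ((i', j), (i', k)))"
proof -
  note a = S_arr[OF A]
  have p: "is_pushout D (snd A ((i, i'), (i', i'))) (snd A ((i, i'), (i, j)))
     (snd A ((i', i'), (i', j))) (snd A ((i, j), (i', j)))"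
    using S_ObjD(4)[OF A, of i i' j] assms pushout_sym by simp
  have q: "is_pushout D (snd A ((i, i'), (i', i'))) (snd A ((i, j), (i, k)) \<odot> snd A ((i, i'), (i, j)))
     (snd A ((i', j), (i', k)) \<odot> snd A ((i', i'), (i', j))) (snd A ((i, k), (i', k)))"
    using S_ObjD(4)[OF A, of i i' k] assms pushout_sym by (simp add: a)
  show ?thesis
    by (rule pushout_sym[OF pushout_cancel[where c = "fst A (i, j)" and d = "fst A (i, k)"
          and p = "fst A (i', j)" and q = "fst A (i', k)", OF p q]]) (use assms a in auto)
qed

text \<open>The condition on the corner maps in row 0 implies that in row \<open>i\<close>, by cobase change.\<close>

lemma S_cofsq:
  assumes c: "f \<in> Cofib (S n D)" and f: "f \<in> hom (S n D) A B" and ijk: "i \<le> j" "j \<le> k" "k \<le> n"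
  shows "cofsq D (snd A ((i, j), (i, k))) (cpt f (i, j)) (cpt f (i, k)) (snd B ((i, j), (i, k)))"
proof -
  have A: "A \<in> Obj (S n D)" and B: "B \<in> Obj (S n D)" using f by (auto simp: S_hom)
  have s: "cofsq D (snd A ((0, j), (0, k))) (cpt f (0, j)) (cpt f (0, k)) (snd B ((0, j), (0, k)))"
    using c f ijk unfolding S_Cofib S_hom by auto
  show ?thesis
    by (rule cofsq_cobase[where a = "fst A (0, j)" and b = "fst A (0, k)" and c = "fst B (0, j)"
        and d = "fst B (0, k)" and ?a2.0 = "fst A (i, j)" and ?b2.0 = "fst A (i, k)"
        and ?c2.0 = "fst B (i, j)" and ?d2.0 = "fst B (i, k)",
          OF s _ _ _ _ _ _ _ _ _ _ _ _ S_pushout[OF A, of 0 i j k] S_pushout[OF B, of 0 i j k]])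
      (use ijk S_arr(1)[OF A] S_arr(1)[OF B] S_cpt[OF f] S_ObjD(3)[OF A] in auto)
qed

text \<open>Apply the corner condition to \<open>(i,i) \<le> (i,j)\<close>, where the first component is a map between
  zero objects.\<close>

lemma S_Cofib_pointwise:
  assumes c: "f \<in> Cofib (S n D)" and f: "f \<in> hom (S n D) A B" and ij: "i \<le> j" "j \<le> n"
  shows "cpt f (i, j) \<in> Cofib D"
proof -
  have A: "A \<in> Obj (S n D)" and B: "B \<in> Obj (S n D)" using f by (auto simp: S_hom)
  have "cpt f (i, i) \<in> hom D (Zero D) (Zero D)"
    using S_cpt(1)[OF f, of i i] S_ObjD(2)[OF A] S_ObjD(2)[OF B] ij by auto
  then have "cpt f (i, i) \<in> Cofib D" using Cofib_Zero Zero_Obj by blast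
  then show ?thesis using cofsq_right[OF cofsq_sym[OF S_cofsq[OF c f, of i i j]]] ij by simp
qed

lemma category_S: "category (S n D)"
proof -
  interpret diagrams D "Ar n" "S_ok n D" "S_co n D" "S_we n D"
    by unfold_locales (rule preord_Ar)
  show ?thesis using category_E by (simp add: S_eq)
qed

text \<open>By cobase change of corner maps, the rows of a pointwise pushout consist of cofibrations, and by
  commutation of colimits the squares forming the quotients are pushouts. The pointwise pushouts \<open>w\<close> can be
  prescribed as long as the distinguished zero object is taken on the diagonal; this serves to
  construct objects of \<open>S n D\<close> with given values.\<close>

lemma S_pushout_choice:
  assumes c: "f \<in> Cofib (S n D)" and f: "f \<in> hom (S n D) A B" and g: "g \<in> hom (S n D) A X"
    and w: "\<And>x. x \<in> Field (Ar n) \<Longrightarrow> is_pushout D (cpt f x) (cpt g x) (fst (w x)) (snd (w x))"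
    "\<And>x. x \<in> Field (Ar n) \<Longrightarrow> fst x = snd x \<Longrightarrow> Cod D (fst (w x)) = Zero D"
  obtains u v Q where "u \<in> hom (S n D) B Q" "v \<in> hom (S n D) X Q" "v \<in> Cofib (S n D)"
    "\<And>x. x \<in> Field (Ar n) \<Longrightarrow> is_pushout D (cpt f x) (cpt g x) (cpt u x) (cpt v x)"
    "\<And>x. x \<in> Field (Ar n) \<Longrightarrow> fst Q x = Cod D (fst (w x))"
proof -
  have O: "A \<in> Obj (S n D)" "B \<in> Obj (S n D)" "X \<in> Obj (S n D)" using f g by (auto simp: S_hom)
  define U V where "U = (\<lambda>x. fst (w x))" and "V = (\<lambda>x. snd (w x))"
  have fg: "is_diag_map (Ar n) D (A, cpt f, B)" "is_diag_map (Ar n) D (A, cpt g, X)"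
    using f g unfolding S_hom by (metis prod.collapse)+
  obtain Q where Q: "is_diag (Ar n) D Q" "\<And>x. x \<in> Field (Ar n) \<Longrightarrow> fst Q x = Cod D (U x)"
    "is_diag_map (Ar n) D (B, restrict U (Field (Ar n)), Q)"
    "is_diag_map (Ar n) D (X, restrict V (Field (Ar n)), Q)"
    using pointwise_pushout_diag[OF preord_Ar fg, of U V] w(1) unfolding U_def V_def by blast
  define u v where "u = (B, restrict U (Field (Ar n)), Q)" and "v = (X, restrict V (Field (Ar n)), Q)"
  have p: "is_pushout D (cpt f (i, j)) (cpt g (i, j)) (cpt u (i, j)) (cpt v (i, j))" if "i \<le> j" "j \<le> n" for i j
    using w(1) that by (simp add: u_def v_def U_def V_def Field_Ar)
  have uv: "cpt u (i, j) \<in> hom D (fst B (i, j)) (fst Q (i, j))" "cpt v (i, j) \<in> hom D (fst X (i, j)) (fst Q (i, j))"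
    if "i \<le> j" "j \<le> n" for i j
    using is_diag_mapD(4)[OF Q(3)] is_diag_mapD(4)[OF Q(4)] that unfolding u_def v_def by (auto simp: Field_Ar)
  have nu: "cpt u (i', j') \<odot> snd B ((i, j), (i', j')) = snd Q ((i, j), (i', j')) \<odot> cpt u (i, j)"
    "cpt v (i', j') \<odot> snd X ((i, j), (i', j')) = snd Q ((i, j), (i', j')) \<odot> cpt v (i, j)"
    if "i \<le> j" "j \<le> n" "i' \<le> j'" "j' \<le> n" "i \<le> i'" "j \<le> j'" for i j i' j'
    using is_diag_mapD(5)[OF Q(3), of "(i, j)" "(i', j')"] is_diag_mapD(5)[OF Q(4), of "(i, j)" "(i', j')"] that
    unfolding u_def v_def by (auto simp: Ar_iff)
  have Qa: "snd Q ((i, j), (i', j')) \<in> hom D (fst Q (i, j)) (fst Q (i', j'))"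
    if "i \<le> j" "j \<le> n" "i' \<le> j'" "j' \<le> n" "i \<le> i'" "j \<le> j'" for i j i' j'
    using is_diagD(4)[OF Q(1)] that by (simp add: Ar_iff)
  have vc: "cpt v (i, j) \<in> Cofib D" if "i \<le> j" "j \<le> n" for i j
    using pushout_Cofib[OF p[OF that] S_Cofib_pointwise[OF c f that]] .
  have sq: "cofsq D (snd X ((i, j), (i, k))) (cpt v (i, j)) (cpt v (i, k)) (snd Q ((i, j), (i, k)))"
    if ijk: "i \<le> j" "j \<le> k" "k \<le> n" for i j k
    by (rule cofsq_sym, rule cofsq_cobase[where a = "fst A (i, j)" and b = "fst B (i, j)"
        and c = "fst A (i, k)" and d = "fst B (i, k)" and ?a2.0 = "fst X (i, j)" and ?b2.0 = "fst Q (i, j)"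
        and ?c2.0 = "fst X (i, k)" and ?d2.0 = "fst Q (i, k)", OF cofsq_sym[OF S_cofsq[OF c f ijk]] _ _ _ _ _ _ _ _ _ _ _ _
          p[of i j] p[of i k]])
      (use ijk S_arr(1)[OF O(1)] S_arr(1)[OF O(2)] S_arr(1)[OF O(3)] Qa S_cpt[OF f] S_cpt[OF g] uv nu vc in auto)
  have QO: "Q \<in> Obj (S n D)"
  proof (rule S_ObjI[OF Q(1)])
    show "fst Q (i, i) = Zero D" if "i \<le> n" for i using Q(2) w(2) that by (simp add: U_def Field_Ar)
    fix i j k assume ijk: "i \<le> j" "j \<le> k" "k \<le> n"
    show "snd Q ((i, j), (i, k)) \<in> Cofib D"
      using cofsq_right[OF sq[OF ijk] S_ObjD(3)[OF O(3) ijk]] .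
    show "is_pushout D (snd Q ((i, j), (i, k))) (snd Q ((i, j), (j, j))) (snd Q ((i, k), (j, k))) (snd Q ((j, j), (j, k)))"
    proof (rule pushout_of_pushouts[where ?A2.0 = "fst A (i, k)" and ?A3.0 = "fst A (j, j)"
          and ?A4.0 = "fst A (j, k)" and ?B1.0 = "fst B (i, j)" and ?B2.0 = "fst B (i, k)"
          and ?B3.0 = "fst B (j, j)" and ?B4.0 = "fst B (j, k)" and ?X1.0 = "fst X (i, j)"
          and ?X2.0 = "fst X (i, k)" and ?X3.0 = "fst X (j, j)" and ?X4.0 = "fst X (j, k)"
          and ?P1.0 = "fst Q (i, j)" and ?P2.0 = "fst Q (i, k)" and ?P3.0 = "fst Q (j, j)"
          and ?P4.0 = "fst Q (j, k)", OF _ _ _ S_ObjD(4)[OF O(2) ijk] _ _ _ _ S_ObjD(4)[OF O(3) ijk] _ _ _ _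
          _ _ _ _ _ _ _ _ _ _ p[of i j] _ _ p[of i k] _ _ p[of j j] _ _ p[of j k]])
      show "h = h'" if h: "h \<in> hom D (fst A (j, k)) z" "h' \<in> hom D (fst A (j, k)) z"
        "h \<odot> snd A ((i, k), (j, k)) = h' \<odot> snd A ((i, k), (j, k))"
        "h \<odot> snd A ((j, j), (j, k)) = h' \<odot> snd A ((j, j), (j, k))" for z h h'
        using pushout_eq[OF S_ObjD(4)[OF O(1) ijk] S_arr(1)[OF O(1)] h(1,2,3,4)] ijk by simp
    qed (use ijk S_arr(1)[OF O(1)] S_arr(1)[OF O(2)] S_arr(1)[OF O(3)] Qa S_cpt[OF f] S_cpt[OF g] uv nu in auto)
  qed
  have uE: "u \<in> hom (S n D) B Q" and vE: "v \<in> hom (S n D) X Q"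
    unfolding S_hom using Q O QO by (auto simp: u_def v_def)
  have "v \<in> Cofib (S n D)" unfolding S_Cofib
    using sq vE by (auto simp: v_def hom_def)
  then show ?thesis using that[OF uE vE] p Q(2) unfolding U_def by (metis Field_Ar surj_pair)
qed

lemma S_pushout_exists:
  assumes c: "f \<in> Cofib (S n D)" and f: "f \<in> hom (S n D) A B" and g: "g \<in> hom (S n D) A X"
  obtains u v Q where "u \<in> hom (S n D) B Q" "v \<in> hom (S n D) X Q" "v \<in> Cofib (S n D)"
    "\<And>x. x \<in> Field (Ar n) \<Longrightarrow> is_pushout D (cpt f x) (cpt g x) (cpt u x) (cpt v x)"
proof -
  have O: "A \<in> Obj (S n D)" "B \<in> Obj (S n D)" "X \<in> Obj (S n D)" using f g by (auto simp: S_hom)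
  \<comment> \<open>on the diagonal the chosen zero object has to be taken\<close>
  have "\<exists>w. is_pushout D (cpt f x) (cpt g x) (fst w) (snd w) \<and> (fst x = snd x \<longrightarrow> Cod D (fst w) = Zero D)"
    if x: "x \<in> Field (Ar n)" for x
  proof (cases x)
    case (Pair i j)
    then have ij: "i \<le> j" "j \<le> n" using x by (auto simp: Field_Ar)
    note fh = S_cpt(1)[OF f ij] and gh = S_cpt(1)[OF g ij]
    show ?thesis
    proof (cases "i = j")
      case False
      obtain u v where "is_pushout D (cpt f x) (cpt g x) u v"
        using Cofib_pushout[OF S_Cofib_pointwise[OF c f ij], of "cpt g x"] fh gh Pair by (auto simp: hom_def)
      then show ?thesis using False Pair by auto
    next
      case True
      have z: "Ident D (Zero D) \<in> hom D (Zero D) (Zero D)" using Ident_hom Zero_Obj by simp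
      have "cpt f x \<in> hom D (Zero D) (Zero D)" "cpt g x \<in> hom D (Zero D) (Zero D)"
        using fh gh S_ObjD(2)[OF O(1)] S_ObjD(2)[OF O(2)] S_ObjD(2)[OF O(3)] True Pair ij by auto
      then have "cpt f x = Ident D (Zero D)" "cpt g x = Ident D (Zero D)"
        using hom_from_Zero_eq[OF _ z] by blast+
      then show ?thesis using pushout_Ident[OF z] z by (intro exI[of _ "(Ident D (Zero D), Ident D (Zero D))"])
          (auto simp: hom_def)
    qed
  qed
  then obtain w where w: "\<And>x. x \<in> Field (Ar n) \<Longrightarrow> is_pushout D (cpt f x) (cpt g x) (fst (w x)) (snd (w x))"
    "\<And>x. x \<in> Field (Ar n) \<Longrightarrow> fst x = snd x \<Longrightarrow> Cod D (fst (w x)) = Zero D"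
    by metis
  show ?thesis using S_pushout_choice[OF c f g w] that by metis
qed

text \<open>Cofibrations compose since corner conditions can be pasted, isomorphisms and maps out of zero have
  corner maps of the required form, and pushouts are those of \<open>S_pushout_exists\<close>.\<close>

lemma cofib_category_S: "cofib_category (S n D)"
proof -
  interpret L: diagrams D "Ar n" "S_ok n D" "S_co n D" "S_we n D"
    rewrites "diag_wcat (Ar n) D (S_ok n D) (S_co n D) (S_we n D) = S n D"
    by unfold_locales (rule preord_Ar, rule S_eq)
  let ?Z = "const_diag (Ar n) D (Zero D)"
  have Zi: "Ident D (Zero D) \<in> hom D (Zero D) (Zero D)" using Ident_hom Zero_Obj by simp
  have Zc: "Ident D (Zero D) \<odot> Ident D (Zero D) = Ident D (Zero D)" using Comp_Ident_left Zi by simp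
  have Z: "fst ?Z (i, j) = Zero D" if "i \<le> j" "j \<le> n" for i j
    using that by (simp add: const_diag_def Field_Ar)
  have Z2: "snd ?Z ((i, j), (i', j')) = Ident D (Zero D)"
     if "i \<le> j" "j \<le> n" "i' \<le> j'" "j' \<le> n" "i \<le> i'" "j \<le> j'" for i j i' j'
    using that by (simp add: const_diag_def Ar_iff)
  have ZD: "is_diag (Ar n) D ?Z"
    using is_diag_const[OF preord_Ar Zero_Obj] .
  have ZO: "?Z \<in> Obj (S n D)"
    by (rule S_ObjI[OF ZD]) (use pushout_Ident[OF Zi] Zero_Obj Cofib_Ident in \<open>auto simp: Z Z2\<close>)
  show ?thesis
  proof (intro cofib_category.intro cofib_category_axioms.intro category_S)
    show "Zero (S n D) \<in> Obj (S n D)" using ZO by (simp add: S_Zero)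
    show "\<exists>!f. f \<in> hom (S n D) (Zero (S n D)) A" if A: "A \<in> Obj (S n D)" for A
    proof -
      have "\<exists>t. t \<in> hom D (Zero D) (fst A x)" if "x \<in> Field (Ar n)" for x
        using Zero_initial is_diagD(3)[OF S_ObjD(1)[OF A] that] by blast
      then obtain t where t: "\<And>x. x \<in> Field (Ar n) \<Longrightarrow> t x \<in> hom D (Zero D) (fst A x)" by metis
      have "(?Z, restrict t (Field (Ar n)), A) \<in> hom (S n D) ?Z A"
      proof (rule L.hom_EI[OF ZD S_ObjD(1)[OF A]])
        show "S_ok n D ?Z" "S_ok n D A" using ZO A by (auto simp: S_Obj)
        show "t x \<in> hom D (fst ?Z x) (fst A x)" if "x \<in> Field (Ar n)" for x
          using t[OF that] that by (simp add: const_diag_def)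
        fix x y assume xy: "(x, y) \<in> Ar n"
        then have F: "x \<in> Field (Ar n)" "y \<in> Field (Ar n)" using preordD[OF preord_Ar] by blast+
        have "snd ?Z (x, y) = Ident D (Zero D)" using xy by (simp add: const_diag_def)
        then show "t y \<odot> snd ?Z (x, y) = snd A (x, y) \<odot> t x"
          using hom_from_Zero_eq[OF Comp_hom[OF Zi t[OF F(2)]] Comp_hom[OF t[OF F(1)] is_diagD(4)[OF S_ObjD(1)[OF A] xy]]]
          by simp
      qed
      moreover have "f = g" if fg: "f \<in> hom (S n D) ?Z A" "g \<in> hom (S n D) ?Z A" for f g
      proof (rule L.hom_eqI[OF fg])
        fix x assume x: "x \<in> Field (Ar n)"
        then show "cpt f x = cpt g x"
          using L.cpt_hom[OF fg(1) x] L.cpt_hom[OF fg(2) x] hom_from_Zero_eq[of "cpt f x" "fst A x"]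
          by (simp add: const_diag_def)
      qed
      ultimately show ?thesis unfolding S_Zero by blast
    qed
    show "\<exists>!f. f \<in> hom (S n D) A (Zero (S n D))" if A: "A \<in> Obj (S n D)" for A
    proof -
      have "\<exists>t. t \<in> hom D (fst A x) (Zero D)" if "x \<in> Field (Ar n)" for x
        using Zero_terminal is_diagD(3)[OF S_ObjD(1)[OF A] that] by blast
      then obtain t where t: "\<And>x. x \<in> Field (Ar n) \<Longrightarrow> t x \<in> hom D (fst A x) (Zero D)" by metis
      have "(A, restrict t (Field (Ar n)), ?Z) \<in> hom (S n D) A ?Z"
      proof (rule L.hom_EI[OF S_ObjD(1)[OF A] ZD])
        show "S_ok n D ?Z" "S_ok n D A" using ZO A by (auto simp: S_Obj)
        show "t x \<in> hom D (fst A x) (fst ?Z x)" if "x \<in> Field (Ar n)" for x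
          using t[OF that] that by (simp add: const_diag_def)
        fix x y assume xy: "(x, y) \<in> Ar n"
        then have F: "x \<in> Field (Ar n)" "y \<in> Field (Ar n)" using preordD[OF preord_Ar] by blast+
        have "snd ?Z (x, y) = Ident D (Zero D)" using xy by (simp add: const_diag_def)
        then show "t y \<odot> snd A (x, y) = snd ?Z (x, y) \<odot> t x"
          using hom_to_Zero_eq[OF Comp_hom[OF is_diagD(4)[OF S_ObjD(1)[OF A] xy] t[OF F(2)]] Comp_hom[OF t[OF F(1)] Zi]]
          by simp
      qed
      moreover have "f = g" if fg: "f \<in> hom (S n D) A ?Z" "g \<in> hom (S n D) A ?Z" for f g
      proof (rule L.hom_eqI[OF fg])
        fix x assume x: "x \<in> Field (Ar n)"
        then show "cpt f x = cpt g x"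
          using L.cpt_hom[OF fg(1) x] L.cpt_hom[OF fg(2) x] hom_to_Zero_eq[of "cpt f x" "fst A x"]
          by (simp add: const_diag_def)
      qed
      ultimately show ?thesis unfolding S_Zero by blast
    qed
    show "Cofib (S n D) \<subseteq> Arr (S n D)" by (auto simp: S_Cofib)
    show "Comp (S n D) g f \<in> Cofib (S n D)"
      if f: "f \<in> Cofib (S n D)" and g: "g \<in> Cofib (S n D)" and fg: "Dom (S n D) g = Cod (S n D) f" for f g
    proof -
      obtain A B X where h: "f \<in> hom (S n D) A B" "g \<in> hom (S n D) B X"
        using f g fg unfolding S_Cofib hom_def by auto
      have A: "A \<in> Obj (S n D)" using h by (simp add: S_hom)
      have c: "Comp (S n D) g f \<in> hom (S n D) A X" using L.E.Comp_hom h by blast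
      have "cofsq D (snd A ((0, j), (0, k))) (cpt (Comp (S n D) g f) (0, j)) (cpt (Comp (S n D) g f) (0, k))
        (snd X ((0, j), (0, k)))" if jk: "j \<le> k" "k \<le> n" for j k
        unfolding L.cpt_Comp[of "(0, j)" g f, unfolded Field_Ar, simplified, OF order_trans[OF jk]]
          L.cpt_Comp[of "(0, k)" g f, unfolded Field_Ar, simplified, OF jk(2)]
        by (rule cofsq_paste[where a = "fst A (0, j)" and b = "fst A (0, k)" and c = "fst B (0, j)"
              and e = "fst X (0, j)", OF S_cofsq[OF f h(1) _ jk] S_cofsq[OF g h(2) _ jk]])
          (use jk S_ObjD(3)[OF A] S_arr(1)[OF A] S_cpt(1)[OF h(1)] S_cpt(1)[OF h(2)] in auto)
      then show ?thesis using c unfolding S_Cofib by (auto simp: hom_def S_dom)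
    qed
    show "f \<in> Cofib (S n D)" if i: "is_iso (S n D) f" for f
    proof -
      obtain A B where h: "f \<in> hom (S n D) A B" using i unfolding is_iso_def hom_def by auto
      have O: "A \<in> Obj (S n D)" "B \<in> Obj (S n D)" using h by (auto simp: S_hom)
      have "cofsq D (snd A ((0, j), (0, k))) (cpt f (0, j)) (cpt f (0, k)) (snd B ((0, j), (0, k)))"
        if jk: "j \<le> k" "k \<le> n" for j k
        by (rule cofsq_iso_leg[where a = "fst A (0, j)" and b = "fst A (0, k)" and c = "fst B (0, j)"
              and d = "fst B (0, k)"])
          (use jk L.cpt_iso[OF i] S_cpt[OF h] S_arr(1)[OF O(1)] S_arr(1)[OF O(2)] in \<open>auto simp: Field_Ar\<close>)
      then show ?thesis using h unfolding S_Cofib by (auto simp: hom_def S_dom)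
    qed
    show "f \<in> Cofib (S n D)" if A: "A \<in> Obj (S n D)" and f: "f \<in> hom (S n D) (Zero (S n D)) A" for A f
    proof -
      have h: "f \<in> hom (S n D) ?Z A" using f by (simp add: S_Zero)
      have "cofsq D (snd ?Z ((0, j), (0, k))) (cpt f (0, j)) (cpt f (0, k)) (snd A ((0, j), (0, k)))"
        if jk: "j \<le> k" "k \<le> n" for j k
      proof -
        have t: "cpt f (0, j) \<in> hom D (Zero D) (fst A (0, j))" "cpt f (0, k) \<in> hom D (Zero D) (fst A (0, k))"
          using S_cpt(1)[OF h, of 0 j] S_cpt(1)[OF h, of 0 k] jk by (auto simp: Z)
        have a: "snd A ((0, j), (0, k)) \<in> hom D (fst A (0, j)) (fst A (0, k))"
          using S_arr(1)[OF A] jk by simp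
        show ?thesis using jk
          by (simp add: Z2) (rule cofsqI[OF pushout_Ident[OF t(1)] t(1) a a
              hom_from_Zero_eq[OF Comp_hom[OF t(1) a] t(2)] Comp_Ident_right[OF a] S_ObjD(3)[OF A]]; simp)
      qed
      then show ?thesis using h unfolding S_Cofib by (auto simp: hom_def S_dom)
    qed
    show "\<exists>u v. is_pushout (S n D) f g u v \<and> v \<in> Cofib (S n D)"
      if f: "f \<in> Cofib (S n D)" and g: "g \<in> Arr (S n D)" "Dom (S n D) g = Dom (S n D) f" for f g
    proof -
      obtain A B X where h: "f \<in> hom (S n D) A B" "g \<in> hom (S n D) A X"
        using f g unfolding S_Cofib hom_def by auto
      then show ?thesis using S_pushout_exists[OF f h] L.pushout_pointwise by metis
    qed
  qed
qed

lemma S_pushout_iff: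
  assumes c: "f \<in> Cofib (S n D)" and f: "f \<in> hom (S n D) A B" and g: "g \<in> hom (S n D) A X"
    and u: "u \<in> hom (S n D) B Q" and v: "v \<in> hom (S n D) X Q"
  shows "is_pushout (S n D) f g u v \<longleftrightarrow>
    (\<forall>x \<in> Field (Ar n). is_pushout D (cpt f x) (cpt g x) (cpt u x) (cpt v x))"
proof -
  interpret L: diagrams D "Ar n" "S_ok n D" "S_co n D" "S_we n D"
    rewrites "diag_wcat (Ar n) D (S_ok n D) (S_co n D) (S_we n D) = S n D"
    by unfold_locales (rule preord_Ar, rule S_eq)
  obtain u' v' Q' where q: "u' \<in> hom (S n D) B Q'" "v' \<in> hom (S n D) X Q'"
    "\<And>x. x \<in> Field (Ar n) \<Longrightarrow> is_pushout D (cpt f x) (cpt g x) (cpt u' x) (cpt v' x)"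
    using S_pushout_exists[OF c f g] by metis
  have p: "is_pushout (S n D) f g u' v'" by (rule L.pushout_pointwise[OF f g q])
  show ?thesis
    using L.pushout_pointwise[OF f g u v] L.pointwise_pushout[OF _ u p q(1,3)] by blast
qed

end

lemma S_pushoutI:
  assumes D: "cofib_category D"
    and h: "f \<in> hom (S n D) A B" "g \<in> hom (S n D) A X" "u \<in> hom (S n D) B Q" "v \<in> hom (S n D) X Q"
    and p: "\<And>x. x \<in> Field (Ar n) \<Longrightarrow> is_pushout D (cpt f x) (cpt g x) (cpt u x) (cpt v x)"
  shows "is_pushout (S n D) f g u v"
proof -
  interpret cofib_category D by (rule D)
  interpret L: diagrams D "Ar n" "S_ok n D" "S_co n D" "S_we n D"
    rewrites "diag_wcat (Ar n) D (S_ok n D) (S_co n D) (S_we n D) = S n D"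
    by unfold_locales (rule preord_Ar, rule S_eq)
  show ?thesis by (rule L.pushout_pointwise[OF h p])
qed

lemma S_pushoutD:
  assumes D: "cofib_category D" and c: "f \<in> Cofib (S n D)" and p: "is_pushout (S n D) f g u v"
  obtains A B X Q where
    "f \<in> hom (S n D) A B" "g \<in> hom (S n D) A X" "u \<in> hom (S n D) B Q" "v \<in> hom (S n D) X Q"
    "\<And>x. x \<in> Field (Ar n) \<Longrightarrow> is_pushout D (cpt f x) (cpt g x) (cpt u x) (cpt v x)"
    "\<And>x. x \<in> Field (Ar n) \<Longrightarrow> cpt f x \<in> Cofib D"
proof -
  interpret cofib_category D by (rule D)
  obtain A B X Q where h: "f \<in> hom (S n D) A B" "g \<in> hom (S n D) A X" "u \<in> hom (S n D) B Q" "v \<in> hom (S n D) X Q"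
    using category.pushout_hom[OF category_S p] .
  have "cpt f x \<in> Cofib D" if "x \<in> Field (Ar n)" for x
    using S_Cofib_pointwise[OF c h(1)] that by (cases x) (auto simp: Field_Ar)
  then show ?thesis using that[OF h] S_pushout_iff[OF c h] p by blast
qed

section \<open>Exact functors\<close>

definition exact_functor :: "('o, 'm) wcat \<Rightarrow> ('p, 'n) wcat \<Rightarrow> ('o \<Rightarrow> 'p) \<Rightarrow> ('m \<Rightarrow> 'n) \<Rightarrow> bool" where
  "exact_functor D D' Fo Fm \<longleftrightarrow>
     (\<forall>a \<in> Obj D. Fo a \<in> Obj D') \<and>
     (\<forall>f a b. f \<in> hom D a b \<longrightarrow> Fm f \<in> hom D' (Fo a) (Fo b)) \<and>
     (\<forall>a \<in> Obj D. Fm (Ident D a) = Ident D' (Fo a)) \<and>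
     (\<forall>f g a b c. f \<in> hom D a b \<longrightarrow> g \<in> hom D b c \<longrightarrow> Fm (Comp D g f) = Comp D' (Fm g) (Fm f)) \<and>
     Fo (Zero D) = Zero D' \<and> (\<forall>f \<in> Cofib D. Fm f \<in> Cofib D') \<and> (\<forall>f \<in> Weq D. Fm f \<in> Weq D') \<and>
     (\<forall>f g u v. f \<in> Cofib D \<longrightarrow> is_pushout D f g u v \<longrightarrow> is_pushout D' (Fm f) (Fm g) (Fm u) (Fm v))"

lemma exactD:
  assumes "exact_functor D D' Fo Fm"
  shows "a \<in> Obj D \<Longrightarrow> Fo a \<in> Obj D'"
    "f \<in> hom D a b \<Longrightarrow> Fm f \<in> hom D' (Fo a) (Fo b)"
    "a \<in> Obj D \<Longrightarrow> Fm (Ident D a) = Ident D' (Fo a)"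
    "f \<in> hom D a b \<Longrightarrow> g \<in> hom D b c \<Longrightarrow> Fm (Comp D g f) = Comp D' (Fm g) (Fm f)"
    "Fo (Zero D) = Zero D'"
    "f \<in> Cofib D \<Longrightarrow> Fm f \<in> Cofib D'"
    "f \<in> Weq D \<Longrightarrow> Fm f \<in> Weq D'"
    "f \<in> Cofib D \<Longrightarrow> is_pushout D f g u v \<Longrightarrow> is_pushout D' (Fm f) (Fm g) (Fm u) (Fm v)"
  using assms unfolding exact_functor_def by blast+

lemma exactI:
  assumes "\<And>a. a \<in> Obj D \<Longrightarrow> Fo a \<in> Obj D'"
    "\<And>f a b. f \<in> hom D a b \<Longrightarrow> Fm f \<in> hom D' (Fo a) (Fo b)"
    "\<And>a. a \<in> Obj D \<Longrightarrow> Fm (Ident D a) = Ident D' (Fo a)"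
    "\<And>f g a b c. f \<in> hom D a b \<Longrightarrow> g \<in> hom D b c \<Longrightarrow> Fm (Comp D g f) = Comp D' (Fm g) (Fm f)"
    "Fo (Zero D) = Zero D'"
    "\<And>f. f \<in> Cofib D \<Longrightarrow> Fm f \<in> Cofib D'"
    "\<And>f. f \<in> Weq D \<Longrightarrow> Fm f \<in> Weq D'"
    "\<And>f g u v. f \<in> Cofib D \<Longrightarrow> is_pushout D f g u v \<Longrightarrow> is_pushout D' (Fm f) (Fm g) (Fm u) (Fm v)"
  shows "exact_functor D D' Fo Fm"
  unfolding exact_functor_def by (intro conjI ballI allI impI assms; assumption)

lemma exact_compose:
  assumes F: "exact_functor D D' Fo Fm" and G: "exact_functor D' D'' Go Gm"
  shows "exact_functor D D'' (Go \<circ> Fo) (Gm \<circ> Fm)"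
proof (rule exactI)
  show "(Gm \<circ> Fm) (Comp D g f) = Comp D'' ((Gm \<circ> Fm) g) ((Gm \<circ> Fm) f)"
    if "f \<in> hom D a b" "g \<in> hom D b c" for f g a b c
    using exactD(4)[OF F that] exactD(4)[OF G exactD(2)[OF F that(1)] exactD(2)[OF F that(2)]] by simp
qed (simp_all add: exactD[OF F] exactD[OF G])

lemma exact_cong:
  assumes F: "exact_functor D D' Fo Fm" and D: "cofib_category D" and W: "Weq D \<subseteq> Arr D"
    and o: "\<And>a. a \<in> Obj D \<Longrightarrow> Go a = Fo a" and m: "\<And>f. f \<in> Arr D \<Longrightarrow> Gm f = Fm f"
  shows "exact_functor D D' Go Gm"
proof -
  interpret cofib_category D by (rule D)
  show ?thesis
  proof (rule exactI)
    show "Gm f \<in> hom D' (Go a) (Go b)" if "f \<in> hom D a b" for f a b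
      using exactD(2)[OF F that] homD[OF that] o m by simp
    show "Gm (Ident D a) = Ident D' (Go a)" if "a \<in> Obj D" for a
      using exactD(3)[OF F that] that o m Ident_simps(1) by simp
    show "Gm (Comp D g f) = Comp D' (Gm g) (Gm f)" if "f \<in> hom D a b" "g \<in> hom D b c" for f g a b c
      using exactD(4)[OF F that] homD(1)[OF Comp_hom[OF that]] homD(1)[OF that(1)] homD(1)[OF that(2)] m by simp
    show "is_pushout D' (Gm f) (Gm g) (Gm u) (Gm v)" if "f \<in> Cofib D" "is_pushout D f g u v" for f g u v
    proof -
      have "f \<in> Arr D" "g \<in> Arr D" "u \<in> Arr D" "v \<in> Arr D"
        using that(2) unfolding is_pushout_def by auto
      then show ?thesis using exactD(8)[OF F that] by (simp add: m)
    qed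
  qed (use exactD[OF F] o m Cofib_Arr W Zero_Obj in auto)
qed

lemma exact_cofsq:
  assumes F: "exact_functor D D' Fo Fm" and D: "cofib_category D" and D': "cofib_category D'"
    and s: "cofsq D f g g' f'" and f: "f \<in> Cofib D"
  shows "cofsq D' (Fm f) (Fm g) (Fm g') (Fm f')"
proof -
  obtain u v h a b c p d where p: "is_pushout D f g u v" and h: "f \<in> hom D a b" "g \<in> hom D a c"
    "u \<in> hom D b p" "v \<in> hom D c p" "h \<in> hom D p d" "g' \<in> hom D b d" "f' \<in> hom D c d"
    "Comp D h u = g'" "Comp D h v = f'" "h \<in> Cofib D"
    using cofib_category.cofsqE[OF D s] .
  show ?thesis
    by (rule cofib_category.cofsqI[OF D' exactD(8)[OF F f p] exactD(2)[OF F h(3)] exactD(2)[OF F h(5)]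
          exactD(2)[OF F h(7)]])
      (use exactD(4)[OF F h(3,5)] exactD(4)[OF F h(4,5)] h exactD(6)[OF F] in simp_all)
qed

text \<open>The S-construction is a functor on exact functors, given by composition with them.\<close>

definition S_fo :: "nat \<Rightarrow> ('o \<Rightarrow> 'p) \<Rightarrow> ('m \<Rightarrow> 'n) \<Rightarrow> (nat \<times> nat, 'o, 'm) diag \<Rightarrow> (nat \<times> nat, 'p, 'n) diag" where
  "S_fo n Fo Fm A = ((\<lambda>x \<in> Field (Ar n). Fo (fst A x)), (\<lambda>p \<in> Ar n. Fm (snd A p)))"

definition S_fm :: "nat \<Rightarrow> ('o \<Rightarrow> 'p) \<Rightarrow> ('m \<Rightarrow> 'n) \<Rightarrow> (nat \<times> nat, 'o, 'm) diag_map \<Rightarrow> (nat \<times> nat, 'p, 'n) diag_map"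
  where
  "S_fm n Fo Fm f = (S_fo n Fo Fm (fst f), (\<lambda>x \<in> Field (Ar n). Fm (cpt f x)), S_fo n Fo Fm (snd (snd f)))"

lemma S_fo_simps:
  "x \<in> Field (Ar n) \<Longrightarrow> fst (S_fo n Fo Fm A) x = Fo (fst A x)"
  "(x, y) \<in> Ar n \<Longrightarrow> snd (S_fo n Fo Fm A) (x, y) = Fm (snd A (x, y))"
  by (auto simp: S_fo_def)

lemma S_fm_simps:
  "fst (S_fm n Fo Fm f) = S_fo n Fo Fm (fst f)" "snd (snd (S_fm n Fo Fm f)) = S_fo n Fo Fm (snd (snd f))"
  "x \<in> Field (Ar n) \<Longrightarrow> cpt (S_fm n Fo Fm f) x = Fm (cpt f x)"
  by (auto simp: S_fm_def)

lemma exact_S_map: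
  assumes F: "exact_functor D D' Fo Fm" and D: "cofib_category D" and D': "cofib_category D'"
  shows "exact_functor (S n D) (S n D') (S_fo n Fo Fm) (S_fm n Fo Fm)"
proof -
  interpret D: cofib_category D by (rule D)
  interpret D': cofib_category D' by (rule D')
  interpret SD: cofib_category "S n D" by (rule D.cofib_category_S)
  interpret SD': cofib_category "S n D'" by (rule D'.cofib_category_S)
  have obj: "S_fo n Fo Fm A \<in> Obj (S n D')" if A: "A \<in> Obj (S n D)" for A
  proof (rule S_ObjI)
    note d = S_ObjD(1)[OF A]
    show "is_diag (Ar n) D' (S_fo n Fo Fm A)"
    proof (rule is_diagI)
      show "fst (S_fo n Fo Fm A) \<in> extensional (Field (Ar n))" "snd (S_fo n Fo Fm A) \<in> extensional (Ar n)"
        by (auto simp: S_fo_def)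
      show "fst (S_fo n Fo Fm A) x \<in> Obj D'" if "x \<in> Field (Ar n)" for x
        using is_diagD(3)[OF d that] exactD(1)[OF F] that by (simp add: S_fo_simps)
      show "snd (S_fo n Fo Fm A) (x, y) \<in> hom D' (fst (S_fo n Fo Fm A) x) (fst (S_fo n Fo Fm A) y)"
        if "(x, y) \<in> Ar n" for x y
        using is_diagD(4)[OF d that] exactD(2)[OF F] that preordD(1,2)[OF preord_Ar that] by (simp add: S_fo_simps)
      show "snd (S_fo n Fo Fm A) (x, x) = Ident D' (fst (S_fo n Fo Fm A) x)" if "x \<in> Field (Ar n)" for x
        using is_diagD(3,5)[OF d that] exactD(3)[OF F] that preordD(4)[OF preord_Ar that] by (simp add: S_fo_simps)
      show "Comp D' (snd (S_fo n Fo Fm A) (y, z)) (snd (S_fo n Fo Fm A) (x, y)) = snd (S_fo n Fo Fm A) (x, z)"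
        if xy: "(x, y) \<in> Ar n" "(y, z) \<in> Ar n" for x y z
        using exactD(4)[OF F is_diagD(4)[OF d xy(1)] is_diagD(4)[OF d xy(2)]] is_diagD(6)[OF d xy] xy
          preordD(3)[OF preord_Ar xy] by (simp add: S_fo_simps)
    qed
    show "fst (S_fo n Fo Fm A) (i, i) = Zero D'" if "i \<le> n" for i
      using that S_ObjD(2)[OF A that] exactD(5)[OF F] by (simp add: S_fo_simps Field_Ar)
    fix i j k assume ijk: "i \<le> j" "j \<le> k" "k \<le> n"
    show "snd (S_fo n Fo Fm A) ((i, j), (i, k)) \<in> Cofib D'"
      using ijk S_ObjD(3)[OF A ijk] exactD(6)[OF F] by (simp add: S_fo_simps Ar_iff)
    show "is_pushout D' (snd (S_fo n Fo Fm A) ((i, j), (i, k))) (snd (S_fo n Fo Fm A) ((i, j), (j, j)))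
                         (snd (S_fo n Fo Fm A) ((i, k), (j, k))) (snd (S_fo n Fo Fm A) ((j, j), (j, k)))"
      using ijk exactD(8)[OF F S_ObjD(3)[OF A ijk] S_ObjD(4)[OF A ijk]] by (simp add: S_fo_simps Ar_iff)
  qed
  have hm: "S_fm n Fo Fm f \<in> hom (S n D') (S_fo n Fo Fm A) (S_fo n Fo Fm B)" if f: "f \<in> hom (S n D) A B" for f A B
  proof -
    have O: "A \<in> Obj (S n D)" "B \<in> Obj (S n D)" "fst f = A" "snd (snd f) = B" using f by (auto simp: S_hom)
    have "(S_fo n Fo Fm A, (\<lambda>x \<in> Field (Ar n). Fm (cpt f x)), S_fo n Fo Fm B) \<in> hom (S n D') (S_fo n Fo Fm A) (S_fo n Fo Fm B)"
    proof (rule S_homI[OF obj[OF O(1)] obj[OF O(2)]])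
      show "Fm (cpt f x) \<in> hom D' (fst (S_fo n Fo Fm A) x) (fst (S_fo n Fo Fm B) x)" if "x \<in> Field (Ar n)" for x
        using exactD(2)[OF F S_hom_comp(1)[OF f that]] that by (simp add: S_fo_simps)
      fix x y assume xy: "(x, y) \<in> Ar n"
      note F1 = preordD(1,2)[OF preord_Ar xy]
      show "Comp D' (Fm (cpt f y)) (snd (S_fo n Fo Fm A) (x, y)) = Comp D' (snd (S_fo n Fo Fm B) (x, y)) (Fm (cpt f x))"
        using exactD(4)[OF F is_diagD(4)[OF S_ObjD(1)[OF O(1)] xy] S_hom_comp(1)[OF f F1(2)]]
          exactD(4)[OF F S_hom_comp(1)[OF f F1(1)] is_diagD(4)[OF S_ObjD(1)[OF O(2)] xy]] S_hom_comp(2)[OF f xy] xy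
        by (simp add: S_fo_simps)
    qed
    then show ?thesis by (simp add: S_fm_def O(3,4))
  qed
  have cof: "S_fm n Fo Fm f \<in> Cofib (S n D')" if f: "f \<in> Cofib (S n D)" for f
  proof -
    obtain A B where h: "f \<in> hom (S n D) A B" using f unfolding S_Cofib hom_def by auto
    have A: "A \<in> Obj (S n D)" "fst f = A" "snd (snd f) = B" using h by (auto simp: S_hom)
    have "cofsq D' (Fm (snd A ((0, j), (0, k)))) (Fm (cpt f (0, j))) (Fm (cpt f (0, k))) (Fm (snd B ((0, j), (0, k))))"
      if jk: "j \<le> k" "k \<le> n" for j k
      by (rule exact_cofsq[OF F D D' D.S_cofsq[OF f h _ jk] S_ObjD(3)[OF A(1) _ jk]]) auto
    then show ?thesis using hm[OF h] A unfolding S_Cofib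
      by (auto simp: hom_def S_fm_simps S_fo_simps Ar_iff Field_Ar)
  qed
  show ?thesis
  proof (rule exactI[OF obj hm _ _ _ cof])
    show "S_fm n Fo Fm (Ident (S n D) A) = Ident (S n D') (S_fo n Fo Fm A)" if A: "A \<in> Obj (S n D)" for A
      by (rule S_hom_eqI[OF hm[OF SD.Ident_hom[OF A]] SD'.Ident_hom[OF obj[OF A]]])
        (use is_diagD(3)[OF S_ObjD(1)[OF A]] exactD(3)[OF F] in \<open>simp add: S_Ident S_fm_simps S_fo_simps\<close>)
    show "S_fm n Fo Fm (Comp (S n D) g f) = Comp (S n D') (S_fm n Fo Fm g) (S_fm n Fo Fm f)"
      if f: "f \<in> hom (S n D) A B" and g: "g \<in> hom (S n D) B X" for f g A B X
      by (rule S_hom_eqI[OF hm[OF SD.Comp_hom[OF f g]] SD'.Comp_hom[OF hm[OF f] hm[OF g]]])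
        (use exactD(4)[OF F S_hom_comp(1)[OF f] S_hom_comp(1)[OF g]] in \<open>simp add: S_Comp S_fm_simps\<close>)
    show "S_fo n Fo Fm (Zero (S n D)) = Zero (S n D')"
    proof (rule diag_eqI)
      show "is_diag (Ar n) D' (S_fo n Fo Fm (Zero (S n D)))" using S_ObjD(1)[OF obj[OF SD.Zero_Obj]] .
      show "is_diag (Ar n) D' (Zero (S n D'))" using S_ObjD(1)[OF SD'.Zero_Obj] .
    qed (use exactD(3)[OF F D.Zero_Obj] exactD(5)[OF F] in \<open>auto simp: S_Zero S_fo_simps const_diag_def\<close>)
    show "S_fm n Fo Fm f \<in> Weq (S n D')" if f: "f \<in> Weq (S n D)" for f
    proof -
      obtain A B where h: "f \<in> hom (S n D) A B" using f unfolding S_Weq hom_def by auto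
      show ?thesis using hm[OF h] f exactD(7)[OF F] unfolding S_Weq by (auto simp: hom_def S_fm_simps)
    qed
    show "is_pushout (S n D') (S_fm n Fo Fm f) (S_fm n Fo Fm g) (S_fm n Fo Fm u) (S_fm n Fo Fm v)"
      if f: "f \<in> Cofib (S n D)" and p: "is_pushout (S n D) f g u v" for f g u v
    proof -
      obtain A B X Q where h: "f \<in> hom (S n D) A B" "g \<in> hom (S n D) A X" "u \<in> hom (S n D) B Q" "v \<in> hom (S n D) X Q"
        and x: "\<And>x. x \<in> Field (Ar n) \<Longrightarrow> is_pushout D (cpt f x) (cpt g x) (cpt u x) (cpt v x)"
         "\<And>x. x \<in> Field (Ar n) \<Longrightarrow> cpt f x \<in> Cofib D"
        using S_pushoutD[OF D f p] by metis
      show ?thesis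
        by (rule S_pushoutI[OF D' hm[OF h(1)] hm[OF h(2)] hm[OF h(3)] hm[OF h(4)]])
          (use exactD(8)[OF F x(2) x(1)] in \<open>simp add: S_fm_simps\<close>)
    qed
  qed
qed

section \<open>Simplicial operators on the S-construction\<close>

lemma pull_simps:
  "x \<in> Field P \<Longrightarrow> fst (pull_diag P \<phi> A) x = fst A (\<phi> x)"
  "(x, y) \<in> P \<Longrightarrow> snd (pull_diag P \<phi> A) (x, y) = snd A (\<phi> x, \<phi> y)"
  "fst (pull_map P \<phi> f) = pull_diag P \<phi> (fst f)" "snd (snd (pull_map P \<phi> f)) = pull_diag P \<phi> (snd (snd f))"
  "x \<in> Field P \<Longrightarrow> cpt (pull_map P \<phi> f) x = cpt f (\<phi> x)"
  by (auto simp: pull_diag_def pull_map_def split: prod.splits)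

lemma mono_Field:
  assumes "preord P" "preord P'" "\<And>x y. (x, y) \<in> P' \<Longrightarrow> (\<phi> x, \<phi> y) \<in> P" "x \<in> Field P'"
  shows "\<phi> x \<in> Field P"
  using assms preord_Field by metis

lemma is_diag_pull:
  assumes P: "preord P" "preord P'" and \<phi>: "\<And>x y. (x, y) \<in> P' \<Longrightarrow> (\<phi> x, \<phi> y) \<in> P"
    and A: "is_diag P C A"
  shows "is_diag P' C (pull_diag P' \<phi> A)"
proof (rule is_diagI)
  note F = mono_Field[OF P \<phi>]
  show "fst (pull_diag P' \<phi> A) \<in> extensional (Field P')" "snd (pull_diag P' \<phi> A) \<in> extensional P'"
    by (auto simp: pull_diag_def)
  show "fst (pull_diag P' \<phi> A) x \<in> Obj C" if "x \<in> Field P'" for x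
    using is_diagD(3)[OF A F] that by (simp add: pull_simps)
  show "snd (pull_diag P' \<phi> A) (x, y) \<in> hom C (fst (pull_diag P' \<phi> A) x) (fst (pull_diag P' \<phi> A) y)"
    if "(x, y) \<in> P'" for x y
    using is_diagD(4)[OF A \<phi>] that preordD(1,2)[OF P(2) that] by (simp add: pull_simps)
  show "snd (pull_diag P' \<phi> A) (x, x) = Ident C (fst (pull_diag P' \<phi> A) x)" if "x \<in> Field P'" for x
    using is_diagD(5)[OF A F] that preordD(4)[OF P(2) that] by (simp add: pull_simps)
  show "Comp C (snd (pull_diag P' \<phi> A) (y, z)) (snd (pull_diag P' \<phi> A) (x, y)) = snd (pull_diag P' \<phi> A) (x, z)"
    if xy: "(x, y) \<in> P'" "(y, z) \<in> P'" for x y z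
    using is_diagD(6)[OF A \<phi>[OF xy(1)] \<phi>[OF xy(2)]] xy preordD(3)[OF P(2) xy] by (simp add: pull_simps)
qed

lemma is_diag_map_pull:
  assumes P: "preord P" "preord P'" and \<phi>: "\<And>x y. (x, y) \<in> P' \<Longrightarrow> (\<phi> x, \<phi> y) \<in> P"
    and f: "is_diag_map P C f"
  shows "is_diag_map P' C (pull_map P' \<phi> f)"
proof -
  note F = mono_Field[OF P \<phi>]
  have "is_diag_map P' C (pull_diag P' \<phi> (fst f), (\<lambda>x \<in> Field P'. cpt f (\<phi> x)), pull_diag P' \<phi> (snd (snd f)))"
  proof (rule is_diag_mapI)
    show "is_diag P' C (pull_diag P' \<phi> (fst f))" "is_diag P' C (pull_diag P' \<phi> (snd (snd f)))"
      by (rule is_diag_pull[OF P \<phi> is_diag_mapD(1)[OF f]] is_diag_pull[OF P \<phi> is_diag_mapD(2)[OF f]];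
          assumption)+
    show "(\<lambda>x \<in> Field P'. cpt f (\<phi> x)) x \<in> hom C (fst (pull_diag P' \<phi> (fst f)) x) (fst (pull_diag P' \<phi> (snd (snd f))) x)"
      if "x \<in> Field P'" for x
      using is_diag_mapD(4)[OF f F] that by (simp add: pull_simps)
    show "Comp C ((\<lambda>x \<in> Field P'. cpt f (\<phi> x)) y) (snd (pull_diag P' \<phi> (fst f)) (x, y)) =
      Comp C (snd (pull_diag P' \<phi> (snd (snd f))) (x, y)) ((\<lambda>x \<in> Field P'. cpt f (\<phi> x)) x)"
      if "(x, y) \<in> P'" for x y
      using is_diag_mapD(5)[OF f \<phi>] that preordD(1,2)[OF P(2) that] by (simp add: pull_simps)
  qed auto
  then show ?thesis by (simp add: pull_map_def split_beta)
qed

lemma Delta_mono: "\<theta> \<in> Delta m n \<Longrightarrow> i \<le> j \<Longrightarrow> j \<le> m \<Longrightarrow> \<theta> i \<le> \<theta> j \<and> \<theta> j \<le> n"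
  unfolding Delta_def by (auto simp: mono_on_def PiE_def Pi_def)

lemma Delta_le: "\<theta> \<in> Delta m n \<Longrightarrow> i \<le> m \<Longrightarrow> \<theta> i \<le> n"
  using Delta_mono by blast

lemma Delta_Ar: "\<theta> \<in> Delta n' n \<Longrightarrow> (x, y) \<in> Ar n' \<Longrightarrow> (map_prod \<theta> \<theta> x, map_prod \<theta> \<theta> y) \<in> Ar n"
  by (cases x, cases y) (auto simp: Ar_iff Delta_mono)

text \<open>Objects, corner conditions and pushouts of \<open>S n D\<close> satisfy the same conditions in every row, not
  only in row 0. This gives exactness also if \<open>\<theta> 0\<close> is not 0.\<close>

lemma exact_S_pull:
  assumes D: "cofib_category D" and \<theta>: "\<theta> \<in> Delta n' n"
  shows "exact_functor (S n D) (S n' D) (pull_diag (Ar n') (map_prod \<theta> \<theta>)) (pull_map (Ar n') (map_prod \<theta> \<theta>))"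
    (is "exact_functor _ _ ?O ?M")
proof -
  interpret D: cofib_category D by (rule D)
  interpret SD: cofib_category "S n D" by (rule D.cofib_category_S)
  interpret SD': cofib_category "S n' D" by (rule D.cofib_category_S)
  have F: "x \<in> Field (Ar n') \<Longrightarrow> map_prod \<theta> \<theta> x \<in> Field (Ar n)" for x
    using mono_Field[OF preord_Ar preord_Ar Delta_Ar[OF \<theta>]] .
  have obj: "?O A \<in> Obj (S n' D)" if A: "A \<in> Obj (S n D)" for A
    by (rule S_ObjI[OF is_diag_pull[OF preord_Ar preord_Ar Delta_Ar[OF \<theta>] S_ObjD(1)[OF A]]])
      (simp_all add: pull_simps Field_Ar Ar_iff S_ObjD[OF A] Delta_mono[OF \<theta>] Delta_le[OF \<theta>])
  have hm: "?M f \<in> hom (S n' D) (?O A) (?O B)" if f: "f \<in> hom (S n D) A B" for f A B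
    using f obj is_diag_map_pull[OF preord_Ar preord_Ar Delta_Ar[OF \<theta>], where C = D and f = f] unfolding S_hom by (simp add: pull_simps)
  have cof: "?M f \<in> Cofib (S n' D)" if f: "f \<in> Cofib (S n D)" for f
  proof -
    obtain A B where h: "f \<in> hom (S n D) A B" using f unfolding S_Cofib hom_def by auto
    have A: "fst f = A" "snd (snd f) = B" using h by (auto simp: S_hom)
    show ?thesis using hm[OF h] D.S_cofsq[OF f h] A Delta_mono[OF \<theta>] unfolding S_Cofib
      by (auto simp: hom_def pull_simps Ar_iff Field_Ar)
  qed
  show ?thesis
  proof (rule exactI[OF obj hm _ _ _ cof])
    show "?M (Ident (S n D) A) = Ident (S n' D) (?O A)" if A: "A \<in> Obj (S n D)" for A
      by (rule S_hom_eqI[OF hm[OF SD.Ident_hom[OF A]] SD'.Ident_hom[OF obj[OF A]]])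
        (simp add: S_Ident pull_simps F)
    show "?M (Comp (S n D) g f) = Comp (S n' D) (?M g) (?M f)"
      if f: "f \<in> hom (S n D) A B" and g: "g \<in> hom (S n D) B X" for f g A B X
      by (rule S_hom_eqI[OF hm[OF SD.Comp_hom[OF f g]] SD'.Comp_hom[OF hm[OF f] hm[OF g]]])
        (simp add: S_Comp pull_simps F)
    show "?O (Zero (S n D)) = Zero (S n' D)"
    proof (rule diag_eqI)
      show "is_diag (Ar n') D (?O (Zero (S n D)))" using S_ObjD(1)[OF obj[OF SD.Zero_Obj]] .
      show "is_diag (Ar n') D (Zero (S n' D))" using S_ObjD(1)[OF SD'.Zero_Obj] .
    qed (auto simp: S_Zero pull_simps const_diag_def F Delta_Ar[OF \<theta>])
    show "?M f \<in> Weq (S n' D)" if f: "f \<in> Weq (S n D)" for f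
    proof -
      obtain A B where h: "f \<in> hom (S n D) A B" using f unfolding S_Weq hom_def by auto
      show ?thesis using hm[OF h] f F unfolding S_Weq by (auto simp: hom_def pull_simps)
    qed
    show "is_pushout (S n' D) (?M f) (?M g) (?M u) (?M v)"
      if f: "f \<in> Cofib (S n D)" and p: "is_pushout (S n D) f g u v" for f g u v
    proof -
      obtain A B X Q where h: "f \<in> hom (S n D) A B" "g \<in> hom (S n D) A X" "u \<in> hom (S n D) B Q" "v \<in> hom (S n D) X Q"
        and x: "\<And>x. x \<in> Field (Ar n) \<Longrightarrow> is_pushout D (cpt f x) (cpt g x) (cpt u x) (cpt v x)"
        using S_pushoutD[OF D f p] by metis
      show ?thesis
        by (rule S_pushoutI[OF D hm[OF h(1)] hm[OF h(2)] hm[OF h(3)] hm[OF h(4)]])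
          (use x F in \<open>simp add: pull_simps\<close>)
    qed
  qed
qed

section \<open>Interchanging two S-constructions\<close>

text \<open>In a diagram of diagrams the second variable can be fixed instead of the first one. The functors
  \<open>swap_o\<close> and \<open>swap_m\<close> exchange the two variables.\<close>

definition col :: "nat \<Rightarrow> (nat \<times> nat, (nat \<times> nat, 'o, 'm) diag, (nat \<times> nat, 'o, 'm) diag_map) diag
    \<Rightarrow> nat \<times> nat \<Rightarrow> (nat \<times> nat, 'o, 'm) diag" where
  "col n A y = ((\<lambda>x \<in> Field (Ar n). fst (fst A x) y), (\<lambda>p \<in> Ar n. cpt (snd A p) y))"

definition swap_o :: "nat \<Rightarrow> nat \<Rightarrow> (nat \<times> nat, (nat \<times> nat, 'o, 'm) diag, (nat \<times> nat, 'o, 'm) diag_map) diag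
    \<Rightarrow> (nat \<times> nat, (nat \<times> nat, 'o, 'm) diag, (nat \<times> nat, 'o, 'm) diag_map) diag" where
  "swap_o n m A = ((\<lambda>y \<in> Field (Ar m). col n A y),
     (\<lambda>p \<in> Ar m. (col n A (fst p), (\<lambda>x \<in> Field (Ar n). snd (fst A x) p), col n A (snd p))))"

definition swap_m :: "nat \<Rightarrow> nat \<Rightarrow> (nat \<times> nat, (nat \<times> nat, 'o, 'm) diag, (nat \<times> nat, 'o, 'm) diag_map) diag_map
    \<Rightarrow> (nat \<times> nat, (nat \<times> nat, 'o, 'm) diag, (nat \<times> nat, 'o, 'm) diag_map) diag_map" where
  "swap_m n m f = (swap_o n m (fst f),
     (\<lambda>y \<in> Field (Ar m). (col n (fst f) y, (\<lambda>x \<in> Field (Ar n). cpt (cpt f x) y), col n (snd (snd f)) y)),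
     swap_o n m (snd (snd f)))"

lemma swap_simps:
  "x \<in> Field (Ar n) \<Longrightarrow> fst (col n A y) x = fst (fst A x) y"
  "(x, x') \<in> Ar n \<Longrightarrow> snd (col n A y) (x, x') = cpt (snd A (x, x')) y"
  "y \<in> Field (Ar m) \<Longrightarrow> fst (swap_o n m A) y = col n A y"
  "(y, y') \<in> Ar m \<Longrightarrow> snd (swap_o n m A) (y, y') = (col n A y, (\<lambda>x \<in> Field (Ar n). snd (fst A x) (y, y')), col n A y')"
  "fst (swap_m n m f) = swap_o n m (fst f)" "snd (snd (swap_m n m f)) = swap_o n m (snd (snd f))"
  "y \<in> Field (Ar m) \<Longrightarrow> cpt (swap_m n m f) y = (col n (fst f) y, (\<lambda>x \<in> Field (Ar n). cpt (cpt f x) y), col n (snd (snd f)) y)"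
  by (auto simp: col_def swap_o_def swap_m_def)

context cofib_category
begin

lemma col_Obj:
  assumes A: "A \<in> Obj (S n (S m D))" and y: "y \<in> Field (Ar m)"
  shows "col n A y \<in> Obj (S n D)"
proof -
  interpret E: cofib_category "S m D" by (rule cofib_category_S)
  note d = S_ObjD(1)[OF A]
  show ?thesis
  proof (rule S_ObjI)
    show "is_diag (Ar n) D (col n A y)"
    proof (rule is_diagI)
      show "fst (col n A y) \<in> extensional (Field (Ar n))" "snd (col n A y) \<in> extensional (Ar n)"
        by (auto simp: col_def)
      show "fst (col n A y) x \<in> Obj D" if "x \<in> Field (Ar n)" for x
        using is_diagD(3)[OF S_ObjD(1)[OF is_diagD(3)[OF d that]] y] that by (simp add: swap_simps)
      show "snd (col n A y) (x, x') \<in> hom D (fst (col n A y) x) (fst (col n A y) x')"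
        if "(x, x') \<in> Ar n" for x x'
        using S_hom_comp(1)[OF is_diagD(4)[OF d that] y] that preordD(1,2)[OF preord_Ar that] by (simp add: swap_simps)
      show "snd (col n A y) (x, x) = Ident D (fst (col n A y) x)" if "x \<in> Field (Ar n)" for x
        using is_diagD(5)[OF d that] that y preordD(4)[OF preord_Ar that] by (simp add: swap_simps S_Ident)
      show "snd (col n A y) (x', x'') \<odot> snd (col n A y) (x, x') = snd (col n A y) (x, x'')"
        if xx: "(x, x') \<in> Ar n" "(x', x'') \<in> Ar n" for x x' x''
        using is_diagD(6)[OF d xx, symmetric] y xx preordD(3)[OF preord_Ar xx] by (simp add: swap_simps S_Comp)
    qed
    show "fst (col n A y) (i, i) = Zero D" if "i \<le> n" for i
      using S_ObjD(2)[OF A that] that y by (simp add: swap_simps Field_Ar S_Zero const_diag_def)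
    fix i j k assume ijk: "i \<le> j" "j \<le> k" "k \<le> n"
    note h = S_arr(1)[OF A]
    have y': "fst y \<le> snd y" "snd y \<le> m" using y Field_Ar by (metis prod.collapse)+
    show "snd (col n A y) ((i, j), (i, k)) \<in> Cofib D"
      using S_Cofib_pointwise[OF S_ObjD(3)[OF A ijk] h[of i j i k], of "fst y" "snd y"] ijk y'
      by (simp add: swap_simps Ar_iff)
    have "is_pushout D (cpt (snd A ((i, j), (i, k))) y) (cpt (snd A ((i, j), (j, j))) y)
       (cpt (snd A ((i, k), (j, k))) y) (cpt (snd A ((j, j), (j, k))) y)"
      using S_pushout_iff[OF S_ObjD(3)[OF A ijk] h h h h] S_ObjD(4)[OF A ijk] ijk y by simp
    then show "is_pushout D (snd (col n A y) ((i, j), (i, k))) (snd (col n A y) ((i, j), (j, j)))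
       (snd (col n A y) ((i, k), (j, k))) (snd (col n A y) ((j, j), (j, k)))"
      using ijk by (simp add: swap_simps Ar_iff)
  qed
qed

lemma col_hom:
  assumes A: "A \<in> Obj (S n (S m D))" and yy: "(y, y') \<in> Ar m"
  shows "(col n A y, (\<lambda>x \<in> Field (Ar n). snd (fst A x) (y, y')), col n A y') \<in> hom (S n D) (col n A y) (col n A y')"
proof (rule S_homI[OF col_Obj[OF A] col_Obj[OF A]])
  note d = S_ObjD(1)[OF A]
  show "snd (fst A x) (y, y') \<in> hom D (fst (col n A y) x) (fst (col n A y') x)" if "x \<in> Field (Ar n)" for x
    using is_diagD(4)[OF S_ObjD(1)[OF is_diagD(3)[OF d that]] yy] that by (simp add: swap_simps)
  show "snd (fst A x') (y, y') \<odot> snd (col n A y) (x, x') = snd (col n A y') (x, x') \<odot> snd (fst A x) (y, y')"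
    if xx: "(x, x') \<in> Ar n" for x x'
    using S_hom_comp(2)[OF is_diagD(4)[OF d xx] yy] xx by (simp add: swap_simps)
qed (use preordD(1,2)[OF preord_Ar yy] in auto)

lemma swap_Obj:
  assumes A: "A \<in> Obj (S n (S m D))"
  shows "swap_o n m A \<in> Obj (S m (S n D))"
proof -
  interpret E: cofib_category "S m D" by (rule cofib_category_S)
  interpret F: cofib_category "S n D" by (rule cofib_category_S)
  note d = S_ObjD(1)[OF A]
  have cA: "snd (swap_o n m A) (y, y') \<in> hom (S n D) (col n A y) (col n A y')" if "(y, y') \<in> Ar m" for y y'
    using col_hom[OF A that] that by (simp add: swap_simps)
  have row: "fst A (i, j) \<in> Obj (S m D)" if "i \<le> j" "j \<le> n" for i j
    using is_diagD(3)[OF d] that by (simp add: Field_Ar)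
  have cf: "snd (swap_o n m A) ((i, j), (i, k)) \<in> Cofib (S n D)" if ijk: "i \<le> j" "j \<le> k" "k \<le> m" for i j k
    unfolding S_Cofib
  proof (intro conjI allI impI)
    show "snd (swap_o n m A) ((i, j), (i, k)) \<in> Arr (S n D)"
      using F.homD(1)[OF cA] ijk by (simp add: Ar_iff)
    fix j' k' assume jk: "j' \<le> k'" "k' \<le> n"
    have "cofsq D (snd (fst A (0, j')) ((i, j), (i, k))) (cpt (snd A ((0, j'), (0, k'))) (i, j))
      (cpt (snd A ((0, j'), (0, k'))) (i, k)) (snd (fst A (0, k')) ((i, j), (i, k)))"
      by (rule S_cofsq[OF S_ObjD(3)[OF A _ jk] S_arr(1)[OF A] ijk]) (use jk in auto)
    \<comment> \<open>the same square of four values, with its two directions exchanged\<close>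
    from cofsq_sym[OF this]
    show "cofsq D (snd (fst (snd (swap_o n m A) ((i, j), (i, k)))) ((0, j'), (0, k')))
       (cpt (snd (swap_o n m A) ((i, j), (i, k))) (0, j')) (cpt (snd (swap_o n m A) ((i, j), (i, k))) (0, k'))
       (snd (snd (snd (snd (swap_o n m A) ((i, j), (i, k))))) ((0, j'), (0, k')))"
      using ijk jk by (simp add: swap_simps Ar_iff Field_Ar)
  qed
  show ?thesis
  proof (rule S_ObjI)
    show "is_diag (Ar m) (S n D) (swap_o n m A)"
    proof (rule is_diagI)
      show "fst (swap_o n m A) \<in> extensional (Field (Ar m))" "snd (swap_o n m A) \<in> extensional (Ar m)"
        by (auto simp: swap_o_def)
      show "fst (swap_o n m A) y \<in> Obj (S n D)" if "y \<in> Field (Ar m)" for y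
        using col_Obj[OF A that] that by (simp add: swap_simps)
      show "snd (swap_o n m A) (y, y') \<in> hom (S n D) (fst (swap_o n m A) y) (fst (swap_o n m A) y')"
        if "(y, y') \<in> Ar m" for y y'
        using cA[OF that] preordD(1,2)[OF preord_Ar that] by (simp add: swap_simps)
      show "snd (swap_o n m A) (y, y) = Ident (S n D) (fst (swap_o n m A) y)" if y: "y \<in> Field (Ar m)" for y
      proof (rule S_hom_eqI)
        show "snd (swap_o n m A) (y, y) \<in> hom (S n D) (col n A y) (col n A y)"
          using cA preordD(4)[OF preord_Ar y] by blast
        show "Ident (S n D) (fst (swap_o n m A) y) \<in> hom (S n D) (col n A y) (col n A y)"
          using F.Ident_hom[OF col_Obj[OF A y]] y by (simp add: swap_simps)
        show "cpt (snd (swap_o n m A) (y, y)) x = cpt (Ident (S n D) (fst (swap_o n m A) y)) x"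
          if x: "x \<in> Field (Ar n)" for x
          using is_diagD(5)[OF S_ObjD(1)[OF is_diagD(3)[OF d x]] y] x y preordD(4)[OF preord_Ar y]
          by (simp add: swap_simps S_Ident)
      qed
      show "Comp (S n D) (snd (swap_o n m A) (y', y'')) (snd (swap_o n m A) (y, y')) = snd (swap_o n m A) (y, y'')"
        if yy: "(y, y') \<in> Ar m" "(y', y'') \<in> Ar m" for y y' y''
      proof (rule S_hom_eqI[OF F.Comp_hom[OF cA[OF yy(1)] cA[OF yy(2)]] cA[OF preordD(3)[OF preord_Ar yy]]])
        fix x assume x: "x \<in> Field (Ar n)"
        show "cpt (Comp (S n D) (snd (swap_o n m A) (y', y'')) (snd (swap_o n m A) (y, y'))) x =
              cpt (snd (swap_o n m A) (y, y'')) x"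
          using is_diagD(6)[OF S_ObjD(1)[OF is_diagD(3)[OF d x]] yy] x yy preordD(3)[OF preord_Ar yy]
          by (simp add: swap_simps S_Comp)
      qed
    qed
    show "fst (swap_o n m A) (i, i) = Zero (S n D)" if i: "i \<le> m" for i
    proof -
      have ii: "(i, i) \<in> Field (Ar m)" using i by (simp add: Field_Ar)
      note c = S_ObjD(1)[OF col_Obj[OF A ii]]
      have z: "fst (col n A (i, i)) x = Zero D" if "x \<in> Field (Ar n)" for x
        using S_ObjD(2)[OF is_diagD(3)[OF d that] i] that by (simp add: swap_simps)
      have "col n A (i, i) = Zero (S n D)"
      proof (rule diag_eqI[OF c S_ObjD(1)[OF F.Zero_Obj]])
        show "fst (col n A (i, i)) x = fst (Zero (S n D)) x" if "x \<in> Field (Ar n)" for x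
          using z[OF that] that by (simp add: S_Zero const_diag_def)
        show "snd (col n A (i, i)) (x, y) = snd (Zero (S n D)) (x, y)" if xy: "(x, y) \<in> Ar n" for x y
        proof -
          have "snd (col n A (i, i)) (x, y) \<in> hom D (Zero D) (Zero D)"
            using is_diagD(4)[OF c xy] z preordD(1,2)[OF preord_Ar xy] by simp
          then show ?thesis using xy hom_from_Zero_eq[OF _ Ident_hom[OF Zero_Obj]]
            by (simp add: S_Zero const_diag_def)
        qed
      qed
      then show ?thesis using ii by (simp add: swap_simps)
    qed
    fix i j k assume ijk: "i \<le> j" "j \<le> k" "k \<le> m"
    show "snd (swap_o n m A) ((i, j), (i, k)) \<in> Cofib (S n D)" by (rule cf[OF ijk])
    show "is_pushout (S n D) (snd (swap_o n m A) ((i, j), (i, k))) (snd (swap_o n m A) ((i, j), (j, j)))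
      (snd (swap_o n m A) ((i, k), (j, k))) (snd (swap_o n m A) ((j, j), (j, k)))"
    proof (rule S_pushoutI[OF cofib_category_axioms cA cA cA cA])
      fix x assume x: "x \<in> Field (Ar n)"
      show "is_pushout D (cpt (snd (swap_o n m A) ((i, j), (i, k))) x) (cpt (snd (swap_o n m A) ((i, j), (j, j))) x)
        (cpt (snd (swap_o n m A) ((i, k), (j, k))) x) (cpt (snd (swap_o n m A) ((j, j), (j, k))) x)"
        using S_ObjD(4)[OF is_diagD(3)[OF d x] ijk] ijk x by (simp add: swap_simps Ar_iff)
    qed (use ijk in \<open>simp_all add: Ar_iff\<close>)
  qed
qed

lemma swap_hom:
  assumes f: "f \<in> hom (S n (S m D)) A B"
  shows "y \<in> Field (Ar m) \<Longrightarrow> cpt (swap_m n m f) y \<in> hom (S n D) (col n A y) (col n B y)"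
    "swap_m n m f \<in> hom (S m (S n D)) (swap_o n m A) (swap_o n m B)"
proof -
  interpret F: cofib_category "S n D" by (rule cofib_category_S)
  have O: "A \<in> Obj (S n (S m D))" "B \<in> Obj (S n (S m D))" "fst f = A" "snd (snd f) = B"
    using f by (auto simp: S_hom)
  have h: "(col n A y, (\<lambda>x \<in> Field (Ar n). cpt (cpt f x) y), col n B y) \<in> hom (S n D) (col n A y) (col n B y)"
    if y: "y \<in> Field (Ar m)" for y
  proof (rule S_homI[OF col_Obj[OF O(1) y] col_Obj[OF O(2) y]])
    show "cpt (cpt f x) y \<in> hom D (fst (col n A y) x) (fst (col n B y) x)" if "x \<in> Field (Ar n)" for x
      using S_hom_comp(1)[OF S_hom_comp(1)[OF f that] y] that by (simp add: swap_simps)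
    show "cpt (cpt f x') y \<odot> snd (col n A y) (x, x') = snd (col n B y) (x, x') \<odot> cpt (cpt f x) y"
      if xx: "(x, x') \<in> Ar n" for x x'
    proof -
      have "cpt (Comp (S m D) (cpt f x') (snd A (x, x'))) y = cpt (Comp (S m D) (snd B (x, x')) (cpt f x)) y"
        using S_hom_comp(2)[OF f xx] by simp
      then show ?thesis using xx y by (simp add: swap_simps S_Comp)
    qed
  qed
  then show c: "cpt (swap_m n m f) y \<in> hom (S n D) (col n A y) (col n B y)" if "y \<in> Field (Ar m)" for y
    using that O by (simp add: swap_simps)
  have "(swap_o n m A, (\<lambda>y \<in> Field (Ar m). (col n A y, (\<lambda>x \<in> Field (Ar n). cpt (cpt f x) y), col n B y)), swap_o n m B)
    \<in> hom (S m (S n D)) (swap_o n m A) (swap_o n m B)"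
  proof (rule S_homI[OF swap_Obj[OF O(1)] swap_Obj[OF O(2)]])
    show "(col n A y, (\<lambda>x \<in> Field (Ar n). cpt (cpt f x) y), col n B y)
       \<in> hom (S n D) (fst (swap_o n m A) y) (fst (swap_o n m B) y)" if "y \<in> Field (Ar m)" for y
      using h[OF that] that by (simp add: swap_simps)
    fix y y' assume yy: "(y, y') \<in> Ar m"
    then have y: "y \<in> Field (Ar m)" "y' \<in> Field (Ar m)" using preordD(1,2)[OF preord_Ar yy] by auto
    have a: "snd (swap_o n m A) (y, y') \<in> hom (S n D) (col n A y) (col n A y')"
      "snd (swap_o n m B) (y, y') \<in> hom (S n D) (col n B y) (col n B y')"
      using col_hom[OF O(1) yy] col_hom[OF O(2) yy] yy by (auto simp: swap_simps)
    show "Comp (S n D) (col n A y', \<lambda>x\<in>Field (Ar n). cpt (cpt f x) y', col n B y') (snd (swap_o n m A) (y, y')) =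
      Comp (S n D) (snd (swap_o n m B) (y, y')) (col n A y, \<lambda>x\<in>Field (Ar n). cpt (cpt f x) y, col n B y)"
    proof (rule S_hom_eqI[OF F.Comp_hom[OF a(1) h[OF y(2)]] F.Comp_hom[OF h[OF y(1)] a(2)]])
      fix x assume x: "x \<in> Field (Ar n)"
      show "cpt (Comp (S n D) (col n A y', \<lambda>x\<in>Field (Ar n). cpt (cpt f x) y', col n B y') (snd (swap_o n m A) (y, y'))) x =
        cpt (Comp (S n D) (snd (swap_o n m B) (y, y')) (col n A y, \<lambda>x\<in>Field (Ar n). cpt (cpt f x) y, col n B y)) x"
        using S_hom_comp(2)[OF S_hom_comp(1)[OF f x] yy] x yy by (simp add: S_Comp swap_simps)
    qed
  qed
  then show "swap_m n m f \<in> hom (S m (S n D)) (swap_o n m A) (swap_o n m B)"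
    by (simp add: swap_m_def O)
qed

text \<open>This is where the cube lemma enters: a cofibration of \<open>S n (S m D)\<close> is a condition on the
  corner maps of cubes, with one edge along the map and one along each of the two directions.\<close>

lemma swap_Cofib:
  assumes c: "f \<in> Cofib (S n (S m D))"
  shows "swap_m n m f \<in> Cofib (S m (S n D))"
proof -
  interpret E: cofib_category "S m D" by (rule cofib_category_S)
  interpret F: cofib_category "S n D" by (rule cofib_category_S)
  obtain A B where f: "f \<in> hom (S n (S m D)) A B" using c unfolding S_Cofib hom_def by auto
  have O: "A \<in> Obj (S n (S m D))" "B \<in> Obj (S n (S m D))" "fst f = A" "snd (snd f) = B"
    using f by (auto simp: S_hom)
  note sA = swap_Obj[OF O(1)] and sB = swap_Obj[OF O(2)]
  have "cofsq (S n D) (snd (swap_o n m A) ((0, j'), (0, k'))) (cpt (swap_m n m f) (0, j'))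
       (cpt (swap_m n m f) (0, k')) (snd (swap_o n m B) ((0, j'), (0, k')))"
    if jk': "j' \<le> k'" "k' \<le> m" for j' k'
  proof -
    let ?a = "snd (swap_o n m A) ((0, j'), (0, k'))" and ?b = "snd (swap_o n m B) ((0, j'), (0, k'))"
    let ?g = "cpt (swap_m n m f) (0, j')" and ?g' = "cpt (swap_m n m f) (0, k')"
    have F0: "(0, j') \<in> Field (Ar m)" "(0, k') \<in> Field (Ar m)" "((0, j'), (0, k')) \<in> Ar m"
      using jk' by (auto simp: Field_Ar Ar_iff)
    have ah: "?a \<in> hom (S n D) (col n A (0, j')) (col n A (0, k'))"
      and bh: "?b \<in> hom (S n D) (col n B (0, j')) (col n B (0, k'))"
      using col_hom[OF O(1) F0(3)] col_hom[OF O(2) F0(3)] F0 by (auto simp: swap_simps)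
    note gh = swap_hom(1)[OF f F0(1)] and gh' = swap_hom(1)[OF f F0(2)]
    have nat: "Comp (S n D) ?g' ?a = Comp (S n D) ?b ?g"
      using S_hom_comp(2)[OF swap_hom(2)[OF f] F0(3)] .
    have ac: "?a \<in> Cofib (S n D)" using S_ObjD(3)[OF sA, of 0 j' k'] jk' by simp
    obtain u v Q where u: "u \<in> hom (S n D) (col n A (0, k')) Q" and v: "v \<in> hom (S n D) (col n B (0, j')) Q"
      and pw: "\<And>x. x \<in> Field (Ar n) \<Longrightarrow> is_pushout D (cpt ?a x) (cpt ?g x) (cpt u x) (cpt v x)"
      using S_pushout_exists[OF ac ah gh] by metis
    have po: "is_pushout (S n D) ?a ?g u v"
      by (rule S_pushoutI[OF cofib_category_axioms ah gh u v pw])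
    obtain h where h: "h \<in> hom (S n D) Q (col n B (0, k'))" "Comp (S n D) h u = ?g'" "Comp (S n D) h v = ?b"
      using F.pushout_ex[OF po ah gh u gh' bh nat] by blast
    have QO: "Q \<in> Obj (S n D)" using u by (simp add: S_hom)
    have "cofsq D (snd Q ((0, j), (0, k))) (cpt h (0, j)) (cpt h (0, k)) (snd (col n B (0, k')) ((0, j), (0, k)))"
      if jk: "j \<le> k" "k \<le> n" for j k
    proof -
      have x: "(0, j) \<in> Field (Ar n)" "(0, k) \<in> Field (Ar n)" "((0, j), (0, k)) \<in> Ar n"
        using jk by (auto simp: Field_Ar Ar_iff)
      let ?A = "\<lambda>x y. fst (fst A x) y" and ?B = "\<lambda>x y. fst (fst B x) y"
      let ?Ah = "snd A ((0, j), (0, k))" and ?Bh = "snd B ((0, j), (0, k))"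
      note dA = S_ObjD(1)[OF O(1)] and dB = S_ObjD(1)[OF O(2)]
      note hAh = is_diagD(4)[OF dA x(3)] and hBh = is_diagD(4)[OF dB x(3)]
      note rA = is_diagD(3)[OF dA x(1)] is_diagD(3)[OF dA x(2)]
      note rB = is_diagD(3)[OF dB x(1)] is_diagD(3)[OF dB x(2)]
      note fj = S_hom_comp(1)[OF f x(1)] and fk = S_hom_comp(1)[OF f x(2)]
      have "cofsq (S m D) ?Ah (cpt f (0, j)) (cpt f (0, k)) ?Bh"
        using E.S_cofsq[OF c f _ jk, of 0] by simp
      then obtain U V H where UV: "is_pushout (S m D) ?Ah (cpt f (0, j)) U V" and H: "H \<in> Cofib (S m D)"
        "H \<in> hom (S m D) (Cod (S m D) U) (Cod (S m D) ?Bh)" "Comp (S m D) H U = cpt f (0, k)" "Comp (S m D) H V = ?Bh"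
        unfolding cofsq_def by auto
      obtain W where W: "U \<in> hom (S m D) (fst A (0, k)) W" "V \<in> hom (S m D) (fst B (0, j)) W"
        using E.pushout_hom_left[OF UV hAh] fj by (auto simp: hom_def)
      have Hh: "H \<in> hom (S m D) W (fst B (0, k))" using H(2) W hBh by (auto simp: hom_def)
      have Ac: "?Ah \<in> Cofib (S m D)" using S_ObjD(3)[OF O(1), of 0 j k] jk by simp
      have UVp: "is_pushout D (cpt ?Ah y) (cpt (cpt f (0, j)) y) (cpt U y) (cpt V y)" if "y \<in> Field (Ar m)" for y
        using S_pushout_iff[OF Ac hAh fj W] UV that by blast
      have WO: "W \<in> Obj (S m D)" using W by (simp add: S_hom)
      have HU: "cpt H y \<odot> cpt U y = cpt (cpt f (0, k)) y" "cpt H y \<odot> cpt V y = cpt ?Bh y" if "y \<in> Field (Ar m)" for y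
        using arg_cong[OF H(3), of "\<lambda>t. cpt t y"] arg_cong[OF H(4), of "\<lambda>t. cpt t y"] that by (simp_all add: S_Comp)
      have hu: "cpt h y \<odot> cpt u y = cpt (cpt f y) (0, k')" "cpt h y \<odot> cpt v y = snd (fst B y) ((0, j'), (0, k'))"
        if "y \<in> Field (Ar n)" for y
        using arg_cong[OF h(2), of "\<lambda>t. cpt t y"] arg_cong[OF h(3), of "\<lambda>t. cpt t y"] that F0
        by (simp_all add: S_Comp swap_simps)
      have sq: "cofsq D (snd W ((0, j'), (0, k'))) (cpt H (0, j')) (cpt H (0, k')) (snd (fst B (0, k)) ((0, j'), (0, k')))"
        by (rule S_cofsq[OF H(1) Hh _ jk']) simp
      have fnat: "cpt (cpt f (0, k)) y \<odot> cpt ?Ah y = cpt ?Bh y \<odot> cpt (cpt f (0, j)) y" if "y \<in> Field (Ar m)" for y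
        using arg_cong[OF S_hom_comp(2)[OF f x(3)], of "\<lambda>t. cpt t y"] that by (simp add: S_Comp)
      have pwx: "is_pushout D (snd (fst A x) ((0, j'), (0, k'))) (cpt (cpt f x) (0, j')) (cpt u x) (cpt v x)"
        if "x \<in> Field (Ar n)" for x
        using pw[OF that] that F0 by (simp add: swap_simps)
      have un: "snd Q ((0, j), (0, k)) \<odot> cpt u (0, j) = cpt u (0, k) \<odot> cpt ?Ah (0, k')"
        "snd Q ((0, j), (0, k)) \<odot> cpt v (0, j) = cpt v (0, k) \<odot> cpt ?Bh (0, j')"
        using S_hom_comp(2)[OF u x(3)] S_hom_comp(2)[OF v x(3)] x F0 by (auto simp: swap_simps)
      have uh: "cpt u x \<in> hom D (?A x (0, k')) (fst Q x)" "cpt h x \<in> hom D (fst Q x) (?B x (0, k'))"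
        if "x \<in> Field (Ar n)" for x
        using S_hom_comp(1)[OF u that] S_hom_comp(1)[OF h(1) that] that by (auto simp: swap_simps)
      have "cofsq D (snd Q ((0, j), (0, k))) (cpt h (0, j)) (cpt h (0, k)) (cpt ?Bh (0, k'))"
        by (rule cofsq_cube_swap[OF S_hom_comp(1)[OF hAh F0(1)] is_diagD(4)[OF S_ObjD(1)[OF rA(1)] F0(3)]
              is_diagD(4)[OF S_ObjD(1)[OF rA(2)] F0(3)] S_hom_comp(1)[OF hAh F0(2)]
              S_hom_comp(1)[OF hBh F0(1)] is_diagD(4)[OF S_ObjD(1)[OF rB(1)] F0(3)]
              is_diagD(4)[OF S_ObjD(1)[OF rB(2)] F0(3)] S_hom_comp(1)[OF hBh F0(2)]
              S_hom_comp(1)[OF fj F0(1)] S_hom_comp(1)[OF fk F0(1)] S_hom_comp(1)[OF fj F0(2)] S_hom_comp(1)[OF fk F0(2)]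
              S_hom_comp(2)[OF hAh F0(3), symmetric] S_hom_comp(2)[OF hBh F0(3), symmetric]
              fnat[OF F0(1)] S_hom_comp(2)[OF fj F0(3)] S_hom_comp(2)[OF fk F0(3)] fnat[OF F0(2)]
              UVp[OF F0(1)] S_hom_comp(1)[OF W(1) F0(1)] UVp[OF F0(2)] S_hom_comp(1)[OF W(1) F0(2)]
              is_diagD(4)[OF S_ObjD(1)[OF WO] F0(3)] S_hom_comp(2)[OF W(1) F0(3), symmetric]
              S_hom_comp(2)[OF W(2) F0(3), symmetric] S_hom_comp(1)[OF Hh F0(1)] HU[OF F0(1)]
              S_hom_comp(1)[OF Hh F0(2)] HU[OF F0(2)] sq pwx[OF x(1)] uh(1)[OF x(1)] pwx[OF x(2)] uh(1)[OF x(2)]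
              is_diagD(4)[OF S_ObjD(1)[OF QO] x(3)] un uh(2)[OF x(1)] hu[OF x(1)] uh(2)[OF x(2)] hu[OF x(2)]])
      then show ?thesis using x by (simp add: swap_simps)
    qed
    then have "h \<in> Cofib (S n D)" using h(1) unfolding S_Cofib by (auto simp: hom_def S_dom)
    then show ?thesis by (rule F.cofsqI[OF po u h(1) bh h(2,3)])
  qed
  then show ?thesis using swap_hom(2)[OF f] O unfolding S_Cofib by (auto simp: hom_def swap_simps)
qed

lemma exact_swap: "exact_functor (S n (S m D)) (S m (S n D)) (swap_o n m) (swap_m n m)"
proof -
  interpret E: cofib_category "S m D" by (rule cofib_category_S)
  interpret F: cofib_category "S n D" by (rule cofib_category_S)
  interpret EE: cofib_category "S n (S m D)" by (rule E.cofib_category_S)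
  interpret FF: cofib_category "S m (S n D)" by (rule F.cofib_category_S)
  show ?thesis
  proof (rule exactI[OF swap_Obj swap_hom(2) _ _ _ swap_Cofib])
    show "swap_m n m (Ident (S n (S m D)) A) = Ident (S m (S n D)) (swap_o n m A)" if A: "A \<in> Obj (S n (S m D))" for A
      by (rule S_hom_eqI[OF swap_hom(2)[OF EE.Ident_hom[OF A]] FF.Ident_hom[OF swap_Obj[OF A]]])
        (auto simp: swap_simps S_Ident)
    show "swap_m n m (Comp (S n (S m D)) g f) = Comp (S m (S n D)) (swap_m n m g) (swap_m n m f)"
      if f: "f \<in> hom (S n (S m D)) A B" and g: "g \<in> hom (S n (S m D)) B X" for f g A B X
      by (rule S_hom_eqI[OF swap_hom(2)[OF EE.Comp_hom[OF f g]] FF.Comp_hom[OF swap_hom(2)[OF f] swap_hom(2)[OF g]]])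
        (auto simp: swap_simps S_Comp)
    show "swap_o n m (Zero (S n (S m D))) = Zero (S m (S n D))"
    proof (rule diag_eqI)
      show "is_diag (Ar m) (S n D) (swap_o n m (Zero (S n (S m D))))" using S_ObjD(1)[OF swap_Obj[OF EE.Zero_Obj]] .
      show "is_diag (Ar m) (S n D) (Zero (S m (S n D)))" using S_ObjD(1)[OF FF.Zero_Obj] .
      have c: "col n (Zero (S n (S m D))) y = Zero (S n D)" if "y \<in> Field (Ar m)" for y
        unfolding S_Zero const_diag_def col_def S_Ident using that by auto
      show "fst (swap_o n m (Zero (S n (S m D)))) y = fst (Zero (S m (S n D))) y" if "y \<in> Field (Ar m)" for y
        using that c[OF that] by (simp add: swap_simps S_Zero const_diag_def)
      show "snd (swap_o n m (Zero (S n (S m D)))) (y, y') = snd (Zero (S m (S n D))) (y, y')" if yy: "(y, y') \<in> Ar m" for y y'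
      proof -
        have "snd (swap_o n m (Zero (S n (S m D)))) (y, y') =
          (Zero (S n D), (\<lambda>x \<in> Field (Ar n). Ident D (Zero D)), Zero (S n D))"
          using yy c preordD(1,2)[OF preord_Ar yy] by (simp add: swap_simps) (auto simp: S_Zero const_diag_def)
        also have "\<dots> = Ident (S n D) (Zero (S n D))" unfolding S_Ident by (auto simp: S_Zero const_diag_def)
        finally show ?thesis using yy by (simp add: S_Zero[of m] const_diag_def)
      qed
    qed
    show "swap_m n m f \<in> Weq (S m (S n D))" if w: "f \<in> Weq (S n (S m D))" for f
    proof -
      obtain A B where f: "f \<in> hom (S n (S m D)) A B" using w unfolding S_Weq hom_def by auto
      show ?thesis
        using swap_hom(2)[OF f] swap_hom(1)[OF f] w unfolding S_Weq by (auto simp: hom_def swap_simps)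
    qed
    show "is_pushout (S m (S n D)) (swap_m n m f) (swap_m n m g) (swap_m n m u) (swap_m n m v)"
      if f: "f \<in> Cofib (S n (S m D))" and p: "is_pushout (S n (S m D)) f g u v" for f g u v
    proof -
      obtain A B X Q where h: "f \<in> hom (S n (S m D)) A B" "g \<in> hom (S n (S m D)) A X"
        "u \<in> hom (S n (S m D)) B Q" "v \<in> hom (S n (S m D)) X Q"
        and x: "\<And>x. x \<in> Field (Ar n) \<Longrightarrow> is_pushout (S m D) (cpt f x) (cpt g x) (cpt u x) (cpt v x)"
         "\<And>x. x \<in> Field (Ar n) \<Longrightarrow> cpt f x \<in> Cofib (S m D)"
        using S_pushoutD[OF E.cofib_category_axioms f p] by metis
      show ?thesis
      proof (rule S_pushoutI[OF F.cofib_category_axioms swap_hom(2)[OF h(1)] swap_hom(2)[OF h(2)] swap_hom(2)[OF h(3)] swap_hom(2)[OF h(4)]])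
        fix y assume y: "y \<in> Field (Ar m)"
        show "is_pushout (S n D) (cpt (swap_m n m f) y) (cpt (swap_m n m g) y) (cpt (swap_m n m u) y) (cpt (swap_m n m v) y)"
        proof (rule S_pushoutI[OF cofib_category_axioms swap_hom(1)[OF h(1) y] swap_hom(1)[OF h(2) y] swap_hom(1)[OF h(3) y] swap_hom(1)[OF h(4) y]])
          fix z assume z: "z \<in> Field (Ar n)"
          have "is_pushout D (cpt (cpt f z) y) (cpt (cpt g z) y) (cpt (cpt u z) y) (cpt (cpt v z) y)"
            using S_pushout_iff[OF x(2)[OF z] S_hom_comp(1)[OF h(1) z] S_hom_comp(1)[OF h(2) z]
                S_hom_comp(1)[OF h(3) z] S_hom_comp(1)[OF h(4) z]] x(1)[OF z] y by blast
          then show "is_pushout D (cpt (cpt (swap_m n m f) y) z) (cpt (cpt (swap_m n m g) y) z)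
            (cpt (cpt (swap_m n m u) y) z) (cpt (cpt (swap_m n m v) y) z)"
            using y z by (simp add: swap_simps)
        qed
      qed
    qed
  qed
qed

end

section \<open>Isomorphisms of categories with cofibrations\<close>

locale cat_iso = D: category D + D': category D' for D :: "('o, 'm) wcat" and D' :: "('p, 'n) wcat" +
  fixes Fo Fm Go Gm
  assumes F_Obj: "a \<in> Obj D \<Longrightarrow> Fo a \<in> Obj D'"
    and F_hom: "f \<in> hom D a b \<Longrightarrow> Fm f \<in> hom D' (Fo a) (Fo b)"
    and F_Ident: "a \<in> Obj D \<Longrightarrow> Fm (Ident D a) = Ident D' (Fo a)"
    and F_Comp: "f \<in> hom D a b \<Longrightarrow> g \<in> hom D b c \<Longrightarrow> Fm (Comp D g f) = Comp D' (Fm g) (Fm f)"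
    and G_Obj: "x \<in> Obj D' \<Longrightarrow> Go x \<in> Obj D"
    and G_hom: "k \<in> hom D' x y \<Longrightarrow> Gm k \<in> hom D (Go x) (Go y)"
    and GF_o: "a \<in> Obj D \<Longrightarrow> Go (Fo a) = a" and GF_m: "f \<in> Arr D \<Longrightarrow> Gm (Fm f) = f"
    and FG_o: "x \<in> Obj D' \<Longrightarrow> Fo (Go x) = x" and FG_m: "k \<in> Arr D' \<Longrightarrow> Fm (Gm k) = k"
begin

lemma G_Ident: "x \<in> Obj D' \<Longrightarrow> Gm (Ident D' x) = Ident D (Go x)"
  using F_Ident[OF G_Obj, of x] FG_o[of x] GF_m D.Ident_simps(1)[OF G_Obj, of x] by metis

lemma G_Comp:
  assumes f: "f \<in> hom D' a b" and g: "g \<in> hom D' b c"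
  shows "Gm (Comp D' g f) = Comp D (Gm g) (Gm f)"
  using F_Comp[OF G_hom[OF f] G_hom[OF g]] FG_m D'.homD(1)[OF f] D'.homD(1)[OF g]
    GF_m D.homD(1)[OF D.Comp_hom[OF G_hom[OF f] G_hom[OF g]]] by metis

lemma cat_iso_sym: "cat_iso D' D Go Gm Fo Fm"
  by unfold_locales (use F_Obj F_hom G_Obj G_hom GF_o GF_m FG_o FG_m G_Ident G_Comp in blast)+

lemma F_pushout:
  assumes p: "is_pushout D f g u v" shows "is_pushout D' (Fm f) (Fm g) (Fm u) (Fm v)"
proof -
  obtain a b c d where h: "f \<in> hom D a b" "g \<in> hom D a c" "u \<in> hom D b d" "v \<in> hom D c d"
    using p by (rule D.pushout_hom)
  note o = D.homD(5)[OF h(1)] D.homD(5)[OF h(2)] D.homD(5)[OF h(3)]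
  show ?thesis
  proof (rule D'.pushoutI[OF h[THEN F_hom]])
    show "Comp D' (Fm u) (Fm f) = Comp D' (Fm v) (Fm g)"
      using F_Comp[OF h(1,3)] F_Comp[OF h(2,4)] D.pushout_commutes[OF p] by simp
    show "\<exists>k\<in>hom D' (Fo d) z. Comp D' k (Fm u) = s \<and> Comp D' k (Fm v) = t"
      if st: "s \<in> hom D' (Fo b) z" "t \<in> hom D' (Fo c) z" "Comp D' s (Fm f) = Comp D' t (Fm g)" for z s t
    proof -
      have z: "z \<in> Obj D'" using D'.homD(5)[OF st(1)] .
      have s: "Gm s \<in> hom D b (Go z)" "Gm t \<in> hom D c (Go z)"
        using G_hom[OF st(1)] G_hom[OF st(2)] GF_o o by auto
      have "Comp D (Gm s) f = Comp D (Gm t) g"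
        using G_Comp[OF F_hom[OF h(1)] st(1)] G_Comp[OF F_hom[OF h(2)] st(2)] st(3)
          GF_m D.homD(1)[OF h(1)] D.homD(1)[OF h(2)] by simp
      then obtain k where k: "k \<in> hom D d (Go z)" "Comp D k u = Gm s" "Comp D k v = Gm t"
        using D.pushout_ex[OF p h(1,2,3) s] by blast
      have "Fm k \<in> hom D' (Fo d) z" using F_hom[OF k(1)] FG_o[OF z] by simp
      moreover have "Comp D' (Fm k) (Fm u) = s" "Comp D' (Fm k) (Fm v) = t"
        using F_Comp[OF h(3) k(1)] F_Comp[OF h(4) k(1)] k(2,3) FG_m D'.homD(1)[OF st(1)] D'.homD(1)[OF st(2)]
        by auto
      ultimately show ?thesis by blast
    qed
    show "k = k'" if k: "k \<in> hom D' (Fo d) z" "k' \<in> hom D' (Fo d) z"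
      "Comp D' k (Fm u) = Comp D' k' (Fm u)" "Comp D' k (Fm v) = Comp D' k' (Fm v)" for z k k'
    proof -
      have g: "Gm k \<in> hom D d (Go z)" "Gm k' \<in> hom D d (Go z)"
        using G_hom[OF k(1)] G_hom[OF k(2)] GF_o o by auto
      have "Gm k = Gm k'"
        by (rule D.pushout_eq[OF p h(3) g])
          (use G_Comp[OF F_hom[OF h(3)] k(1)] G_Comp[OF F_hom[OF h(3)] k(2)] G_Comp[OF F_hom[OF h(4)] k(1)]
            G_Comp[OF F_hom[OF h(4)] k(2)] k(3,4) GF_m D.homD(1)[OF h(3)] D.homD(1)[OF h(4)] in simp_all)
      then show ?thesis using FG_m D'.homD(1)[OF k(1)] D'.homD(1)[OF k(2)] by metis
    qed
  qed
qed

end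

text \<open>The structure of a category with cofibrations is transported from \<open>D'\<close> to \<open>D\<close>.\<close>

locale wcat_iso = cat_iso D D' Fo Fm Go Gm + D'c: cofib_category D'
  for D :: "('o, 'm) wcat" and D' :: "('p, 'n) wcat" and Fo Fm Go Gm +
  assumes F_Zero: "Zero D \<in> Obj D" "Fo (Zero D) = Zero D'"
    and Arr: "Cofib D \<subseteq> Arr D" "Weq D \<subseteq> Arr D" "Weq D' \<subseteq> Arr D'"
    and Cofib_iff: "f \<in> Arr D \<Longrightarrow> Fm f \<in> Cofib D' \<longleftrightarrow> f \<in> Cofib D"
    and Weq_iff: "f \<in> Arr D \<Longrightarrow> Fm f \<in> Weq D' \<longleftrightarrow> f \<in> Weq D"
begin

lemma G_Arr: "k \<in> Arr D' \<Longrightarrow> Gm k \<in> Arr D"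
  using G_hom[OF D'.Arr_hom] D.homD(1) by blast

lemma exact_F: "exact_functor D D' Fo Fm"
  by (rule exactI) (use F_Obj F_hom F_Ident F_Comp F_Zero Cofib_iff Weq_iff Arr F_pushout in auto)

lemma exact_G: "exact_functor D' D Go Gm"
proof (rule exactI[OF G_Obj G_hom G_Ident G_Comp])
  show "Go (Zero D') = Zero D" using F_Zero GF_o by metis
  show "Gm f \<in> Cofib D" if "f \<in> Cofib D'" for f
  proof -
    have "f \<in> Arr D'" using that D'c.Cofib_Arr by blast
    then show ?thesis using Cofib_iff[OF G_Arr] FG_m that by metis
  qed
  show "Gm f \<in> Weq D" if "f \<in> Weq D'" for f
  proof -
    have "f \<in> Arr D'" using that Arr by blast
    then show ?thesis using Weq_iff[OF G_Arr] FG_m that by metis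
  qed
  show "is_pushout D (Gm f) (Gm g) (Gm u) (Gm v)" if "is_pushout D' f g u v" for f g u v
    using cat_iso.F_pushout[OF cat_iso_sym that] .
qed

lemma F_inj: "f \<in> Arr D \<Longrightarrow> g \<in> Arr D \<Longrightarrow> Fm f = Fm g \<Longrightarrow> f = g"
  using GF_m by metis

lemma cofib_category: "cofib_category D"
proof (intro cofib_category.intro cofib_category_axioms.intro D.category_axioms F_Zero(1) Arr(1))
  note z = F_Zero
  show "\<exists>!f. f \<in> hom D (Zero D) a" if a: "a \<in> Obj D" for a
  proof -
    obtain k where k: "k \<in> hom D' (Zero D') (Fo a)" using D'c.Zero_initial[OF F_Obj[OF a]] by blast
    then have "Gm k \<in> hom D (Zero D) a" using G_hom[OF k] GF_o z a by metis
    moreover have "f = g" if fg: "f \<in> hom D (Zero D) a" "g \<in> hom D (Zero D) a" for f g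
      using F_inj[OF D.homD(1)[OF fg(1)] D.homD(1)[OF fg(2)]] D'c.hom_from_Zero_eq F_hom[OF fg(1)] F_hom[OF fg(2)] z
      by simp
    ultimately show ?thesis by blast
  qed
  show "\<exists>!f. f \<in> hom D a (Zero D)" if a: "a \<in> Obj D" for a
  proof -
    obtain k where k: "k \<in> hom D' (Fo a) (Zero D')" using D'c.Zero_terminal[OF F_Obj[OF a]] by blast
    then have "Gm k \<in> hom D a (Zero D)" using G_hom[OF k] GF_o z a by metis
    moreover have "f = g" if fg: "f \<in> hom D a (Zero D)" "g \<in> hom D a (Zero D)" for f g
      using F_inj[OF D.homD(1)[OF fg(1)] D.homD(1)[OF fg(2)]] D'c.hom_to_Zero_eq F_hom[OF fg(1)] F_hom[OF fg(2)] z
      by simp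
    ultimately show ?thesis by blast
  qed
  show "Comp D g f \<in> Cofib D" if fg: "f \<in> Cofib D" "g \<in> Cofib D" "Dom D g = Cod D f" for f g
  proof -
    have h: "f \<in> hom D (Dom D f) (Cod D f)" "g \<in> hom D (Cod D f) (Cod D g)"
      using fg Arr(1) by (auto simp: hom_def)
    have "Comp D' (Fm g) (Fm f) \<in> Cofib D'"
      by (rule D'c.Cofib_Comp) (use fg Cofib_iff Arr(1) F_hom[OF h(1)] F_hom[OF h(2)] in \<open>auto simp: hom_def\<close>)
    then show ?thesis using F_Comp[OF h] Cofib_iff[OF D.homD(1)[OF D.Comp_hom[OF h]]] by simp
  qed
  show "f \<in> Cofib D" if i: "is_iso D f" for f
  proof -
    obtain a b where f: "f \<in> hom D a b" using i unfolding is_iso_def hom_def by auto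
    obtain g where g: "g \<in> hom D b a" "Comp D g f = Ident D a" "Comp D f g = Ident D b"
      using D.isoE[OF i f] .
    have "is_iso D' (Fm f)"
      by (rule D'.isoI[OF F_hom[OF f] F_hom[OF g(1)]])
        (use F_Comp[OF f g(1)] F_Comp[OF g(1) f] g F_Ident D.homD(4,5)[OF f] in auto)
    then show ?thesis using D'c.Cofib_iso Cofib_iff D.homD(1)[OF f] by blast
  qed
  show "f \<in> Cofib D" if "a \<in> Obj D" "f \<in> hom D (Zero D) a" for a f
    using D'c.Cofib_Zero[OF F_Obj[OF that(1)], of "Fm f"] F_hom[OF that(2)] z Cofib_iff D.homD(1)[OF that(2)] by auto
  show "\<exists>u v. is_pushout D f g u v \<and> v \<in> Cofib D"
    if f: "f \<in> Cofib D" and g: "g \<in> Arr D" "Dom D g = Dom D f" for f g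
  proof -
    have h: "f \<in> hom D (Dom D f) (Cod D f)" "g \<in> hom D (Dom D f) (Cod D g)"
      using f g Arr(1) by (auto simp: hom_def)
    have "Fm f \<in> Cofib D'" using Cofib_iff f Arr(1) by blast
    then obtain u v where p: "is_pushout D' (Fm f) (Fm g) u v" "v \<in> Cofib D'"
      using D'c.Cofib_pushout[of "Fm f" "Fm g"] F_hom[OF h(1)] F_hom[OF h(2)] by (auto simp: hom_def)
    then have "is_pushout D f g (Gm u) (Gm v)"
      using cat_iso.F_pushout[OF cat_iso_sym p(1)] GF_m D.homD(1)[OF h(1)] D.homD(1)[OF h(2)] by simp
    then show ?thesis using exactD(6)[OF exact_G p(2)] by blast
  qed
qed

end

section \<open>The iterated S-construction\<close>

lemma Ars_Nil: "Ars [] = {([], [])}" "Field (Ars []) = {[]}"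
  by (auto simp: Ars_def Field_def)

lemma Ars_Cons: "(x # xs, y # ys) \<in> Ars (n # ns) \<longleftrightarrow> (x, y) \<in> Ar n \<and> (xs, ys) \<in> Ars ns"
  unfolding Ars_def by (auto simp: less_Suc_eq_0_disj)

lemma Ars_ConsE:
  assumes "(l, l') \<in> Ars (n # ns)"
  obtains x xs y ys where "l = x # xs" "l' = y # ys" "(x, y) \<in> Ar n" "(xs, ys) \<in> Ars ns"
proof -
  have "length l = Suc (length ns)" "length l' = Suc (length ns)" using assms by (auto simp: Ars_def)
  then obtain x xs y ys where "l = x # xs" "l' = y # ys" by (metis length_Suc_conv)
  then show ?thesis using assms that Ars_Cons by metis
qed

lemma Field_Ars_Cons: "x # xs \<in> Field (Ars (n # ns)) \<longleftrightarrow> x \<in> Field (Ar n) \<and> xs \<in> Field (Ars ns)"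
  unfolding preord_Field[OF preord_Ars] preord_Field[OF preord_Ar] Ars_Cons ..

lemma Field_Ars_ConsE:
  assumes "l \<in> Field (Ars (n # ns))"
  obtains x xs where "l = x # xs" "x \<in> Field (Ar n)" "xs \<in> Field (Ars ns)"
  using assms unfolding preord_Field[OF preord_Ars] preord_Field[OF preord_Ar] by (metis Ars_ConsE list.inject)

lemma S_iter_diag_wcat: "\<exists>ok co we. S_iter C ns = diag_wcat (Ars ns) C ok co we"
  by (cases ns) auto

lemma S_iter_Obj_diag: "A \<in> Obj (S_iter C ns) \<Longrightarrow> is_diag (Ars ns) C A"
  using S_iter_diag_wcat[of C ns] by (auto simp: diag_wcat_simps)

lemma S_iter_simps:
  "Dom (S_iter C ns) f = fst f" "Cod (S_iter C ns) f = snd (snd f)"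
  "Ident (S_iter C ns) A = (A, (\<lambda>x \<in> Field (Ars ns). Ident C (fst A x)), A)"
  "Comp (S_iter C ns) g f = (fst f, (\<lambda>x \<in> Field (Ars ns). Comp C (cpt g x) (cpt f x)), snd (snd g))"
  "Zero (S_iter C ns) = const_diag (Ars ns) C (Zero C)"
  using S_iter_diag_wcat[of C ns] by (auto simp: diag_wcat_simps)

lemma S_iter_Arr: "f \<in> Arr (S_iter C ns) \<longleftrightarrow>
  is_diag_map (Ars ns) C f \<and> fst f \<in> Obj (S_iter C ns) \<and> snd (snd f) \<in> Obj (S_iter C ns)"
  using S_iter_diag_wcat[of C ns] is_diag_mapD(1,2)[of "Ars ns" C f] by (auto simp: diag_wcat_simps)

lemma S_iter_hom: "f \<in> hom (S_iter C ns) A B \<longleftrightarrow>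
  fst f = A \<and> snd (snd f) = B \<and> is_diag_map (Ars ns) C f \<and> A \<in> Obj (S_iter C ns) \<and> B \<in> Obj (S_iter C ns)"
  unfolding hom_def S_iter_simps using S_iter_Arr by blast

lemma S_iter_homI:
  assumes "A \<in> Obj (S_iter C ns)" "B \<in> Obj (S_iter C ns)"
    "\<And>x. x \<in> Field (Ars ns) \<Longrightarrow> t x \<in> hom C (fst A x) (fst B x)"
    "\<And>x y. (x, y) \<in> Ars ns \<Longrightarrow> Comp C (t y) (snd A (x, y)) = Comp C (snd B (x, y)) (t x)"
  shows "(A, restrict t (Field (Ars ns)), B) \<in> hom (S_iter C ns) A B"
  unfolding S_iter_hom using assms preordD(1,2)[OF preord_Ars]
  by (auto intro!: is_diag_mapI dest: S_iter_Obj_diag)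

lemma S_iter_hom_eqI:
  assumes "f \<in> hom (S_iter C ns) A B" "g \<in> hom (S_iter C ns) A B"
    "\<And>x. x \<in> Field (Ars ns) \<Longrightarrow> cpt f x = cpt g x"
  shows "f = g"
  using assms diag_map_eqI[of "Ars ns" C f g] unfolding S_iter_hom by auto

lemma S_iter_hom_comp:
  assumes "f \<in> hom (S_iter C ns) A B"
  shows "x \<in> Field (Ars ns) \<Longrightarrow> cpt f x \<in> hom C (fst A x) (fst B x)"
    "(x, y) \<in> Ars ns \<Longrightarrow> Comp C (cpt f y) (snd A (x, y)) = Comp C (snd B (x, y)) (cpt f x)"
  using assms is_diag_mapD(4,5)[of "Ars ns" C f] unfolding S_iter_hom by auto

lemma category_S_iter:
  assumes "category C"
  shows "category (S_iter C ns)"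
proof -
  obtain ok co we where "S_iter C ns = diag_wcat (Ars ns) C ok co we" using S_iter_diag_wcat by blast
  then show ?thesis
    using diagrams.category_E[of C "Ars ns" ok co we] assms preord_Ars
    by (simp add: diagrams_def diagrams_axioms_def)
qed

lemma S_iter_Cons:
  "A \<in> Obj (S_iter C (n # ns)) \<longleftrightarrow> is_diag (Ars (n # ns)) C A \<and> curry_diag n ns A \<in> Obj (S n (S_iter C ns))"
  "f \<in> Cofib (S_iter C (n # ns)) \<longleftrightarrow> f \<in> Arr (S_iter C (n # ns)) \<and> curry_map n ns f \<in> Cofib (S n (S_iter C ns))"
  "f \<in> Weq (S_iter C (n # ns)) \<longleftrightarrow> f \<in> Arr (S_iter C (n # ns)) \<and> curry_map n ns f \<in> Weq (S n (S_iter C ns))"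
  by (simp_all add: diag_wcat_simps)

lemma S_iter_Nil:
  "A \<in> Obj (S_iter C []) \<longleftrightarrow> is_diag (Ars []) C A"
  "f \<in> Cofib (S_iter C []) \<longleftrightarrow> f \<in> Arr (S_iter C []) \<and> cpt f [] \<in> Cofib C"
  "f \<in> Weq (S_iter C []) \<longleftrightarrow> f \<in> Arr (S_iter C []) \<and> cpt f [] \<in> Weq C"
  by (auto simp: diag_wcat_simps split: prod.splits)

(* Membership in the iterates is handled by S_iter_Cons and S_iter_Nil only. *)
declare S_iter.simps [simp del]

lemma slice_simps:
  "xs \<in> Field (Ars ns) \<Longrightarrow> fst (slice ns A x) xs = fst A (x # xs)"
  "(xs, ys) \<in> Ars ns \<Longrightarrow> snd (slice ns A x) (xs, ys) = snd A (x # xs, x # ys)"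
  by (auto simp: slice_def)

lemma curry_simps:
  "x \<in> Field (Ar n) \<Longrightarrow> fst (curry_diag n ns A) x = slice ns A x"
  "(x, y) \<in> Ar n \<Longrightarrow> snd (curry_diag n ns A) (x, y)
    = (slice ns A x, (\<lambda>xs \<in> Field (Ars ns). snd A (x # xs, y # xs)), slice ns A y)"
  "fst (curry_map n ns f) = curry_diag n ns (fst f)"
  "snd (snd (curry_map n ns f)) = curry_diag n ns (snd (snd f))"
  "x \<in> Field (Ar n) \<Longrightarrow> cpt (curry_map n ns f) x
    = (slice ns (fst f) x, (\<lambda>xs \<in> Field (Ars ns). cpt f (x # xs)), slice ns (snd (snd f)) x)"
  by (auto simp: curry_diag_def curry_map_def split: prod.splits)

text \<open>A relation \<open>(x, xs) \<le> (y, ys)\<close> of the product is factored through \<open>(y, xs)\<close>.\<close>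

definition uncurry_diag :: "('o, 'm, 'x) cat_scheme \<Rightarrow> nat \<Rightarrow> nat list
    \<Rightarrow> (nat \<times> nat, ('o, 'm) mdiag, ('o, 'm) mdiag_map) diag \<Rightarrow> ('o, 'm) mdiag" where
  "uncurry_diag C n ns A =
     ((\<lambda>l \<in> Field (Ars (n # ns)). fst (fst A (hd l)) (tl l)),
      (\<lambda>p \<in> Ars (n # ns). Comp C (snd (fst A (hd (snd p))) (tl (fst p), tl (snd p)))
         (cpt (snd A (hd (fst p), hd (snd p))) (tl (fst p)))))"

definition uncurry_map :: "('o, 'm, 'x) cat_scheme \<Rightarrow> nat \<Rightarrow> nat list
    \<Rightarrow> (nat \<times> nat, ('o, 'm) mdiag, ('o, 'm) mdiag_map) diag_map \<Rightarrow> ('o, 'm) mdiag_map" where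
  "uncurry_map C n ns f =
     (uncurry_diag C n ns (fst f),
      (\<lambda>l \<in> Field (Ars (n # ns)). cpt (cpt f (hd l)) (tl l)),
      uncurry_diag C n ns (snd (snd f)))"

lemma uncurry_simps:
  "x \<in> Field (Ar n) \<Longrightarrow> xs \<in> Field (Ars ns) \<Longrightarrow> fst (uncurry_diag C n ns A) (x # xs) = fst (fst A x) xs"
  "(x, y) \<in> Ar n \<Longrightarrow> (xs, ys) \<in> Ars ns \<Longrightarrow> snd (uncurry_diag C n ns A) (x # xs, y # ys)
    = Comp C (snd (fst A y) (xs, ys)) (cpt (snd A (x, y)) xs)"
  "x \<in> Field (Ar n) \<Longrightarrow> xs \<in> Field (Ars ns) \<Longrightarrow> cpt (uncurry_map C n ns f) (x # xs) = cpt (cpt f x) xs"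
  "fst (uncurry_map C n ns f) = uncurry_diag C n ns (fst f)"
  "snd (snd (uncurry_map C n ns f)) = uncurry_diag C n ns (snd (snd f))"
  by (auto simp: uncurry_diag_def uncurry_map_def Field_Ars_Cons Ars_Cons)

lemma is_diag_slice:
  assumes A: "is_diag (Ars (n # ns)) C A" and x: "x \<in> Field (Ar n)"
  shows "is_diag (Ars ns) C (slice ns A x)"
proof -
  have "slice ns A x = pull_diag (Ars ns) ((#) x) A" unfolding slice_def pull_diag_def ..
  moreover have "is_diag (Ars ns) C (pull_diag (Ars ns) ((#) x) A)"
    by (rule is_diag_pull[OF preord_Ars preord_Ars _ A]) (use x in \<open>simp add: Ars_Cons preord_Field[OF preord_Ar]\<close>)
  ultimately show ?thesis by simp
qed

context cofib_category
begin

lemma uncurry_is_diag: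
  assumes A: "is_diag (Ar n) (S_iter D ns) A"
  shows "is_diag (Ars (n # ns)) D (uncurry_diag D n ns A)"
proof (rule is_diagI)
  let ?U = "uncurry_diag D n ns A"
  have dA: "is_diag (Ars ns) D (fst A x)" if "x \<in> Field (Ar n)" for x
    using S_iter_Obj_diag is_diagD(3)[OF A that] by blast
  note hA = is_diagD(4)[OF A]
  show "fst ?U \<in> extensional (Field (Ars (n # ns)))" "snd ?U \<in> extensional (Ars (n # ns))"
    by (auto simp: uncurry_diag_def)
  show "fst ?U l \<in> Obj D" if "l \<in> Field (Ars (n # ns))" for l
    using that by (elim Field_Ars_ConsE) (use is_diagD(3)[OF dA] in \<open>simp add: uncurry_simps\<close>)
  show "snd ?U (l, l') \<in> hom D (fst ?U l) (fst ?U l')" if l: "(l, l') \<in> Ars (n # ns)" for l l'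
  proof -
    obtain x xs y ys where l: "l = x # xs" "l' = y # ys" "(x, y) \<in> Ar n" "(xs, ys) \<in> Ars ns"
      using Ars_ConsE[OF l] .
    note F = preordD(1,2)[OF preord_Ar l(3)] preordD(1,2)[OF preord_Ars l(4)]
    show ?thesis
      using Comp_hom[OF S_iter_hom_comp(1)[OF hA[OF l(3)] F(3)] is_diagD(4)[OF dA[OF F(2)] l(4)]] l F
      by (simp add: uncurry_simps)
  qed
  show "snd ?U (l, l) = Ident D (fst ?U l)" if l: "l \<in> Field (Ars (n # ns))" for l
  proof -
    obtain x xs where l: "l = x # xs" "x \<in> Field (Ar n)" "xs \<in> Field (Ars ns)"
      using Field_Ars_ConsE[OF l] .
    have xx: "(x, x) \<in> Ar n" "(xs, xs) \<in> Ars ns" using preordD(4)[OF preord_Ar l(2)] preordD(4)[OF preord_Ars l(3)] by auto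
    show ?thesis using l xx is_diagD(5)[OF A l(2)] is_diagD(5)[OF dA[OF l(2)] l(3)] is_diagD(3)[OF dA[OF l(2)] l(3)]
      by (simp add: uncurry_simps S_iter_simps chase)
  qed
  show "snd ?U (l', l'') \<odot> snd ?U (l, l') = snd ?U (l, l'')"
    if l: "(l, l') \<in> Ars (n # ns)" "(l', l'') \<in> Ars (n # ns)" for l l' l''
  proof -
    obtain x xs y ys where l1: "l = x # xs" "l' = y # ys" "(x, y) \<in> Ar n" "(xs, ys) \<in> Ars ns"
      using Ars_ConsE[OF l(1)] .
    obtain z zs where l2: "l'' = z # zs" "(y, z) \<in> Ar n" "(ys, zs) \<in> Ars ns"
      using Ars_ConsE[OF l(2)] l1(2) by (metis list.inject)
    note F = preordD(1,2)[OF preord_Ar l1(3)] preordD(1,2)[OF preord_Ars l1(4)]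
      preordD(2)[OF preord_Ar l2(2)] preordD(2)[OF preord_Ars l2(3)]
    note t = preordD(3)[OF preord_Ar l1(3) l2(2)] preordD(3)[OF preord_Ars l1(4) l2(3)]
    note h = S_iter_hom_comp(1)[OF hA[OF l1(3)] F(3)] is_diagD(4)[OF dA[OF F(2)] l1(4)]
      S_iter_hom_comp(1)[OF hA[OF l2(2)] F(3)] S_iter_hom_comp(1)[OF hA[OF l2(2)] F(4)] is_diagD(4)[OF dA[OF F(5)] l2(3)]
      is_diagD(4)[OF dA[OF F(5)] l1(4)]
    note nat = S_iter_hom_comp(2)[OF hA[OF l2(2)] l1(4)]
    have c: "cpt (snd A (x, z)) xs = cpt (snd A (y, z)) xs \<odot> cpt (snd A (x, y)) xs"
      using is_diagD(6)[OF A l1(3) l2(2), symmetric] F by (simp add: S_iter_simps)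
    have c2: "snd (fst A z) (xs, zs) = snd (fst A z) (ys, zs) \<odot> snd (fst A z) (xs, ys)"
      using is_diagD(6)[OF dA[OF F(5)] l1(4) l2(3)] by simp
    show ?thesis
      using l1 l2 t F h by (simp add: uncurry_simps c c2 chase rw[OF nat h(2) h(4)])
  qed
qed

lemma curry_uncurry:
  assumes A: "is_diag (Ar n) (S_iter D ns) A"
  shows "curry_diag n ns (uncurry_diag D n ns A) = A"
proof -
  let ?U = "uncurry_diag D n ns A"
  have dA: "is_diag (Ars ns) D (fst A x)" if "x \<in> Field (Ar n)" for x
    using S_iter_Obj_diag is_diagD(3)[OF A that] by blast
  note hA = is_diagD(4)[OF A]
  have s: "slice ns ?U x = fst A x" if x: "x \<in> Field (Ar n)" for x
  proof (rule diag_eqI[OF is_diag_slice[OF uncurry_is_diag[OF A] x] dA[OF x]])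
    show "fst (slice ns ?U x) xs = fst (fst A x) xs" if "xs \<in> Field (Ars ns)" for xs
      using x that by (simp add: slice_simps uncurry_simps)
    show "snd (slice ns ?U x) (xs, ys) = snd (fst A x) (xs, ys)" if xs: "(xs, ys) \<in> Ars ns" for xs ys
      using x xs preordD(4)[OF preord_Ar x] preordD(1)[OF preord_Ars xs] is_diagD(5)[OF A x] is_diagD(4)[OF dA[OF x] xs]
      by (simp add: slice_simps uncurry_simps S_iter_simps chase)
  qed
  have m: "(\<lambda>xs \<in> Field (Ars ns). snd ?U (x # xs, y # xs)) = cpt (snd A (x, y))" if xy: "(x, y) \<in> Ar n" for x y
  proof (rule extensionalityI)
    show "cpt (snd A (x, y)) \<in> extensional (Field (Ars ns))"
      using is_diag_mapD(3) hA[OF xy] unfolding S_iter_hom by blast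
    show "(\<lambda>xs \<in> Field (Ars ns). snd ?U (x # xs, y # xs)) xs = cpt (snd A (x, y)) xs" if xs: "xs \<in> Field (Ars ns)" for xs
      using xy xs preordD(1,2)[OF preord_Ar xy] preordD(4)[OF preord_Ars xs] S_iter_hom_comp(1)[OF hA[OF xy] xs]
        is_diagD(5)[OF dA xs, of y] is_diagD(3)[OF dA xs, of y]
      by (simp add: uncurry_simps chase)
  qed auto
  have p: "snd A (x, y) = (fst A x, cpt (snd A (x, y)), fst A y)" if "(x, y) \<in> Ar n" for x y
    using hA[OF that] unfolding S_iter_hom by (metis prod.collapse)
  show ?thesis
  proof (rule prod_eqI)
    show "fst (curry_diag n ns ?U) = fst A"
      by (rule extensionalityI[OF _ is_diagD(1)[OF A]]) (auto simp: curry_diag_def s)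
    show "snd (curry_diag n ns ?U) = snd A"
    proof (rule extensionalityI[OF _ is_diagD(2)[OF A]])
      fix q assume q: "q \<in> Ar n"
      obtain x y where xy: "q = (x, y)" by (cases q)
      show "snd (curry_diag n ns ?U) q = snd A q"
        unfolding xy using q[unfolded xy] preordD(1,2)[OF preord_Ar, of x y] p[of x y] m[of x y] s
        by (simp add: curry_simps)
    qed (auto simp: curry_diag_def)
  qed
qed

lemma uncurry_curry:
  assumes A: "A \<in> Obj (S_iter D (n # ns))"
  shows "uncurry_diag D n ns (curry_diag n ns A) = A"
proof -
  note d = S_iter_Obj_diag[OF A]
  have c: "is_diag (Ar n) (S_iter D ns) (curry_diag n ns A)"
    using A S_iter_Cons(1) S_ObjD(1) by blast
  show ?thesis
  proof (rule diag_eqI[OF uncurry_is_diag[OF c] d])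
    show "fst (uncurry_diag D n ns (curry_diag n ns A)) l = fst A l" if "l \<in> Field (Ars (n # ns))" for l
      using that by (elim Field_Ars_ConsE) (simp add: uncurry_simps curry_simps slice_simps)
    show "snd (uncurry_diag D n ns (curry_diag n ns A)) (l, l') = snd A (l, l')" if l: "(l, l') \<in> Ars (n # ns)" for l l'
    proof -
      obtain x xs y ys where l: "l = x # xs" "l' = y # ys" "(x, y) \<in> Ar n" "(xs, ys) \<in> Ars ns"
        using Ars_ConsE[OF l] .
      note F = preordD(1,2)[OF preord_Ar l(3)] preordD(1,2)[OF preord_Ars l(4)]
      show ?thesis
        using l F is_diagD(6)[OF d, of "x # xs" "y # xs" "y # ys"] preordD(4)[OF preord_Ars F(3)] preordD(4)[OF preord_Ar F(2)]
        by (simp add: uncurry_simps curry_simps slice_simps Ars_Cons)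
    qed
  qed
qed

end

lemma curry_hom:
  assumes f: "f \<in> hom (S_iter C (n # ns)) A B"
  shows "curry_map n ns f \<in> hom (S n (S_iter C ns)) (curry_diag n ns A) (curry_diag n ns B)"
    "x \<in> Field (Ar n) \<Longrightarrow> cpt (curry_map n ns f) x \<in> hom (S_iter C ns) (slice ns A x) (slice ns B x)"
proof -
  have O: "curry_diag n ns A \<in> Obj (S n (S_iter C ns))" "curry_diag n ns B \<in> Obj (S n (S_iter C ns))"
    "fst f = A" "snd (snd f) = B"
    using f unfolding S_iter_hom S_iter_Cons by auto
  have so: "slice ns A x \<in> Obj (S_iter C ns)" "slice ns B x \<in> Obj (S_iter C ns)"
    if "x \<in> Field (Ar n)" for x
    using is_diagD(3)[OF S_ObjD(1)[OF O(1)] that] is_diagD(3)[OF S_ObjD(1)[OF O(2)] that] that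
    by (simp_all add: curry_simps)
  have h: "(slice ns A x, (\<lambda>xs \<in> Field (Ars ns). cpt f (x # xs)), slice ns B x)
      \<in> hom (S_iter C ns) (slice ns A x) (slice ns B x)" if x: "x \<in> Field (Ar n)" for x
  proof (rule S_iter_homI[OF so[OF x]])
    show "cpt f (x # xs) \<in> hom C (fst (slice ns A x) xs) (fst (slice ns B x) xs)" if "xs \<in> Field (Ars ns)" for xs
      using S_iter_hom_comp(1)[OF f, of "x # xs"] that x by (simp add: slice_simps Field_Ars_Cons)
    show "Comp C (cpt f (x # ys)) (snd (slice ns A x) (xs, ys))
       = Comp C (snd (slice ns B x) (xs, ys)) (cpt f (x # xs))"
      if "(xs, ys) \<in> Ars ns" for xs ys
      using S_iter_hom_comp(2)[OF f, of "x # xs" "x # ys"] that preordD(4)[OF preord_Ar x]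
      by (simp add: slice_simps Ars_Cons)
  qed
  then show "x \<in> Field (Ar n) \<Longrightarrow> cpt (curry_map n ns f) x \<in> hom (S_iter C ns) (slice ns A x) (slice ns B x)"
    by (simp add: curry_simps O)
  have "(curry_diag n ns A, (\<lambda>x \<in> Field (Ar n). (slice ns A x, (\<lambda>xs \<in> Field (Ars ns). cpt f (x # xs)), slice ns B x)),
    curry_diag n ns B) \<in> hom (S n (S_iter C ns)) (curry_diag n ns A) (curry_diag n ns B)"
  proof (rule S_homI[OF O(1,2)])
    show "(slice ns A x, \<lambda>xs\<in>Field (Ars ns). cpt f (x # xs), slice ns B x)
       \<in> hom (S_iter C ns) (fst (curry_diag n ns A) x) (fst (curry_diag n ns B) x)" if "x \<in> Field (Ar n)" for x
      using h[OF that] that by (simp add: curry_simps)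
    fix x y assume xy: "(x, y) \<in> Ar n"
    show "Comp (S_iter C ns) (slice ns A y, \<lambda>xs\<in>Field (Ars ns). cpt f (y # xs), slice ns B y) (snd (curry_diag n ns A) (x, y)) =
         Comp (S_iter C ns) (snd (curry_diag n ns B) (x, y)) (slice ns A x, \<lambda>xs\<in>Field (Ars ns). cpt f (x # xs), slice ns B x)"
      using S_iter_hom_comp(2)[OF f, of "x # zs" "y # zs" for zs] xy preordD(4)[OF preord_Ars]
      by (auto simp: S_iter_simps curry_simps Ars_Cons intro!: restrict_ext)
  qed
  then show "curry_map n ns f \<in> hom (S n (S_iter C ns)) (curry_diag n ns A) (curry_diag n ns B)"
    by (simp add: curry_map_def split_beta O)
qed

lemma weq_S_iter_pointwise:
  "f \<in> Weq (S_iter C ns) \<longleftrightarrow> f \<in> Arr (S_iter C ns) \<and> (\<forall>xs \<in> Field (Ars ns). cpt f xs \<in> Weq C)"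
proof (induction ns arbitrary: f)
  case Nil
  show ?case unfolding S_iter_Nil Ars_Nil by simp
next
  case (Cons n ns)
  show ?case
  proof (cases "f \<in> Arr (S_iter C (n # ns))")
    case False
    then show ?thesis unfolding S_iter_Cons by simp
  next
    case True
    have f: "f \<in> hom (S_iter C (n # ns)) (fst f) (snd (snd f))"
      using True unfolding S_iter_hom S_iter_Arr by blast
    have cA: "cpt (curry_map n ns f) x \<in> Arr (S_iter C ns)" if "x \<in> Field (Ar n)" for x
      using curry_hom(2)[OF f that] by (simp add: hom_def)
    have "curry_map n ns f \<in> Arr (S n (S_iter C ns))"
      using curry_hom(1)[OF f] by (simp add: hom_def)
    then have "f \<in> Weq (S_iter C (n # ns)) \<longleftrightarrow> (\<forall>x \<in> Field (Ar n). \<forall>xs \<in> Field (Ars ns). cpt f (x # xs) \<in> Weq C)"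
      unfolding S_iter_Cons S_Weq using True cA by (simp add: Cons.IH) (simp add: curry_simps)
    also have "\<dots> \<longleftrightarrow> (\<forall>l \<in> Field (Ars (n # ns)). cpt f l \<in> Weq C)"
      by (metis Field_Ars_Cons Field_Ars_ConsE)
    finally show ?thesis using True by simp
  qed
qed

lemma weq_S_iter_Arr: "Weq (S_iter C ns) \<subseteq> Arr (S_iter C ns)"
  using weq_S_iter_pointwise by blast

context waldhausen_category
begin

lemma category_S_iter_C: "category (S_iter C ns)"
  by (rule category_S_iter[OF category_axioms])

lemma uncurry_Obj:
  assumes "A \<in> Obj (S n (S_iter C ns))" shows "uncurry_diag C n ns A \<in> Obj (S_iter C (n # ns))"
  unfolding S_iter_Cons using uncurry_is_diag curry_uncurry S_ObjD(1)[OF assms] assms by simp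

lemma uncurry_hom:
  assumes f: "f \<in> hom (S n (S_iter C ns)) A B"
  shows "uncurry_map C n ns f \<in> hom (S_iter C (n # ns)) (uncurry_diag C n ns A) (uncurry_diag C n ns B)"
proof -
  have O: "A \<in> Obj (S n (S_iter C ns))" "B \<in> Obj (S n (S_iter C ns))" "fst f = A" "snd (snd f) = B"
    using f by (auto simp: S_hom)
  note dA = S_ObjD(1)[OF O(1)] and dB = S_ObjD(1)[OF O(2)]
  have "(uncurry_diag C n ns A, (\<lambda>l \<in> Field (Ars (n # ns)). cpt (cpt f (hd l)) (tl l)), uncurry_diag C n ns B)
     \<in> hom (S_iter C (n # ns)) (uncurry_diag C n ns A) (uncurry_diag C n ns B)"
  proof (rule S_iter_homI[OF uncurry_Obj[OF O(1)] uncurry_Obj[OF O(2)]])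
    show "cpt (cpt f (hd l)) (tl l) \<in> hom C (fst (uncurry_diag C n ns A) l) (fst (uncurry_diag C n ns B) l)"
      if "l \<in> Field (Ars (n # ns))" for l
      using that by (elim Field_Ars_ConsE) (use S_iter_hom_comp(1)[OF S_hom_comp(1)[OF f]] in \<open>simp add: uncurry_simps\<close>)
    fix l l' assume l: "(l, l') \<in> Ars (n # ns)"
    obtain x xs y ys where l1: "l = x # xs" "l' = y # ys" "(x, y) \<in> Ar n" "(xs, ys) \<in> Ars ns"
      using Ars_ConsE[OF l] .
    note F = preordD(1,2)[OF preord_Ar l1(3)] preordD(1,2)[OF preord_Ars l1(4)]
    note h = S_iter_hom_comp(1)[OF is_diagD(4)[OF dA l1(3)] F(3)] S_iter_hom_comp(1)[OF is_diagD(4)[OF dB l1(3)] F(3)]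
      is_diagD(4)[OF S_iter_Obj_diag[OF is_diagD(3)[OF dA F(2)]] l1(4)]
      is_diagD(4)[OF S_iter_Obj_diag[OF is_diagD(3)[OF dB F(2)]] l1(4)]
      S_iter_hom_comp(1)[OF S_hom_comp(1)[OF f F(1)] F(3)] S_iter_hom_comp(1)[OF S_hom_comp(1)[OF f F(2)] F(3)]
      S_iter_hom_comp(1)[OF S_hom_comp(1)[OF f F(2)] F(4)]
    have n1: "cpt (cpt f y) xs \<odot> cpt (snd A (x, y)) xs = cpt (snd B (x, y)) xs \<odot> cpt (cpt f x) xs"
      using arg_cong[OF S_hom_comp(2)[OF f l1(3)], of "\<lambda>t. cpt t xs"] F by (simp add: S_iter_simps)
    note n2 = S_iter_hom_comp(2)[OF S_hom_comp(1)[OF f F(2)] l1(4)]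
    show "cpt (cpt f (hd l')) (tl l') \<odot> snd (uncurry_diag C n ns A) (l, l')
       = snd (uncurry_diag C n ns B) (l, l') \<odot> cpt (cpt f (hd l)) (tl l)"
      using l1 h by (simp add: uncurry_simps chase rw[OF n2 h(3) h(7)] n1)
  qed
  then show ?thesis by (simp add: uncurry_map_def O)
qed

text \<open>Currying is an isomorphism on the nose: diagrams are extensional, and the cofibrations and weak
  equivalences of \<open>S_iter\<close> are defined by currying.\<close>

lemma curry_iso:
  assumes ns: "cofib_category (S_iter C ns)"
  shows "wcat_iso (S_iter C (n # ns)) (S n (S_iter C ns)) (curry_diag n ns) (curry_map n ns)
     (uncurry_diag C n ns) (uncurry_map C n ns)"
proof -
  interpret E: cofib_category "S_iter C ns" by (rule ns)
  interpret SE: cofib_category "S n (S_iter C ns)" by (rule E.cofib_category_S)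
  interpret F: category "S_iter C (n # ns)" by (rule category_S_iter_C)
  have GF: "uncurry_diag C n ns (curry_diag n ns A) = A" if "A \<in> Obj (S_iter C (n # ns))" for A
    using uncurry_curry[OF that] .
  have FG: "curry_diag n ns (uncurry_diag C n ns A) = A" if "A \<in> Obj (S n (S_iter C ns))" for A
    using curry_uncurry[OF S_ObjD(1)[OF that]] .
  have FO: "curry_diag n ns A \<in> Obj (S n (S_iter C ns))" if "A \<in> Obj (S_iter C (n # ns))" for A
    using that S_iter_Cons(1) by blast
  show ?thesis
  proof
    show "curry_map n ns (Ident (S_iter C (n # ns)) A) = Ident (S n (S_iter C ns)) (curry_diag n ns A)"
      if A: "A \<in> Obj (S_iter C (n # ns))" for A
      by (rule S_hom_eqI[OF curry_hom(1)[OF F.Ident_hom[OF A]] SE.Ident_hom[OF FO[OF A]]])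
        (auto simp: curry_simps S_Ident S_iter_simps slice_simps Field_Ars_Cons intro!: restrict_ext)
    show "curry_map n ns (Comp (S_iter C (n # ns)) g f) = Comp (S n (S_iter C ns)) (curry_map n ns g) (curry_map n ns f)"
      if f: "f \<in> hom (S_iter C (n # ns)) A B" and g: "g \<in> hom (S_iter C (n # ns)) B X" for f g A B X
      by (rule S_hom_eqI[OF curry_hom(1)[OF F.Comp_hom[OF f g]] SE.Comp_hom[OF curry_hom(1)[OF f] curry_hom(1)[OF g]]])
        (auto simp: curry_simps S_Comp S_iter_simps Field_Ars_Cons intro!: restrict_ext)
    show "uncurry_map C n ns (curry_map n ns f) = f" if f: "f \<in> Arr (S_iter C (n # ns))" for f
    proof -
      have h: "f \<in> hom (S_iter C (n # ns)) (fst f) (snd (snd f))" using f unfolding S_iter_hom S_iter_Arr by blast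
      then have o: "fst f \<in> Obj (S_iter C (n # ns))" "snd (snd f) \<in> Obj (S_iter C (n # ns))" by (auto simp: S_iter_hom)
      have k: "uncurry_map C n ns (curry_map n ns f) \<in> hom (S_iter C (n # ns)) (fst f) (snd (snd f))"
        using uncurry_hom[OF curry_hom(1)[OF h]] GF[OF o(1)] GF[OF o(2)] by simp
      show ?thesis
        by (rule S_iter_hom_eqI[OF k h]) (elim Field_Ars_ConsE, simp add: uncurry_simps curry_simps)
    qed
    show "curry_map n ns (uncurry_map C n ns k) = k" if k: "k \<in> Arr (S n (S_iter C ns))" for k
    proof -
      have h: "k \<in> hom (S n (S_iter C ns)) (fst k) (snd (snd k))" using k unfolding S_hom S_Arr by blast
      then have o: "fst k \<in> Obj (S n (S_iter C ns))" "snd (snd k) \<in> Obj (S n (S_iter C ns))" by (auto simp: S_hom)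
      have l: "curry_map n ns (uncurry_map C n ns k) \<in> hom (S n (S_iter C ns)) (fst k) (snd (snd k))"
        using curry_hom(1)[OF uncurry_hom[OF h]] FG[OF o(1)] FG[OF o(2)] by simp
      show ?thesis
      proof (rule S_hom_eqI[OF l h])
        fix x assume x: "x \<in> Field (Ar n)"
        have l1: "cpt (curry_map n ns (uncurry_map C n ns k)) x \<in> hom (S_iter C ns) (fst (fst k) x) (fst (snd (snd k)) x)"
          using S_hom_comp(1)[OF l x] .
        show "cpt (curry_map n ns (uncurry_map C n ns k)) x = cpt k x"
          by (rule S_iter_hom_eqI[OF l1 S_hom_comp(1)[OF h x]])
            (use x in \<open>simp add: curry_simps uncurry_simps\<close>)
      qed
    qed
    have Z: "is_diag (Ars (n # ns)) C (Zero (S_iter C (n # ns)))"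
      unfolding S_iter_simps by (rule is_diag_const[OF preord_Ars Zero_Obj])
    show cz: "curry_diag n ns (Zero (S_iter C (n # ns))) = Zero (S n (S_iter C ns))"
    proof (rule prod_eqI)
      have sz: "slice ns (Zero (S_iter C (n # ns))) x = Zero (S_iter C ns)" if x: "x \<in> Field (Ar n)" for x
        unfolding S_iter_simps const_diag_def slice_def using x preordD(4)[OF preord_Ar x]
        by (auto simp: Field_Ars_Cons Ars_Cons intro!: restrict_ext)
      show "fst (curry_diag n ns (Zero (S_iter C (n # ns)))) = fst (Zero (S n (S_iter C ns)))"
        unfolding curry_diag_def S_Zero const_diag_def using sz by (auto intro!: restrict_ext)
      show "snd (curry_diag n ns (Zero (S_iter C (n # ns)))) = snd (Zero (S n (S_iter C ns)))"
      proof (rule extensionalityI)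
        fix p assume p: "p \<in> Ar n"
        obtain x y where xy: "p = (x, y)" by (cases p)
        note F = preordD(1,2)[OF preord_Ar p[unfolded xy]]
        show "snd (curry_diag n ns (Zero (S_iter C (n # ns)))) p = snd (Zero (S n (S_iter C ns))) p"
          unfolding xy using p[unfolded xy] F preordD(4)[OF preord_Ars]
          by (simp add: curry_simps sz S_Zero)
            (auto simp: const_diag_def S_iter_simps Ars_Cons intro!: restrict_ext)
      qed (auto simp: curry_diag_def S_Zero const_diag_def)
    qed
    show "Zero (S_iter C (n # ns)) \<in> Obj (S_iter C (n # ns))"
      unfolding S_iter_Cons using Z cz SE.Zero_Obj by simp
    show "Cofib (S_iter C (n # ns)) \<subseteq> Arr (S_iter C (n # ns))" using S_iter_Cons(2) by blast
    show "Weq (S_iter C (n # ns)) \<subseteq> Arr (S_iter C (n # ns))" by (rule weq_S_iter_Arr)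
    show "Weq (S n (S_iter C ns)) \<subseteq> Arr (S n (S_iter C ns))" by (auto simp: S_Weq)
    show "curry_map n ns f \<in> Cofib (S n (S_iter C ns)) \<longleftrightarrow> f \<in> Cofib (S_iter C (n # ns))"
      "curry_map n ns f \<in> Weq (S n (S_iter C ns)) \<longleftrightarrow> f \<in> Weq (S_iter C (n # ns))"
      if "f \<in> Arr (S_iter C (n # ns))" for f
      using that by (simp_all add: S_iter_Cons)
  qed (fact FO curry_hom(1) uncurry_Obj uncurry_hom GF FG)+
qed

definition point_map :: "'m \<Rightarrow> ('o, 'm) mdiag_map" where
  "point_map f = (const_diag (Ars []) C (Dom C f), (\<lambda>xs \<in> Field (Ars []). f), const_diag (Ars []) C (Cod C f))"

lemma Nil_iso:
  "wcat_iso (S_iter C []) C (\<lambda>A. fst A []) (\<lambda>f. cpt f []) (const_diag (Ars []) C) point_map"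
proof -
  interpret F: category "S_iter C []" by (rule category_S_iter_C)
  have n: "[] \<in> Field (Ars [])" "([], []) \<in> Ars []" by (auto simp: Ars_Nil)
  have GO: "const_diag (Ars []) C a \<in> Obj (S_iter C [])" if "a \<in> Obj C" for a
    unfolding S_iter_Nil by (rule is_diag_const[OF preord_Ars that])
  have GF: "const_diag (Ars []) C (fst A []) = A" if A: "A \<in> Obj (S_iter C [])" for A
  proof -
    have d: "is_diag (Ars []) C A" using A unfolding S_iter_Nil .
    show ?thesis
      by (rule diag_eqI[OF is_diag_const[OF preord_Ars is_diagD(3)[OF d n(1)]] d])
        (use is_diagD(5)[OF d n(1)] in \<open>auto simp: Ars_Nil const_diag_def\<close>)
  qed
  have Gh: "point_map k \<in> hom (S_iter C []) (const_diag (Ars []) C x) (const_diag (Ars []) C y)"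
    if k: "k \<in> hom C x y" for k x y
  proof -
    have "(const_diag (Ars []) C x, (\<lambda>xs \<in> Field (Ars []). k), const_diag (Ars []) C y)
      \<in> hom (S_iter C []) (const_diag (Ars []) C x) (const_diag (Ars []) C y)"
      by (rule S_iter_homI[OF GO GO]) (use k homD[OF k] in \<open>auto simp: const_diag_def Ars_Nil chase\<close>)
    then show ?thesis using homD[OF k] by (simp add: point_map_def)
  qed
  show ?thesis
  proof
    show "point_map (cpt f []) = f" if f: "f \<in> Arr (S_iter C [])" for f
    proof -
      have h: "f \<in> hom (S_iter C []) (fst f) (snd (snd f))" using f unfolding S_iter_hom S_iter_Arr by blast
      then have o: "fst f \<in> Obj (S_iter C [])" "snd (snd f) \<in> Obj (S_iter C [])" by (auto simp: S_iter_hom)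
      have k: "point_map (cpt f []) \<in> hom (S_iter C []) (fst f) (snd (snd f))"
        using Gh[OF S_iter_hom_comp(1)[OF h n(1)]] GF[OF o(1)] GF[OF o(2)] by simp
      show ?thesis by (rule S_iter_hom_eqI[OF k h]) (simp add: Ars_Nil point_map_def)
    qed
    show "Zero (S_iter C []) \<in> Obj (S_iter C [])" unfolding S_iter_simps using GO[OF Zero_Obj] .
    show "Cofib (S_iter C []) \<subseteq> Arr (S_iter C [])" using S_iter_Nil(2) by blast
    show "Weq (S_iter C []) \<subseteq> Arr (S_iter C [])" by (rule weq_S_iter_Arr)
    show "fst A [] \<in> Obj C" if "A \<in> Obj (S_iter C [])" for A
      using is_diagD(3)[OF S_iter_Obj_diag[OF that] n(1)] .
    show "cpt f [] \<in> hom C (fst A []) (fst B [])" if "f \<in> hom (S_iter C []) A B" for f A B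
      using S_iter_hom_comp(1)[OF that n(1)] .
    show "cpt f [] \<in> Cofib C \<longleftrightarrow> f \<in> Cofib (S_iter C [])" if "f \<in> Arr (S_iter C [])" for f
      unfolding S_iter_Nil using that by simp
    show "cpt f [] \<in> Weq C \<longleftrightarrow> f \<in> Weq (S_iter C [])" if "f \<in> Arr (S_iter C [])" for f
      unfolding S_iter_Nil using that by simp
  qed (auto simp: S_iter_simps n const_diag_def point_map_def GO[unfolded const_diag_def] GF[unfolded const_diag_def] Gh[unfolded point_map_def const_diag_def] Weq_Arr[THEN subsetD])
qed

lemma cofib_category_S_iter: "cofib_category (S_iter C ns)"
proof (induction ns)
  case Nil
  show ?case using wcat_iso.cofib_category[OF Nil_iso] .
next
  case (Cons n ns)
  show ?case using wcat_iso.cofib_category[OF curry_iso[OF Cons]] .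
qed

lemmas exact_curry = wcat_iso.exact_F[OF curry_iso[OF cofib_category_S_iter]]
lemmas exact_uncurry = wcat_iso.exact_G[OF curry_iso[OF cofib_category_S_iter]]

text \<open>An operation on diagrams inherits exactness from the operation that it becomes after currying;
  that the result lies in \<open>S_iter\<close> is then part of the conclusion.\<close>

lemma exact_via_curry:
  assumes H: "exact_functor (S n (S_iter C ns)) (S n' (S_iter C ns')) Ho Hm"
    and o: "\<And>A. A \<in> Obj (S_iter C (n # ns)) \<Longrightarrow> is_diag (Ars (n' # ns')) C (Go A)"
      "\<And>A. A \<in> Obj (S_iter C (n # ns)) \<Longrightarrow> curry_diag n' ns' (Go A) = Ho (curry_diag n ns A)"
    and m: "\<And>f. f \<in> Arr (S_iter C (n # ns)) \<Longrightarrow> is_diag_map (Ars (n' # ns')) C (Gm f)"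
      "\<And>f. f \<in> Arr (S_iter C (n # ns)) \<Longrightarrow> fst (Gm f) = Go (fst f) \<and> snd (snd (Gm f)) = Go (snd (snd f))"
      "\<And>f. f \<in> Arr (S_iter C (n # ns)) \<Longrightarrow> curry_map n' ns' (Gm f) = Hm (curry_map n ns f)"
  shows "exact_functor (S_iter C (n # ns)) (S_iter C (n' # ns')) Go Gm"
proof (rule exact_cong[OF exact_compose[OF exact_compose[OF exact_curry H] exact_uncurry] cofib_category_S_iter weq_S_iter_Arr])
  show o': "Go A = (uncurry_diag C n' ns' \<circ> (Ho \<circ> curry_diag n ns)) A" if A: "A \<in> Obj (S_iter C (n # ns))" for A
  proof -
    have "Go A \<in> Obj (S_iter C (n' # ns'))"
      using o[OF A] exactD(1)[OF exact_compose[OF exact_curry H] A] by (simp add: S_iter_Cons)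
    then show ?thesis using uncurry_curry[of "Go A" n' ns'] o(2)[OF A] by simp
  qed
  show "Gm f = (uncurry_map C n' ns' \<circ> (Hm \<circ> curry_map n ns)) f" if f: "f \<in> Arr (S_iter C (n # ns))" for f
  proof -
    have "fst f \<in> Obj (S_iter C (n # ns))" "snd (snd f) \<in> Obj (S_iter C (n # ns))" using f unfolding S_iter_Arr by auto
    then have "Go (fst f) \<in> Obj (S_iter C (n' # ns'))" "Go (snd (snd f)) \<in> Obj (S_iter C (n' # ns'))"
      using o exactD(1)[OF exact_compose[OF exact_curry H]] by (auto simp: S_iter_Cons(1)[of _ C n' ns'])
    then have "Gm f \<in> Arr (S_iter C (n' # ns'))" unfolding S_iter_Arr using m(1,2)[OF f] by simp
    then show ?thesis
      using cat_iso.GF_m[OF wcat_iso.axioms(1)[OF curry_iso[OF cofib_category_S_iter]], of "Gm f" n' ns'] m(3)[OF f] by simp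
  qed
qed

end

section \<open>Reindexing the iterated S-construction\<close>

definition exact_pull :: "('o, 'm) wcat \<Rightarrow> nat list \<Rightarrow> nat list \<Rightarrow> ((nat \<times> nat) list \<Rightarrow> (nat \<times> nat) list) \<Rightarrow> bool"
  where
  "exact_pull C ns ns' \<phi> \<longleftrightarrow> (\<forall>xs ys. (xs, ys) \<in> Ars ns' \<longrightarrow> (\<phi> xs, \<phi> ys) \<in> Ars ns) \<and>
     exact_functor (S_iter C ns) (S_iter C ns') (pull_diag (Ars ns') \<phi>) (pull_map (Ars ns') \<phi>)"

lemma exact_pullD:
  assumes "exact_pull C ns ns' \<phi>"
  shows "(xs, ys) \<in> Ars ns' \<Longrightarrow> (\<phi> xs, \<phi> ys) \<in> Ars ns"
    "xs \<in> Field (Ars ns') \<Longrightarrow> \<phi> xs \<in> Field (Ars ns)"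
    "exact_functor (S_iter C ns) (S_iter C ns') (pull_diag (Ars ns') \<phi>) (pull_map (Ars ns') \<phi>)"
  using assms unfolding exact_pull_def preord_Field[OF preord_Ars] by auto

lemma pull_pull:
  assumes "\<And>x y. (x, y) \<in> P'' \<Longrightarrow> (\<phi>' x, \<phi>' y) \<in> P'" "preord P'" "preord P''"
  shows "pull_diag P'' \<phi>' (pull_diag P' \<phi> A) = pull_diag P'' (\<phi> \<circ> \<phi>') A"
    "pull_map P'' \<phi>' (pull_map P' \<phi> f) = pull_map P'' (\<phi> \<circ> \<phi>') f"
proof -
  have F: "x \<in> Field P'' \<Longrightarrow> \<phi>' x \<in> Field P'" for x
    using assms(1) preord_Field[OF assms(2)] preord_Field[OF assms(3)] by blast
  show *: "pull_diag P'' \<phi>' (pull_diag P' \<phi> A) = pull_diag P'' (\<phi> \<circ> \<phi>') A" for A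
    unfolding pull_diag_def using assms F by (auto intro!: restrict_ext)
  show "pull_map P'' \<phi>' (pull_map P' \<phi> f) = pull_map P'' (\<phi> \<circ> \<phi>') f"
    unfolding pull_map_def using F by (auto simp: * split_beta intro!: restrict_ext)
qed

lemma pull_cong:
  assumes "\<And>x. x \<in> Field P \<Longrightarrow> \<phi> x = \<psi> x" "preord P"
  shows "pull_diag P \<phi> A = pull_diag P \<psi> A" "pull_map P \<phi> f = pull_map P \<psi> f"
proof -
  show *: "pull_diag P \<phi> A = pull_diag P \<psi> A" for A
    unfolding pull_diag_def using assms(1) preordD(1,2)[OF assms(2)] by (auto intro!: restrict_ext)
  show "pull_map P \<phi> f = pull_map P \<psi> f"
    unfolding pull_map_def using assms(1) by (auto simp: * split_beta intro!: restrict_ext)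
qed

lemma exact_pull_cong:
  assumes "exact_pull C ns ns' \<phi>" "\<And>xs. xs \<in> Field (Ars ns') \<Longrightarrow> \<psi> xs = \<phi> xs"
  shows "exact_pull C ns ns' \<psi>"
proof -
  have "pull_diag (Ars ns') \<psi> = pull_diag (Ars ns') \<phi>" "pull_map (Ars ns') \<psi> = pull_map (Ars ns') \<phi>"
    using pull_cong[of "Ars ns'" \<psi> \<phi>] assms(2) preord_Ars by blast+
  then show ?thesis using assms preordD(1,2)[OF preord_Ars] unfolding exact_pull_def by metis
qed

lemma exact_pull_comp:
  fixes C :: "('a, 'b) wcat"
  assumes 1: "exact_pull C ns ns' \<phi>" and 2: "exact_pull C ns' ns'' \<phi>'"
  shows "exact_pull C ns ns'' (\<phi> \<circ> \<phi>')"
proof -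
  have p: "pull_diag (Ars ns'') \<phi>' (pull_diag (Ars ns') \<phi> A) = pull_diag (Ars ns'') (\<phi> \<circ> \<phi>') A"
    "pull_map (Ars ns'') \<phi>' (pull_map (Ars ns') \<phi> f) = pull_map (Ars ns'') (\<phi> \<circ> \<phi>') f"
    for A :: "('a, 'b) mdiag" and f :: "('a, 'b) mdiag_map"
    by (rule pull_pull[OF _ preord_Ars preord_Ars], rule exact_pullD(1)[OF 2], assumption)+
  have e: "pull_diag (Ars ns'') \<phi>' \<circ> pull_diag (Ars ns') \<phi> =
      (pull_diag (Ars ns'') (\<phi> \<circ> \<phi>') :: ('a, 'b) mdiag \<Rightarrow> _)"
    "pull_map (Ars ns'') \<phi>' \<circ> pull_map (Ars ns') \<phi> =
      (pull_map (Ars ns'') (\<phi> \<circ> \<phi>') :: ('a, 'b) mdiag_map \<Rightarrow> _)"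
    by (rule ext, simp only: comp_apply p)+
  show ?thesis
    using exact_compose[OF exact_pullD(3)[OF 1] exact_pullD(3)[OF 2], unfolded e]
      exact_pullD(1)[OF 1] exact_pullD(1)[OF 2]
    unfolding exact_pull_def by simp
qed

lemma curry_diag_eqI:
  assumes "\<And>x. x \<in> Field (Ar n) \<Longrightarrow> slice ns A x = fst B x"
    "\<And>x y. (x, y) \<in> Ar n \<Longrightarrow> (slice ns A x, (\<lambda>xs \<in> Field (Ars ns). snd A (x # xs, y # xs)), slice ns A y) = snd B (x, y)"
    "fst B \<in> extensional (Field (Ar n))" "snd B \<in> extensional (Ar n)"
  shows "curry_diag n ns A = B"
proof (rule prod_eqI)
  show "fst (curry_diag n ns A) = fst B"
    by (rule extensionalityI[OF _ assms(3)]) (auto simp: curry_diag_def assms(1))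
  show "snd (curry_diag n ns A) = snd B"
  proof (rule extensionalityI[OF _ assms(4)])
    fix p assume "p \<in> Ar n"
    then show "snd (curry_diag n ns A) p = snd B p"
      using assms(2)[of "fst p" "snd p"] by (simp add: curry_diag_def split_beta)
  qed (auto simp: curry_diag_def)
qed

lemma curry_map_eqI:
  assumes "curry_diag n ns (fst f) = fst g" "curry_diag n ns (snd (snd f)) = snd (snd g)"
    "\<And>x. x \<in> Field (Ar n) \<Longrightarrow> (slice ns (fst f) x, (\<lambda>xs \<in> Field (Ars ns). cpt f (x # xs)), slice ns (snd (snd f)) x) = cpt g x"
    "cpt g \<in> extensional (Field (Ar n))"
  shows "curry_map n ns f = g"
proof -
  have "cpt (curry_map n ns f) = cpt g"
    by (rule extensionalityI[OF _ assms(4)])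
      (use assms(3) in \<open>auto simp: curry_map_def split_beta\<close>)
  then show ?thesis using assms(1,2) by (simp add: prod_eq_iff curry_simps)
qed

lemma exact_id: "exact_functor D D id id"
  by (rule exactI) auto

context waldhausen_category
begin

lemma exact_pull_id: "exact_pull C ns ns id"
proof -
  have "exact_functor (S_iter C ns) (S_iter C ns) (pull_diag (Ars ns) id) (pull_map (Ars ns) id)"
  proof (rule exact_cong[OF exact_id cofib_category_S_iter weq_S_iter_Arr])
    show *: "pull_diag (Ars ns) id A = id A" if "A \<in> Obj (S_iter C ns)" for A
      by (rule diag_eqI[OF is_diag_pull[OF preord_Ars preord_Ars _ S_iter_Obj_diag[OF that]]])
        (use S_iter_Obj_diag[OF that] in \<open>auto simp: pull_simps\<close>)
    show "pull_map (Ars ns) id f = id f" if "f \<in> Arr (S_iter C ns)" for f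
      by (rule diag_map_eqI[OF is_diag_map_pull[OF preord_Ars preord_Ars, where f = f and C = C]])
        (use that in \<open>auto simp: pull_simps S_iter_Arr * [unfolded id_def] id_def\<close>)
  qed
  then show ?thesis unfolding exact_pull_def by simp
qed

text \<open>Reindexing the last directions is \<open>S n\<close> applied to an exact functor.\<close>

lemma exact_pull_tail:
  assumes \<phi>: "exact_pull C ns ns' \<phi>"
  shows "exact_pull C (n # ns) (n # ns') (\<lambda>l. hd l # \<phi> (tl l))"
proof -
  let ?\<psi> = "\<lambda>l. hd l # \<phi> (tl l)"
  let ?O = "pull_diag (Ars ns') \<phi>" and ?M = "pull_map (Ars ns') \<phi>"
  have mono: "(?\<psi> l, ?\<psi> l') \<in> Ars (n # ns)" if "(l, l') \<in> Ars (n # ns')" for l l'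
    using that by (elim Ars_ConsE) (simp add: Ars_Cons exact_pullD(1)[OF \<phi>])
  have sl: "slice ns' (pull_diag (Ars (n # ns')) ?\<psi> A) x = ?O (slice ns A x)" if x: "x \<in> Field (Ar n)" for A x
    unfolding slice_def pull_diag_def using x preordD(4)[OF preord_Ar x] exact_pullD(1,2)[OF \<phi>]
    by (auto simp: Field_Ars_Cons Ars_Cons intro!: restrict_ext)
  have cu: "curry_diag n ns' (pull_diag (Ars (n # ns')) ?\<psi> A) = S_fo n ?O ?M (curry_diag n ns A)" for A
  proof (rule curry_diag_eqI)
    show "slice ns' (pull_diag (Ars (n # ns')) ?\<psi> A) x = fst (S_fo n ?O ?M (curry_diag n ns A)) x"
      if "x \<in> Field (Ar n)" for x
      using that sl by (simp add: S_fo_simps curry_simps)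
    show "(slice ns' (pull_diag (Ars (n # ns')) ?\<psi> A) x,
         \<lambda>xs\<in>Field (Ars ns'). snd (pull_diag (Ars (n # ns')) ?\<psi> A) (x # xs, y # xs),
         slice ns' (pull_diag (Ars (n # ns')) ?\<psi> A) y) = snd (S_fo n ?O ?M (curry_diag n ns A)) (x, y)"
      if xy: "(x, y) \<in> Ar n" for x y
      using xy sl[OF preordD(1)[OF preord_Ar xy], of A] sl[OF preordD(2)[OF preord_Ar xy], of A]
        preordD(1,2)[OF preord_Ar xy] preordD(4)[OF preord_Ars] exact_pullD(2)[OF \<phi>]
      by (auto simp: S_fo_simps curry_simps pull_map_def pull_simps Ars_Cons intro!: restrict_ext)
  qed (auto simp: S_fo_def)
  have "exact_functor (S_iter C (n # ns)) (S_iter C (n # ns')) (pull_diag (Ars (n # ns')) ?\<psi>) (pull_map (Ars (n # ns')) ?\<psi>)"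
  proof (rule exact_via_curry[OF exact_S_map[OF exact_pullD(3)[OF \<phi>] cofib_category_S_iter cofib_category_S_iter]])
    show "is_diag (Ars (n # ns')) C (pull_diag (Ars (n # ns')) ?\<psi> A)" if "A \<in> Obj (S_iter C (n # ns))" for A
      by (rule is_diag_pull[OF preord_Ars preord_Ars mono S_iter_Obj_diag[OF that]])
    show "is_diag_map (Ars (n # ns')) C (pull_map (Ars (n # ns')) ?\<psi> f)" if "f \<in> Arr (S_iter C (n # ns))" for f
      by (rule is_diag_map_pull[OF preord_Ars preord_Ars mono that[unfolded S_iter_Arr, THEN conjunct1]])
    show "curry_map n ns' (pull_map (Ars (n # ns')) ?\<psi> f) = S_fm n ?O ?M (curry_map n ns f)" for f
    proof (rule curry_map_eqI)
      show "(slice ns' (fst (pull_map (Ars (n # ns')) ?\<psi> f)) x,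
          \<lambda>xs\<in>Field (Ars ns'). cpt (pull_map (Ars (n # ns')) ?\<psi> f) (x # xs),
          slice ns' (snd (snd (pull_map (Ars (n # ns')) ?\<psi> f))) x) = cpt (S_fm n ?O ?M (curry_map n ns f)) x"
        if x: "x \<in> Field (Ar n)" for x
        using x sl[OF x, of "fst f"] sl[OF x, of "snd (snd f)"] exact_pullD(2)[OF \<phi>]
        unfolding S_fm_simps(3)[OF x] curry_simps(5)[OF x]
        by (auto simp: pull_map_def split_beta Field_Ars_Cons intro!: restrict_ext)
    qed (auto simp: pull_simps S_fm_simps curry_simps cu S_fm_def)
  qed (auto simp: cu pull_simps)
  then show ?thesis unfolding exact_pull_def using mono by blast
qed

text \<open>Reindexing the first direction is a simplicial operator of the outermost S-construction.\<close>

lemma exact_pull_head: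
  assumes \<theta>: "\<theta> \<in> Delta n' n"
  shows "exact_pull C (n # ns) (n' # ns) (\<lambda>l. map_prod \<theta> \<theta> (hd l) # tl l)"
proof -
  let ?\<psi> = "\<lambda>l. map_prod \<theta> \<theta> (hd l) # tl l"
  let ?O = "pull_diag (Ar n') (map_prod \<theta> \<theta>)" and ?M = "pull_map (Ar n') (map_prod \<theta> \<theta>)"
  note dA = Delta_Ar[OF \<theta>]
  have dF: "x \<in> Field (Ar n') \<Longrightarrow> map_prod \<theta> \<theta> x \<in> Field (Ar n)" for x
    using mono_Field[OF preord_Ar preord_Ar dA] .
  have mono: "(?\<psi> l, ?\<psi> l') \<in> Ars (n # ns)" if "(l, l') \<in> Ars (n' # ns)" for l l'
    using that by (elim Ars_ConsE) (simp add: Ars_Cons dA)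
  have sl: "slice ns (pull_diag (Ars (n' # ns)) ?\<psi> A) x = slice ns A (map_prod \<theta> \<theta> x)" if x: "x \<in> Field (Ar n')" for A x
    unfolding slice_def pull_diag_def using x preordD(4)[OF preord_Ar x]
    by (auto simp: Field_Ars_Cons Ars_Cons intro!: restrict_ext)
  have cu: "curry_diag n' ns (pull_diag (Ars (n' # ns)) ?\<psi> A) = ?O (curry_diag n ns A)" for A
  proof (rule curry_diag_eqI)
    show "slice ns (pull_diag (Ars (n' # ns)) ?\<psi> A) x = fst (?O (curry_diag n ns A)) x"
      if "x \<in> Field (Ar n')" for x
      using that sl dF[OF that] by (simp add: pull_simps curry_simps)
    show "(slice ns (pull_diag (Ars (n' # ns)) ?\<psi> A) x,
         \<lambda>xs\<in>Field (Ars ns). snd (pull_diag (Ars (n' # ns)) ?\<psi> A) (x # xs, y # xs),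
         slice ns (pull_diag (Ars (n' # ns)) ?\<psi> A) y) = snd (?O (curry_diag n ns A)) (x, y)"
      if xy: "(x, y) \<in> Ar n'" for x y
      using xy sl[OF preordD(1)[OF preord_Ar xy], of A] sl[OF preordD(2)[OF preord_Ar xy], of A]
        preordD(1,2)[OF preord_Ar xy] preordD(4)[OF preord_Ars] dA[OF xy]
      by (auto simp: pull_simps curry_simps Ars_Cons intro!: restrict_ext)
  qed (auto simp: pull_diag_def)
  have "exact_functor (S_iter C (n # ns)) (S_iter C (n' # ns)) (pull_diag (Ars (n' # ns)) ?\<psi>) (pull_map (Ars (n' # ns)) ?\<psi>)"
  proof (rule exact_via_curry[OF exact_S_pull[OF cofib_category_S_iter \<theta>]])
    show "is_diag (Ars (n' # ns)) C (pull_diag (Ars (n' # ns)) ?\<psi> A)" if "A \<in> Obj (S_iter C (n # ns))" for A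
      by (rule is_diag_pull[OF preord_Ars preord_Ars mono S_iter_Obj_diag[OF that]])
    show "is_diag_map (Ars (n' # ns)) C (pull_map (Ars (n' # ns)) ?\<psi> f)" if "f \<in> Arr (S_iter C (n # ns))" for f
      by (rule is_diag_map_pull[OF preord_Ars preord_Ars mono that[unfolded S_iter_Arr, THEN conjunct1]])
    show "curry_map n' ns (pull_map (Ars (n' # ns)) ?\<psi> f) = ?M (curry_map n ns f)" for f
    proof (rule curry_map_eqI)
      show "(slice ns (fst (pull_map (Ars (n' # ns)) ?\<psi> f)) x,
          \<lambda>xs\<in>Field (Ars ns). cpt (pull_map (Ars (n' # ns)) ?\<psi> f) (x # xs),
          slice ns (snd (snd (pull_map (Ars (n' # ns)) ?\<psi> f))) x) = cpt (?M (curry_map n ns f)) x"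
        if x: "x \<in> Field (Ar n')" for x
        using x sl[OF x, of "fst f"] sl[OF x, of "snd (snd f)"] dF[OF x] by (auto simp: pull_simps curry_simps Field_Ars_Cons intro!: restrict_ext)
    qed (simp_all add: pull_simps curry_simps cu, auto simp: pull_map_def split_beta)
  qed (auto simp: cu pull_simps)
  then show ?thesis unfolding exact_pull_def using mono by blast
qed

text \<open>The first two directions are exchanged by \<open>exact_swap\<close>, after currying twice.\<close>

lemma exact_pull_swap:
  "exact_pull C (n # m # ns) (m # n # ns) (\<lambda>l. hd (tl l) # hd l # tl (tl l))"
proof -
  let ?\<psi> = "\<lambda>l :: (nat \<times> nat) list. hd (tl l) # hd l # tl (tl l)"
  let ?E = "S_iter C ns"
  interpret E: cofib_category ?E by (rule cofib_category_S_iter)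
  let ?c = "S_fo n (curry_diag m ns) (curry_map m ns)" and ?cm = "S_fm n (curry_diag m ns) (curry_map m ns)"
  let ?u = "S_fo m (uncurry_diag C n ns) (uncurry_map C n ns)" and ?um = "S_fm m (uncurry_diag C n ns) (uncurry_map C n ns)"
  have c: "exact_functor (S n (S_iter C (m # ns))) (S n (S m ?E)) ?c ?cm"
    by (rule exact_S_map[OF exact_curry cofib_category_S_iter E.cofib_category_S])
  have u: "exact_functor (S m (S n ?E)) (S m (S_iter C (n # ns))) ?u ?um"
    by (rule exact_S_map[OF exact_uncurry E.cofib_category_S cofib_category_S_iter])
  note ex = exact_compose[OF exact_compose[OF c E.exact_swap] u]
  have mono: "(?\<psi> l, ?\<psi> l') \<in> Ars (n # m # ns)" if "(l, l') \<in> Ars (m # n # ns)" for l l'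
    using that by (elim Ars_ConsE) (simp add: Ars_Cons)
  have dg: "is_diag (Ars (m # n # ns)) C (pull_diag (Ars (m # n # ns)) ?\<psi> A)" if "A \<in> Obj (S_iter C (n # m # ns))" for A
    by (rule is_diag_pull[OF preord_Ars preord_Ars mono S_iter_Obj_diag[OF that]])
  have sl2: "slice ns (slice (n # ns) (pull_diag (Ars (m # n # ns)) ?\<psi> A) y) x = slice ns (slice (m # ns) A x) y"
    if x: "x \<in> Field (Ar n)" "y \<in> Field (Ar m)" for A x y
    unfolding slice_def pull_diag_def using x preordD(4)[OF preord_Ar x(1)] preordD(4)[OF preord_Ar x(2)]
    by (auto simp: Field_Ars_Cons Ars_Cons intro!: restrict_ext)
  have cs: "curry_diag n ns (slice (n # ns) (pull_diag (Ars (m # n # ns)) ?\<psi> A) y)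
     = col n (?c (curry_diag n (m # ns) A)) y" if y: "y \<in> Field (Ar m)" for A y
  proof (rule curry_diag_eqI)
    show "slice ns (slice (n # ns) (pull_diag (Ars (m # n # ns)) ?\<psi> A) y) x = fst (col n (?c (curry_diag n (m # ns) A)) y) x"
      if "x \<in> Field (Ar n)" for x
      using that y by (simp add: swap_simps S_fo_simps curry_simps sl2)
    show "(slice ns (slice (n # ns) (pull_diag (Ars (m # n # ns)) ?\<psi> A) y) x,
       \<lambda>xs\<in>Field (Ars ns). snd (slice (n # ns) (pull_diag (Ars (m # n # ns)) ?\<psi> A) y) (x # xs, x' # xs),
       slice ns (slice (n # ns) (pull_diag (Ars (m # n # ns)) ?\<psi> A) y) x')
       = snd (col n (?c (curry_diag n (m # ns) A)) y) (x, x')" if x: "(x, x') \<in> Ar n" for x x'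
      using x y sl2[OF preordD(1)[OF preord_Ar x] y, of A] sl2[OF preordD(2)[OF preord_Ar x] y, of A]
        preordD(1,2)[OF preord_Ar x] preordD(4)[OF preord_Ar y] preordD(4)[OF preord_Ars]
      by (auto simp: swap_simps S_fo_simps curry_simps slice_simps pull_simps Ars_Cons Field_Ars_Cons intro!: restrict_ext)
  qed (auto simp: col_def)
  note exc = exact_compose[OF exact_compose[OF exact_curry c] E.exact_swap]
  have sO: "slice (n # ns) (pull_diag (Ars (m # n # ns)) ?\<psi> A) y \<in> Obj (S_iter C (n # ns))"
    if A: "A \<in> Obj (S_iter C (n # m # ns))" and y: "y \<in> Field (Ar m)" for A y
    unfolding S_iter_Cons cs[OF y]
    using is_diag_slice[OF dg[OF A] y] is_diagD(3)[OF S_ObjD(1)[OF exactD(1)[OF exc A]] y] y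
    by (simp add: swap_simps)
  have sU: "slice (n # ns) (pull_diag (Ars (m # n # ns)) ?\<psi> A) y = uncurry_diag C n ns (col n (?c (curry_diag n (m # ns) A)) y)"
    if A: "A \<in> Obj (S_iter C (n # m # ns))" and y: "y \<in> Field (Ar m)" for A y
    using uncurry_curry[OF sO[OF A y], unfolded cs[OF y]] by simp
  have cu: "curry_diag m (n # ns) (pull_diag (Ars (m # n # ns)) ?\<psi> A) = (?u \<circ> (swap_o n m \<circ> ?c)) (curry_diag n (m # ns) A)"
    if A: "A \<in> Obj (S_iter C (n # m # ns))" for A
  proof (rule curry_diag_eqI)
    show "slice (n # ns) (pull_diag (Ars (m # n # ns)) ?\<psi> A) y = fst ((?u \<circ> (swap_o n m \<circ> ?c)) (curry_diag n (m # ns) A)) y"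
      if "y \<in> Field (Ar m)" for y
      using that by (simp add: S_fo_simps swap_simps sU[OF A])
    show "(slice (n # ns) (pull_diag (Ars (m # n # ns)) ?\<psi> A) y,
       \<lambda>xs\<in>Field (Ars (n # ns)). snd (pull_diag (Ars (m # n # ns)) ?\<psi> A) (y # xs, y' # xs),
       slice (n # ns) (pull_diag (Ars (m # n # ns)) ?\<psi> A) y')
       = snd ((?u \<circ> (swap_o n m \<circ> ?c)) (curry_diag n (m # ns) A)) (y, y')" if y: "(y, y') \<in> Ar m" for y y'
    proof -
      have "(\<lambda>xs\<in>Field (Ars (n # ns)). snd (pull_diag (Ars (m # n # ns)) ?\<psi> A) (y # xs, y' # xs))
        = cpt (uncurry_map C n ns (snd (swap_o n m (?c (curry_diag n (m # ns) A))) (y, y')))"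
      proof (rule extensionalityI)
        fix l assume "l \<in> Field (Ars (n # ns))"
        then obtain x xs where l: "l = x # xs" "x \<in> Field (Ar n)" "xs \<in> Field (Ars ns)" by (rule Field_Ars_ConsE)
        show "(\<lambda>xs\<in>Field (Ars (n # ns)). snd (pull_diag (Ars (m # n # ns)) ?\<psi> A) (y # xs, y' # xs)) l
          = cpt (uncurry_map C n ns (snd (swap_o n m (?c (curry_diag n (m # ns) A))) (y, y'))) l"
          using l y preordD(4)[OF preord_Ars l(3)] preordD(4)[OF preord_Ar l(2)]
          by (simp add: uncurry_simps swap_simps S_fo_simps curry_simps slice_simps pull_simps Ars_Cons Field_Ars_Cons)
      qed (auto simp: uncurry_map_def)
      then show ?thesis using y preordD(1,2)[OF preord_Ar y] sU[OF A]
        by (simp add: S_fo_simps uncurry_map_def) (simp add: swap_simps)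
    qed
  qed (auto simp: S_fo_def)
  have "exact_functor (S_iter C (n # m # ns)) (S_iter C (m # n # ns)) (pull_diag (Ars (m # n # ns)) ?\<psi>) (pull_map (Ars (m # n # ns)) ?\<psi>)"
  proof (rule exact_via_curry[OF ex dg cu])
    show "is_diag_map (Ars (m # n # ns)) C (pull_map (Ars (m # n # ns)) ?\<psi> f)" if "f \<in> Arr (S_iter C (n # m # ns))" for f
      by (rule is_diag_map_pull[OF preord_Ars preord_Ars mono that[unfolded S_iter_Arr, THEN conjunct1]])
    show "curry_map m (n # ns) (pull_map (Ars (m # n # ns)) ?\<psi> f) = (?um \<circ> (swap_m n m \<circ> ?cm)) (curry_map n (m # ns) f)"
      if f: "f \<in> Arr (S_iter C (n # m # ns))" for f
    proof (rule curry_map_eqI)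
      have o: "fst f \<in> Obj (S_iter C (n # m # ns))" "snd (snd f) \<in> Obj (S_iter C (n # m # ns))"
        using f unfolding S_iter_Arr by auto
      show "curry_diag m (n # ns) (fst (pull_map (Ars (m # n # ns)) ?\<psi> f)) = fst ((?um \<circ> (swap_m n m \<circ> ?cm)) (curry_map n (m # ns) f))"
        "curry_diag m (n # ns) (snd (snd (pull_map (Ars (m # n # ns)) ?\<psi> f))) = snd (snd ((?um \<circ> (swap_m n m \<circ> ?cm)) (curry_map n (m # ns) f)))"
        using cu[OF o(1)] cu[OF o(2)] by (simp_all add: pull_simps S_fm_simps swap_simps curry_simps)
      fix y assume y: "y \<in> Field (Ar m)"
      have "(\<lambda>xs\<in>Field (Ars (n # ns)). cpt (pull_map (Ars (m # n # ns)) ?\<psi> f) (y # xs))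
        = cpt (uncurry_map C n ns (cpt (swap_m n m (?cm (curry_map n (m # ns) f))) y))"
      proof (rule extensionalityI)
        fix l assume "l \<in> Field (Ars (n # ns))"
        then obtain x xs where l: "l = x # xs" "x \<in> Field (Ar n)" "xs \<in> Field (Ars ns)" by (rule Field_Ars_ConsE)
        show "(\<lambda>xs\<in>Field (Ars (n # ns)). cpt (pull_map (Ars (m # n # ns)) ?\<psi> f) (y # xs)) l
          = cpt (uncurry_map C n ns (cpt (swap_m n m (?cm (curry_map n (m # ns) f))) y)) l"
          using l y by (simp add: uncurry_simps swap_simps S_fm_simps curry_simps pull_simps Field_Ars_Cons)
      qed (auto simp: uncurry_map_def)
      then show "(slice (n # ns) (fst (pull_map (Ars (m # n # ns)) ?\<psi> f)) y,
          \<lambda>xs\<in>Field (Ars (n # ns)). cpt (pull_map (Ars (m # n # ns)) ?\<psi> f) (y # xs),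
          slice (n # ns) (snd (snd (pull_map (Ars (m # n # ns)) ?\<psi> f))) y)
          = cpt ((?um \<circ> (swap_m n m \<circ> ?cm)) (curry_map n (m # ns) f)) y"
        using y sU[OF o(1) y] sU[OF o(2) y]
        by (simp add: S_fm_simps uncurry_map_def pull_simps) (simp add: swap_simps S_fm_simps curry_simps)
    qed (auto simp: S_fm_def)
  qed (auto simp: pull_simps)
  then show ?thesis unfolding exact_pull_def using mono by blast
qed

end

lemma length_Ars: "xs \<in> Field (Ars ns) \<Longrightarrow> length xs = length ns"
  unfolding preord_Field[OF preord_Ars] by (auto simp: Ars_def)

definition reindex :: "nat \<Rightarrow> (nat \<Rightarrow> nat) \<Rightarrow> 'a list \<Rightarrow> 'a list" where
  "reindex q \<pi> xs = map (\<lambda>r. xs ! \<pi> r) [0..<q]"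

lemma length_reindex [simp]: "length (reindex q \<pi> xs) = q"
  by (simp add: reindex_def)

lemma nth_reindex [simp]: "r < q \<Longrightarrow> reindex q \<pi> xs ! r = xs ! \<pi> r"
  by (simp add: reindex_def)

lemma permutes_less: "\<pi> permutes {..<q} \<Longrightarrow> r < q \<Longrightarrow> \<pi> r < q"
  using permutes_in_image[of \<pi> "{..<q}" r] by auto

lemma reindex_reindex:
  "\<rho> permutes {..<q} \<Longrightarrow> reindex q \<rho> (reindex q \<pi> xs) = reindex q (\<pi> \<circ> \<rho>) xs"
  by (rule nth_equalityI) (auto simp: permutes_less)

context waldhausen_category
begin

lemma exact_pull_op:
  assumes "\<theta> \<in> Delta m' m"
  shows "exact_pull C (replicate q m) (replicate q m') (map (map_prod \<theta> \<theta>))"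
proof (induction q)
  case 0
  show ?case unfolding replicate_0
    by (rule exact_pull_cong[OF exact_pull_id]) (auto simp: Ars_Nil)
next
  case (Suc q)
  show ?case unfolding replicate_Suc
    by (rule exact_pull_cong[OF exact_pull_comp[OF exact_pull_head[OF assms] exact_pull_tail[OF Suc]]])
      (elim Field_Ars_ConsE, simp)
qed

text \<open>The transposition \<open>(0 1)\<close> is \<open>exact_pull_swap\<close>, transpositions not moving 0 come from one
  direction less, and \<open>(0 b)\<close> is the conjugate of \<open>(1 b)\<close> by \<open>(0 1)\<close>.\<close>

lemma exact_pull_transpose:
  "a < q \<Longrightarrow> b < q \<Longrightarrow> exact_pull C (replicate q m) (replicate q m) (reindex q (Transposition.transpose a b))"
proof (induction q arbitrary: a b)
  case 0
  then show ?case by simp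
next
  case (Suc q)
  let ?R = "replicate (Suc q) m"
  have id: "exact_pull C ?R ?R (reindex (Suc q) id)"
    by (rule exact_pull_cong[OF exact_pull_id]) (auto dest!: length_Ars intro!: nth_equalityI)
  have tail: "exact_pull C ?R ?R (reindex (Suc q) (Transposition.transpose (Suc a) (Suc b)))" if "a < q" "b < q" for a b
    unfolding replicate_Suc
  proof (rule exact_pull_cong[OF exact_pull_tail[OF Suc.IH[OF that]]], elim Field_Ars_ConsE)
    fix xs x ys assume xs: "xs = x # ys" "ys \<in> Field (Ars (replicate q m))"
    have l: "length ys = q" using length_Ars[OF xs(2)] by simp
    have "Transposition.transpose (Suc a) (Suc b) (Suc i) = Suc (Transposition.transpose a b i)" for i
      by (simp add: Transposition.transpose_def)
    then show "reindex (Suc q) (Transposition.transpose (Suc a) (Suc b)) xs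
      = hd xs # reindex q (Transposition.transpose a b) (tl xs)"
      unfolding xs(1) by (intro nth_equalityI) (auto simp: nth_Cons' Transposition.transpose_def less_Suc_eq_0_disj)
  qed
  have comp: "exact_pull C ?R ?R (reindex (Suc q) (\<pi> \<circ> \<rho>))"
    if "exact_pull C ?R ?R (reindex (Suc q) \<pi>)" "exact_pull C ?R ?R (reindex (Suc q) \<rho>)" "\<rho> permutes {..<Suc q}" for \<pi> \<rho>
    by (rule exact_pull_cong[OF exact_pull_comp[OF that(2,1)]]) (simp add: reindex_reindex[OF that(3)])
  have lt: "exact_pull C ?R ?R (reindex (Suc q) (Transposition.transpose a b))" if ab: "a < b" "b < Suc q" for a b
  proof (cases a)
    case (Suc a')
    then obtain b' where "b = Suc b'" using ab by (cases b) auto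
    then show ?thesis using tail[of a' b'] Suc ab by simp
  next
    case 0
    then obtain q' where q: "q = Suc q'" using ab by (cases q) auto
    have 01: "exact_pull C ?R ?R (reindex (Suc q) (Transposition.transpose 0 1))"
      unfolding q replicate_Suc
      by (rule exact_pull_cong[OF exact_pull_swap])
        (elim Field_Ars_ConsE, auto dest!: length_Ars intro!: nth_equalityI
          simp: nth_Cons' Transposition.transpose_def)
    show ?thesis
    proof (cases "b = 1")
      case True
      then show ?thesis using 01 0 by simp
    next
      case False
      then obtain b' where b: "b = Suc b'" "b' < q" using ab 0 by (cases b) auto
      have p: "Transposition.transpose 0 1 permutes {..<Suc q}" "Transposition.transpose 1 b permutes {..<Suc q}"
        using ab q by (auto intro!: permutes_swap_id)
      have "exact_pull C ?R ?R (reindex (Suc q) (Transposition.transpose 1 b))"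
        using tail[of 0 b'] b q by simp
      then have "exact_pull C ?R ?R (reindex (Suc q)
        (Transposition.transpose 0 1 \<circ> Transposition.transpose 1 b \<circ> Transposition.transpose 0 1))"
        by (intro comp 01 p) auto
      then show ?thesis using transpose_comp_triple[of 0 b 1] False 0 b by simp
    qed
  qed
  consider "a = b" | "a < b" | "b < a" by linarith
  then show ?case
    using id lt[of a b] lt[of b a] Suc.prems by cases (auto simp: transpose_commute[of a b] id_def)
qed

lemma exact_pull_perm:
  assumes "\<pi> permutes {..<q}"
  shows "exact_pull C (replicate q m) (replicate q m) (reindex q \<pi>)"
  using assms finite_lessThan
proof (induction rule: permutes_induct)
  case id
  show ?case by (rule exact_pull_cong[OF exact_pull_id]) (auto dest!: length_Ars intro!: nth_equalityI)
next
  case (swap a b p)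
  show ?case
    by (rule exact_pull_cong[OF exact_pull_comp[OF swap.IH exact_pull_transpose[of a q b]]])
      (use swap in \<open>auto simp: reindex_reindex comp_def\<close>)
qed

end

section \<open>Extension by zero in a new direction\<close>

context cofib_category
begin

lemma the_Zero:
  "a \<in> Obj D \<Longrightarrow> (THE f. f \<in> hom D (Zero D) a) \<in> hom D (Zero D) a"
  "a \<in> Obj D \<Longrightarrow> (THE f. f \<in> hom D a (Zero D)) \<in> hom D a (Zero D)"
  using theI'[OF Zero_initial] theI'[OF Zero_terminal] by auto

lemma zero_arr_hom: "a \<in> Obj D \<Longrightarrow> b \<in> Obj D \<Longrightarrow> zero_arr D a b \<in> hom D a b"
  unfolding zero_arr_def using the_Zero Comp_hom by blast

lemma zero_arr_comp:
  assumes "a \<in> Obj D"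
  shows "f \<in> hom D b c \<Longrightarrow> f \<odot> zero_arr D a b = zero_arr D a c"
    "f \<in> hom D b c \<Longrightarrow> zero_arr D c a \<odot> f = zero_arr D b a"
proof -
  assume f: "f \<in> hom D b c"
  note b = homD(4)[OF f] and c = homD(5)[OF f]
  have "f \<odot> (THE g. g \<in> hom D (Zero D) b) = (THE g. g \<in> hom D (Zero D) c)"
    using hom_from_Zero_eq Comp_hom[OF the_Zero(1)[OF b] f] the_Zero(1)[OF c] by blast
  then show "f \<odot> zero_arr D a b = zero_arr D a c"
    unfolding zero_arr_def using Comp_assoc[OF the_Zero(2)[OF assms] the_Zero(1)[OF b] f] by simp
  have "(THE g. g \<in> hom D c (Zero D)) \<odot> f = (THE g. g \<in> hom D b (Zero D))"
    using hom_to_Zero_eq Comp_hom[OF f the_Zero(2)[OF c]] the_Zero(2)[OF b] by blast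
  then show "zero_arr D c a \<odot> f = zero_arr D b a"
    unfolding zero_arr_def using Comp_assoc[OF f the_Zero(2)[OF c] the_Zero(1)[OF assms]] by simp
qed

lemma zero_arr_Zero:
  "f \<in> hom D (Zero D) a \<Longrightarrow> zero_arr D (Zero D) a = f" "f \<in> hom D a (Zero D) \<Longrightarrow> zero_arr D a (Zero D) = f"
  using hom_from_Zero_eq hom_to_Zero_eq zero_arr_hom Zero_Obj homD(4,5) by metis+

lemma zero_arr_Zero_Zero: "zero_arr D (Zero D) (Zero D) = Ident D (Zero D)"
  using zero_arr_Zero Ident_hom Zero_Obj by blast

end

text \<open>Extension by zero in a single direction: \<open>a\<close> on the intervals that contain the jump of \<open>\<delta>\<close> and zero
  elsewhere.\<close>

definition jump_obj :: "('o, 'm) wcat \<Rightarrow> (nat \<Rightarrow> nat) \<Rightarrow> 'o \<Rightarrow> nat \<times> nat \<Rightarrow> 'o" where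
  "jump_obj D \<delta> a x = (if jumps \<delta> x then a else Zero D)"

definition jump_diag :: "('o, 'm) wcat \<Rightarrow> nat \<Rightarrow> (nat \<Rightarrow> nat) \<Rightarrow> 'o \<Rightarrow> (nat \<times> nat, 'o, 'm) diag" where
  "jump_diag D m \<delta> a = ((\<lambda>x \<in> Field (Ar m). jump_obj D \<delta> a x),
     (\<lambda>(x, y) \<in> Ar m. if jumps \<delta> x \<and> jumps \<delta> y then Ident D a else zero_arr D (jump_obj D \<delta> a x) (jump_obj D \<delta> a y)))"

definition jump_map :: "('o, 'm) wcat \<Rightarrow> nat \<Rightarrow> (nat \<Rightarrow> nat) \<Rightarrow> 'm \<Rightarrow> (nat \<times> nat, 'o, 'm) diag_map" where
  "jump_map D m \<delta> f = (jump_diag D m \<delta> (Dom D f), (\<lambda>x \<in> Field (Ar m). if jumps \<delta> x then f else Ident D (Zero D)), jump_diag D m \<delta> (Cod D f))"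

lemma jump_simps:
  "x \<in> Field (Ar m) \<Longrightarrow> fst (jump_diag D m \<delta> a) x = jump_obj D \<delta> a x"
  "(x, y) \<in> Ar m \<Longrightarrow> snd (jump_diag D m \<delta> a) (x, y) =
     (if jumps \<delta> x \<and> jumps \<delta> y then Ident D a else zero_arr D (jump_obj D \<delta> a x) (jump_obj D \<delta> a y))"
  "x \<in> Field (Ar m) \<Longrightarrow> cpt (jump_map D m \<delta> f) x = (if jumps \<delta> x then f else Ident D (Zero D))"
  "fst (jump_map D m \<delta> f) = jump_diag D m \<delta> (Dom D f)" "snd (snd (jump_map D m \<delta> f)) = jump_diag D m \<delta> (Cod D f)"
  by (auto simp: jump_diag_def jump_map_def)

text \<open>This makes extension by zero functorial: a composite between two nonzero values does not pass
  through zero.\<close>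

lemma jumps_convex:
  assumes \<delta>: "\<delta> \<in> Delta m 1" and xy: "(x, y) \<in> Ar m" "(y, z) \<in> Ar m" and j: "jumps \<delta> x" "jumps \<delta> z"
  shows "jumps \<delta> y"
proof -
  obtain i i' j j' k k' where x: "x = (i, i')" "y = (j, j')" "z = (k, k')" by (cases x, cases y, cases z)
  have "\<delta> j \<le> \<delta> k" "\<delta> i' \<le> \<delta> j'" "\<delta> j' \<le> 1"
    using xy Delta_mono[OF \<delta>] Delta_le[OF \<delta>] unfolding x Ar_iff by auto
  then show ?thesis using j unfolding x jumps_def by simp
qed

context cofib_category
begin

lemma jump_obj_Obj: "a \<in> Obj D \<Longrightarrow> jump_obj D \<delta> a x \<in> Obj D"
  by (simp add: jump_obj_def Zero_Obj)

lemma jump_diag_Obj: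
  assumes \<delta>: "\<delta> \<in> Delta m 1" and a: "a \<in> Obj D"
  shows "jump_diag D m \<delta> a \<in> Obj (S m D)"
proof (rule S_ObjI)
  let ?A = "jump_diag D m \<delta> a"
  have ar: "snd ?A (x, y) \<in> hom D (jump_obj D \<delta> a x) (jump_obj D \<delta> a y)" if "(x, y) \<in> Ar m" for x y
    using that zero_arr_hom[OF jump_obj_Obj[OF a] jump_obj_Obj[OF a]] Ident_hom[OF a] by (simp add: jump_simps) (auto simp: jump_obj_def)
  show "is_diag (Ar m) D ?A"
  proof (rule is_diagI)
    show "fst ?A \<in> extensional (Field (Ar m))" "snd ?A \<in> extensional (Ar m)" by (auto simp: jump_diag_def)
    show "fst ?A x \<in> Obj D" if "x \<in> Field (Ar m)" for x
      using that jump_obj_Obj[OF a] by (simp add: jump_simps)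
    show "snd ?A (x, y) \<in> hom D (fst ?A x) (fst ?A y)" if "(x, y) \<in> Ar m" for x y
      using ar[OF that] preordD(1,2)[OF preord_Ar that] by (simp add: jump_simps)
    show "snd ?A (x, x) = Ident D (fst ?A x)" if "x \<in> Field (Ar m)" for x
      using that preordD(4)[OF preord_Ar that] by (simp add: jump_simps jump_obj_def zero_arr_Zero_Zero)
    show "snd ?A (y, z) \<odot> snd ?A (x, y) = snd ?A (x, z)" if xy: "(x, y) \<in> Ar m" and yz: "(y, z) \<in> Ar m" for x y z
    proof (cases "jumps \<delta> x \<and> jumps \<delta> z")
      case True
      then show ?thesis
        using jumps_convex[OF \<delta> xy yz] xy yz preordD(3)[OF preord_Ar xy yz] Ident_hom[OF a]
        by (simp add: jump_simps Comp_Ident_left)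
    next
      case False
      then have "snd ?A (x, z) = zero_arr D (jump_obj D \<delta> a x) (jump_obj D \<delta> a z)"
        "snd ?A (x, y) = zero_arr D (jump_obj D \<delta> a x) (jump_obj D \<delta> a y) \<or> snd ?A (y, z) = zero_arr D (jump_obj D \<delta> a y) (jump_obj D \<delta> a z)"
        using xy yz preordD(3)[OF preord_Ar xy yz] by (auto simp: jump_simps)
      then show ?thesis using zero_arr_comp(1)[OF jump_obj_Obj[OF a] ar[OF yz]] zero_arr_comp(2)[OF jump_obj_Obj[OF a] ar[OF xy]] by metis
    qed
  qed
  show "fst ?A (i, i) = Zero D" if "i \<le> m" for i
    using that by (auto simp: jump_simps Field_Ar jump_obj_def jumps_def)
  fix i j k assume ijk: "i \<le> j" "j \<le> k" "k \<le> m"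
  have d: "\<delta> i \<le> \<delta> j" "\<delta> j \<le> \<delta> k" "\<delta> k \<le> 1"
    using ijk Delta_mono[OF \<delta>] Delta_le[OF \<delta>] by auto
  note h = ar[of "(i, j)" "(i, k)", unfolded Ar_iff] ar[of "(i, j)" "(j, j)", unfolded Ar_iff]
    ar[of "(i, k)" "(j, k)", unfolded Ar_iff] ar[of "(j, j)" "(j, k)", unfolded Ar_iff]
  have z: "Ident D (Zero D) \<in> hom D (Zero D) (Zero D)" using Ident_hom Zero_Obj by simp
  have za: "zero_arr D (Zero D) a \<in> hom D (Zero D) a" "zero_arr D a (Zero D) \<in> hom D a (Zero D)"
    using zero_arr_hom a Zero_Obj by auto
  show "snd ?A ((i, j), (i, k)) \<in> Cofib D"
    using ijk d za a Cofib_Zero[OF a za(1)] Cofib_Ident[OF a] Cofib_Ident[OF Zero_Obj]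
    by (auto simp: jump_simps Ar_iff jump_obj_def jumps_def zero_arr_Zero_Zero)
  \<comment> \<open>the jump lies between \<open>i\<close> and \<open>j\<close>, between \<open>j\<close> and \<open>k\<close>, or outside\<close>
  consider "\<delta> i = 0" "\<delta> j = 1" "\<delta> k = 1" | "\<delta> i = 0" "\<delta> j = 0" "\<delta> k = 1" | "\<delta> i = \<delta> k" "\<delta> j = \<delta> k"
    using d by linarith
  then show "is_pushout D (snd ?A ((i, j), (i, k))) (snd ?A ((i, j), (j, j))) (snd ?A ((i, k), (j, k))) (snd ?A ((j, j), (j, k)))"
    using ijk pushout_Ident[OF za(2)] pushout_sym[OF pushout_Ident[OF za(1)]] pushout_Ident[OF z]
    by cases (auto simp: jump_simps Ar_iff jump_obj_def jumps_def zero_arr_Zero_Zero)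
qed

text \<open>In each corner condition either the diagrams are constant, or they start at zero and the corner map
  is a component.\<close>

lemma exact_jump:
  assumes \<delta>: "\<delta> \<in> Delta m 1" and W: "Weq D \<subseteq> Arr D" "Ident D (Zero D) \<in> Weq D"
  shows "exact_functor D (S m D) (jump_diag D m \<delta>) (jump_map D m \<delta>)"
proof -
  interpret SD: cofib_category "S m D" by (rule cofib_category_S)
  note obj = jump_diag_Obj[OF \<delta>]
  have z: "Ident D (Zero D) \<in> hom D (Zero D) (Zero D)" using Ident_hom Zero_Obj by simp
  have ar: "snd (jump_diag D m \<delta> a) (x, y) \<in> hom D (jump_obj D \<delta> a x) (jump_obj D \<delta> a y)"
    if "a \<in> Obj D" "(x, y) \<in> Ar m" for a x y
    using is_diagD(4)[OF S_ObjD(1)[OF obj[OF that(1)]] that(2)] preordD(1,2)[OF preord_Ar that(2)] by (simp add: jump_simps)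
  have hm: "jump_map D m \<delta> f \<in> hom (S m D) (jump_diag D m \<delta> a) (jump_diag D m \<delta> b)" if f: "f \<in> hom D a b" for f a b
  proof -
    note o = homD(4,5)[OF f]
    have th: "(if jumps \<delta> x then f else Ident D (Zero D)) \<in> hom D (jump_obj D \<delta> a x) (jump_obj D \<delta> b x)" for x
      using f z by (simp add: jump_obj_def)
    have "(jump_diag D m \<delta> a, (\<lambda>x \<in> Field (Ar m). if jumps \<delta> x then f else Ident D (Zero D)), jump_diag D m \<delta> b)
      \<in> hom (S m D) (jump_diag D m \<delta> a) (jump_diag D m \<delta> b)"
    proof (rule S_homI[OF obj[OF o(1)] obj[OF o(2)]])
      show "(if jumps \<delta> x then f else Ident D (Zero D)) \<in> hom D (fst (jump_diag D m \<delta> a) x) (fst (jump_diag D m \<delta> b) x)"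
        if "x \<in> Field (Ar m)" for x using th that by (simp add: jump_simps)
      fix x y assume xy: "(x, y) \<in> Ar m"
      show "(if jumps \<delta> y then f else Ident D (Zero D)) \<odot> snd (jump_diag D m \<delta> a) (x, y)
         = snd (jump_diag D m \<delta> b) (x, y) \<odot> (if jumps \<delta> x then f else Ident D (Zero D))"
      proof (cases "jumps \<delta> x \<and> jumps \<delta> y")
        case True
        then show ?thesis using f xy by (simp add: jump_simps Comp_Ident_left Comp_Ident_right)
      next
        case False
        then show ?thesis
          using zero_arr_comp(1)[OF jump_obj_Obj[OF o(1)] th] zero_arr_comp(2)[OF jump_obj_Obj[OF o(2)] th] xy
          by (simp only: jump_simps if_False)
      qed
    qed
    then show ?thesis using homD[OF f] by (simp add: jump_map_def)
  qed
  have cof: "jump_map D m \<delta> f \<in> Cofib (S m D)" if c: "f \<in> Cofib D" for f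
  proof -
    obtain a b where f: "f \<in> hom D a b" using c Cofib_Arr Arr_hom by blast
    note o = homD(4,5)[OF f]
    have "cofsq D (snd (jump_diag D m \<delta> a) ((0, j), (0, k))) (cpt (jump_map D m \<delta> f) (0, j)) (cpt (jump_map D m \<delta> f) (0, k))
        (snd (jump_diag D m \<delta> b) ((0, j), (0, k)))" if jk: "j \<le> k" "k \<le> m" for j k
    proof -
      have J: "jumps \<delta> (0, k)" if "jumps \<delta> (0, j)"
        using Delta_mono[OF \<delta> jk] Delta_le[OF \<delta> jk(2)] that by (auto simp: jumps_def)
      have F: "(0, j) \<in> Field (Ar m)" "(0, k) \<in> Field (Ar m)" "((0, j), (0, k)) \<in> Ar m" using jk by (auto simp: Field_Ar Ar_iff)
      note h = S_hom_comp[OF hm[OF f]]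
      show ?thesis
      proof (cases "jumps \<delta> (0, j)")
        case True
        then show ?thesis using J cofsq_pushout[OF pushout_Ident[OF f]] F by (simp add: jump_simps)
      next
        case False
        let ?g = "cpt (jump_map D m \<delta> f) (0, k)"
        have g: "?g \<in> hom D (jump_obj D \<delta> a (0, k)) (jump_obj D \<delta> b (0, k))" "?g \<in> Cofib D"
          using h(1)[OF F(2)] F c Cofib_Ident[OF Zero_Obj] by (auto simp: jump_simps)
        have s: "snd (jump_diag D m \<delta> a) ((0, j), (0, k)) \<in> hom D (Zero D) (jump_obj D \<delta> a (0, k))"
          "snd (jump_diag D m \<delta> b) ((0, j), (0, k)) \<in> hom D (Zero D) (jump_obj D \<delta> b (0, k))"
          using ar[OF o(1) F(3)] ar[OF o(2) F(3)] False by (simp_all add: jump_obj_def)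
        have "cofsq D (Ident D (Zero D)) (snd (jump_diag D m \<delta> a) ((0, j), (0, k))) (snd (jump_diag D m \<delta> b) ((0, j), (0, k))) ?g"
          by (rule cofsqI[OF pushout_Ident[OF s(1)] s(1) g(1) g(1)
                hom_from_Zero_eq[OF Comp_hom[OF s(1) g(1)] s(2)] Comp_Ident_right[OF g(1)] g(2)])
        then show ?thesis using cofsq_sym False F by (simp add: jump_simps)
      qed
    qed
    then show ?thesis using hm[OF f] homD[OF f] unfolding S_Cofib by (auto simp: hom_def jump_simps(4,5))
  qed
  show ?thesis
  proof (rule exactI[OF obj hm _ _ _ cof])
    show "jump_map D m \<delta> (Ident D a) = Ident (S m D) (jump_diag D m \<delta> a)" if a: "a \<in> Obj D" for a
      by (rule S_hom_eqI[OF hm[OF Ident_hom[OF a]] SD.Ident_hom[OF obj[OF a]]])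
        (simp add: jump_simps S_Ident jump_obj_def)
    show "jump_map D m \<delta> (g \<odot> f) = Comp (S m D) (jump_map D m \<delta> g) (jump_map D m \<delta> f)"
      if f: "f \<in> hom D a b" and g: "g \<in> hom D b c" for f g a b c
      by (rule S_hom_eqI[OF hm[OF Comp_hom[OF f g]] SD.Comp_hom[OF hm[OF f] hm[OF g]]])
        (simp add: jump_simps S_Comp Comp_Ident_left[OF z])
    show "jump_diag D m \<delta> (Zero D) = Zero (S m D)"
      by (rule diag_eqI[OF S_ObjD(1)[OF obj[OF Zero_Obj]] S_ObjD(1)[OF SD.Zero_Obj]])
        (auto simp: jump_simps S_Zero const_diag_def jump_obj_def zero_arr_Zero_Zero)
    show "jump_map D m \<delta> f \<in> Weq (S m D)" if w: "f \<in> Weq D" for f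
    proof -
      obtain a b where f: "f \<in> hom D a b" using w W(1) Arr_hom by blast
      show ?thesis using hm[OF f] w W(2) unfolding S_Weq by (auto simp: hom_def jump_simps)
    qed
    show "is_pushout (S m D) (jump_map D m \<delta> f) (jump_map D m \<delta> g) (jump_map D m \<delta> u) (jump_map D m \<delta> v)"
      if p: "is_pushout D f g u v" for f g u v
    proof -
      obtain a b c d where h: "f \<in> hom D a b" "g \<in> hom D a c" "u \<in> hom D b d" "v \<in> hom D c d"
        using p by (rule pushout_hom)
      show ?thesis
        by (rule S_pushoutI[OF cofib_category_axioms hm[OF h(1)] hm[OF h(2)] hm[OF h(3)] hm[OF h(4)]])
          (use p pushout_Ident[OF z] in \<open>simp add: jump_simps\<close>)
    qed
  qed
qed

end

lemma Ars_snoc: "(xs @ [x], ys @ [y]) \<in> Ars (ns @ [n]) \<longleftrightarrow> (xs, ys) \<in> Ars ns \<and> (x, y) \<in> Ar n"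
  unfolding Ars_def by (auto simp: nth_append less_Suc_eq)

lemma Ars_last:
  assumes "(l, l') \<in> Ars (replicate (Suc q) m)"
  shows "(butlast l, butlast l') \<in> Ars (replicate q m)" "(last l, last l') \<in> Ar m" "l \<noteq> []" "l' \<noteq> []"
proof -
  have n: "l \<noteq> []" "l' \<noteq> []" using assms by (auto simp: Ars_def)
  have r: "replicate (Suc q) m = replicate q m @ [m]" by (simp add: replicate_append_same)
  show "(butlast l, butlast l') \<in> Ars (replicate q m)" "(last l, last l') \<in> Ar m"
    using assms Ars_snoc[of "butlast l" "last l" "butlast l'" "last l'" "replicate q m" m] n unfolding r by simp_all
  show "l \<noteq> []" "l' \<noteq> []" by (fact n)+
qed

lemma Field_last:
  assumes "l \<in> Field (Ars (replicate (Suc q) m))"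
  shows "butlast l \<in> Field (Ars (replicate q m))" "last l \<in> Field (Ar m)" "l \<noteq> []"
  using assms Ars_last unfolding preord_Field[OF preord_Ars] preord_Field[OF preord_Ar] by blast+

(* New directions are added at the end of the list, but replicate_Suc unfolds at its head. *)
declare replicate_Suc [simp del]

lemma extend_simps:
  "l \<in> Field (Ars (replicate (Suc q) m)) \<Longrightarrow> fst (extend_diag C q m \<delta> A) l = extend_obj C \<delta> A l"
  "(l, l') \<in> Ars (replicate (Suc q) m) \<Longrightarrow> snd (extend_diag C q m \<delta> A) (l, l') =
    (if jumps \<delta> (last l) \<and> jumps \<delta> (last l') then snd A (butlast l, butlast l')
     else zero_arr C (extend_obj C \<delta> A l) (extend_obj C \<delta> A l'))"
  "fst (extend_map C q m \<delta> f) = extend_diag C q m \<delta> (fst f)"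
  "snd (snd (extend_map C q m \<delta> f)) = extend_diag C q m \<delta> (snd (snd f))"
  "l \<in> Field (Ars (replicate (Suc q) m)) \<Longrightarrow> cpt (extend_map C q m \<delta> f) l =
    (if jumps \<delta> (last l) then cpt f (butlast l) else Ident C (Zero C))"
  by (auto simp: extend_diag_def extend_map_def split: prod.splits)

context cofib_category
begin

lemma is_diag_extend:
  assumes \<delta>: "\<delta> \<in> Delta m 1" and A: "is_diag (Ars (replicate q m)) D A"
  shows "is_diag (Ars (replicate (Suc q) m)) D (extend_diag D q m \<delta> A)"
    "l \<in> Field (Ars (replicate (Suc q) m)) \<Longrightarrow> extend_obj D \<delta> A l \<in> Obj D"
    "(l, l') \<in> Ars (replicate (Suc q) m) \<Longrightarrow>
       snd (extend_diag D q m \<delta> A) (l, l') \<in> hom D (extend_obj D \<delta> A l) (extend_obj D \<delta> A l')"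
proof -
  let ?P = "Ars (replicate (Suc q) m)" and ?B = "extend_diag D q m \<delta> A"
  have o: "extend_obj D \<delta> A l \<in> Obj D" if "l \<in> Field ?P" for l
    using is_diagD(3)[OF A Field_last(1)[OF that]] Zero_Obj by (simp add: extend_obj_def)
  have ar: "snd ?B (l, l') \<in> hom D (extend_obj D \<delta> A l) (extend_obj D \<delta> A l')" if l: "(l, l') \<in> ?P" for l l'
    using is_diagD(4)[OF A Ars_last(1)[OF l]] zero_arr_hom[OF o[OF preordD(1)[OF preord_Ars l]] o[OF preordD(2)[OF preord_Ars l]]]
    by (simp add: extend_simps(2)[OF l]) (simp add: extend_obj_def)
  show "l \<in> Field ?P \<Longrightarrow> extend_obj D \<delta> A l \<in> Obj D" by (rule o)
  show "(l, l') \<in> ?P \<Longrightarrow> snd ?B (l, l') \<in> hom D (extend_obj D \<delta> A l) (extend_obj D \<delta> A l')" by (rule ar)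
  show "is_diag ?P D ?B"
  proof (rule is_diagI)
    show "fst ?B \<in> extensional (Field ?P)" "snd ?B \<in> extensional ?P" by (auto simp: extend_diag_def)
    show "fst ?B l \<in> Obj D" if "l \<in> Field ?P" for l using o[OF that] by (simp add: extend_simps(1)[OF that])
    show "snd ?B (l, l') \<in> hom D (fst ?B l) (fst ?B l')" if "(l, l') \<in> ?P" for l l'
      using ar[OF that]
      by (simp add: extend_simps(1)[OF preordD(1)[OF preord_Ars that]] extend_simps(1)[OF preordD(2)[OF preord_Ars that]])
    show "snd ?B (l, l) = Ident D (fst ?B l)" if l: "l \<in> Field ?P" for l
      using is_diagD(5)[OF A Field_last(1)[OF l]]
      by (simp add: extend_simps(2)[OF preordD(4)[OF preord_Ars l]] extend_simps(1)[OF l] extend_obj_def zero_arr_Zero_Zero)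
    show "snd ?B (l', l'') \<odot> snd ?B (l, l') = snd ?B (l, l'')" if l: "(l, l') \<in> ?P" and l': "(l', l'') \<in> ?P" for l l' l''
    proof -
      note l'' = preordD(3)[OF preord_Ars l l']
      note F = preordD(1,2)[OF preord_Ars l] preordD(2)[OF preord_Ars l']
      show ?thesis
      proof (cases "jumps \<delta> (last l) \<and> jumps \<delta> (last l'')")
        case True
        then show ?thesis
          using jumps_convex[OF \<delta> Ars_last(2)[OF l] Ars_last(2)[OF l']] is_diagD(6)[OF A Ars_last(1)[OF l] Ars_last(1)[OF l']]
          by (simp add: extend_simps(2)[OF l] extend_simps(2)[OF l'] extend_simps(2)[OF l''])
      next
        case False
        then have "snd ?B (l, l'') = zero_arr D (extend_obj D \<delta> A l) (extend_obj D \<delta> A l'')"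
          "snd ?B (l, l') = zero_arr D (extend_obj D \<delta> A l) (extend_obj D \<delta> A l') \<or>
           snd ?B (l', l'') = zero_arr D (extend_obj D \<delta> A l') (extend_obj D \<delta> A l'')"
          by (auto simp: extend_simps(2)[OF l] extend_simps(2)[OF l'] extend_simps(2)[OF l''])
        then show ?thesis
          using zero_arr_comp(1)[OF o[OF F(1)] ar[OF l']] zero_arr_comp(2)[OF o[OF F(3)] ar[OF l]] by metis
      qed
    qed
  qed
qed

lemma is_diag_map_extend:
  assumes \<delta>: "\<delta> \<in> Delta m 1" and f: "is_diag_map (Ars (replicate q m)) D f"
  shows "is_diag_map (Ars (replicate (Suc q) m)) D (extend_map D q m \<delta> f)"
proof -
  let ?P = "Ars (replicate (Suc q) m)"
  let ?t = "\<lambda>l. if jumps \<delta> (last l) then cpt f (butlast l) else Ident D (Zero D)"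
  let ?A = "extend_diag D q m \<delta> (fst f)" and ?B = "extend_diag D q m \<delta> (snd (snd f))"
  note d = is_diag_mapD(1,2)[OF f]
  note eA = is_diag_extend[OF \<delta> d(1)] and eB = is_diag_extend[OF \<delta> d(2)]
  have th: "?t l \<in> hom D (extend_obj D \<delta> (fst f) l) (extend_obj D \<delta> (snd (snd f)) l)" if l: "l \<in> Field ?P" for l
    using is_diag_mapD(4)[OF f Field_last(1)[OF l]] Ident_hom[OF Zero_Obj] by (simp add: extend_obj_def)
  have "is_diag_map ?P D (?A, restrict ?t (Field ?P), ?B)"
  proof (rule is_diag_mapI[OF eA(1) eB(1)])
    show "restrict ?t (Field ?P) l \<in> hom D (fst ?A l) (fst ?B l)" if l: "l \<in> Field ?P" for l
      using th[OF l] by (simp only: restrict_apply'[OF l] extend_simps(1)[OF l])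
    fix l l' assume l: "(l, l') \<in> ?P"
    note F = preordD(1,2)[OF preord_Ars l]
    have "?t l' \<odot> snd ?A (l, l') = snd ?B (l, l') \<odot> ?t l"
    proof (cases "jumps \<delta> (last l) \<and> jumps \<delta> (last l')")
      case True
      then show ?thesis using is_diag_mapD(5)[OF f Ars_last(1)[OF l]] by (simp add: extend_simps(2)[OF l])
    next
      case False
      then have "snd ?A (l, l') = zero_arr D (extend_obj D \<delta> (fst f) l) (extend_obj D \<delta> (fst f) l')"
        "snd ?B (l, l') = zero_arr D (extend_obj D \<delta> (snd (snd f)) l) (extend_obj D \<delta> (snd (snd f)) l')"
        by (auto simp: extend_simps(2)[OF l])
      then show ?thesis
        using zero_arr_comp(1)[OF eA(2)[OF F(1)] th[OF F(2)]] zero_arr_comp(2)[OF eB(2)[OF F(2)] th[OF F(1)]]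
        by simp
    qed
    then show "restrict ?t (Field ?P) l' \<odot> snd ?A (l, l') = snd ?B (l, l') \<odot> restrict ?t (Field ?P) l"
      using F by simp
  qed auto
  then show ?thesis by (simp add: extend_map_def split_beta)
qed

end

context waldhausen_category
begin

text \<open>Without other directions, the objects of \<open>C\<close> and the diagrams on the one-point poset have to be
  identified.\<close>

lemma exact_extend_0:
  assumes \<delta>: "\<delta> \<in> Delta m 1"
  shows "exact_functor (S_iter C []) (S_iter C [m]) (extend_diag C 0 m \<delta>) (extend_map C 0 m \<delta>)"
proof -
  let ?k = "const_diag (Ars []) C"
  have n: "[] \<in> Field (Ars [])" "([], []) \<in> Ars []" by (auto simp: Ars_Nil)
  have E: "exact_functor C (S m C) (jump_diag C m \<delta>) (jump_map C m \<delta>)"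
    using exact_jump[OF \<delta>] Weq_Arr Weq_iso Ident_iso Zero_Obj by blast
  have K: "exact_functor (S m C) (S m (S_iter C [])) (S_fo m ?k point_map) (S_fm m ?k point_map)"
    by (rule exact_S_map[OF wcat_iso.exact_G[OF Nil_iso] cofib_category_axioms cofib_category_S_iter])
  note ex = exact_compose[OF exact_compose[OF exact_compose[OF wcat_iso.exact_F[OF Nil_iso] E] K] exact_uncurry]
  have s: "replicate (Suc 0) m = [m]" by (simp add: replicate_Suc)
  have o: "extend_diag C 0 m \<delta> A = uncurry_diag C m [] (S_fo m ?k point_map (jump_diag C m \<delta> (fst A [])))"
    if A: "A \<in> Obj (S_iter C [])" for A
  proof (rule diag_eqI)
    note d = S_iter_Obj_diag[OF A]
    show "is_diag (Ars [m]) C (extend_diag C 0 m \<delta> A)"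
      using is_diag_extend(1)[OF \<delta>, of 0 A] d by (simp add: s)
    show dU: "is_diag (Ars [m]) C (uncurry_diag C m [] (S_fo m ?k point_map (jump_diag C m \<delta> (fst A []))))"
      using S_iter_Obj_diag[OF exactD(1)[OF ex A]] by simp
    show "fst (extend_diag C 0 m \<delta> A) l = fst (uncurry_diag C m [] (S_fo m ?k point_map (jump_diag C m \<delta> (fst A [])))) l"
      if "l \<in> Field (Ars [m])" for l
      using that extend_simps(1)[of l 0 m C \<delta> A, unfolded s]
      by (elim Field_Ars_ConsE)
        (auto simp: Ars_Nil Field_Ars_Cons uncurry_simps S_fo_simps jump_simps const_diag_def extend_obj_def jump_obj_def)
    show "snd (extend_diag C 0 m \<delta> A) (l, l') = snd (uncurry_diag C m [] (S_fo m ?k point_map (jump_diag C m \<delta> (fst A [])))) (l, l')"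
      if l: "(l, l') \<in> Ars [m]" for l l'
    proof -
      obtain x y where xy: "l = [x]" "l' = [y]" "(x, y) \<in> Ar m"
        using l by (elim Ars_ConsE) (auto simp: Ars_Nil)
      note a = is_diagD(3)[OF d n(1)] is_diagD(5)[OF d n(1)]
      have h: "snd (jump_diag C m \<delta> (fst A [])) (x, y) \<in> hom C (jump_obj C \<delta> (fst A []) x) (jump_obj C \<delta> (fst A []) y)"
        using is_diagD(4)[OF S_ObjD(1)[OF jump_diag_Obj[OF \<delta> a(1)]] xy(3)] preordD(1,2)[OF preord_Ar xy(3)] by (simp add: jump_simps)
      have "snd (uncurry_diag C m [] (S_fo m ?k point_map (jump_diag C m \<delta> (fst A [])))) ([x], [y])
        = snd (jump_diag C m \<delta> (fst A [])) (x, y)"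
        using xy preordD(1,2)[OF preord_Ar xy(3)] n h homD[OF h]
        by (simp add: uncurry_simps S_fo_simps point_map_def jump_simps(1)) (simp add: const_diag_def Comp_Ident_left)
      then show ?thesis
        using extend_simps(2)[of l l' 0 m C \<delta> A, unfolded s] l xy a by (simp add: jump_simps extend_obj_def jump_obj_def)
    qed
  qed
  show ?thesis
  proof (rule exact_cong[OF ex cofib_category_S_iter weq_S_iter_Arr])
    show "extend_diag C 0 m \<delta> A = (uncurry_diag C m [] \<circ> (S_fo m ?k point_map \<circ> (jump_diag C m \<delta> \<circ> (\<lambda>A. fst A [])))) A"
      if "A \<in> Obj (S_iter C [])" for A using o[OF that] by simp
    show "extend_map C 0 m \<delta> f = (uncurry_map C m [] \<circ> (S_fm m ?k point_map \<circ> (jump_map C m \<delta> \<circ> (\<lambda>f. cpt f [])))) f"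
      if f: "f \<in> Arr (S_iter C [])" for f
    proof -
      have h: "f \<in> hom (S_iter C []) (fst f) (snd (snd f))" using f unfolding S_iter_hom S_iter_Arr by blast
      then have ob: "fst f \<in> Obj (S_iter C [])" "snd (snd f) \<in> Obj (S_iter C [])" by (auto simp: S_iter_hom)
      note g = exactD(2)[OF ex h]
      have c: "cpt f [] \<in> hom C (fst (fst f) []) (fst (snd (snd f)) [])" using S_iter_hom_comp(1)[OF h n(1)] .
      show ?thesis
      proof (rule diag_map_eqI)
        show "is_diag_map (Ars [m]) C (extend_map C 0 m \<delta> f)"
          using is_diag_map_extend[OF \<delta>, of 0 f] f unfolding S_iter_Arr by (simp add: s)
        show "is_diag_map (Ars [m]) C ((uncurry_map C m [] \<circ> (S_fm m ?k point_map \<circ> (jump_map C m \<delta> \<circ> (\<lambda>f. cpt f [])))) f)"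
          using g unfolding S_iter_hom by blast
        show "fst (extend_map C 0 m \<delta> f) = fst ((uncurry_map C m [] \<circ> (S_fm m ?k point_map \<circ> (jump_map C m \<delta> \<circ> (\<lambda>f. cpt f [])))) f)"
          "snd (snd (extend_map C 0 m \<delta> f)) = snd (snd ((uncurry_map C m [] \<circ> (S_fm m ?k point_map \<circ> (jump_map C m \<delta> \<circ> (\<lambda>f. cpt f [])))) f))"
          using o[OF ob(1)] o[OF ob(2)] g unfolding S_iter_hom by (simp_all add: extend_simps)
        show "cpt (extend_map C 0 m \<delta> f) l = cpt ((uncurry_map C m [] \<circ> (S_fm m ?k point_map \<circ> (jump_map C m \<delta> \<circ> (\<lambda>f. cpt f [])))) f) l"
          if "l \<in> Field (Ars [m])" for l
          using that extend_simps(5)[of l 0 m C \<delta> f, unfolded s]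
          by (elim Field_Ars_ConsE) (auto simp: Ars_Nil Field_Ars_Cons uncurry_simps S_fm_simps jump_simps point_map_def)
      qed
    qed
  qed
qed

text \<open>Extension concerns the last direction and currying the first one, so it is \<open>S m\<close> applied to
  extension with one direction less.\<close>

lemma exact_extend:
  assumes \<delta>: "\<delta> \<in> Delta m 1"
  shows "exact_functor (S_iter C (replicate q m)) (S_iter C (replicate (Suc q) m)) (extend_diag C q m \<delta>) (extend_map C q m \<delta>)"
proof (induction q)
  case 0
  show ?case using exact_extend_0[OF \<delta>] by (simp add: replicate_Suc)
next
  case (Suc q)
  let ?ns = "replicate q m" and ?ns' = "replicate (Suc q) m"
  let ?O = "extend_diag C q m \<delta>" and ?M = "extend_map C q m \<delta>"
  note ex = exact_S_map[OF Suc cofib_category_S_iter cofib_category_S_iter, of m]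
  have r: "replicate (Suc (Suc q)) m = m # ?ns'" "replicate (Suc q) m = m # ?ns" by (simp_all add: replicate_Suc)
  have mem: "x # xs \<in> Field (Ars (replicate (Suc (Suc q)) m)) \<longleftrightarrow> x \<in> Field (Ar m) \<and> xs \<in> Field (Ars ?ns')"
    "(x # xs, y # ys) \<in> Ars (replicate (Suc (Suc q)) m) \<longleftrightarrow> (x, y) \<in> Ar m \<and> (xs, ys) \<in> Ars ?ns'" for x xs y ys
    using Field_Ars_Cons[of x xs m ?ns'] Ars_Cons[of x xs y ys m ?ns'] by (simp_all add: r(1))
  have eo: "extend_obj C \<delta> A (x # xs) = extend_obj C \<delta> (slice ?ns A x) xs" if "xs \<in> Field (Ars ?ns')" for A x xs
    using Field_last[OF that] by (simp add: extend_obj_def slice_simps)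
  have sl: "slice ?ns' (extend_diag C (Suc q) m \<delta> A) x = ?O (slice ?ns A x)" if x: "x \<in> Field (Ar m)" for A x
  proof (rule prod_eqI)
    show "fst (slice ?ns' (extend_diag C (Suc q) m \<delta> A) x) = fst (?O (slice ?ns A x))"
      using x by (auto simp: slice_def extend_diag_def mem eo[unfolded slice_def] intro!: restrict_ext)
    show "snd (slice ?ns' (extend_diag C (Suc q) m \<delta> A) x) = snd (?O (slice ?ns A x))"
    proof (rule extensionalityI)
      fix p assume p: "p \<in> Ars ?ns'"
      obtain xs ys where xs: "p = (xs, ys)" by (cases p)
      note F = preordD(1,2)[OF preord_Ars p[unfolded xs]]
      show "snd (slice ?ns' (extend_diag C (Suc q) m \<delta> A) x) p = snd (?O (slice ?ns A x)) p"
        unfolding xs using x p[unfolded xs] Ars_last[OF p[unfolded xs]] preordD(4)[OF preord_Ar x] eo F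
        by (simp add: slice_simps(2) extend_simps(2) mem)
    qed (auto simp: slice_def extend_diag_def)
  qed
  have "extend_obj C \<delta> A (x # xs) = Zero C" if "\<not> jumps \<delta> (last xs)" "xs \<noteq> []" for A x xs
    using that by (simp add: extend_obj_def)
  note ez = this
  have cu: "curry_diag m ?ns' (extend_diag C (Suc q) m \<delta> A) = S_fo m ?O ?M (curry_diag m ?ns A)" for A
  proof (rule curry_diag_eqI)
    show "slice ?ns' (extend_diag C (Suc q) m \<delta> A) x = fst (S_fo m ?O ?M (curry_diag m ?ns A)) x" if "x \<in> Field (Ar m)" for x
      using that sl[OF that] by (simp add: S_fo_simps curry_simps)
    show "(slice ?ns' (extend_diag C (Suc q) m \<delta> A) x,
          \<lambda>xs\<in>Field (Ars ?ns'). snd (extend_diag C (Suc q) m \<delta> A) (x # xs, y # xs),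
          slice ?ns' (extend_diag C (Suc q) m \<delta> A) y) = snd (S_fo m ?O ?M (curry_diag m ?ns A)) (x, y)"
      if xy: "(x, y) \<in> Ar m" for x y
    proof -
      note F = preordD(1,2)[OF preord_Ar xy]
      have "(\<lambda>xs\<in>Field (Ars ?ns'). snd (extend_diag C (Suc q) m \<delta> A) (x # xs, y # xs)) =
        (\<lambda>l \<in> Field (Ars ?ns'). if jumps \<delta> (last l)
            then (\<lambda>xs\<in>Field (Ars ?ns). snd A (x # xs, y # xs)) (butlast l) else Ident C (Zero C))"
      proof (rule restrict_ext)
        fix xs assume xs: "xs \<in> Field (Ars ?ns')"
        show "snd (extend_diag C (Suc q) m \<delta> A) (x # xs, y # xs) = (if jumps \<delta> (last xs)
            then (\<lambda>xs\<in>Field (Ars ?ns). snd A (x # xs, y # xs)) (butlast xs) else Ident C (Zero C))"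
          using xy preordD(4)[OF preord_Ars xs] Field_last[OF xs] ez
          by (simp add: extend_simps(2) mem zero_arr_Zero_Zero)
      qed
      then show ?thesis using xy F sl[OF F(1)] sl[OF F(2)]
        by (simp add: S_fo_simps curry_simps extend_map_def)
    qed
  qed (auto simp: S_fo_def)
  have "exact_functor (S_iter C (m # ?ns)) (S_iter C (m # ?ns')) (extend_diag C (Suc q) m \<delta>) (extend_map C (Suc q) m \<delta>)"
  proof (rule exact_via_curry[OF ex])
    show "is_diag (Ars (m # ?ns')) C (extend_diag C (Suc q) m \<delta> A)" if "A \<in> Obj (S_iter C (m # ?ns))" for A
      using is_diag_extend(1)[OF \<delta>, of "Suc q" A] S_iter_Obj_diag[OF that] by (simp add: r)
    show "is_diag_map (Ars (m # ?ns')) C (extend_map C (Suc q) m \<delta> f)" if "f \<in> Arr (S_iter C (m # ?ns))" for f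
      using is_diag_map_extend[OF \<delta>, of "Suc q" f] that unfolding S_iter_Arr by (simp add: r)
    show "curry_map m ?ns' (extend_map C (Suc q) m \<delta> f) = S_fm m ?O ?M (curry_map m ?ns f)" for f
    proof (rule curry_map_eqI)
      fix x assume x: "x \<in> Field (Ar m)"
      have "(\<lambda>xs\<in>Field (Ars ?ns'). cpt (extend_map C (Suc q) m \<delta> f) (x # xs)) =
        (\<lambda>l \<in> Field (Ars ?ns'). if jumps \<delta> (last l)
            then (\<lambda>xs\<in>Field (Ars ?ns). cpt f (x # xs)) (butlast l) else Ident C (Zero C))"
      proof (rule restrict_ext)
        fix xs assume xs: "xs \<in> Field (Ars ?ns')"
        show "cpt (extend_map C (Suc q) m \<delta> f) (x # xs) = (if jumps \<delta> (last xs)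
            then (\<lambda>xs\<in>Field (Ars ?ns). cpt f (x # xs)) (butlast xs) else Ident C (Zero C))"
          using x xs Field_last[OF xs] by (simp add: extend_simps(5) mem)
      qed
      then show "(slice ?ns' (fst (extend_map C (Suc q) m \<delta> f)) x,
         \<lambda>xs\<in>Field (Ars ?ns'). cpt (extend_map C (Suc q) m \<delta> f) (x # xs),
         slice ?ns' (snd (snd (extend_map C (Suc q) m \<delta> f))) x) = cpt (S_fm m ?O ?M (curry_map m ?ns f)) x"
        using x sl[OF x, of "fst f"] sl[OF x, of "snd (snd f)"]
        by (simp add: S_fm_simps curry_simps extend_simps(3,4) extend_map_def[of C q])
    qed (simp_all add: extend_simps(3,4) S_fm_simps curry_simps cu, auto simp: S_fm_def)
  qed (simp_all add: cu extend_simps(3,4))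
  then show ?case by (simp add: r)
qed

end

section \<open>The simplices of the algebraic K-theory spectrum\<close>

lemma Field_ord: "i \<in> Field (ord m) \<longleftrightarrow> i \<le> m"
  unfolding preord_Field[OF preord_ord] by (simp add: ord_def)

lemma ord_iff: "(i, j) \<in> ord m \<longleftrightarrow> i \<le> j \<and> j \<le> m"
  by (simp add: ord_def)

lemma Ars_replicate: "(xs, ys) \<in> Ars (replicate q m) \<longleftrightarrow>
    length xs = q \<and> length ys = q \<and> (\<forall>r < q. (xs ! r, ys ! r) \<in> Ar m)"
  by (auto simp: Ars_def)

lemma Field_Ars_replicate: "xs \<in> Field (Ars (replicate q m)) \<longleftrightarrow>
    length xs = q \<and> (\<forall>r < q. xs ! r \<in> Field (Ar m))"
  unfolding preord_Field[OF preord_Ars] preord_Field[OF preord_Ar] by (auto simp: Ars_replicate)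

lemma nerve_w_cat:
  assumes "Weq E \<subseteq> Arr E"
  shows "A \<in> nerve (w_cat E) m \<longleftrightarrow> is_diag (ord m) E A \<and> (\<forall>(i, j) \<in> ord m. snd A (i, j) \<in> Weq E)"
  unfolding nerve_def is_diag_def w_cat_def hom_def using assms by (auto simp: split_beta)

lemma map_chain_simps:
  "i \<le> m \<Longrightarrow> fst (map_chain m F G A) i = F (fst A i)"
  "(i, j) \<in> ord m \<Longrightarrow> snd (map_chain m F G A) (i, j) = G (snd A (i, j))"
  by (auto simp: map_chain_def)

lemma map_chain_nerve:
  assumes F: "exact_functor E E' Fo Fm" and W: "Weq E \<subseteq> Arr E" "Weq E' \<subseteq> Arr E'"
    and A: "A \<in> nerve (w_cat E) m"
  shows "map_chain m Fo Fm A \<in> nerve (w_cat E') m"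
proof -
  let ?B = "map_chain m Fo Fm A"
  have d: "is_diag (ord m) E A" and w: "\<And>i j. (i, j) \<in> ord m \<Longrightarrow> snd A (i, j) \<in> Weq E"
    using A unfolding nerve_w_cat[OF W(1)] by auto
  have s: "fst ?B i = Fo (fst A i)" if "i \<in> Field (ord m)" for i
    using that by (simp add: map_chain_simps Field_ord)
  have "is_diag (ord m) E' ?B"
  proof (rule is_diagI)
    show "fst ?B \<in> extensional (Field (ord m))" "snd ?B \<in> extensional (ord m)"
      by (auto simp: map_chain_def extensional_def Field_ord)
    show "fst ?B i \<in> Obj E'" if "i \<in> Field (ord m)" for i
      using is_diagD(3)[OF d that] exactD(1)[OF F] s[OF that] by simp
    show "snd ?B (i, j) \<in> hom E' (fst ?B i) (fst ?B j)" if "(i, j) \<in> ord m" for i j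
      using exactD(2)[OF F is_diagD(4)[OF d that]] s preordD(1,2)[OF preord_ord that] that by (simp add: map_chain_simps)
    show "snd ?B (i, i) = Ident E' (fst ?B i)" if "i \<in> Field (ord m)" for i
      using is_diagD(3,5)[OF d that] exactD(3)[OF F] s[OF that] preordD(4)[OF preord_ord that] by (simp add: map_chain_simps)
    show "Comp E' (snd ?B (j, k)) (snd ?B (i, j)) = snd ?B (i, k)" if ij: "(i, j) \<in> ord m" "(j, k) \<in> ord m" for i j k
      using exactD(4)[OF F is_diagD(4)[OF d ij(1)] is_diagD(4)[OF d ij(2)]] is_diagD(6)[OF d ij] ij
        preordD(3)[OF preord_ord ij] by (simp add: map_chain_simps)
  qed
  then show ?thesis
    unfolding nerve_w_cat[OF W(2)] using w exactD(7)[OF F] by (auto simp: map_chain_simps)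
qed

lemma Delta_ord: "\<theta> \<in> Delta m' m \<Longrightarrow> (i, j) \<in> ord m' \<Longrightarrow> (\<theta> i, \<theta> j) \<in> ord m"
  using Delta_mono by (auto simp: ord_iff)

lemma pull_nerve:
  assumes \<theta>: "\<theta> \<in> Delta m' m" and W: "Weq E \<subseteq> Arr E" and A: "A \<in> nerve (w_cat E) m"
  shows "pull_diag (ord m') \<theta> A \<in> nerve (w_cat E) m'"
proof -
  have "is_diag (ord m') E (pull_diag (ord m') \<theta> A)"
    by (rule is_diag_pull[OF preord_ord preord_ord Delta_ord[OF \<theta>]
          A[unfolded nerve_w_cat[OF W], THEN conjunct1]])
  then show ?thesis using A Delta_ord[OF \<theta>] unfolding nerve_w_cat[OF W] by (auto simp: pull_simps)
qed

text \<open>A simplex of \<open>K C\<close> is a chain of diagrams in \<open>C\<close>. It is determined by the objects and the arrows of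
  the \<open>i\<close>-th diagram and by the components of the weak equivalence from the \<open>i\<close>-th to the \<open>j\<close>-th one.
  All operations of \<open>K C\<close> have simple formulas in these terms.\<close>

definition kob :: "('o, 'm) K_simplex \<Rightarrow> nat \<Rightarrow> (nat \<times> nat) list \<Rightarrow> 'o" where
  "kob A i xs = fst (fst A i) xs"

definition kar :: "('o, 'm) K_simplex \<Rightarrow> nat \<Rightarrow> (nat \<times> nat) list \<Rightarrow> (nat \<times> nat) list \<Rightarrow> 'm" where
  "kar A i xs ys = snd (fst A i) (xs, ys)"

definition kwe :: "('o, 'm) K_simplex \<Rightarrow> nat \<Rightarrow> nat \<Rightarrow> (nat \<times> nat) list \<Rightarrow> 'm" where
  "kwe A i j xs = cpt (snd A (i, j)) xs"

lemma Spx_K: "A \<in> Spx (K C) q m \<longleftrightarrow> is_diag (ord m) (S_iter C (replicate q m)) A \<and>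
    (\<forall>(i, j) \<in> ord m. snd A (i, j) \<in> Weq (S_iter C (replicate q m)))"
  unfolding K_def by (simp add: nerve_w_cat[OF weq_S_iter_Arr])

lemma Spx_K_nerve: "Spx (K C) q m = nerve (w_cat (S_iter C (replicate q m))) m"
  by (simp add: K_def)

lemma K_simplexD:
  assumes "A \<in> Spx (K C) q m"
  shows "i \<le> m \<Longrightarrow> fst A i \<in> Obj (S_iter C (replicate q m))"
    "i \<le> j \<Longrightarrow> j \<le> m \<Longrightarrow> snd A (i, j) \<in> hom (S_iter C (replicate q m)) (fst A i) (fst A j)"
    "i \<le> m \<Longrightarrow> xs \<in> Field (Ars (replicate q m)) \<Longrightarrow> kob A i xs \<in> Obj C"
    "i \<le> m \<Longrightarrow> (xs, ys) \<in> Ars (replicate q m) \<Longrightarrow> kar A i xs ys \<in> hom C (kob A i xs) (kob A i ys)"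
    "i \<le> j \<Longrightarrow> j \<le> m \<Longrightarrow> xs \<in> Field (Ars (replicate q m)) \<Longrightarrow> kwe A i j xs \<in> hom C (kob A i xs) (kob A j xs)"
proof -
  have d: "is_diag (ord m) (S_iter C (replicate q m)) A" using assms unfolding Spx_K by blast
  show o: "i \<le> m \<Longrightarrow> fst A i \<in> Obj (S_iter C (replicate q m))" for i
    using is_diagD(3)[OF d] by (simp add: Field_ord)
  show h: "i \<le> j \<Longrightarrow> j \<le> m \<Longrightarrow> snd A (i, j) \<in> hom (S_iter C (replicate q m)) (fst A i) (fst A j)"
    using is_diagD(4)[OF d] by (simp add: ord_iff)
  show "i \<le> m \<Longrightarrow> xs \<in> Field (Ars (replicate q m)) \<Longrightarrow> kob A i xs \<in> Obj C"
    unfolding kob_def using is_diagD(3)[OF S_iter_Obj_diag[OF o]] by blast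
  show "i \<le> m \<Longrightarrow> (xs, ys) \<in> Ars (replicate q m) \<Longrightarrow> kar A i xs ys \<in> hom C (kob A i xs) (kob A i ys)"
    unfolding kob_def kar_def using is_diagD(4)[OF S_iter_Obj_diag[OF o]] by blast
  show "i \<le> j \<Longrightarrow> j \<le> m \<Longrightarrow> xs \<in> Field (Ars (replicate q m)) \<Longrightarrow> kwe A i j xs \<in> hom C (kob A i xs) (kob A j xs)"
    unfolding kob_def kwe_def using S_iter_hom_comp(1)[OF h] by blast
qed

lemma K_eqI:
  assumes A: "A \<in> Spx (K C) q m" and B: "B \<in> Spx (K C) q m"
    and o: "\<And>i xs. i \<le> m \<Longrightarrow> xs \<in> Field (Ars (replicate q m)) \<Longrightarrow> kob A i xs = kob B i xs"
    and a: "\<And>i xs ys. i \<le> m \<Longrightarrow> (xs, ys) \<in> Ars (replicate q m) \<Longrightarrow> kar A i xs ys = kar B i xs ys"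
    and w: "\<And>i j xs. i \<le> j \<Longrightarrow> j \<le> m \<Longrightarrow> xs \<in> Field (Ars (replicate q m)) \<Longrightarrow> kwe A i j xs = kwe B i j xs"
  shows "A = B"
proof (rule diag_eqI)
  show "is_diag (ord m) (S_iter C (replicate q m)) A" "is_diag (ord m) (S_iter C (replicate q m)) B"
    using A B by (auto simp: Spx_K)
  show e: "fst A i = fst B i" if "i \<in> Field (ord m)" for i
    using o a that by (intro diag_eqI[OF S_iter_Obj_diag[OF K_simplexD(1)[OF A]] S_iter_Obj_diag[OF K_simplexD(1)[OF B]]])
      (auto simp: kob_def kar_def Field_ord)
  show "snd A (i, j) = snd B (i, j)" if "(i, j) \<in> ord m" for i j
    using that w K_simplexD(2)[OF B, of i j] e by (intro S_iter_hom_eqI[OF K_simplexD(2)[OF A]])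
      (auto simp: kwe_def ord_iff Field_ord)
qed

lemma K_sel:
  "pt (K C) = K_pt C" "op (K C) = K_op" "act (K C) = K_act" "str (K C) = K_str C"
  by (simp_all add: K_def)

lemma K_op_simps:
  assumes "\<theta> \<in> Delta m' m"
  shows "i \<le> m' \<Longrightarrow> xs \<in> Field (Ars (replicate q m')) \<Longrightarrow> kob (K_op q m' m \<theta> A) i xs = kob A (\<theta> i) (map (map_prod \<theta> \<theta>) xs)"
    "i \<le> m' \<Longrightarrow> (xs, ys) \<in> Ars (replicate q m')
      \<Longrightarrow> kar (K_op q m' m \<theta> A) i xs ys = kar A (\<theta> i) (map (map_prod \<theta> \<theta>) xs) (map (map_prod \<theta> \<theta>) ys)"
    "i \<le> j \<Longrightarrow> j \<le> m' \<Longrightarrow> xs \<in> Field (Ars (replicate q m'))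
      \<Longrightarrow> kwe (K_op q m' m \<theta> A) i j xs = kwe A (\<theta> i) (\<theta> j) (map (map_prod \<theta> \<theta>) xs)"
  unfolding kob_def kar_def kwe_def K_op_def Let_def
  by (simp_all add: map_chain_simps pull_simps Field_ord ord_iff)

lemma K_act_reindex: "K_act q m \<pi> = map_chain m (pull_diag (Ars (replicate q m)) (reindex q \<pi>))
     (pull_map (Ars (replicate q m)) (reindex q \<pi>))"
  unfolding K_act_def reindex_def Let_def ..

lemma K_act_simps:
  shows "i \<le> m \<Longrightarrow> xs \<in> Field (Ars (replicate q m)) \<Longrightarrow> kob (K_act q m \<pi> A) i xs = kob A i (reindex q \<pi> xs)"
    "i \<le> m \<Longrightarrow> (xs, ys) \<in> Ars (replicate q m)
      \<Longrightarrow> kar (K_act q m \<pi> A) i xs ys = kar A i (reindex q \<pi> xs) (reindex q \<pi> ys)"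
    "i \<le> j \<Longrightarrow> j \<le> m \<Longrightarrow> xs \<in> Field (Ars (replicate q m))
      \<Longrightarrow> kwe (K_act q m \<pi> A) i j xs = kwe A i j (reindex q \<pi> xs)"
  unfolding kob_def kar_def kwe_def K_act_reindex
  by (simp_all add: map_chain_simps pull_simps ord_iff)

lemma K_str_simps:
  shows "i \<le> m \<Longrightarrow> l \<in> Field (Ars (replicate (Suc q) m)) \<Longrightarrow>
      kob (K_str C q m A (Some [d])) i l = (if jumps d (last l) then kob A i (butlast l) else Zero C)"
    "i \<le> m \<Longrightarrow> (l, l') \<in> Ars (replicate (Suc q) m) \<Longrightarrow>
      kar (K_str C q m A (Some [d])) i l l' = (if jumps d (last l) \<and> jumps d (last l')
        then kar A i (butlast l) (butlast l')
        else zero_arr C (kob (K_str C q m A (Some [d])) i l) (kob (K_str C q m A (Some [d])) i l'))"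
    "i \<le> j \<Longrightarrow> j \<le> m \<Longrightarrow> l \<in> Field (Ars (replicate (Suc q) m)) \<Longrightarrow>
      kwe (K_str C q m A (Some [d])) i j l = (if jumps d (last l) then kwe A i j (butlast l) else Ident C (Zero C))"
  unfolding kob_def kar_def kwe_def K_str_def
  using preordD(1,2)[OF preord_Ars, of l l' "replicate (Suc q) m"]
  by (simp_all add: map_chain_simps extend_simps ord_iff extend_obj_def)

lemma K_pt_simps:
  shows "i \<le> m \<Longrightarrow> l \<in> Field (Ars (replicate q m)) \<Longrightarrow> kob (K_pt C q m) i l = Zero C"
    "i \<le> m \<Longrightarrow> (l, l') \<in> Ars (replicate q m) \<Longrightarrow> kar (K_pt C q m) i l l' = Ident C (Zero C)"
    "i \<le> j \<Longrightarrow> j \<le> m \<Longrightarrow> l \<in> Field (Ars (replicate q m)) \<Longrightarrow> kwe (K_pt C q m) i j l = Ident C (Zero C)"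
  unfolding kob_def kar_def kwe_def K_pt_def
  by (simp_all add: S_iter_simps const_diag_def Field_ord ord_iff)

lemma sphere_iff:
  "Some ds \<in> sphere k m \<longleftrightarrow> length ds = k \<and> (\<forall>d \<in> set ds. d \<in> Delta m 1 \<and> d ` {..m} = {..1})"
  unfolding sphere_def by auto

lemma sphere_1E:
  assumes "s \<in> sphere 1 m"
  obtains "s = None" | d where "s = Some [d]" "d \<in> Delta m 1" "d ` {..m} = {..1}"
proof (cases s)
  case (Some ds)
  then have "length ds = 1" "\<forall>d \<in> set ds. d \<in> Delta m 1 \<and> d ` {..m} = {..1}" using assms sphere_iff by auto
  then show ?thesis using that Some by (cases ds) auto
qed (use that in blast)

lemma reindex_Ars:
  assumes "\<pi> permutes {..<q}"
  shows "(xs, ys) \<in> Ars (replicate q m) \<Longrightarrow> (reindex q \<pi> xs, reindex q \<pi> ys) \<in> Ars (replicate q m)"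
    "xs \<in> Field (Ars (replicate q m)) \<Longrightarrow> reindex q \<pi> xs \<in> Field (Ars (replicate q m))"
  using assms by (auto simp: Ars_replicate Field_Ars_replicate permutes_less)

lemma op_Ars:
  assumes "\<theta> \<in> Delta m' m"
  shows "(xs, ys) \<in> Ars (replicate q m') \<Longrightarrow> (map (map_prod \<theta> \<theta>) xs, map (map_prod \<theta> \<theta>) ys) \<in> Ars (replicate q m)"
    "xs \<in> Field (Ars (replicate q m')) \<Longrightarrow> map (map_prod \<theta> \<theta>) xs \<in> Field (Ars (replicate q m))"
proof -
  have F: "x \<in> Field (Ar m') \<Longrightarrow> map_prod \<theta> \<theta> x \<in> Field (Ar m)" for x
    using mono_Field[OF preord_Ar preord_Ar Delta_Ar[OF assms]] .
  show "(xs, ys) \<in> Ars (replicate q m') \<Longrightarrow> (map (map_prod \<theta> \<theta>) xs, map (map_prod \<theta> \<theta>) ys) \<in> Ars (replicate q m)"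
    by (simp add: Ars_replicate Delta_Ar[OF assms])
  show "xs \<in> Field (Ars (replicate q m')) \<Longrightarrow> map (map_prod \<theta> \<theta>) xs \<in> Field (Ars (replicate q m))"
    by (simp add: Field_Ars_replicate F)
qed

lemma Delta_compose: "\<theta> \<in> Delta m' m \<Longrightarrow> \<theta>' \<in> Delta m'' m' \<Longrightarrow> compose {..m''} \<theta> \<theta>' \<in> Delta m'' m"
  unfolding Delta_def by (auto simp: compose_def mono_on_def PiE_iff)

lemma jumps_surj:
  assumes "d \<in> Delta m 1" "jumps d (i, j)" "i \<le> m" "j \<le> m"
  shows "d ` {..m} = {..1}"
proof
  show "d ` {..m} \<subseteq> {..1}" using Delta_le[OF assms(1)] by auto
  show "{..1} \<subseteq> d ` {..m}"
  proof
    fix x :: nat assume "x \<in> {..1}"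
    then have "x = d i \<or> x = d j" using assms(2) by (auto simp: jumps_def)
    then show "x \<in> d ` {..m}" using assms(3,4) by auto
  qed
qed

text \<open>The condition under which an extension by zero along the list \<open>ds\<close>, in the directions \<open>p\<close>,
  \<open>p + 1\<close>, \<open>\<dots>\<close>, does not vanish.\<close>

definition alljump :: "nat \<Rightarrow> (nat \<Rightarrow> nat) list \<Rightarrow> (nat \<times> nat) list \<Rightarrow> bool" where
  "alljump p ds xs \<longleftrightarrow> (\<forall>l < length ds. jumps (ds ! l) (xs ! (p + l)))"

lemma alljump_Cons: "alljump p (d # ds) xs \<longleftrightarrow> jumps d (xs ! p) \<and> alljump (Suc p) ds xs"
  unfolding alljump_def by (auto simp: less_Suc_eq_0_disj)

lemma take_Ars:
  "(xs, ys) \<in> Ars (replicate (p + k) m) \<Longrightarrow> (take p xs, take p ys) \<in> Ars (replicate p m)"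
  "xs \<in> Field (Ars (replicate (p + k) m)) \<Longrightarrow> take p xs \<in> Field (Ars (replicate p m))"
  by (auto simp: Ars_replicate Field_Ars_replicate)

lemma last_take: "p < length xs \<Longrightarrow> last (take (Suc p) xs) = xs ! p" "p < length xs \<Longrightarrow> butlast (take (Suc p) xs) = take p xs"
  by (simp_all add: take_Suc_conv_app_nth)

text \<open>Exact functors act on the nerves of the weak equivalences.\<close>

lemma (in waldhausen_category) K_closed:
  shows "K_pt C q m \<in> Spx (K C) q m"
    "\<theta> \<in> Delta m' m \<Longrightarrow> A \<in> Spx (K C) q m \<Longrightarrow> K_op q m' m \<theta> A \<in> Spx (K C) q m'"
    "\<pi> permutes {..<q} \<Longrightarrow> A \<in> Spx (K C) q m \<Longrightarrow> K_act q m \<pi> A \<in> Spx (K C) q m"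
    "A \<in> Spx (K C) q m \<Longrightarrow> s \<in> sphere 1 m \<Longrightarrow> K_str C q m A s \<in> Spx (K C) (Suc q) m"
proof -
  have E: "cofib_category (S_iter C ns)" for ns by (rule cofib_category_S_iter)
  show pt: "K_pt C q m \<in> Spx (K C) q m" for q
  proof -
    interpret E: cofib_category "S_iter C (replicate q m)" by (rule E)
    have w: "Ident (S_iter C (replicate q m)) (Zero (S_iter C (replicate q m))) \<in> Weq (S_iter C (replicate q m))"
      unfolding weq_S_iter_pointwise using E.Ident_simps(1)[OF E.Zero_Obj] Weq_iso[OF Ident_iso[OF Zero_Obj]]
      by (simp add: S_iter_simps const_diag_def)
    show ?thesis unfolding Spx_K K_pt_def
      using E.is_diag_const[OF preord_ord E.Zero_Obj] w by (auto simp: const_diag_def)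
  qed
  show "K_op q m' m \<theta> A \<in> Spx (K C) q m'" if "\<theta> \<in> Delta m' m" "A \<in> Spx (K C) q m"
    using map_chain_nerve[OF exact_pullD(3)[OF exact_pull_op[OF that(1)]] weq_S_iter_Arr weq_S_iter_Arr
        pull_nerve[OF that(1) weq_S_iter_Arr that(2)[unfolded Spx_K_nerve]]]
    unfolding Spx_K_nerve K_op_def Let_def .
  show "K_act q m \<pi> A \<in> Spx (K C) q m" if "\<pi> permutes {..<q}" "A \<in> Spx (K C) q m"
    using map_chain_nerve[OF exact_pullD(3)[OF exact_pull_perm[OF that(1)]] weq_S_iter_Arr weq_S_iter_Arr
        that(2)[unfolded Spx_K_nerve]]
    unfolding Spx_K_nerve K_act_reindex .
  show "K_str C q m A s \<in> Spx (K C) (Suc q) m" if A: "A \<in> Spx (K C) q m" and s: "s \<in> sphere 1 m"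
    using s
  proof (cases rule: sphere_1E)
    case 1
    then show ?thesis using pt by (simp add: K_str_def)
  next
    case (2 d)
    then show ?thesis
      using map_chain_nerve[OF exact_extend[OF 2(2)] weq_S_iter_Arr weq_S_iter_Arr A[unfolded Spx_K_nerve]]
      unfolding Spx_K_nerve K_str_def by simp
  qed
qed

context waldhausen_category
begin

lemma str_list_K:
  assumes "x \<in> Spx (K C) p m" "Some ds \<in> sphere (length ds) m"
  defines "y \<equiv> str_list (K C) p m x ds"
  shows "y \<in> Spx (K C) (p + length ds) m"
    "i \<le> m \<Longrightarrow> xs \<in> Field (Ars (replicate (p + length ds) m)) \<Longrightarrow>
       kob y i xs = (if alljump p ds xs then kob x i (take p xs) else Zero C)"
    "i \<le> m \<Longrightarrow> (xs, ys) \<in> Ars (replicate (p + length ds) m) \<Longrightarrow>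
       kar y i xs ys = (if alljump p ds xs \<and> alljump p ds ys then kar x i (take p xs) (take p ys)
         else zero_arr C (kob y i xs) (kob y i ys))"
    "i \<le> j \<Longrightarrow> j \<le> m \<Longrightarrow> xs \<in> Field (Ars (replicate (p + length ds) m)) \<Longrightarrow>
       kwe y i j xs = (if alljump p ds xs then kwe x i j (take p xs) else Ident C (Zero C))"
  using assms(1,2) unfolding y_def
proof (induction ds arbitrary: p x i j xs ys)
  case Nil
  { case 1 then show ?case by simp }
  { case 2 then show ?case by (simp add: alljump_def Field_Ars_replicate) }
  { case 3 then show ?case by (simp add: alljump_def Ars_replicate) }
  { case 4 then show ?case by (simp add: alljump_def Field_Ars_replicate) }
next
  case (Cons d ds)
  have d: "Some [d] \<in> sphere 1 m" "Some ds \<in> sphere (length ds) m" if "Some (d # ds) \<in> sphere (length (d # ds)) m"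
    using that by (auto simp: sphere_iff)
  let ?x = "\<lambda>p x. K_str C p m x (Some [d])"
  have e: "str_list (K C) p m x (d # ds) = str_list (K C) (Suc p) m (?x p x) ds" for p x by (simp add: K_sel)
  have c: "?x p x \<in> Spx (K C) (Suc p) m" if "x \<in> Spx (K C) p m" "Some (d # ds) \<in> sphere (length (d # ds)) m" for p x
    using K_closed(4)[OF that(1) d(1)[OF that(2)]] .
  have t: "take (Suc p) xs \<in> Field (Ars (replicate (Suc p) m))" "p < length xs"
    if "xs \<in> Field (Ars (replicate (p + length (d # ds)) m))" for p xs
    using that take_Ars(2)[of xs "Suc p" "length ds" m] by (auto simp: Field_Ars_replicate)
  have t2: "(take (Suc p) xs, take (Suc p) ys) \<in> Ars (replicate (Suc p) m)" "p < length xs" "p < length ys"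
    if "(xs, ys) \<in> Ars (replicate (p + length (d # ds)) m)" for p xs ys
    using that take_Ars(1)[of xs ys "Suc p" "length ds" m] by (auto simp: Ars_replicate)
  {
    case 1
    show ?case unfolding e using Cons.IH(1)[OF c d(2)] 1 by simp
  next
    case 2
    show ?case unfolding e alljump_Cons
      using Cons.IH(2)[OF _ _ c d(2), of i xs p x] 2
      by (simp add: K_str_simps(1)[OF 2(1) t(1)[OF 2(2)]] last_take[OF t(2)[OF 2(2)]])
  next
    case 3
    note F = preordD(1,2)[OF preord_Ars 3(2)]
    have k: "kob (str_list (K C) (Suc p) m (?x p x) ds) i xs =
        (if alljump (Suc p) ds xs then kob (?x p x) i (take (Suc p) xs) else Zero C)"
      "kob (str_list (K C) (Suc p) m (?x p x) ds) i ys =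
        (if alljump (Suc p) ds ys then kob (?x p x) i (take (Suc p) ys) else Zero C)"
      using Cons.IH(2)[OF 3(1) _ c d(2), of xs p x] Cons.IH(2)[OF 3(1) _ c d(2), of ys p x] 3 F by simp_all
    show ?case unfolding e alljump_Cons
      using Cons.IH(3)[OF _ _ c d(2), of i xs ys p x] 3 K_str_simps(2)[OF 3(1) t2(1)[OF 3(2)], of C x d]
        last_take[OF t2(2)[OF 3(2)]] last_take[OF t2(3)[OF 3(2)]] k
      by simp
  next
    case 4
    show ?case unfolding e alljump_Cons
      using Cons.IH(4)[OF _ _ _ c d(2), of i j xs p x] 4
      by (simp add: K_str_simps(3)[OF 4(1,2) t(1)[OF 4(3)]] last_take[OF t(2)[OF 4(3)]])
  }
qed

end

lemma sphere_op_simps: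
  "sphere_op m' \<theta> None = None"
  "sphere_op m' \<theta> (Some [d]) = (if compose {..m'} d \<theta> ` {..m'} = {..1} then Some [compose {..m'} d \<theta>] else None)"
  by (simp_all add: sphere_op_def)

lemma permutes_of_inj:
  assumes inj: "inj_on f {..<k::nat}" and sub: "\<And>i. i < k \<Longrightarrow> f i < k" and out: "\<And>i. \<not> i < k \<Longrightarrow> f i = i"
  shows "f permutes {..<k}"
proof (rule bij_imp_permutes)
  have "f ` {..<k} \<subseteq> {..<k}" using sub by auto
  then show "bij_betw f {..<k} {..<k}"
    unfolding bij_betw_def using inj card_image[OF inj] card_subset_eq[OF finite_lessThan] by simp
qed (use out in auto)

lemma block_sum_permutes:
  assumes a: "a permutes {..<p}" and b: "b permutes {..<k}"
  shows "block_sum p a b permutes {..<p + k}"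
proof (rule permutes_of_inj)
  have a': "i < p \<Longrightarrow> a i < p" for i using permutes_less[OF a] .
  have b': "i < k \<Longrightarrow> b i < k" for i using permutes_less[OF b] .
  show "inj_on (block_sum p a b) {..<p + k}"
  proof (rule inj_onI)
    fix x y assume xy: "x \<in> {..<p + k}" "y \<in> {..<p + k}" "block_sum p a b x = block_sum p a b y"
    then show "x = y"
      using a'[of x] a'[of y] injD[OF permutes_inj[OF a], of x y] injD[OF permutes_inj[OF b], of "x - p" "y - p"]
      by (auto simp: block_sum_def split: if_splits)
  qed
  show "block_sum p a b i < p + k" if "i < p + k" for i
    using that a'[of i] b'[of "i - p"] by (auto simp: block_sum_def)
  show "block_sum p a b i = i" if "\<not> i < p + k" for i
    using that permutes_not_in[OF b, of "i - p"] by (auto simp: block_sum_def)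
qed

lemma alljump_block_sum:
  assumes b: "b permutes {..<k}" and l: "length ds = k"
  shows "alljump p (map (\<lambda>r. ds ! inv b r) [0..<k]) xs \<longleftrightarrow> alljump p ds (reindex (p + k) (block_sum p a b) xs)"
proof -
  have "(\<forall>r < k. jumps (ds ! inv b r) (xs ! (p + r))) \<longleftrightarrow> (\<forall>r < k. jumps (ds ! r) (xs ! (p + b r)))"
    (is "?L \<longleftrightarrow> ?R")
  proof
    assume L: ?L
    show ?R
    proof (intro allI impI)
      fix r assume r: "r < k"
      show "jumps (ds ! r) (xs ! (p + b r))"
        using L[rule_format, OF permutes_less[OF b r]] permutes_inverses(2)[OF b] by simp
    qed
  next
    assume R: ?R
    show ?L
    proof (intro allI impI)
      fix r assume r: "r < k"
      show "jumps (ds ! inv b r) (xs ! (p + r))"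
        using R[rule_format, OF permutes_less[OF permutes_inv[OF b] r]] permutes_inverses(1)[OF b] by simp
    qed
  qed
  then show ?thesis unfolding alljump_def using l by (simp add: block_sum_def)
qed

lemma take_reindex_block_sum:
  "a permutes {..<p} \<Longrightarrow> length xs = p + k \<Longrightarrow> take p (reindex (p + k) (block_sum p a b) xs) = reindex p a (take p xs)"
  by (rule nth_equalityI) (auto simp: block_sum_def permutes_less)

lemma sphere_act_Some: "Some ds \<in> sphere k m \<Longrightarrow> b permutes {..<k} \<Longrightarrow>
   sphere_act k b (Some ds) = Some (map (\<lambda>r. ds ! inv b r) [0..<k]) \<and> Some (map (\<lambda>r. ds ! inv b r) [0..<k]) \<in> sphere k m"
  by (auto simp: sphere_act_def sphere_iff permutes_less[OF permutes_inv])

context waldhausen_category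
begin

text \<open>If \<open>d \<circ> \<theta>\<close> is not surjective, its composite is the base point of the circle. On the other side no
  interval contains the jump any more, so the diagram is zero.\<close>

lemma K_str_op:
  assumes \<theta>: "\<theta> \<in> Delta m' m" and x: "x \<in> Spx (K C) n m" and s: "s \<in> sphere 1 m"
  shows "K_op (Suc n) m' m \<theta> (K_str C n m x s) = K_str C n m' (K_op n m' m \<theta> x) (sphere_op m' \<theta> s)"
  using s
proof (cases rule: sphere_1E)
  case 1
  have "K_op (Suc n) m' m \<theta> (K_pt C (Suc n) m) = K_pt C (Suc n) m'"
    by (rule K_eqI[OF K_closed(2)[OF \<theta> K_closed(1)] K_closed(1)])
      (simp_all add: K_op_simps[OF \<theta>] K_pt_simps op_Ars[OF \<theta>] Delta_mono[OF \<theta>] Delta_le[OF \<theta>])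
  then show ?thesis using 1 by (simp add: K_str_def sphere_op_simps)
next
  case (2 d)
  let ?e = "compose {..m'} d \<theta>"
  let ?l = "K_op (Suc n) m' m \<theta> (K_str C n m x (Some [d]))"
  have e: "?e \<in> Delta m' 1" using Delta_compose[OF 2(2) \<theta>] .
  note lc = K_closed(2)[OF \<theta> K_closed(4)[OF x s, unfolded 2(1)]]
  have j: "jumps d (map_prod \<theta> \<theta> y) \<longleftrightarrow> jumps ?e y" if "y \<in> Field (Ar m')" for y
    using that by (cases y) (auto simp: jumps_def compose_def Field_Ar)
  have g: "last (map (map_prod \<theta> \<theta>) l) = map_prod \<theta> \<theta> (last l)" "butlast (map (map_prod \<theta> \<theta>) l) = map (map_prod \<theta> \<theta>) (butlast l)"
    "jumps d (map_prod \<theta> \<theta> (last l)) \<longleftrightarrow> jumps ?e (last l)"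
    if "l \<in> Field (Ars (replicate (Suc n) m'))" for l
    using Field_last[OF that] j by (auto simp: last_map map_butlast)
  note si = K_op_simps[OF \<theta>] op_Ars[OF \<theta>] Delta_mono[OF \<theta>] Delta_le[OF \<theta>] K_str_simps Field_last Ars_last
  have lo: "kob ?l i l = (if jumps ?e (last l) then kob x (\<theta> i) (map (map_prod \<theta> \<theta>) (butlast l)) else Zero C)"
    if "i \<le> m'" "l \<in> Field (Ars (replicate (Suc n) m'))" for i l
    using that by (simp add: si g)
  have la: "kar ?l i l l' = (if jumps ?e (last l) \<and> jumps ?e (last l')
      then kar x (\<theta> i) (map (map_prod \<theta> \<theta>) (butlast l)) (map (map_prod \<theta> \<theta>) (butlast l'))
      else zero_arr C (kob ?l i l) (kob ?l i l'))"
    if "i \<le> m'" and l: "(l, l') \<in> Ars (replicate (Suc n) m')" for i l l'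
    using that preordD(1,2)[OF preord_Ars l] by (simp add: si g)
  have lw: "kwe ?l i j l = (if jumps ?e (last l) then kwe x (\<theta> i) (\<theta> j) (map (map_prod \<theta> \<theta>) (butlast l)) else Ident C (Zero C))"
    if "i \<le> j" "j \<le> m'" "l \<in> Field (Ars (replicate (Suc n) m'))" for i j l
    using that by (simp add: si g)
  show ?thesis
  proof (cases "?e ` {..m'} = {..1}")
    case True
    let ?r = "K_str C n m' (K_op n m' m \<theta> x) (Some [?e])"
    have rc: "?r \<in> Spx (K C) (Suc n) m'"
      using K_closed(4)[OF K_closed(2)[OF \<theta> x], of "Some [?e]"] e True by (simp add: sphere_iff)
    have ro: "kob ?r i l = kob ?l i l" if "i \<le> m'" "l \<in> Field (Ars (replicate (Suc n) m'))" for i l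
      using that lo[OF that] by (simp add: si)
    have "?l = ?r"
    proof (rule K_eqI[OF lc rc])
      show "kar ?l i l l' = kar ?r i l l'" if "i \<le> m'" and l: "(l, l') \<in> Ars (replicate (Suc n) m')" for i l l'
        using la[OF that] that ro preordD(1,2)[OF preord_Ars l] by (simp add: K_str_simps(2)) (simp add: si)
      show "kwe ?l i j l = kwe ?r i j l" if "i \<le> j" "j \<le> m'" "l \<in> Field (Ars (replicate (Suc n) m'))" for i j l
        using that by (simp add: lw[OF that] K_str_simps(3)) (simp add: si)
    qed (simp add: ro)
    then show ?thesis using True 2 by (simp add: sphere_op_simps)
  next
    case False
    have n: "\<not> jumps ?e y" if "y \<in> Field (Ar m')" for y
      using jumps_surj[OF e, of "fst y" "snd y"] that False by (cases y) (auto simp: Field_Ar)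
    have nl: "\<not> jumps ?e (last l)" if "l \<in> Field (Ars (replicate (Suc n) m'))" for l using n Field_last[OF that] by blast
    have "?l = K_pt C (Suc n) m'"
    proof (rule K_eqI[OF lc K_closed(1)])
      show "kob ?l i l = kob (K_pt C (Suc n) m') i l" if "i \<le> m'" "l \<in> Field (Ars (replicate (Suc n) m'))" for i l
        using that nl by (simp add: lo K_pt_simps)
      show "kar ?l i l l' = kar (K_pt C (Suc n) m') i l l'" if "i \<le> m'" and l: "(l, l') \<in> Ars (replicate (Suc n) m')" for i l l'
        using that nl preordD(1,2)[OF preord_Ars l] by (simp add: la lo K_pt_simps zero_arr_Zero_Zero)
      show "kwe ?l i j l = kwe (K_pt C (Suc n) m') i j l" if "i \<le> j" "j \<le> m'" "l \<in> Field (Ars (replicate (Suc n) m'))" for i j l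
        using that nl by (simp add: lw K_pt_simps)
    qed
    then show ?thesis using False 2 by (simp add: sphere_op_simps K_str_def)
  qed
qed

lemma sigma_K_None: "sigma (K C) p k m x None = K_pt C (p + k) m"
  by (simp add: sigma_def K_sel)

lemma sigma_K:
  assumes "x \<in> Spx (K C) p m" "Some ds \<in> sphere k m"
  shows "i \<le> m \<Longrightarrow> xs \<in> Field (Ars (replicate (p + k) m)) \<Longrightarrow>
       kob (sigma (K C) p k m x (Some ds)) i xs = (if alljump p ds xs then kob x i (take p xs) else Zero C)"
    "i \<le> m \<Longrightarrow> (xs, ys) \<in> Ars (replicate (p + k) m) \<Longrightarrow>
       kar (sigma (K C) p k m x (Some ds)) i xs ys = (if alljump p ds xs \<and> alljump p ds ys then kar x i (take p xs) (take p ys)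
         else zero_arr C (kob (sigma (K C) p k m x (Some ds)) i xs) (kob (sigma (K C) p k m x (Some ds)) i ys))"
    "i \<le> j \<Longrightarrow> j \<le> m \<Longrightarrow> xs \<in> Field (Ars (replicate (p + k) m)) \<Longrightarrow>
       kwe (sigma (K C) p k m x (Some ds)) i j xs = (if alljump p ds xs then kwe x i j (take p xs) else Ident C (Zero C))"
proof -
  have k: "k = length ds" "Some ds \<in> sphere (length ds) m" using assms(2) by (auto simp: sphere_iff)
  show "i \<le> m \<Longrightarrow> xs \<in> Field (Ars (replicate (p + k) m)) \<Longrightarrow>
       kob (sigma (K C) p k m x (Some ds)) i xs = (if alljump p ds xs then kob x i (take p xs) else Zero C)"
    using str_list_K(2)[OF assms(1) k(2)] unfolding sigma_def k(1) by simp
  show "i \<le> m \<Longrightarrow> (xs, ys) \<in> Ars (replicate (p + k) m) \<Longrightarrow>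
       kar (sigma (K C) p k m x (Some ds)) i xs ys = (if alljump p ds xs \<and> alljump p ds ys then kar x i (take p xs) (take p ys)
         else zero_arr C (kob (sigma (K C) p k m x (Some ds)) i xs) (kob (sigma (K C) p k m x (Some ds)) i ys))"
    using str_list_K(3)[OF assms(1) k(2)] unfolding sigma_def k(1) by simp
  show "i \<le> j \<Longrightarrow> j \<le> m \<Longrightarrow> xs \<in> Field (Ars (replicate (p + k) m)) \<Longrightarrow>
       kwe (sigma (K C) p k m x (Some ds)) i j xs = (if alljump p ds xs then kwe x i j (take p xs) else Ident C (Zero C))"
    using str_list_K(4)[OF assms(1) k(2)] unfolding sigma_def k(1) by simp
qed

lemma sigma_K_closed: "x \<in> Spx (K C) p m \<Longrightarrow> s \<in> sphere k m \<Longrightarrow> sigma (K C) p k m x s \<in> Spx (K C) (p + k) m"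
proof (cases s)
  case None
  then show ?thesis using K_closed(1) sigma_K_None by simp
next
  case (Some ds)
  assume "x \<in> Spx (K C) p m" "s \<in> sphere k m"
  then show ?thesis using str_list_K(1)[of x p m ds] Some by (simp add: sigma_def sphere_iff)
qed

lemma K_act_pt: "\<pi> permutes {..<q} \<Longrightarrow> K_act q m \<pi> (K_pt C q m) = K_pt C q m"
  by (rule K_eqI[OF K_closed(3)[OF _ K_closed(1)] K_closed(1)])
    (simp_all add: K_act_simps K_pt_simps reindex_Ars)

text \<open>By \<open>K_eqI\<close>, equality of simplices reduces to the formulas for their values.\<close>

lemma symmetric_spectrum_K: "symmetric_spectrum (K C)"
proof (unfold_locales, unfold K_sel)
  show "K_pt C n m \<in> Spx (K C) n m" for n m by (rule K_closed(1))
  show op_closed: "K_op n m' m \<theta> x \<in> Spx (K C) n m'" if "\<theta> \<in> Delta m' m" "x \<in> Spx (K C) n m" for n m m' \<theta> x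
    by (rule K_closed(2)[OF that])
  show "K_op n m m (restrict id {..m}) x = x" if x: "x \<in> Spx (K C) n m" for x n m
  proof -
    have \<theta>: "restrict id {..m} \<in> Delta m m" by (auto simp: Delta_def mono_on_def)
    have e: "map (map_prod (restrict id {..m}) (restrict id {..m})) xs = xs" if "xs \<in> Field (Ars (replicate n m))" for xs
      by (rule nth_equalityI) (use that in \<open>auto simp: Field_Ars_replicate Field_Ar map_prod_def split_beta prod_eq_iff
          , (metis Field_Ar order_trans prod.collapse)+\<close>)
    show ?thesis
      by (rule K_eqI[OF op_closed[OF \<theta> x] x])
        (use preordD(1,2)[OF preord_Ars] in \<open>auto simp: K_op_simps[OF \<theta>] e\<close>)
  qed
  show "K_op n m'' m (compose {..m''} \<theta> \<theta>') x = K_op n m'' m' \<theta>' (K_op n m' m \<theta> x)"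
    if \<theta>: "\<theta> \<in> Delta m' m" and \<theta>': "\<theta>' \<in> Delta m'' m'" and x: "x \<in> Spx (K C) n m" for \<theta> m' m \<theta>' m'' x n
  proof -
    note c = Delta_compose[OF \<theta> \<theta>']
    have e: "map (map_prod (compose {..m''} \<theta> \<theta>') (compose {..m''} \<theta> \<theta>')) xs
      = map (map_prod \<theta> \<theta>) (map (map_prod \<theta>' \<theta>') xs)" if "xs \<in> Field (Ars (replicate n m''))" for xs
    proof (rule nth_equalityI)
      fix r assume r: "r < length (map (map_prod (compose {..m''} \<theta> \<theta>') (compose {..m''} \<theta> \<theta>')) xs)"
      then have "xs ! r \<in> Field (Ar m'')" using that by (auto simp: Field_Ars_replicate)
      then show "map (map_prod (compose {..m''} \<theta> \<theta>') (compose {..m''} \<theta> \<theta>')) xs ! r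
        = map (map_prod \<theta> \<theta>) (map (map_prod \<theta>' \<theta>') xs) ! r"
        using r by (cases "xs ! r") (auto simp: Field_Ar compose_def)
    qed simp
    have ce: "i \<le> m'' \<Longrightarrow> compose {..m''} \<theta> \<theta>' i = \<theta> (\<theta>' i)" for i by (simp add: compose_def)
    show ?thesis
      by (rule K_eqI[OF op_closed[OF c x] op_closed[OF \<theta>' op_closed[OF \<theta> x]]])
        (use preordD(1,2)[OF preord_Ars] in \<open>simp_all add: K_op_simps[OF c] K_op_simps[OF \<theta>] K_op_simps[OF \<theta>'] op_Ars[OF \<theta>']
            Delta_mono[OF \<theta>'] Delta_le[OF \<theta>'] e ce del: map_map\<close>)
  qed
  show "K_op n m' m \<theta> (K_pt C n m) = K_pt C n m'" if \<theta>: "\<theta> \<in> Delta m' m" for \<theta> m' m n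
    by (rule K_eqI[OF op_closed[OF \<theta> K_closed(1)] K_closed(1)])
      (simp_all add: K_op_simps[OF \<theta>] K_pt_simps op_Ars[OF \<theta>] Delta_mono[OF \<theta>] Delta_le[OF \<theta>])
  show act_closed: "K_act n m \<pi> x \<in> Spx (K C) n m" if "\<pi> \<in> Sym n" "x \<in> Spx (K C) n m" for \<pi> n x m
    using K_closed(3) that by (simp add: Sym_def)
  show "K_act n m id x = x" if x: "x \<in> Spx (K C) n m" for x n m
  proof -
    have e: "reindex n id xs = xs" if "xs \<in> Field (Ars (replicate n m))" for xs
      by (rule nth_equalityI) (use that in \<open>auto simp: Field_Ars_replicate\<close>)
    show ?thesis
      by (rule K_eqI[OF K_closed(3)[OF permutes_id x] x])
        (use preordD(1,2)[OF preord_Ars] in \<open>auto simp: K_act_simps e\<close>)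
  qed
  show "K_act n m (\<pi> \<circ> \<rho>) x = K_act n m \<pi> (K_act n m \<rho> x)"
    if "\<pi> \<in> Sym n" "\<rho> \<in> Sym n" and x: "x \<in> Spx (K C) n m" for \<pi> \<rho> x n m
  proof -
    have p: "\<pi> permutes {..<n}" "\<rho> permutes {..<n}" using that by (auto simp: Sym_def)
    show ?thesis
      by (rule K_eqI[OF K_closed(3)[OF permutes_compose[OF p(2,1)] x] K_closed(3)[OF p(1) K_closed(3)[OF p(2) x]]])
        (simp_all add: K_act_simps reindex_Ars[OF p(1)] reindex_reindex[OF p(2)])
  qed
  show "K_act n m \<pi> (K_pt C n m) = K_pt C n m" if "\<pi> \<in> Sym n" for \<pi> n m
    using K_act_pt that by (simp add: Sym_def)
  show "K_act n m' \<pi> (K_op n m' m \<theta> x) = K_op n m' m \<theta> (K_act n m \<pi> x)"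
    if "\<pi> \<in> Sym n" and \<theta>: "\<theta> \<in> Delta m' m" and x: "x \<in> Spx (K C) n m" for \<pi> n \<theta> m' m x
  proof -
    have p: "\<pi> permutes {..<n}" using that by (simp add: Sym_def)
    have e: "reindex n \<pi> (map (map_prod \<theta> \<theta>) xs) = map (map_prod \<theta> \<theta>) (reindex n \<pi> xs)"
      if "xs \<in> Field (Ars (replicate n m'))" for xs
      by (rule nth_equalityI) (use that permutes_less[OF p] in \<open>auto simp: Field_Ars_replicate\<close>)
    show ?thesis
      by (rule K_eqI[OF K_closed(3)[OF p op_closed[OF \<theta> x]] op_closed[OF \<theta> K_closed(3)[OF p x]]])
        (use preordD(1,2)[OF preord_Ars] in \<open>simp_all add: K_act_simps K_op_simps[OF \<theta>] reindex_Ars[OF p] op_Ars[OF \<theta>]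
            Delta_mono[OF \<theta>] Delta_le[OF \<theta>] e\<close>)
  qed
  show "K_str C n m x s \<in> Spx (K C) (Suc n) m" if "x \<in> Spx (K C) n m" "s \<in> sphere 1 m" for x n m s
    by (rule K_closed(4)[OF that])
  show "K_str C n m (K_pt C n m) s = K_pt C (Suc n) m" if s: "s \<in> sphere 1 m" for s n m
    using s
  proof (cases rule: sphere_1E)
    case 1
    then show ?thesis by (simp add: K_str_def)
  next
    case (2 d)
    have o: "kob (K_str C n m (K_pt C n m) (Some [d])) i l = Zero C"
      if "i \<le> m" "l \<in> Field (Ars (replicate (Suc n) m))" for i l
      using that by (simp add: K_str_simps(1) K_pt_simps Field_last)
    have "K_str C n m (K_pt C n m) (Some [d]) = K_pt C (Suc n) m"
    proof (rule K_eqI[OF K_closed(4)[OF K_closed(1) s, unfolded 2(1)] K_closed(1)])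
      show "kar (K_str C n m (K_pt C n m) (Some [d])) i l l' = kar (K_pt C (Suc n) m) i l l'"
        if i: "i \<le> m" and l: "(l, l') \<in> Ars (replicate (Suc n) m)" for i l l'
        using i l o preordD(1,2)[OF preord_Ars l] Ars_last(1)[OF l]
        by (simp add: K_str_simps(2)[OF i l] K_pt_simps zero_arr_Zero_Zero)
    qed (simp_all add: o K_str_simps(3) K_pt_simps Field_last)
    then show ?thesis using 2 by simp
  qed
  show "K_str C n m x None = K_pt C (Suc n) m" for x n m by (simp add: K_str_def)
  show "K_op (Suc n) m' m \<theta> (K_str C n m x s) = K_str C n m' (K_op n m' m \<theta> x) (sphere_op m' \<theta> s)"
    if "\<theta> \<in> Delta m' m" "x \<in> Spx (K C) n m" "s \<in> sphere 1 m" for \<theta> m' m x n s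
    by (rule K_str_op[OF that])
  show "sigma (K C) n k m (K_act n m a x) (sphere_act k b s) = K_act (n + k) m (block_sum n a b) (sigma (K C) n k m x s)"
    if "a \<in> Sym n" "b \<in> Sym k" and x: "x \<in> Spx (K C) n m" and s: "s \<in> sphere k m" for a n b k x m s
  proof -
    have p: "a permutes {..<n}" "b permutes {..<k}" using that by (auto simp: Sym_def)
    note bs = block_sum_permutes[OF p]
    show ?thesis
    proof (cases s)
      case None
      then show ?thesis using K_act_pt[OF bs] by (simp add: sphere_act_def sigma_K_None)
    next
      case (Some ds)
      let ?es = "map (\<lambda>r. ds ! inv b r) [0..<k]"
      have ds: "Some ds \<in> sphere k m" "length ds = k" using s Some by (auto simp: sphere_iff)
      have es: "sphere_act k b s = Some ?es" "Some ?es \<in> sphere k m" using sphere_act_Some[OF ds(1) p(2)] Some by auto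
      note ax = K_closed(3)[OF p(1) x]
      note L = sigma_K[OF ax es(2)] and R = sigma_K[OF x ds(1)]
      note aj = alljump_block_sum[OF p(2) ds(2), of n _ a]
      have t: "take n (reindex (n + k) (block_sum n a b) xs) = reindex n a (take n xs)" if "xs \<in> Field (Ars (replicate (n + k) m))" for xs
        using that by (intro take_reindex_block_sum[OF p(1)]) (simp add: Field_Ars_replicate)
      let ?l = "sigma (K C) n k m (K_act n m a x) (Some ?es)" and ?r = "K_act (n + k) m (block_sum n a b) (sigma (K C) n k m x (Some ds))"
      have o: "kob ?l i xs = kob ?r i xs" if "i \<le> m" "xs \<in> Field (Ars (replicate (n + k) m))" for i xs
        using that by (simp add: L(1) K_act_simps R(1) reindex_Ars[OF bs] aj t take_Ars)
      have "?l = ?r"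
      proof (rule K_eqI[OF sigma_K_closed[OF ax es(2)] K_closed(3)[OF bs sigma_K_closed[OF x ds(1)]] o])
        show "kar ?l i xs ys = kar ?r i xs ys" if i: "i \<le> m" and xy: "(xs, ys) \<in> Ars (replicate (n + k) m)" for i xs ys
        proof -
          note F = preordD(1,2)[OF preord_Ars xy]
          have "kar ?l i xs ys = (if alljump n ?es xs \<and> alljump n ?es ys then kar (K_act n m a x) i (take n xs) (take n ys)
            else zero_arr C (kob ?r i xs) (kob ?r i ys))"
            using L(2)[OF i xy] o[OF i F(1)] o[OF i F(2)] by simp
          also have "\<dots> = kar ?r i xs ys"
            using i xy F by (simp add: K_act_simps R(2) reindex_Ars[OF bs] aj t take_Ars)
          finally show ?thesis .
        qed
        show "kwe ?l i j xs = kwe ?r i j xs" if "i \<le> j" "j \<le> m" "xs \<in> Field (Ars (replicate (n + k) m))" for i j xs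
          using that by (simp add: L(3) K_act_simps R(3) reindex_Ars[OF bs] aj t take_Ars)
      qed
      then show ?thesis using es(1) Some by simp
    qed
  qed
qed

end

section \<open>Latching objects\<close>

abbreviation "tsph \<equiv> truncated_sphere_spectrum"

lemma tsph_sel:
  "Spx tsph n m = (if n = 0 then {None} else sphere n m)" "pt tsph n m = None"
  "act tsph n m = sphere_act n"
  "str tsph n m s t = (case (s, t) of (Some ds, Some es) \<Rightarrow> Some (ds @ es) | _ \<Rightarrow> None)"
  by (simp_all add: truncated_sphere_spectrum_def sphere_spectrum_def)

lemma tsph_sphere: "y \<in> Spx tsph q m \<Longrightarrow> y \<in> sphere q m"
  by (auto simp: tsph_sel sphere_def split: if_splits)

lemma str_list_tsph: "str_list tsph r m y es = map_option (\<lambda>ds. ds @ es) y"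
  by (induction es arbitrary: r y) (auto simp: tsph_sel option.map_comp option.map_ident comp_def split: option.splits)

lemma inv_block_swap: "inv (block_swap p q) = block_swap q p"
  by (rule inv_unique_comp) (auto simp: block_swap_def fun_eq_iff)

text \<open>The block permutation moves the new coordinates, which the structure map appends, to the front.\<close>

lemma left_sigma_tsph:
  assumes "s \<in> sphere k m" "y \<in> sphere r m"
  shows "left_sigma tsph k r m s y = (case (s, y) of (Some es, Some ds) \<Rightarrow> Some (es @ ds) | _ \<Rightarrow> None)"
proof (cases "s = None \<or> y = None")
  case True
  then show ?thesis
    by (auto simp: left_sigma_def sigma_def str_list_tsph tsph_sel sphere_act_def split: option.splits)
next
  case False
  then obtain es ds where s: "s = Some es" "y = Some ds" by auto
  have l: "length es = k" "length ds = r" using assms s by (auto simp: sphere_iff)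
  have "map (\<lambda>i. (ds @ es) ! block_swap k r i) [0..<k + r] = es @ ds"
    by (rule nth_equalityI) (auto simp: l block_swap_def nth_append)
  then show ?thesis using s
    by (simp add: left_sigma_def sigma_def str_list_tsph tsph_sel sphere_act_def inv_block_swap)
qed

lemma str_list_append: "str_list X p m x (ds @ es) = str_list X (p + length ds) m (str_list X p m x ds) es"
  by (induction ds arbitrary: p x) auto

text \<open>On representatives, the isomorphism \<open>X \<and> \<S> \<cong> X\<close>.\<close>

definition val :: "'a symspec \<Rightarrow> nat \<Rightarrow> nat \<Rightarrow> ('a, sph) smash_tuple \<Rightarrow> 'a" where
  "val X n m = (\<lambda>(p, q, \<gamma>, x, s). act X n m \<gamma> (sigma X p q m x s))"

context symmetric_spectrum
begin

lemma str_list_closed: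
  "x \<in> Spx X p m \<Longrightarrow> Some ds \<in> sphere (length ds) m \<Longrightarrow> str_list X p m x ds \<in> Spx X (p + length ds) m"
proof (induction ds arbitrary: p x)
  case (Cons d ds)
  have "Some [d] \<in> sphere 1 m" "Some ds \<in> sphere (length ds) m" using Cons.prems(2) by (auto simp: sphere_iff)
  then show ?case using Cons.IH[OF str_closed[OF Cons.prems(1)]] by simp
qed simp

lemma str_list_pt: "Some ds \<in> sphere (length ds) m \<Longrightarrow> str_list X p m (pt X p m) ds = pt X (p + length ds) m"
proof (induction ds arbitrary: p)
  case (Cons d ds)
  have "Some [d] \<in> sphere 1 m" "Some ds \<in> sphere (length ds) m" using Cons.prems by (auto simp: sphere_iff)
  then show ?case using Cons.IH[of "Suc p"] str_pt_left by simp
qed simp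

lemma sigma_closed: "x \<in> Spx X p m \<Longrightarrow> s \<in> sphere k m \<Longrightarrow> sigma X p k m x s \<in> Spx X (p + k) m"
  using pt_closed str_list_closed by (cases s) (auto simp: sigma_def sphere_iff)

lemma sigma_pt: "s \<in> sphere k m \<Longrightarrow> sigma X p k m (pt X p m) s = pt X (p + k) m"
  using str_list_pt by (cases s) (auto simp: sigma_def sphere_iff)

lemma sigma_assoc:
  assumes "x \<in> Spx X p m" "s \<in> sphere k m" "y \<in> sphere r m"
  shows "sigma X (p + k) r m (sigma X p k m x s) y = sigma X p (k + r) m x (left_sigma tsph k r m s y)"
  unfolding left_sigma_tsph[OF assms(2,3)]
  using assms sigma_pt[OF assms(3), of "p + k"]
  by (auto simp: sigma_def str_list_append sphere_iff add.assoc split: option.splits)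

lemma val_cong: "smash_rel X tsph n m t t' \<Longrightarrow> val X n m t = val X n m t'"
proof (induction rule: smash_rel.induct)
  case (equivariant p q \<gamma> a b x y)
  have "a permutes {..<p}" "b permutes {..<q}" using equivariant by (auto simp: Sym_def)
  then have "block_sum p a b \<in> Sym (p + q)" using block_sum_permutes by (simp add: Sym_def)
  then have "act X n m (\<gamma> \<circ> block_sum p a b) (sigma X p q m x y) =
      act X n m \<gamma> (act X n m (block_sum p a b) (sigma X p q m x y))"
    using equivariant tsph_sphere sigma_closed by (intro act_comp) auto
  also have "act X n m (block_sum p a b) (sigma X p q m x y) = sigma X p q m (act X p m a x) (act tsph q m b y)"
    using sigma_equivariant[of a p b q x m y] equivariant tsph_sphere[OF equivariant(6)] by (simp add: tsph_sel)
  finally show ?case by (simp add: val_def comp_def)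
next
  case (balanced p k r \<gamma> x s y)
  then show ?case using sigma_assoc[OF _ _ tsph_sphere] by (simp add: val_def add.assoc)
next
  case (pointed p q \<gamma> x y p' q' \<gamma>' x' y')
  have *: "val X n m (p, q, \<gamma>, x, y) = pt X n m"
    if "(p, q, \<gamma>, x, y) \<in> smash_tuples X tsph n m" "x = pt X p m \<or> y = pt tsph q m" for p q \<gamma> x y
    using that sigma_pt[OF tsph_sphere] act_pt by (auto simp: val_def smash_tuples_def tsph_sel(2) sigma_def[of X p q m x None])
  show ?case using *[OF pointed(1,2)] *[OF pointed(3,4)] by simp
qed

lemma val_equivclp: "equivclp (smash_rel X tsph n m) t t' \<Longrightarrow> val X n m t = val X n m t'"
  by (induction rule: equivclp_induct) (auto dest: val_cong)

lemma smash_rel_tuples: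
  assumes "smash_rel X tsph n m t t'"
  shows "t \<in> smash_tuples X tsph n m" "t' \<in> smash_tuples X tsph n m"
proof -
  have "t \<in> smash_tuples X tsph n m \<and> t' \<in> smash_tuples X tsph n m"
    using assms
  proof (induction rule: smash_rel.induct)
    case (equivariant p q \<gamma> a b x y)
    have p: "a permutes {..<p}" "b permutes {..<q}" "\<gamma> permutes {..<n}" using equivariant by (auto simp: Sym_def)
    then have "\<gamma> \<circ> block_sum p a b \<in> Sym n"
      using block_sum_permutes[OF p(1,2)] equivariant(1) permutes_compose[OF _ p(3)] by (simp add: Sym_def)
    moreover have "act tsph q m b y \<in> Spx tsph q m"
      using equivariant(6) sphere_act_Some[OF _ p(2)]
      by (cases y) (auto simp: tsph_sel sphere_act_def sphere_def split: if_splits)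
    ultimately show ?case using equivariant act_closed by (simp add: smash_tuples_def)
  next
    case (balanced p k r \<gamma> x s y)
    have "left_sigma tsph k r m s y \<in> Spx tsph (k + r) m"
    proof (cases "s = None \<or> y = None")
      case True
      then show ?thesis unfolding left_sigma_tsph[OF balanced(4) tsph_sphere[OF balanced(5)]]
        by (auto simp: tsph_sel sphere_def split: option.splits)
    next
      case False
      then obtain es ds where s: "s = Some es" "y = Some ds" by auto
      then have "r \<noteq> 0" using balanced(5) by (auto simp: tsph_sel split: if_splits)
      then show ?thesis unfolding left_sigma_tsph[OF balanced(4) tsph_sphere[OF balanced(5)]]
        using balanced(4) tsph_sphere[OF balanced(5)] unfolding s by (auto simp: tsph_sel sphere_iff)
    qed
    then show ?case using balanced sigma_closed by (simp add: smash_tuples_def)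
  next
    case (pointed p q \<gamma> x y p' q' \<gamma>' x' y')
    then show ?case by simp
  qed
  then show "t \<in> smash_tuples X tsph n m" "t' \<in> smash_tuples X tsph n m" by auto
qed

lemma latching_map_class:
  "latching_map X n m {t'. equivclp (smash_rel X tsph n m) t t'} = val X n m t"
proof -
  have "val X n m ` {t'. equivclp (smash_rel X tsph n m) t t'} = {val X n m t}"
  proof
    show "val X n m ` {t'. equivclp (smash_rel X tsph n m) t t'} \<subseteq> {val X n m t}"
    proof
      fix v assume "v \<in> val X n m ` {t'. equivclp (smash_rel X tsph n m) t t'}"
      then obtain t' where "equivclp (smash_rel X tsph n m) t t'" "v = val X n m t'" by blast
      then show "v \<in> {val X n m t}" using val_equivclp[of n m t t'] by simp
    qed
  qed auto
  then show ?thesis unfolding latching_map_def val_def by simp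
qed

lemma latching_image: "latching_map X n m ` latching X n m = val X n m ` smash_tuples X tsph n m"
proof -
  have "latching X n m = (\<lambda>t. {t'. equivclp (smash_rel X tsph n m) t t'}) ` smash_tuples X tsph n m"
    by (auto simp: latching_def smash_def quotient_def)
  then show ?thesis by (simp add: image_image latching_map_class)
qed

text \<open>Flatness says that a tuple is determined by its value, up to the relation.\<close>

lemma flatI:
  assumes "\<And>n m t t'. \<lbrakk>t \<in> smash_tuples X tsph n m; t' \<in> smash_tuples X tsph n m; val X n m t = val X n m t'\<rbrakk>
    \<Longrightarrow> equivclp (smash_rel X tsph n m) t t'"
  shows "flat X"
  unfolding flat_def
proof (intro allI inj_onI)
  fix n m c c'
  assume c: "c \<in> latching X n m" "c' \<in> latching X n m" and e: "latching_map X n m c = latching_map X n m c'"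
  let ?R = "equivclp (smash_rel X tsph n m)"
  obtain t t' where t: "t \<in> smash_tuples X tsph n m" "t' \<in> smash_tuples X tsph n m"
    "c = {u. ?R t u}" "c' = {u. ?R t' u}"
    using c unfolding latching_def smash_def quotient_def by auto
  then have "?R t t'" using assms e latching_map_class by metis
  then show "c = c'" unfolding t(3,4) by (auto intro: equivclp_trans equivclp_sym)
qed

end

section \<open>Concentrated simplices\<close>

text \<open>A simplex is concentrated at position \<open>r\<close> along \<open>d\<close> if it is, up to a permutation moving \<open>r\<close>
  to the end, the image of some simplex and of \<open>d\<close> under the structure map. As \<open>(0, m)\<close> contains the
  jump of any surjection \<open>d\<close>, that simplex has to be the restriction to \<open>(0, m)\<close> in this direction.\<close>

definition concentrated :: "('o, 'm) wcat \<Rightarrow> nat \<Rightarrow> nat \<Rightarrow> ('o, 'm) K_simplex \<Rightarrow> nat \<Rightarrow> (nat \<Rightarrow> nat) \<Rightarrow> bool" where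
  "concentrated C n m y r d \<longleftrightarrow>
     (\<forall>i \<le> m. \<forall>xs \<in> Field (Ars (replicate n m)).
        kob y i xs = (if jumps d (xs ! r) then kob y i (xs[r := (0, m)]) else Zero C)) \<and>
     (\<forall>i \<le> m. \<forall>(xs, ys) \<in> Ars (replicate n m).
        kar y i xs ys = (if jumps d (xs ! r) \<and> jumps d (ys ! r) then kar y i (xs[r := (0, m)]) (ys[r := (0, m)])
          else zero_arr C (kob y i xs) (kob y i ys))) \<and>
     (\<forall>i j. i \<le> j \<longrightarrow> j \<le> m \<longrightarrow> (\<forall>xs \<in> Field (Ars (replicate n m)).
        kwe y i j xs = (if jumps d (xs ! r) then kwe y i j (xs[r := (0, m)]) else Ident C (Zero C))))"

lemma concentratedD:
  assumes "concentrated C n m y r d"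
  shows "\<lbrakk>i \<le> m; xs \<in> Field (Ars (replicate n m))\<rbrakk> \<Longrightarrow>
        kob y i xs = (if jumps d (xs ! r) then kob y i (xs[r := (0, m)]) else Zero C)"
    "\<lbrakk>i \<le> m; (xs, ys) \<in> Ars (replicate n m)\<rbrakk> \<Longrightarrow>
        kar y i xs ys = (if jumps d (xs ! r) \<and> jumps d (ys ! r) then kar y i (xs[r := (0, m)]) (ys[r := (0, m)])
          else zero_arr C (kob y i xs) (kob y i ys))"
    "\<lbrakk>i \<le> j; j \<le> m; xs \<in> Field (Ars (replicate n m))\<rbrakk> \<Longrightarrow>
        kwe y i j xs = (if jumps d (xs ! r) then kwe y i j (xs[r := (0, m)]) else Ident C (Zero C))"
  using assms unfolding concentrated_def by fast+

lemma concentratedI: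
  assumes "\<And>i xs. \<lbrakk>i \<le> m; xs \<in> Field (Ars (replicate n m))\<rbrakk> \<Longrightarrow>
        kob y i xs = (if jumps d (xs ! r) then kob y i (xs[r := (0, m)]) else Zero C)"
    "\<And>i xs ys. \<lbrakk>i \<le> m; (xs, ys) \<in> Ars (replicate n m)\<rbrakk> \<Longrightarrow>
        kar y i xs ys = (if jumps d (xs ! r) \<and> jumps d (ys ! r) then kar y i (xs[r := (0, m)]) (ys[r := (0, m)])
          else zero_arr C (kob y i xs) (kob y i ys))"
    "\<And>i j xs. \<lbrakk>i \<le> j; j \<le> m; xs \<in> Field (Ars (replicate n m))\<rbrakk> \<Longrightarrow>
        kwe y i j xs = (if jumps d (xs ! r) then kwe y i j (xs[r := (0, m)]) else Ident C (Zero C))"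
  shows "concentrated C n m y r d"
  using assms unfolding concentrated_def by blast

definition surj1 :: "nat \<Rightarrow> (nat \<Rightarrow> nat) \<Rightarrow> bool" where
  "surj1 m d \<longleftrightarrow> d \<in> Delta m 1 \<and> d ` {..m} = {..1}"

lemma sphere_surj1: "Some ds \<in> sphere k m \<longleftrightarrow> length ds = k \<and> (\<forall>d \<in> set ds. surj1 m d)"
  by (simp add: sphere_iff surj1_def)

lemma surj1_ends: assumes "surj1 m d" shows "d 0 = 0" "d m = 1"
proof -
  have d: "d \<in> Delta m 1" "d ` {..m} = {..1}" using assms by (auto simp: surj1_def)
  have "0 \<in> d ` {..m}" "1 \<in> d ` {..m}" unfolding d(2) by auto
  then obtain i j where "i \<le> m" "d i = 0" "j \<le> m" "d j = 1" by auto
  then show "d 0 = 0" "d m = 1" using Delta_mono[OF d(1), of 0 i] Delta_mono[OF d(1), of j m] by auto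
qed

lemma surj1_jumps: "surj1 m d \<Longrightarrow> jumps d (0, m)"
  using surj1_ends by (simp add: jumps_def)

text \<open>The jump of \<open>d\<close> is the elementary interval which tells \<open>d\<close> from all other surjections.\<close>

lemma surj1_cell:
  assumes d: "surj1 m d"
  obtains e where "e < m" "jumps d (e, Suc e)" "\<And>d'. surj1 m d' \<Longrightarrow> jumps d' (e, Suc e) \<Longrightarrow> d' = d"
proof -
  define e where "e = (LEAST e. d e = 1)"
  have e: "d e = 1" "e \<le> m" "\<And>i. i < e \<Longrightarrow> d i \<noteq> 1"
    unfolding e_def using surj1_ends[OF d] by (auto intro: LeastI Least_le dest: not_less_Least)
  have "e \<noteq> 0" using e surj1_ends[OF d] by (metis zero_neq_one)
  then obtain e' where e': "e = Suc e'" by (cases e) auto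
  have D: "d \<in> Delta m 1" using d by (simp add: surj1_def)
  have v: "d i = (if i \<le> e' then 0 else 1)" if "i \<le> m" for i
    using e(3)[of i] Delta_le[OF D that] Delta_mono[OF D, of e i] e(1) that e' by (auto simp: less_Suc_eq_le)
  show ?thesis
  proof (rule that[of e'])
    show "e' < m" using e(2) e' by simp
    show "jumps d (e', Suc e')" using v e(2) e' by (simp add: jumps_def)
    show "d' = d" if d': "surj1 m d'" and j: "jumps d' (e', Suc e')" for d'
    proof -
      have D': "d' \<in> Delta m 1" using d' by (simp add: surj1_def)
      have "d' i = d i" if "i \<le> m" for i
        using v[OF that] j Delta_mono[OF D', of i e'] Delta_mono[OF D', of "Suc e'" i] Delta_le[OF D' that] that e(2) e'
        by (auto simp: jumps_def not_le Suc_le_eq)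
      then show ?thesis
        using D D' by (intro extensionalityI[of d' "{..m}" d]) (auto simp: Delta_def PiE_def)
    qed
  qed
qed

lemma update_Ars:
  "xs \<in> Field (Ars (replicate n m)) \<Longrightarrow> v \<in> Field (Ar m) \<Longrightarrow> xs[r := v] \<in> Field (Ars (replicate n m))"
  "(xs, ys) \<in> Ars (replicate n m) \<Longrightarrow> v \<in> Field (Ar m) \<Longrightarrow> (xs[r := v], ys[r := v]) \<in> Ars (replicate n m)"
  by (cases "r < length xs";
      auto simp: Field_Ars_replicate Ars_replicate nth_list_update preordD(4)[OF preord_Ar])+

lemma top_Ar: "(0, m) \<in> Field (Ar m)"
  by (simp add: Field_Ar)

context waldhausen_category
begin

lemma K_eq_ptI:
  assumes y: "y \<in> Spx (K C) n m"
    and o: "\<And>i xs. i \<le> m \<Longrightarrow> xs \<in> Field (Ars (replicate n m)) \<Longrightarrow> kob y i xs = Zero C"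
  shows "y = K_pt C n m"
proof (rule K_eqI[OF y K_closed(1)])
  note z = hom_from_Zero_eq[OF _ Ident_hom[OF Zero_Obj]]
  show "kar y i xs ys = kar (K_pt C n m) i xs ys" if "i \<le> m" "(xs, ys) \<in> Ars (replicate n m)" for i xs ys
    using K_simplexD(4)[OF y that] that preordD(1,2)[OF preord_Ars that(2)] z by (simp add: o K_pt_simps)
  show "kwe y i j xs = kwe (K_pt C n m) i j xs" if "i \<le> j" "j \<le> m" "xs \<in> Field (Ars (replicate n m))" for i j xs
    using K_simplexD(5)[OF y that] that z by (simp add: o K_pt_simps)
qed (simp add: o K_pt_simps)

text \<open>On the elementary interval of the jump of \<open>d\<close>, concentration along \<open>d\<close> gives the value at \<open>(0, m)\<close>,
  and concentration along another \<open>d'\<close> gives zero.\<close>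

lemma concentrated_unique:
  assumes y: "y \<in> Spx (K C) n m" and r: "r < n" and c: "concentrated C n m y r d" "concentrated C n m y r d'"
    and d: "surj1 m d" "surj1 m d'" and ne: "y \<noteq> K_pt C n m"
  shows "d = d'"
proof (rule ccontr)
  assume neq: "d \<noteq> d'"
  obtain e where e: "e < m" "jumps d (e, Suc e)" "\<And>d'. surj1 m d' \<Longrightarrow> jumps d' (e, Suc e) \<Longrightarrow> d' = d"
    using surj1_cell[OF d(1)] by metis
  have eF: "(e, Suc e) \<in> Field (Ar m)" using e(1) by (simp add: Field_Ar)
  have nj: "\<not> jumps d' (e, Suc e)" using e(3)[OF d(2)] neq by metis
  have "kob y i xs = Zero C" if i: "i \<le> m" and xs: "xs \<in> Field (Ars (replicate n m))" for i xs
  proof -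
    have l: "r < length xs" using xs r by (simp add: Field_Ars_replicate)
    note xe = update_Ars(1)[OF xs eF, of r]
    have "kob y i (xs[r := (0, m)]) = kob y i (xs[r := (e, Suc e)])"
      using concentratedD(1)[OF c(1) i xe] e(2) l by simp
    also have "\<dots> = Zero C" using concentratedD(1)[OF c(2) i xe] nj l by simp
    finally show ?thesis using concentratedD(1)[OF c(1) i xs] by simp
  qed
  then show False using K_eq_ptI[OF y] ne by blast
qed

end

lemma permutes_block:
  assumes \<beta>: "\<beta> permutes {..<p + q}" and im: "\<beta> ` {p..<p + q} = {p..<p + q}"
  obtains a b where "a permutes {..<p}" "b permutes {..<q}" "\<beta> = block_sum p a b"
proof -
  let ?a = "\<lambda>i. if i < p then \<beta> i else i" and ?b = "\<lambda>i. if i < q then \<beta> (p + i) - p else i"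
  have inj: "\<beta> x = \<beta> y \<longleftrightarrow> x = y" for x y using permutes_inj[OF \<beta>] by (auto dest: injD)
  have hi: "p \<le> \<beta> i \<and> \<beta> i < p + q" if "p \<le> i" "i < p + q" for i
    using im that by (metis atLeastLessThan_iff imageI)
  have lo: "\<beta> i < p" if i: "i < p" for i
  proof (rule ccontr)
    assume "\<not> \<beta> i < p"
    then have "\<beta> i \<in> \<beta> ` {p..<p + q}" using im permutes_less[OF \<beta>, of i] i by auto
    then show False using inj i by auto
  qed
  have "?a permutes {..<p}" by (rule permutes_of_inj) (use lo inj in \<open>auto intro!: inj_onI\<close>)
  moreover have "?b permutes {..<q}"
  proof (rule permutes_of_inj)
    show "inj_on ?b {..<q}"
    proof (rule inj_onI)
      fix i j assume ij: "i \<in> {..<q}" "j \<in> {..<q}" "?b i = ?b j"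
      then have "\<beta> (p + i) = \<beta> (p + j)" using hi[of "p + i"] hi[of "p + j"] by auto
      then show "i = j" using inj by auto
    qed
  next
    fix i assume "i < q" then show "?b i < q" using hi[of "p + i"] by auto
  qed auto
  moreover have "\<beta> = block_sum p ?a ?b"
  proof
    fix i
    consider "i < p" | "p \<le> i" "i < p + q" | "\<not> i < p + q" by linarith
    then show "\<beta> i = block_sum p ?a ?b i"
      by cases (use hi[of i] permutes_not_in[OF \<beta>, of i] in \<open>auto simp: block_sum_def\<close>)
  qed
  ultimately show ?thesis using that by blast
qed

lemma reindex_update:
  assumes "\<pi> permutes {..<n}" "c < n" "length xs = n"
  shows "reindex n \<pi> (xs[\<pi> c := v]) = (reindex n \<pi> xs)[c := v]"
  by (rule nth_equalityI) (use assms permutes_less[OF assms(1)] permutes_inj[OF assms(1)] in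
      \<open>auto simp: nth_list_update dest: injD\<close>)

text \<open>The coordinates \<open>ws\<close> are put at the positions \<open>\<gamma> r\<close> with \<open>r < p\<close>; at the others the interval
  \<open>(0, m)\<close> contains every jump. Evaluation at such a list therefore undoes extensions by zero.\<close>

definition lift :: "nat \<Rightarrow> nat \<Rightarrow> (nat \<Rightarrow> nat) \<Rightarrow> nat \<Rightarrow> (nat \<times> nat) list \<Rightarrow> (nat \<times> nat) list" where
  "lift n p \<gamma> m ws = reindex n (inv \<gamma>) (ws @ replicate (n - p) (0, m))"

lemma lift_props:
  assumes \<gamma>: "\<gamma> permutes {..<n}" and p: "p \<le> n"
  shows "length ws = p \<Longrightarrow> reindex n \<gamma> (lift n p \<gamma> m ws) = ws @ replicate (n - p) (0, m)"
    "ws \<in> Field (Ars (replicate p m)) \<Longrightarrow> lift n p \<gamma> m ws \<in> Field (Ars (replicate n m))"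
    "(ws, ws') \<in> Ars (replicate p m) \<Longrightarrow> (lift n p \<gamma> m ws, lift n p \<gamma> m ws') \<in> Ars (replicate n m)"
    "c < p \<Longrightarrow> length ws = p \<Longrightarrow> lift n p \<gamma> m ws ! \<gamma> c = ws ! c"
    "c < p \<Longrightarrow> length ws = p \<Longrightarrow> lift n p \<gamma> m (ws[c := v]) = (lift n p \<gamma> m ws)[\<gamma> c := v]"
proof -
  note i = permutes_inv[OF \<gamma>]
  show "length ws = p \<Longrightarrow> reindex n \<gamma> (lift n p \<gamma> m ws) = ws @ replicate (n - p) (0, m)"
    unfolding lift_def reindex_reindex[OF \<gamma>] permutes_inv_o(2)[OF \<gamma>]
    by (rule nth_equalityI) (use p in auto)
  show "ws \<in> Field (Ars (replicate p m)) \<Longrightarrow> lift n p \<gamma> m ws \<in> Field (Ars (replicate n m))"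
    unfolding lift_def using p top_Ar
    by (intro reindex_Ars(2)[OF i]) (auto simp: Field_Ars_replicate nth_append)
  show "(ws, ws') \<in> Ars (replicate p m) \<Longrightarrow> (lift n p \<gamma> m ws, lift n p \<gamma> m ws') \<in> Ars (replicate n m)"
    unfolding lift_def using p preordD(4)[OF preord_Ar top_Ar]
    by (intro reindex_Ars(1)[OF i]) (auto simp: Ars_replicate nth_append)
  show "c < p \<Longrightarrow> length ws = p \<Longrightarrow> lift n p \<gamma> m ws ! \<gamma> c = ws ! c"
    using p permutes_less[OF \<gamma>, of c] permutes_inverses(2)[OF \<gamma>, of c] by (simp add: lift_def nth_append)
  show "c < p \<Longrightarrow> length ws = p \<Longrightarrow> lift n p \<gamma> m (ws[c := v]) = (lift n p \<gamma> m ws)[\<gamma> c := v]"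
    using reindex_update[OF i, of "\<gamma> c" "ws @ replicate (n - p) (0, m)" v] p permutes_less[OF \<gamma>, of c]
      permutes_inverses(2)[OF \<gamma>, of c] by (simp add: lift_def list_update_append)
qed

lemma list_update_last: "length l = Suc p \<Longrightarrow> l[p := v] = butlast l @ [v]"
  by (cases l rule: rev_cases) (auto simp: list_update_append)

lemma nth_last: "length l = Suc p \<Longrightarrow> l ! p = last l"
  by (cases l rule: rev_cases) auto

text \<open>By exactness of evaluation, fixing one coordinate of a simplex of \<open>K C\<close> gives a simplex of one level
  less.\<close>

lemma exact_eval:
  assumes D: "cofib_category D" and x: "x \<in> Field (Ar n)"
  shows "exact_functor (S n D) D (\<lambda>A. fst A x) (\<lambda>f. cpt f x)"
proof -
  interpret D: cofib_category D by (rule D)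
  show ?thesis
  proof (rule exactI)
    show "fst A x \<in> Obj D" if "A \<in> Obj (S n D)" for A using is_diagD(3)[OF S_ObjD(1)[OF that] x] .
    show "cpt f x \<in> hom D (fst A x) (fst B x)" if "f \<in> hom (S n D) A B" for f A B using S_hom_comp(1)[OF that x] .
    show "cpt f x \<in> Cofib D" if f: "f \<in> Cofib (S n D)" for f
    proof -
      obtain A B where h: "f \<in> hom (S n D) A B" using f unfolding S_Cofib hom_def by auto
      show ?thesis using D.S_Cofib_pointwise[OF f h, of "fst x" "snd x"] x by (cases x) (auto simp: Field_Ar)
    qed
    show "is_pushout D (cpt f x) (cpt g x) (cpt u x) (cpt v x)"
      if "f \<in> Cofib (S n D)" "is_pushout (S n D) f g u v" for f g u v
      using S_pushoutD[OF D that] x by metis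
  qed (use x in \<open>auto simp: S_Ident S_Comp S_Zero S_Weq const_diag_def\<close>)
qed

context waldhausen_category
begin

text \<open>The simplex \<open>z\<close> is the evaluation of \<open>w\<close> at \<open>(0, m)\<close> in the last direction, which is first moved
  to the front, where currying can split it off.\<close>

lemma concentrated_last:
  assumes w: "w \<in> Spx (K C) (Suc p) m" and c: "concentrated C (Suc p) m w p d" and d: "surj1 m d"
  obtains z where "z \<in> Spx (K C) p m" "w = K_str C p m z (Some [d])"
proof -
  let ?ns = "replicate p m"
  let ?t = "(0, m)"
  have r: "replicate (Suc p) m = m # ?ns" by (simp add: replicate_Suc)
  have sw: "block_swap p 1 permutes {..<Suc p}"
    by (rule permutes_of_inj) (auto simp: block_swap_def inj_on_def split: if_splits)
  define z0 where "z0 = K_act (Suc p) m (block_swap p 1) w"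
  have z0: "z0 \<in> nerve (w_cat (S_iter C (m # ?ns))) m"
    using K_closed(3)[OF sw w] unfolding z0_def Spx_K_nerve r .
  have re: "reindex (Suc p) (block_swap p 1) (?t # us) = us @ [?t]" if "length us = p" for us
    by (rule nth_equalityI) (use that in \<open>auto simp: block_swap_def nth_append less_Suc_eq\<close>)
  have mem: "us @ [?t] \<in> Field (Ars (replicate (Suc p) m)) \<and> ?t # us \<in> Field (Ars (replicate (Suc p) m)) \<and> length us = p"
    if "us \<in> Field (Ars ?ns)" for us
    using that top_Ar Field_Ars_Cons[of ?t us m ?ns] length_Ars[OF that] unfolding r
    by (auto simp: r[symmetric] Field_Ars_replicate nth_append less_Suc_eq)
  have mem2: "(us @ [?t], vs @ [?t]) \<in> Ars (replicate (Suc p) m) \<and> (?t # us, ?t # vs) \<in> Ars (replicate (Suc p) m)"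
    if "(us, vs) \<in> Ars ?ns" for us vs
    using that preordD(4)[OF preord_Ar top_Ar] Ars_Cons[of ?t us ?t vs m ?ns]
    by (auto simp: r[symmetric] Ars_replicate nth_append less_Suc_eq)
  define z where "z = map_chain m ((\<lambda>A. fst A ?t) \<circ> curry_diag m ?ns) ((\<lambda>f. cpt f ?t) \<circ> curry_map m ?ns) z0"
  have zc: "z \<in> Spx (K C) p m"
    unfolding z_def Spx_K_nerve
    by (rule map_chain_nerve[OF exact_compose[OF exact_curry exact_eval[OF cofib_category_S_iter top_Ar]]
          weq_S_iter_Arr weq_S_iter_Arr z0])
  have zo: "kob z i us = kob w i (us @ [?t])" if "i \<le> m" "us \<in> Field (Ars ?ns)" for i us
    using K_act_simps(1)[of i m "?t # us" "Suc p" "block_swap p 1" w] that mem[OF that(2)] re[of us] top_Ar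
    unfolding z0_def[symmetric] by (simp add: z_def kob_def map_chain_simps curry_simps slice_simps)
  have za: "kar z i us vs = kar w i (us @ [?t]) (vs @ [?t])" if "i \<le> m" "(us, vs) \<in> Ars ?ns" for i us vs
    using K_act_simps(2)[of i m "?t # us" "?t # vs" "Suc p" "block_swap p 1" w] that mem2[OF that(2)] re[of us] re[of vs] top_Ar
      length_Ars[OF preordD(1)[OF preord_Ars that(2)]] length_Ars[OF preordD(2)[OF preord_Ars that(2)]]
    unfolding z0_def[symmetric] by (simp add: z_def kar_def map_chain_simps curry_simps slice_simps)
  have zw: "kwe z i j us = kwe w i j (us @ [?t])" if "i \<le> j" "j \<le> m" "us \<in> Field (Ars ?ns)" for i j us
    using K_act_simps(3)[of i j m "?t # us" "Suc p" "block_swap p 1" w] that mem[OF that(3)] re[of us] top_Ar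
    unfolding z0_def[symmetric] by (simp add: z_def kwe_def map_chain_simps curry_simps ord_iff)
  have ds: "Some [d] \<in> sphere 1 m" using d by (simp add: sphere_surj1)
  let ?s = "K_str C p m z (Some [d])"
  have o: "kob w i l = kob ?s i l" if i: "i \<le> m" and l: "l \<in> Field (Ars (replicate (Suc p) m))" for i l
    using concentratedD(1)[OF c i l] zo[OF i Field_last(1)[OF l]] length_Ars[OF l]
    by (simp add: K_str_simps(1)[OF i l] list_update_last nth_last)
  have "w = ?s"
  proof (rule K_eqI[OF w K_closed(4)[OF zc ds] o])
    show "kar w i l l' = kar ?s i l l'" if i: "i \<le> m" and l: "(l, l') \<in> Ars (replicate (Suc p) m)" for i l l'
      using concentratedD(2)[OF c i l] za[OF i Ars_last(1)[OF l]] preordD(1,2)[OF preord_Ars l] o[OF i]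
        length_Ars[OF preordD(1)[OF preord_Ars l]] length_Ars[OF preordD(2)[OF preord_Ars l]]
      by (simp add: K_str_simps(2)[OF i l] list_update_last nth_last)
    show "kwe w i j l = kwe ?s i j l" if i: "i \<le> j" "j \<le> m" and l: "l \<in> Field (Ars (replicate (Suc p) m))" for i j l
      using concentratedD(3)[OF c i l] zw[OF i Field_last(1)[OF l]] length_Ars[OF l]
      by (simp add: K_str_simps(3)[OF i l] list_update_last nth_last)
  qed
  then show ?thesis using that zc by blast
qed

lemma concentrated_act:
  assumes a: "a permutes {..<p}" and c: "c < p" and x: "concentrated C p m x c d"
  shows "concentrated C p m (K_act p m a x) (a c) d"
proof (rule concentratedI)
  have u: "reindex p a (ws[a c := (0, m)]) = (reindex p a ws)[c := (0, m)]" if "ws \<in> Field (Ars (replicate p m))" for ws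
    using reindex_update[OF a c] length_Ars[OF that] by simp
  note up = update_Ars[OF _ top_Ar]
  show "kob (K_act p m a x) i ws = (if jumps d (ws ! a c) then kob (K_act p m a x) i (ws[a c := (0, m)]) else Zero C)"
    if i: "i \<le> m" and ws: "ws \<in> Field (Ars (replicate p m))" for i ws
    using concentratedD(1)[OF x i reindex_Ars(2)[OF a ws]] c
    by (simp add: K_act_simps(1)[OF i ws] K_act_simps(1)[OF i up(1)[OF ws]] u[OF ws])
  show "kwe (K_act p m a x) i j ws = (if jumps d (ws ! a c) then kwe (K_act p m a x) i j (ws[a c := (0, m)]) else Ident C (Zero C))"
    if i: "i \<le> j" "j \<le> m" and ws: "ws \<in> Field (Ars (replicate p m))" for i j ws
    using concentratedD(3)[OF x i reindex_Ars(2)[OF a ws]] c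
    by (simp add: K_act_simps(3)[OF i ws] K_act_simps(3)[OF i up(1)[OF ws]] u[OF ws])
  show "kar (K_act p m a x) i ws vs = (if jumps d (ws ! a c) \<and> jumps d (vs ! a c)
      then kar (K_act p m a x) i (ws[a c := (0, m)]) (vs[a c := (0, m)])
      else zero_arr C (kob (K_act p m a x) i ws) (kob (K_act p m a x) i vs))"
    if i: "i \<le> m" and ws: "(ws, vs) \<in> Ars (replicate p m)" for i ws vs
    using concentratedD(2)[OF x i reindex_Ars(1)[OF a ws]] c preordD(1,2)[OF preord_Ars ws]
    by (simp add: K_act_simps(2)[OF i ws] K_act_simps(2)[OF i up(2)[OF ws]] K_act_simps(1)[OF i] u)
qed

lemma val_K_eq: "val (K C) n m (p, q, \<gamma>, x, s) = K_act n m \<gamma> (sigma (K C) p q m x s)"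
  by (simp add: val_def K_sel)

text \<open>The value \<open>y\<close> of a tuple \<open>(p, q, \<gamma>, x, s)\<close> is concentrated at the positions \<open>\<gamma> (p + l)\<close> along the
  components of \<open>s\<close>. Evaluating it at lifted coordinates recovers \<open>x\<close>, so that any further
  concentration of \<open>y\<close> is visible in \<open>x\<close>.\<close>

lemma
  assumes x: "x \<in> Spx (K C) p m" and ds: "Some ds \<in> sphere q m" and \<gamma>: "\<gamma> permutes {..<n}" and n: "p + q = n"
  defines "y \<equiv> val (K C) n m (p, q, \<gamma>, x, Some ds)"
  shows val_K:
    "\<And>i xs. i \<le> m \<Longrightarrow> xs \<in> Field (Ars (replicate n m)) \<Longrightarrow>
       kob y i xs = (if alljump p ds (reindex n \<gamma> xs) then kob x i (take p (reindex n \<gamma> xs)) else Zero C)"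
    "\<And>i xs ys. i \<le> m \<Longrightarrow> (xs, ys) \<in> Ars (replicate n m) \<Longrightarrow>
       kar y i xs ys = (if alljump p ds (reindex n \<gamma> xs) \<and> alljump p ds (reindex n \<gamma> ys)
         then kar x i (take p (reindex n \<gamma> xs)) (take p (reindex n \<gamma> ys)) else zero_arr C (kob y i xs) (kob y i ys))"
    "\<And>i j xs. i \<le> j \<Longrightarrow> j \<le> m \<Longrightarrow> xs \<in> Field (Ars (replicate n m)) \<Longrightarrow>
       kwe y i j xs = (if alljump p ds (reindex n \<gamma> xs) then kwe x i j (take p (reindex n \<gamma> xs)) else Ident C (Zero C))"
  and val_lift:
    "\<And>i ws. i \<le> m \<Longrightarrow> ws \<in> Field (Ars (replicate p m)) \<Longrightarrow> kob y i (lift n p \<gamma> m ws) = kob x i ws"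
    "\<And>i ws vs. i \<le> m \<Longrightarrow> (ws, vs) \<in> Ars (replicate p m) \<Longrightarrow> kar y i (lift n p \<gamma> m ws) (lift n p \<gamma> m vs) = kar x i ws vs"
    "\<And>i j ws. i \<le> j \<Longrightarrow> j \<le> m \<Longrightarrow> ws \<in> Field (Ars (replicate p m)) \<Longrightarrow> kwe y i j (lift n p \<gamma> m ws) = kwe x i j ws"
  and concentrated_val: "\<And>l. l < q \<Longrightarrow> concentrated C n m y (\<gamma> (p + l)) (ds ! l)"
  and concentrated_restrict: "\<And>c d. c < p \<Longrightarrow> concentrated C n m y (\<gamma> c) d \<Longrightarrow> concentrated C p m x c d"
proof -
  note re = reindex_Ars[OF \<gamma>]
  note sg = sigma_K[OF x ds, unfolded n]
  have y: "y = K_act n m \<gamma> (sigma (K C) p q m x (Some ds))" by (simp add: y_def val_K_eq)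
  show v1: "kob y i xs = (if alljump p ds (reindex n \<gamma> xs) then kob x i (take p (reindex n \<gamma> xs)) else Zero C)"
    if "i \<le> m" "xs \<in> Field (Ars (replicate n m))" for i xs
    unfolding y using that by (simp add: K_act_simps sg(1) re)
  show v2: "kar y i xs ys = (if alljump p ds (reindex n \<gamma> xs) \<and> alljump p ds (reindex n \<gamma> ys)
         then kar x i (take p (reindex n \<gamma> xs)) (take p (reindex n \<gamma> ys)) else zero_arr C (kob y i xs) (kob y i ys))"
    if "i \<le> m" "(xs, ys) \<in> Ars (replicate n m)" for i xs ys
    unfolding y using that preordD(1,2)[OF preord_Ars that(2)] by (simp add: K_act_simps sg(2) re)
  show v3: "kwe y i j xs = (if alljump p ds (reindex n \<gamma> xs) then kwe x i j (take p (reindex n \<gamma> xs)) else Ident C (Zero C))"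
    if "i \<le> j" "j \<le> m" "xs \<in> Field (Ars (replicate n m))" for i j xs
    unfolding y using that by (simp add: K_act_simps sg(3) re)
  have pn: "p \<le> n" "n - p = q" using n by auto
  note lf = lift_props[OF \<gamma> pn(1)]
  have al: "alljump p ds (ws @ replicate q (0, m))" if "length ws = p" for ws
    using ds that surj1_jumps by (auto simp: alljump_def nth_append sphere_surj1)
  show l1: "kob y i (lift n p \<gamma> m ws) = kob x i ws" if "i \<le> m" "ws \<in> Field (Ars (replicate p m))" for i ws
    using length_Ars[OF that(2)] that by (simp add: v1 lf(2) lf(1) pn al)
  show l2: "kar y i (lift n p \<gamma> m ws) (lift n p \<gamma> m vs) = kar x i ws vs" if "i \<le> m" "(ws, vs) \<in> Ars (replicate p m)" for i ws vs
    using length_Ars[OF preordD(1)[OF preord_Ars that(2)]] length_Ars[OF preordD(2)[OF preord_Ars that(2)]] that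
    by (simp add: v2 lf(3) lf(1) pn al)
  show l3: "kwe y i j (lift n p \<gamma> m ws) = kwe x i j ws" if "i \<le> j" "j \<le> m" "ws \<in> Field (Ars (replicate p m))" for i j ws
    using length_Ars[OF that(3)] that by (simp add: v3 lf(2) lf(1) pn al)
  show "concentrated C n m y (\<gamma> (p + l)) (ds ! l)" if l: "l < q" for l
  proof -
    let ?r = "\<gamma> (p + l)"
    have ll: "l < length ds" "jumps (ds ! l) (0, m)" using ds l surj1_jumps by (auto simp: sphere_surj1)
    have u: "reindex n \<gamma> (xs[?r := (0, m)]) = (reindex n \<gamma> xs)[p + l := (0, m)]" if "xs \<in> Field (Ars (replicate n m))" for xs
      using reindex_update[OF \<gamma>, of "p + l"] length_Ars[OF that] l n by simp
    have j: "jumps (ds ! l) (xs ! ?r)" if "alljump p ds (reindex n \<gamma> xs)" for xs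
      using that ll(1) l n by (auto simp: alljump_def)
    have a: "alljump p ds ((reindex n \<gamma> xs)[p + l := (0, m)]) \<longleftrightarrow> alljump p ds (reindex n \<gamma> xs)"
      if j: "jumps (ds ! l) (xs ! ?r)" for xs
    proof -
      have "jumps (ds ! k) ((reindex n \<gamma> xs)[p + l := (0, m)] ! (p + k)) \<longleftrightarrow> jumps (ds ! k) (reindex n \<gamma> xs ! (p + k))"
        if "k < q" for k
        using that j ll(2) l n by (cases "k = l") simp_all
      then show ?thesis using ds by (simp add: alljump_def sphere_iff)
    qed
    have t: "take p ((reindex n \<gamma> xs)[p + l := (0, m)]) = take p (reindex n \<gamma> xs)" for xs by (simp add: take_update_cancel)
    note up = update_Ars[OF _ top_Ar]
    show ?thesis
    proof (rule concentratedI)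
      show o: "kob y i xs = (if jumps (ds ! l) (xs ! ?r) then kob y i (xs[?r := (0, m)]) else Zero C)"
        if "i \<le> m" "xs \<in> Field (Ars (replicate n m))" for i xs
        using that j[of xs] by (auto simp: v1 up u a t)
      show "kwe y i k xs = (if jumps (ds ! l) (xs ! ?r) then kwe y i k (xs[?r := (0, m)]) else Ident C (Zero C))"
        if "i \<le> k" "k \<le> m" "xs \<in> Field (Ars (replicate n m))" for i k xs
        using that j[of xs] by (auto simp: v3 up u a t)
      show "kar y i xs ys = (if jumps (ds ! l) (xs ! ?r) \<and> jumps (ds ! l) (ys ! ?r)
          then kar y i (xs[?r := (0, m)]) (ys[?r := (0, m)]) else zero_arr C (kob y i xs) (kob y i ys))"
        if i: "i \<le> m" and xy: "(xs, ys) \<in> Ars (replicate n m)" for i xs ys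
      proof (cases "jumps (ds ! l) (xs ! ?r) \<and> jumps (ds ! l) (ys ! ?r)")
        case True
        note F = preordD(1,2)[OF preord_Ars xy]
        have "kob y i xs = kob y i (xs[?r := (0, m)])" "kob y i ys = kob y i (ys[?r := (0, m)])"
          using o[OF i F(1)] o[OF i F(2)] True by auto
        then show ?thesis using True v2[OF i xy] v2[OF i up(2)[OF xy]] F by (simp add: u a t)
      next
        case False
        then show ?thesis using v2[OF i xy] j[of xs] j[of ys] by auto
      qed
    qed
  qed
  show "concentrated C p m x c d" if c: "c < p" and y: "concentrated C n m y (\<gamma> c) d" for c d
  proof (rule concentratedI)
    note up = update_Ars[OF _ top_Ar]
    have lu: "(lift n p \<gamma> m ws)[\<gamma> c := (0, m)] = lift n p \<gamma> m (ws[c := (0, m)])" "lift n p \<gamma> m ws ! \<gamma> c = ws ! c"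
      if "ws \<in> Field (Ars (replicate p m))" for ws
      using lf(4,5)[OF c] length_Ars[OF that] by simp_all
    show "kob x i ws = (if jumps d (ws ! c) then kob x i (ws[c := (0, m)]) else Zero C)"
      if i: "i \<le> m" and ws: "ws \<in> Field (Ars (replicate p m))" for i ws
      using concentratedD(1)[OF y i lf(2)[OF ws]] by (simp add: lu[OF ws] l1 i ws up)
    show "kwe x i k ws = (if jumps d (ws ! c) then kwe x i k (ws[c := (0, m)]) else Ident C (Zero C))"
      if i: "i \<le> k" "k \<le> m" and ws: "ws \<in> Field (Ars (replicate p m))" for i k ws
      using concentratedD(3)[OF y i lf(2)[OF ws]] by (simp add: lu[OF ws] l3 i ws up)
    show "kar x i ws vs = (if jumps d (ws ! c) \<and> jumps d (vs ! c)
        then kar x i (ws[c := (0, m)]) (vs[c := (0, m)]) else zero_arr C (kob x i ws) (kob x i vs))"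
      if i: "i \<le> m" and ws: "(ws, vs) \<in> Ars (replicate p m)" for i ws vs
      using concentratedD(2)[OF y i lf(3)[OF ws]] preordD(1,2)[OF preord_Ars ws] by (simp add: lu l1 l2 i ws up)
  qed
qed

lemma val_inj:
  assumes x: "x \<in> Spx (K C) p m" "x' \<in> Spx (K C) p m" and ds: "Some ds \<in> sphere q m" "Some ds' \<in> sphere q m"
    and \<gamma>: "\<gamma> permutes {..<n}" and n: "p + q = n"
    and e: "val (K C) n m (p, q, \<gamma>, x, Some ds) = val (K C) n m (p, q, \<gamma>, x', Some ds')"
  shows "x = x'"
  by (rule K_eqI[OF x])
    (simp_all add: val_lift[OF x(1) ds(1) \<gamma> n, symmetric] val_lift[OF x(2) ds(2) \<gamma> n, symmetric] e)

lemma val_closed: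
  "x \<in> Spx (K C) p m \<Longrightarrow> s \<in> sphere q m \<Longrightarrow> \<gamma> permutes {..<n} \<Longrightarrow> p + q = n
    \<Longrightarrow> val (K C) n m (p, q, \<gamma>, x, s) \<in> Spx (K C) n m"
  unfolding val_K_eq using K_closed(3) sigma_K_closed by blast

lemma Some_tuple:
  "(p, q, \<gamma>, x, Some ds) \<in> smash_tuples (K C) tsph n m \<longleftrightarrow>
     p + q = n \<and> \<gamma> permutes {..<n} \<and> x \<in> Spx (K C) p m \<and> 0 < q \<and> Some ds \<in> sphere q m"
  by (auto simp: smash_tuples_def tsph_sel Sym_def)

text \<open>If the value is concentrated at a position belonging to \<open>x\<close>, then so is \<open>x\<close>. A transposition in
  \<open>\<Sigma>\<^sub>p\<close> makes it the last position of \<open>x\<close>, where \<open>x\<close> comes from a structure map, and the balancing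
  relation moves the direction into the second factor.\<close>

lemma enlarge:
  assumes t: "(p, q, \<gamma>, x, Some ds) \<in> smash_tuples (K C) tsph n m"
    and r: "r < n" "r \<notin> \<gamma> ` {p..<n}" and d: "surj1 m d"
    and c: "concentrated C n m (val (K C) n m (p, q, \<gamma>, x, Some ds)) r d"
  obtains p' q' \<gamma>' x' ds' where "(p', q', \<gamma>', x', Some ds') \<in> smash_tuples (K C) tsph n m"
    "equivclp (smash_rel (K C) tsph n m) (p, q, \<gamma>, x, Some ds) (p', q', \<gamma>', x', Some ds')"
    "\<gamma>' ` {p'..<n} = insert r (\<gamma> ` {p..<n})"
proof -
  let ?R = "smash_rel (K C) tsph n m"
  have n: "p + q = n" and \<gamma>: "\<gamma> permutes {..<n}" and x: "x \<in> Spx (K C) p m" and q: "0 < q" and ds: "Some ds \<in> sphere q m"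
    using t unfolding Some_tuple by auto
  define c where "c = inv \<gamma> r"
  have rc: "\<gamma> c = r" "c < n" unfolding c_def using permutes_inverses(1)[OF \<gamma>] permutes_less[OF permutes_inv[OF \<gamma>] r(1)] by auto
  then have cp: "c < p" using r(2) by (metis atLeastLessThan_iff image_eqI not_le)
  then obtain p1 where p1: "p = Suc p1" by (cases p) auto
  define a where "a = Transposition.transpose c p1"
  have a: "a permutes {..<p}" "a c = p1" "a \<circ> a = id" "a p1 = c"
    unfolding a_def using cp p1 by (auto intro!: permutes_swap_id)
  have "concentrated C p m (K_act p m a x) p1 d"
    using concentrated_act[OF a(1) cp concentrated_restrict[OF x ds \<gamma> n cp]] assms(5) a(2) rc by simp
  then obtain z where z: "z \<in> Spx (K C) p1 m" "K_act p m a x = K_str C p1 m z (Some [d])"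
    using concentrated_last[of "K_act p m a x" p1 m d] K_closed(3)[OF a(1) x] d unfolding p1 by blast
  define \<gamma>1 where "\<gamma>1 = \<gamma> \<circ> block_sum p a id"
  have bs: "block_sum p a id permutes {..<n}" using block_sum_permutes[OF a(1) permutes_id, of q] n by simp
  have \<gamma>1: "\<gamma>1 permutes {..<n}" unfolding \<gamma>1_def by (rule permutes_compose[OF bs \<gamma>])
  have aa: "a (a i) = i" for i using a(3) by (metis comp_apply id_apply)
  have al: "i < p \<Longrightarrow> a i < p" for i using permutes_less[OF a(1)] .
  have "\<gamma> = \<gamma>1 \<circ> block_sum p a id"
    unfolding \<gamma>1_def by (auto simp: fun_eq_iff block_sum_def aa al)
  then have 1: "?R (p, q, \<gamma>, x, Some ds) (p, q, \<gamma>1, act (K C) p m a x, act tsph q m id (Some ds))"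
    using smash_rel.equivariant[of p q n \<gamma>1 a id x "K C" m "Some ds" tsph] n \<gamma>1 a(1) x q ds
    by (simp add: Sym_def permutes_id tsph_sel)
  have id: "act tsph q m id (Some ds) = Some ds"
    using ds by (auto simp: tsph_sel sphere_act_def sphere_iff inv_id map_nth)
  have d1: "Some [d] \<in> sphere 1 m" using d by (simp add: sphere_surj1)
  have sg: "sigma (K C) p1 1 m z (Some [d]) = act (K C) p m a x" using z(2) by (simp add: sigma_def K_sel)
  have ls: "left_sigma tsph 1 q m (Some [d]) (Some ds) = Some (d # ds)" using left_sigma_tsph[OF d1 ds] by simp
  have 2: "?R (p, q, \<gamma>1, act (K C) p m a x, Some ds) (p1, 1 + q, \<gamma>1, z, Some (d # ds))"
    using smash_rel.balanced[of p1 1 q n \<gamma>1 z "K C" m "Some [d]" "Some ds" tsph] n \<gamma>1 z d1 q ds p1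
    unfolding sg ls by (simp add: Sym_def tsph_sel)
  show ?thesis
  proof (rule that)
    show "(p1, 1 + q, \<gamma>1, z, Some (d # ds)) \<in> smash_tuples (K C) tsph n m"
      using symmetric_spectrum.smash_rel_tuples(2)[OF symmetric_spectrum_K 2] .
    show "equivclp ?R (p, q, \<gamma>, x, Some ds) (p1, 1 + q, \<gamma>1, z, Some (d # ds))"
      using 1 2 unfolding id by (meson equivclp_trans r_into_equivclp)
    have "{p1..<n} = insert p1 {p..<n}" using p1 n by auto
    moreover have "\<gamma>1 i = \<gamma> i" if "p \<le> i" for i using that by (simp add: \<gamma>1_def block_sum_def)
    moreover have "\<gamma>1 p1 = r" using p1 a(4) rc by (simp add: \<gamma>1_def block_sum_def)
    ultimately show "\<gamma>1 ` {p1..<n} = insert r (\<gamma> ` {p..<n})" by auto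
  qed
qed

lemma enlarge_set:
  assumes t: "(p, q, \<gamma>, x, Some ds) \<in> smash_tuples (K C) tsph n m" and U: "finite U"
    "\<And>r. r \<in> U \<Longrightarrow> r < n \<and> (\<exists>d. surj1 m d \<and> concentrated C n m (val (K C) n m (p, q, \<gamma>, x, Some ds)) r d)"
  shows "\<exists>p' q' \<gamma>' x' ds'. (p', q', \<gamma>', x', Some ds') \<in> smash_tuples (K C) tsph n m \<and>
    equivclp (smash_rel (K C) tsph n m) (p, q, \<gamma>, x, Some ds) (p', q', \<gamma>', x', Some ds') \<and>
    \<gamma>' ` {p'..<n} = U \<union> \<gamma> ` {p..<n}"
  using U
proof (induction U rule: finite_induct)
  case empty
  then show ?case using t by (metis equivclp_refl Un_empty_left)
next
  case (insert r U)
  then obtain p' q' \<gamma>' x' ds' where IH: "(p', q', \<gamma>', x', Some ds') \<in> smash_tuples (K C) tsph n m"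
    "equivclp (smash_rel (K C) tsph n m) (p, q, \<gamma>, x, Some ds) (p', q', \<gamma>', x', Some ds')"
    "\<gamma>' ` {p'..<n} = U \<union> \<gamma> ` {p..<n}" by blast
  obtain d where d: "r < n" "surj1 m d" "concentrated C n m (val (K C) n m (p, q, \<gamma>, x, Some ds)) r d" using insert.prems by blast
  show ?case
  proof (cases "r \<in> \<gamma>' ` {p'..<n}")
    case True
    then have "\<gamma>' ` {p'..<n} = insert r U \<union> \<gamma> ` {p..<n}" using IH(3) by auto
    then show ?thesis using IH by blast
  next
    case False
    have "concentrated C n m (val (K C) n m (p', q', \<gamma>', x', Some ds')) r d"
      using d(3) symmetric_spectrum.val_equivclp[OF symmetric_spectrum_K IH(2)] by simp
    from enlarge[OF IH(1) d(1) False d(2) this] obtain p2 q2 \<gamma>2 x2 ds2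
      where 2: "(p2, q2, \<gamma>2, x2, Some ds2) \<in> smash_tuples (K C) tsph n m"
      "equivclp (smash_rel (K C) tsph n m) (p', q', \<gamma>', x', Some ds') (p2, q2, \<gamma>2, x2, Some ds2)"
      "\<gamma>2 ` {p2..<n} = insert r (\<gamma>' ` {p'..<n})" .
    have "\<gamma>2 ` {p2..<n} = insert r U \<union> \<gamma> ` {p..<n}" using 2(3) IH(3) by auto
    then show ?thesis using 2 equivclp_trans[OF IH(2) 2(2)] by blast
  qed
qed

text \<open>The permutation \<open>\<beta>\<close> comparing \<open>\<gamma>\<close> with \<open>\<gamma>'\<close> preserves the last \<open>q\<close> positions, so it lies in
  \<open>\<Sigma>\<^sub>p \<times> \<Sigma>\<^sub>q\<close> and can be removed by equivariance. Then the value determines the first factor by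
  evaluation and the second one by the uniqueness of jumps.\<close>

lemma same_positions:
  assumes t: "(p, q, \<gamma>, x, Some ds) \<in> smash_tuples (K C) tsph n m" "(p', q', \<gamma>', x', Some ds') \<in> smash_tuples (K C) tsph n m"
    and e: "val (K C) n m (p, q, \<gamma>, x, Some ds) = val (K C) n m (p', q', \<gamma>', x', Some ds')"
    and ne: "val (K C) n m (p, q, \<gamma>, x, Some ds) \<noteq> K_pt C n m"
    and R: "\<gamma> ` {p..<n} = \<gamma>' ` {p'..<n}"
  shows "equivclp (smash_rel (K C) tsph n m) (p, q, \<gamma>, x, Some ds) (p', q', \<gamma>', x', Some ds')"
proof -
  let ?R = "smash_rel (K C) tsph n m"
  have n: "p + q = n" and \<gamma>: "\<gamma> permutes {..<n}" and x: "x \<in> Spx (K C) p m" and q: "0 < q" and ds: "Some ds \<in> sphere q m"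
    using t(1) unfolding Some_tuple by auto
  have n': "p' + q' = n" and \<gamma>': "\<gamma>' permutes {..<n}" and x': "x' \<in> Spx (K C) p' m" and ds': "Some ds' \<in> sphere q' m"
    using t(2) unfolding Some_tuple by auto
  have "card {p..<n} = card {p'..<n}"
    using R card_image[of \<gamma> "{p..<n}"] card_image[of \<gamma>' "{p'..<n}"] permutes_inj_on[OF \<gamma>] permutes_inj_on[OF \<gamma>'] by metis
  then have pp: "p' = p" "q' = q" using n n' by auto
  define \<beta> where "\<beta> = inv \<gamma>' \<circ> \<gamma>"
  have \<beta>: "\<beta> permutes {..<p + q}" unfolding \<beta>_def n by (rule permutes_compose[OF \<gamma> permutes_inv[OF \<gamma>']])
  have "\<beta> ` {p..<n} = inv \<gamma>' ` \<gamma>' ` {p..<n}" unfolding \<beta>_def image_comp[symmetric] using R pp by simp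
  also have "\<dots> = {p..<n}" by (simp add: image_comp permutes_inv_o(2)[OF \<gamma>'])
  finally obtain a b where ab: "a permutes {..<p}" "b permutes {..<q}" "\<beta> = block_sum p a b"
    using permutes_block[OF \<beta>] n by metis
  have g: "\<gamma> = \<gamma>' \<circ> block_sum p a b"
    unfolding ab(3)[symmetric] \<beta>_def by (simp add: o_assoc permutes_inv_o(1)[OF \<gamma>'])
  let ?es = "map (\<lambda>r. ds ! inv b r) [0..<q]"
  have es: "act tsph q m b (Some ds) = Some ?es" "Some ?es \<in> sphere q m"
    using sphere_act_Some[OF ds ab(2)] by (auto simp: tsph_sel)
  have 1: "?R (p, q, \<gamma>, x, Some ds) (p, q, \<gamma>', act (K C) p m a x, Some ?es)"
    using smash_rel.equivariant[of p q n \<gamma>' a b x "K C" m "Some ds" tsph] n \<gamma>' ab(1,2) x q ds unfolding g es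
    by (simp add: Sym_def tsph_sel)
  have ax: "act (K C) p m a x \<in> Spx (K C) p m" using K_closed(3)[OF ab(1) x] by (simp add: K_sel)
  have v: "val (K C) n m (p, q, \<gamma>', act (K C) p m a x, Some ?es) = val (K C) n m (p, q, \<gamma>', x', Some ds')"
    using symmetric_spectrum.val_cong[OF symmetric_spectrum_K 1] e pp by simp
  have xx: "act (K C) p m a x = x'"
    by (rule val_inj[OF ax x'[unfolded pp] es(2) ds'[unfolded pp] \<gamma>' n v])
  have "?es = ds'"
  proof (rule nth_equalityI)
    have l: "length ds' = q" using ds' pp by (simp add: sphere_iff)
    show "length ?es = length ds'" using l by simp
    fix l assume "l < length ?es"
    then have lq: "l < q" by simp
    have y: "val (K C) n m (p, q, \<gamma>', x', Some ds') \<in> Spx (K C) n m"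
      by (rule val_closed[OF x'[unfolded pp] ds'[unfolded pp] \<gamma>' n])
    show "?es ! l = ds' ! l"
    proof (rule concentrated_unique[OF y])
      show "\<gamma>' (p + l) < n" using permutes_less[OF \<gamma>'] lq n by simp
      show "concentrated C n m (val (K C) n m (p, q, \<gamma>', x', Some ds')) (\<gamma>' (p + l)) (?es ! l)"
        using concentrated_val[OF ax es(2) \<gamma>' n lq] unfolding v .
      show "concentrated C n m (val (K C) n m (p, q, \<gamma>', x', Some ds')) (\<gamma>' (p + l)) (ds' ! l)"
        by (rule concentrated_val[OF x'[unfolded pp] ds'[unfolded pp] \<gamma>' n lq])
      show "surj1 m (?es ! l)" "surj1 m (ds' ! l)"
        using es(2) ds' lq l pp unfolding sphere_surj1 by (metis nth_mem)+
      show "val (K C) n m (p, q, \<gamma>', x', Some ds') \<noteq> K_pt C n m" using ne e pp by simp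
    qed
  qed
  then show ?thesis using 1 xx pp by auto
qed

lemma val_pt:
  assumes t: "(p, q, \<gamma>, x, s) \<in> smash_tuples (K C) tsph n m" and v: "val (K C) n m (p, q, \<gamma>, x, s) = K_pt C n m"
  shows "x = pt (K C) p m \<or> s = pt tsph q m"
proof (cases s)
  case None
  then show ?thesis by (simp add: tsph_sel)
next
  case (Some ds)
  have n: "p + q = n" and \<gamma>: "\<gamma> permutes {..<n}" and x: "x \<in> Spx (K C) p m" and ds: "Some ds \<in> sphere q m"
    using t unfolding Some Some_tuple by auto
  have pn: "p \<le> n" using n by simp
  have "x = K_pt C p m"
  proof (rule K_eq_ptI[OF x])
    show "kob x i ws = Zero C" if "i \<le> m" "ws \<in> Field (Ars (replicate p m))" for i ws
      using val_lift(1)[OF x ds \<gamma> n that] v that lift_props(2)[OF \<gamma> pn that(2)] unfolding Some by (simp add: K_pt_simps)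
  qed
  then show ?thesis by (simp add: K_sel)
qed

text \<open>Both tuples are enlarged to the union of their sets of positions.\<close>

theorem flat_K: "flat (K C)"
proof (rule symmetric_spectrum.flatI[OF symmetric_spectrum_K])
  fix n m and t t' :: "(('o, 'm) K_simplex, sph) smash_tuple"
  let ?R = "smash_rel (K C) tsph n m"
  assume t: "t \<in> smash_tuples (K C) tsph n m" "t' \<in> smash_tuples (K C) tsph n m"
    and e: "val (K C) n m t = val (K C) n m t'"
  obtain p q \<gamma> x s where T: "t = (p, q, \<gamma>, x, s)" by (cases t)
  obtain p' q' \<gamma>' x' s' where T': "t' = (p', q', \<gamma>', x', s')" by (cases t')
  show "equivclp ?R t t'"
  proof (cases "val (K C) n m t = K_pt C n m")
    case True
    then have "?R t t'"
      unfolding T T' using val_pt t e by (intro smash_rel.pointed) (auto simp: T T')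
    then show ?thesis by (rule r_into_equivclp)
  next
    case False
    have pt: "val (K C) n m (p, q, \<gamma>, x, None) = K_pt C n m"
      if "(p, q, \<gamma>, x, None) \<in> smash_tuples (K C) tsph n m" for p q \<gamma> x
      using that K_act_pt by (auto simp: val_K_eq sigma_K_None smash_tuples_def Sym_def)
    obtain ds ds' where s: "s = Some ds" "s' = Some ds'"
      using pt False e t unfolding T T' by (cases s; cases s') auto
    have t1: "(p, q, \<gamma>, x, Some ds) \<in> smash_tuples (K C) tsph n m"
      "(p', q', \<gamma>', x', Some ds') \<in> smash_tuples (K C) tsph n m" using t T T' s by auto
    have cv: "r < n \<and> (\<exists>d. surj1 m d \<and> concentrated C n m (val (K C) n m (p, q, \<gamma>, x, Some ds)) r d)"
      if tt: "(p, q, \<gamma>, x, Some ds) \<in> smash_tuples (K C) tsph n m" and r: "r \<in> \<gamma> ` {p..<n}" for p q \<gamma> x ds r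
    proof -
      have n: "p + q = n" and \<gamma>: "\<gamma> permutes {..<n}" and x: "x \<in> Spx (K C) p m" and ds: "Some ds \<in> sphere q m"
        using tt unfolding Some_tuple by auto
      obtain i where i: "p \<le> i" "i < n" "r = \<gamma> i" using r by auto
      have l: "i - p < q" "r = \<gamma> (p + (i - p))" using i n by auto
      have "surj1 m (ds ! (i - p))" using ds l(1) by (auto simp: sphere_surj1)
      then show ?thesis using concentrated_val[OF x ds \<gamma> n l(1)] l(2) permutes_less[OF \<gamma> i(2)] i(3) by auto
    qed
    have ev: "val (K C) n m (p, q, \<gamma>, x, Some ds) = val (K C) n m (p', q', \<gamma>', x', Some ds')" using e T T' s by simp
    obtain p1 q1 \<gamma>1 x1 ds1 where 1: "(p1, q1, \<gamma>1, x1, Some ds1) \<in> smash_tuples (K C) tsph n m"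
      "equivclp ?R (p, q, \<gamma>, x, Some ds) (p1, q1, \<gamma>1, x1, Some ds1)"
      "\<gamma>1 ` {p1..<n} = \<gamma>' ` {p'..<n} \<union> \<gamma> ` {p..<n}"
      using enlarge_set[OF t1(1), of "\<gamma>' ` {p'..<n}"] cv[OF t1(2)] ev by auto
    obtain p2 q2 \<gamma>2 x2 ds2 where 2: "(p2, q2, \<gamma>2, x2, Some ds2) \<in> smash_tuples (K C) tsph n m"
      "equivclp ?R (p', q', \<gamma>', x', Some ds') (p2, q2, \<gamma>2, x2, Some ds2)"
      "\<gamma>2 ` {p2..<n} = \<gamma> ` {p..<n} \<union> \<gamma>' ` {p'..<n}"
      using enlarge_set[OF t1(2), of "\<gamma> ` {p..<n}"] cv[OF t1(1)] ev by auto
    note v = symmetric_spectrum.val_equivclp[OF symmetric_spectrum_K 1(2)]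
      symmetric_spectrum.val_equivclp[OF symmetric_spectrum_K 2(2)]
    have mid: "equivclp ?R (p1, q1, \<gamma>1, x1, Some ds1) (p2, q2, \<gamma>2, x2, Some ds2)"
    proof (rule same_positions[OF 1(1) 2(1)])
      show "val (K C) n m (p1, q1, \<gamma>1, x1, Some ds1) = val (K C) n m (p2, q2, \<gamma>2, x2, Some ds2)"
        using v ev by simp
      show "val (K C) n m (p1, q1, \<gamma>1, x1, Some ds1) \<noteq> K_pt C n m" using v False T s by simp
      show "\<gamma>1 ` {p1..<n} = \<gamma>2 ` {p2..<n}" using 1(3) 2(3) by auto
    qed
    show ?thesis unfolding T T' s
      by (rule equivclp_trans[OF equivclp_trans[OF 1(2) mid] equivclp_sym[OF 2(2)]])
  qed
qed

end

section \<open>A symmetric simplex outside of the latching object\<close>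

text \<open>This retracts \<open>[m]\<close> onto the interval \<open>x\<close>. Applied to both ends of an interval \<open>y\<close> it gives \<open>x \<inter> y\<close>, or
  a degenerate interval at an end of \<open>x\<close> if \<open>x\<close> and \<open>y\<close> are disjoint.\<close>

definition clamp :: "nat \<Rightarrow> nat \<times> nat \<Rightarrow> nat \<Rightarrow> nat" where
  "clamp m x = (\<lambda>t \<in> {..m}. max (fst x) (min (snd x) t))"

abbreviation clamp2 :: "nat \<Rightarrow> nat \<times> nat \<Rightarrow> nat \<times> nat \<Rightarrow> nat \<times> nat" where
  "clamp2 m x \<equiv> map_prod (clamp m x) (clamp m x)"

lemma clamp_Delta: "x \<in> Field (Ar m) \<Longrightarrow> clamp m x \<in> Delta m m"
  by (cases x) (auto simp: Delta_def clamp_def mono_on_def Field_Ar)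

lemma clamp_Ar:
  assumes x: "(x, x') \<in> Ar m" and y: "(y, y') \<in> Ar m"
  shows "(clamp2 m x y, clamp2 m x' y') \<in> Ar m"
  using assms by (cases x; cases x'; cases y; cases y') (auto simp: clamp_def Ar_iff)

text \<open>The diagram \<open>(x, y) \<mapsto> G(x \<inter> y)\<close>.\<close>

definition meet_diag :: "nat \<Rightarrow> (nat \<times> nat, 'o, 'm) diag
    \<Rightarrow> (nat \<times> nat, (nat \<times> nat, 'o, 'm) diag, (nat \<times> nat, 'o, 'm) diag_map) diag" where
  "meet_diag m G = ((\<lambda>x \<in> Field (Ar m). pull_diag (Ar m) (clamp2 m x) G),
     (\<lambda>p \<in> Ar m. (pull_diag (Ar m) (clamp2 m (fst p)) G,
        (\<lambda>y \<in> Field (Ar m). snd G (clamp2 m (fst p) y, clamp2 m (snd p) y)),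
        pull_diag (Ar m) (clamp2 m (snd p)) G)))"

lemma meet_diag_simps:
  "x \<in> Field (Ar m) \<Longrightarrow> fst (meet_diag m G) x = pull_diag (Ar m) (clamp2 m x) G"
  "(x, x') \<in> Ar m \<Longrightarrow> y \<in> Field (Ar m) \<Longrightarrow> cpt (snd (meet_diag m G) (x, x')) y = snd G (clamp2 m x y, clamp2 m x' y)"
  "(x, x') \<in> Ar m \<Longrightarrow> fst (snd (meet_diag m G) (x, x')) = pull_diag (Ar m) (clamp2 m x) G"
  "(x, x') \<in> Ar m \<Longrightarrow> snd (snd (snd (meet_diag m G) (x, x'))) = pull_diag (Ar m) (clamp2 m x') G"
  by (simp_all add: meet_diag_def)

context cofib_category
begin

text \<open>The value at \<open>x\<close> is the image of \<open>G\<close> under the simplicial operator \<open>clamp m x\<close>. As \<open>x\<close> varies with \<open>y\<close>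
  fixed, the ends of \<open>x \<inter> y\<close> follow those of \<open>x\<close> or stay constant, so that the squares to be
  considered are squares of \<open>G\<close>, some of them degenerate.\<close>

lemma meet_diag_Obj:
  assumes G: "G \<in> Obj (S m D)"
  shows "meet_diag m G \<in> Obj (S m (S m D))"
proof -
  interpret SD: cofib_category "S m D" by (rule cofib_category_S)
  note dG = S_ObjD(1)[OF G]
  have row: "pull_diag (Ar m) (clamp2 m x) G \<in> Obj (S m D)" if "x \<in> Field (Ar m)" for x
    using exactD(1)[OF exact_S_pull[OF cofib_category_axioms clamp_Delta[OF that]] G] .
  have rr: "(z, z) \<in> Ar m" if "z \<in> Field (Ar m)" for z using preordD(4)[OF preord_Ar that] .
  have h: "snd (meet_diag m G) (x, x') \<in> hom (S m D) (pull_diag (Ar m) (clamp2 m x) G) (pull_diag (Ar m) (clamp2 m x') G)"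
    if x: "(x, x') \<in> Ar m" for x x'
  proof -
    note F = preordD(1,2)[OF preord_Ar x]
    have "(pull_diag (Ar m) (clamp2 m x) G, (\<lambda>y \<in> Field (Ar m). snd G (clamp2 m x y, clamp2 m x' y)), pull_diag (Ar m) (clamp2 m x') G)
      \<in> hom (S m D) (pull_diag (Ar m) (clamp2 m x) G) (pull_diag (Ar m) (clamp2 m x') G)"
    proof (rule S_homI[OF row[OF F(1)] row[OF F(2)]])
      show "snd G (clamp2 m x y, clamp2 m x' y) \<in> hom D (fst (pull_diag (Ar m) (clamp2 m x) G) y) (fst (pull_diag (Ar m) (clamp2 m x') G) y)"
        if "y \<in> Field (Ar m)" for y
        using is_diagD(4)[OF dG clamp_Ar[OF x rr[OF that]]] that by (simp add: pull_simps)
      show "snd G (clamp2 m x y', clamp2 m x' y') \<odot> snd (pull_diag (Ar m) (clamp2 m x) G) (y, y')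
        = snd (pull_diag (Ar m) (clamp2 m x') G) (y, y') \<odot> snd G (clamp2 m x y, clamp2 m x' y)"
        if y: "(y, y') \<in> Ar m" for y y'
      proof -
        note Fy = preordD(1,2)[OF preord_Ar y]
        show ?thesis
          using is_diagD(6)[OF dG clamp_Ar[OF rr[OF F(1)] y] clamp_Ar[OF x rr[OF Fy(2)]]]
            is_diagD(6)[OF dG clamp_Ar[OF x rr[OF Fy(1)]] clamp_Ar[OF rr[OF F(2)] y]] y by (simp add: pull_simps)
      qed
    qed
    then show ?thesis using x by (simp add: meet_diag_def)
  qed
  have ga: "snd G ((i, a), (i, b)) \<in> hom D (fst G (i, a)) (fst G (i, b))" if "i \<le> a" "a \<le> b" "b \<le> m" for i a b
    using S_arr(1)[OF G] that by simp
  have gc: "snd G ((i, b), (i, c)) \<odot> snd G ((i, a), (i, b)) = snd G ((i, a), (i, c))" if "i \<le> a" "a \<le> b" "b \<le> c" "c \<le> m" for i a b c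
    using S_arr(2)[OF G] that by simp
  have gi: "snd G ((i, a), (i, a)) = Ident D (fst G (i, a))" if "i \<le> a" "a \<le> m" for i a
    using is_diagD(5)[OF dG] that by (simp add: Field_Ar)
  have q: "cofsq D (snd G ((i, a), (i, a))) (snd G ((i, a), (i, b))) (snd G ((i, a), (i, c))) (snd G ((i, b), (i, c)))"
    if "i \<le> a" "a \<le> b" "b \<le> c" "c \<le> m" for i a b c
    using cofsqI[OF pushout_Ident[OF ga[of i a b]] ga[of i a b] ga[of i b c] ga[of i b c] gc[of i a b c]
        Comp_Ident_right[OF ga[of i b c]] S_ObjD(3)[OF G, of i b c]] that gi[of i a] by simp
  show ?thesis
  proof (rule S_ObjI)
    show "is_diag (Ar m) (S m D) (meet_diag m G)"
    proof (rule is_diagI)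
      show "fst (meet_diag m G) \<in> extensional (Field (Ar m))" "snd (meet_diag m G) \<in> extensional (Ar m)" by (auto simp: meet_diag_def)
      show "fst (meet_diag m G) x \<in> Obj (S m D)" if "x \<in> Field (Ar m)" for x using row[OF that] that by (simp add: meet_diag_simps)
      show "snd (meet_diag m G) (x, x') \<in> hom (S m D) (fst (meet_diag m G) x) (fst (meet_diag m G) x')" if "(x, x') \<in> Ar m" for x x'
        using h[OF that] preordD(1,2)[OF preord_Ar that] by (simp add: meet_diag_simps)
      show "snd (meet_diag m G) (x, x) = Ident (S m D) (fst (meet_diag m G) x)" if x: "x \<in> Field (Ar m)" for x
      proof (rule S_hom_eqI[OF h[OF rr[OF x]]])
        show "Ident (S m D) (fst (meet_diag m G) x) \<in> hom (S m D) (pull_diag (Ar m) (clamp2 m x) G) (pull_diag (Ar m) (clamp2 m x) G)"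
          using SD.Ident_hom[OF row[OF x]] x by (simp add: meet_diag_simps)
        show "cpt (snd (meet_diag m G) (x, x)) y = cpt (Ident (S m D) (fst (meet_diag m G) x)) y" if y: "y \<in> Field (Ar m)" for y
          using is_diagD(5)[OF dG preordD(1)[OF preord_Ar clamp_Ar[OF rr[OF x] rr[OF y]]]] x y rr[OF x]
          by (simp add: meet_diag_simps S_Ident pull_simps)
      qed
      show "Comp (S m D) (snd (meet_diag m G) (x', x'')) (snd (meet_diag m G) (x, x')) = snd (meet_diag m G) (x, x'')"
        if x: "(x, x') \<in> Ar m" "(x', x'') \<in> Ar m" for x x' x''
        by (rule S_hom_eqI[OF SD.Comp_hom[OF h[OF x(1)] h[OF x(2)]] h[OF preordD(3)[OF preord_Ar x]]])
          (use is_diagD(6)[OF dG clamp_Ar[OF x(1) rr] clamp_Ar[OF x(2) rr]] x preordD(3)[OF preord_Ar x] in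
            \<open>simp add: meet_diag_simps S_Comp\<close>)
    qed
    show "fst (meet_diag m G) (i, i) = Zero (S m D)" if i: "i \<le> m" for i
    proof -
      have ii: "(i, i) \<in> Field (Ar m)" using i by (simp add: Field_Ar)
      have c: "clamp2 m (i, i) y = (i, i)" if "y \<in> Field (Ar m)" for y
        using that by (cases y) (auto simp: clamp_def Field_Ar)
      have "pull_diag (Ar m) (clamp2 m (i, i)) G = Zero (S m D)"
      proof (rule diag_eqI[OF S_ObjD(1)[OF row[OF ii]] S_ObjD(1)[OF SD.Zero_Obj]])
        show "fst (pull_diag (Ar m) (clamp2 m (i, i)) G) y = fst (Zero (S m D)) y" if "y \<in> Field (Ar m)" for y
          using that c[OF that] S_ObjD(2)[OF G i] by (simp add: pull_simps S_Zero const_diag_def)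
        show "snd (pull_diag (Ar m) (clamp2 m (i, i)) G) (y, y') = snd (Zero (S m D)) (y, y')" if "(y, y') \<in> Ar m" for y y'
          using that c[OF preordD(1)[OF preord_Ar that]] c[OF preordD(2)[OF preord_Ar that]] S_ObjD(2)[OF G i]
            is_diagD(5)[OF dG ii] by (simp add: pull_simps S_Zero const_diag_def)
      qed
      then show ?thesis using ii by (simp add: meet_diag_simps)
    qed
    fix i j k assume ijk: "i \<le> j" "j \<le> k" "k \<le> m"
    have A: "((i, j), (i, k)) \<in> Ar m" "((i, j), (j, j)) \<in> Ar m" "((i, k), (j, k)) \<in> Ar m" "((j, j), (j, k)) \<in> Ar m"
      using ijk by (auto simp: Ar_iff)
    show "snd (meet_diag m G) ((i, j), (i, k)) \<in> Cofib (S m D)"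
      unfolding S_Cofib
    proof (intro conjI allI impI)
      show "snd (meet_diag m G) ((i, j), (i, k)) \<in> Arr (S m D)" using h[OF A(1)] by (simp add: hom_def)
      fix j' k' assume jk: "j' \<le> k'" "k' \<le> m"
      have F: "(0, j') \<in> Field (Ar m)" "(0, k') \<in> Field (Ar m)" "((0, j'), (0, k')) \<in> Ar m"
        using jk by (auto simp: Field_Ar Ar_iff)
      have cl: "clamp m (i, l) 0 = i" "clamp m (i, l) j' = max i (min l j')" "clamp m (i, l) k' = max i (min l k')" if "i \<le> l" for l
        using jk that by (auto simp: clamp_def)
      have "cofsq D (snd G ((i, max i (min j j')), (i, max i (min j k')))) (snd G ((i, max i (min j j')), (i, max i (min k j'))))
        (snd G ((i, max i (min j k')), (i, max i (min k k')))) (snd G ((i, max i (min k j')), (i, max i (min k k'))))"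
      proof (cases "j \<le> j'")
        case True
        \<comment> \<open>one of the two edges at the initial corner is an identity, so the corner map is an arrow of \<open>G\<close>\<close>
        then have e: "min j k' = min j j'" using jk by simp
        show ?thesis unfolding e by (rule q) (use ijk jk in auto)
      next
        case False
        then have e: "min k j' = min j j'" using ijk by simp
        show ?thesis unfolding e by (rule cofsq_sym, rule q) (use ijk jk in auto)
      qed
      then show "cofsq D (snd (fst (snd (meet_diag m G) ((i, j), (i, k)))) ((0, j'), (0, k')))
         (cpt (snd (meet_diag m G) ((i, j), (i, k))) (0, j')) (cpt (snd (meet_diag m G) ((i, j), (i, k))) (0, k'))
         (snd (snd (snd (snd (meet_diag m G) ((i, j), (i, k))))) ((0, j'), (0, k')))"
        using A(1) F ijk by (simp add: meet_diag_simps pull_simps cl)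
    qed
    show "is_pushout (S m D) (snd (meet_diag m G) ((i, j), (i, k))) (snd (meet_diag m G) ((i, j), (j, j)))
      (snd (meet_diag m G) ((i, k), (j, k))) (snd (meet_diag m G) ((j, j), (j, k)))"
    proof (rule S_pushoutI[OF cofib_category_axioms h[OF A(1)] h[OF A(2)] h[OF A(3)] h[OF A(4)]])
      fix y assume y: "y \<in> Field (Ar m)"
      obtain s t where st: "y = (s, t)" "s \<le> t" "t \<le> m" using y by (cases y) (auto simp: Field_Ar)
      have cl: "clamp2 m (a, b) y = (max a (min b s), max a (min b t))" for a b using st by (simp add: clamp_def)
      let ?p = "\<lambda>a b. (max a (min b s), max a (min b t))"
      have pF: "?p a b \<in> Field (Ar m)" if "a \<le> m" for a b using that st by (auto simp: Field_Ar)
      have "is_pushout D (snd G (?p i j, ?p i k)) (snd G (?p i j, ?p j j)) (snd G (?p i k, ?p j k)) (snd G (?p j j, ?p j k))"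
      proof -
        \<comment> \<open>if \<open>j\<close> is not inside of \<open>y = (s, t)\<close>, two opposite edges are identities; otherwise this is a quotient
          in \<open>G\<close>\<close>
        consider "j \<le> s" | "t \<le> j" | "s < j" "j < t" by linarith
        then show ?thesis
        proof cases
          case 1
          then have e: "?p i j = (j, j)" "?p i k = ?p j k" "?p j j = (j, j)" using ijk st by auto
          have g: "snd G ((j, j), ?p j k) \<in> hom D (fst G (j, j)) (fst G (?p j k))"
            using S_arr(1)[OF G] 1 ijk st by simp
          have "snd G ((j, j), (j, j)) = Ident D (fst G (j, j))" "snd G (?p j k, ?p j k) = Ident D (fst G (?p j k))"
            using gi[of j j] is_diagD(5)[OF dG pF[of j k]] ijk by simp_all
          then show ?thesis using pushout_sym[OF pushout_Ident[OF g]] e by simp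
        next
          case 2
          then have e: "?p i k = ?p i j" "?p j k = (j, j)" "?p j j = (j, j)" using ijk st by auto
          have g: "snd G (?p i j, (j, j)) \<in> hom D (fst G (?p i j)) (fst G (j, j))"
            using S_arr(1)[OF G] 2 ijk st by simp
          have "snd G ((j, j), (j, j)) = Ident D (fst G (j, j))" "snd G (?p i j, ?p i j) = Ident D (fst G (?p i j))"
            using gi[of j j] is_diagD(5)[OF dG pF[of i j]] ijk by simp_all
          then show ?thesis using pushout_Ident[OF g] e by simp
        next
          case 3
          then have e: "?p i j = (max i s, j)" "?p i k = (max i s, min k t)" "?p j k = (j, min k t)" "?p j j = (j, j)"
            using ijk st by auto
          show ?thesis unfolding e by (rule S_ObjD(4)[OF G]) (use 3 ijk st in auto)
        qed
      qed
      then show "is_pushout D (cpt (snd (meet_diag m G) ((i, j), (i, k))) y) (cpt (snd (meet_diag m G) ((i, j), (j, j))) y)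
        (cpt (snd (meet_diag m G) ((i, k), (j, k))) y) (cpt (snd (meet_diag m G) ((j, j), (j, k))) y)"
        using A y by (simp add: meet_diag_simps cl)
    qed
  qed
qed

text \<open>The coproduct, over the zero object, of the extensions of \<open>a\<close> by zero along the two surjections
  \<open>[2] \<rightarrow> [1]\<close>. On \<open>(0,1)\<close> and on \<open>(1,2)\<close> one of the summands is zero, and the coproduct is chosen to be \<open>a\<close>.\<close>

lemma split_filtration:
  assumes a: "a \<in> Obj D"
  obtains G where "G \<in> Obj (S 2 D)" "fst G (0, 1) = a" "fst G (1, 2) = a"
proof -
  interpret SD: cofib_category "S 2 D" by (rule cofib_category_S)
  let ?d1 = "\<lambda>i \<in> {..2::nat}. if i < 1 then 0 else 1::nat" and ?d2 = "\<lambda>i \<in> {..2::nat}. if i < 2 then 0 else 1::nat"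
  have d: "?d1 \<in> Delta 2 1" "?d2 \<in> Delta 2 1" by (auto simp: Delta_def mono_on_def)
  let ?A = "jump_diag D 2 ?d1 a" and ?B = "jump_diag D 2 ?d2 a" and ?Z = "Zero (S 2 D)"
  have O: "?A \<in> Obj (S 2 D)" "?B \<in> Obj (S 2 D)" using jump_diag_Obj d a by blast+
  obtain f where f: "f \<in> hom (S 2 D) ?Z ?A" using SD.Zero_initial[OF O(1)] by blast
  obtain g where g: "g \<in> hom (S 2 D) ?Z ?B" using SD.Zero_initial[OF O(2)] by blast
  have fc: "f \<in> Cofib (S 2 D)" by (rule SD.Cofib_Zero[OF O(1) f])
  obtain u v Q where q: "u \<in> hom (S 2 D) ?A Q" "v \<in> hom (S 2 D) ?B Q"
    "\<And>x. x \<in> Field (Ar 2) \<Longrightarrow> is_pushout D (cpt f x) (cpt g x) (cpt u x) (cpt v x)"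
    using S_pushout_exists[OF fc f g] by metis
  have QO: "Q \<in> Obj (S 2 D)" using q(1) by (simp add: S_hom)
  have F: "(0, 1) \<in> Field (Ar 2)" "(1, 2) \<in> Field (Ar 2)" by (simp_all add: Field_Ar)
  have j: "jumps ?d1 (0, 1)" "\<not> jumps ?d1 (1, 2)" "\<not> jumps ?d2 (0, 1)" "jumps ?d2 (1, 2)" by (simp_all add: jumps_def)
  have z: "fst ?Z x = Zero D" if "x \<in> Field (Ar 2)" for x using that by (simp add: S_Zero const_diag_def)
  have AB: "fst ?A (0, 1) = a" "fst ?A (1, 2) = Zero D" "fst ?B (0, 1) = Zero D" "fst ?B (1, 2) = a"
    using F j by (simp_all add: jump_simps jump_obj_def)
  note fh = S_hom_comp(1)[OF f F(1)] S_hom_comp(1)[OF f F(2)] and gh = S_hom_comp(1)[OF g F(1)] S_hom_comp(1)[OF g F(2)]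
  have zi: "Ident D (Zero D) \<in> hom D (Zero D) (Zero D)" using Ident_hom Zero_Obj by simp
  have f12: "cpt f (1, 2) = Ident D (Zero D)"
    by (rule hom_from_Zero_eq[OF _ zi]) (use fh(2) z[OF F(2)] AB(2) in simp)
  have g01: "cpt g (0, 1) = Ident D (Zero D)"
    by (rule hom_from_Zero_eq[OF _ zi]) (use gh(1) z[OF F(1)] AB(3) in simp)
  define w where "w = (\<lambda>x. if x = (0, 1) then (Ident D a, cpt f x) else if x = (1, 2) then (cpt g x, Ident D a)
     else (cpt u x, cpt v x))"
  have w1: "is_pushout D (cpt f x) (cpt g x) (fst (w x)) (snd (w x))" if x: "x \<in> Field (Ar 2)" for x
  proof -
    have "is_pushout D (cpt f (0, 1)) (cpt g (0, 1)) (Ident D a) (cpt f (0, 1))"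
      using pushout_sym[OF pushout_Ident[of "cpt f (0, 1)" "Zero D" a]] fh(1) z F AB g01 by simp
    moreover have "is_pushout D (cpt f (1, 2)) (cpt g (1, 2)) (cpt g (1, 2)) (Ident D a)"
      using pushout_Ident[of "cpt g (1, 2)" "Zero D" a] gh(2) z F AB f12 by simp
    ultimately show ?thesis using q(3)[OF x] by (simp add: w_def)
  qed
  have w2: "Cod D (fst (w x)) = Zero D" if x: "x \<in> Field (Ar 2)" "fst x = snd x" for x
  proof -
    have "fst Q x = Zero D" using S_ObjD(2)[OF QO, of "fst x"] x by (cases x) (auto simp: Field_Ar)
    then have "Cod D (cpt u x) = Zero D" using S_hom_comp(1)[OF q(1) x(1)] by (simp add: hom_def)
    then show ?thesis using x(2) by (auto simp: w_def)
  qed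
  obtain u' v' G where G: "u' \<in> hom (S 2 D) ?A G" "\<And>x. x \<in> Field (Ar 2) \<Longrightarrow> fst G x = Cod D (fst (w x))"
    using S_pushout_choice[OF fc f g w1 w2] by metis
  have "Cod D (cpt g (1, 2)) = a" using gh(2) AB by (simp add: hom_def)
  then have "fst G (0, 1) = a" "fst G (1, 2) = a"
    using G(2)[OF F(1)] G(2)[OF F(2)] Ident_simps(3)[OF a] by (simp_all add: w_def)
  moreover have "G \<in> Obj (S 2 D)" using G(1) by (simp add: S_hom)
  ultimately show ?thesis using that by blast
qed

end

text \<open>For disjoint intervals the two results are different degenerate intervals, but at both of them a
  filtration is zero.\<close>

lemma clamp_sym:
  assumes x: "(x, x') \<in> Ar m" and y: "(y, y') \<in> Ar m"
  shows "clamp2 m x y = clamp2 m y x \<or>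
    (fst (clamp2 m x y) = snd (clamp2 m x y) \<and> fst (clamp2 m y x) = snd (clamp2 m y x))"
  using assms by (cases x; cases y; cases x'; cases y') (auto simp: clamp_def Ar_iff max_def min_def)

context waldhausen_category
begin

text \<open>The diagram \<open>(x, y) \<mapsto> G(x \<inter> y)\<close> for the split filtration \<open>G\<close>, as a constant chain.\<close>

lemma symmetric_simplex:
  assumes c: "c \<in> Obj C"
  obtains A where "A \<in> Spx (K C) 2 2" "K_act 2 2 (Transposition.transpose 0 1) A = A"
    "kob A 0 [(0, 1), (0, 1)] = c" "kob A 0 [(1, 2), (1, 2)] = c"
proof -
  let ?D = "S_iter C []" and ?m = "2::nat"
  interpret D: cofib_category ?D by (rule cofib_category_S_iter)
  have n: "[] \<in> Field (Ars [])" "([], []) \<in> Ars []" by (auto simp: Ars_Nil)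
  have c0: "const_diag (Ars []) C c \<in> Obj ?D"
    unfolding S_iter_Nil by (rule is_diag_const[OF preord_Ars c])
  obtain G where G: "G \<in> Obj (S ?m ?D)" "fst G (0, 1) = const_diag (Ars []) C c" "fst G (1, 2) = const_diag (Ars []) C c"
    using D.split_filtration[OF c0] .
  note dG = S_ObjD(1)[OF G(1)]
  let ?N = "meet_diag ?m G"
  let ?U = "uncurry_diag C ?m []" and ?Um = "uncurry_map C ?m []"
  define B where "B = uncurry_diag C ?m [?m] (S_fo ?m ?U ?Um ?N)"
  have B: "B \<in> Obj (S_iter C [?m, ?m])"
    unfolding B_def
    by (rule uncurry_Obj[OF exactD(1)[OF exact_S_map[OF exact_uncurry D.cofib_category_S cofib_category_S_iter] D.meet_diag_Obj[OF G(1)]]])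
  have r: "replicate 2 2 = [?m, ?m]" by (simp add: numeral_2_eq_2 replicate_Suc)
  have mem: "[x, y] \<in> Field (Ars [?m, ?m]) \<longleftrightarrow> x \<in> Field (Ar ?m) \<and> y \<in> Field (Ar ?m)"
    "([x, y], [x', y']) \<in> Ars [?m, ?m] \<longleftrightarrow> (x, x') \<in> Ar ?m \<and> (y, y') \<in> Ar ?m"
    "[x] \<in> Field (Ars [?m]) \<longleftrightarrow> x \<in> Field (Ar ?m)" "([x], [x']) \<in> Ars [?m] \<longleftrightarrow> (x, x') \<in> Ar ?m" for x y x' y'
    by (auto simp: Field_Ars_Cons Ars_Cons Ars_Nil)
  have Bo: "fst B [x, y] = fst (fst G (clamp2 ?m x y)) []" if "x \<in> Field (Ar ?m)" "y \<in> Field (Ar ?m)" for x y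
    using that n by (simp add: B_def uncurry_simps S_fo_simps mem meet_diag_simps pull_simps)
  have Ba: "snd B ([x, y], [x', y']) = cpt (snd G (clamp2 ?m x y, clamp2 ?m x' y')) []"
    if x: "(x, x') \<in> Ar ?m" and y: "(y, y') \<in> Ar ?m" for x x' y y'
  proof -
    note F = preordD(1,2)[OF preord_Ar x] preordD(1,2)[OF preord_Ar y]
    have rr: "(z, z) \<in> Ar ?m" if "z \<in> Field (Ar ?m)" for z using preordD(4)[OF preord_Ar that] .
    note ab = clamp_Ar[OF x rr[OF F(3)]] clamp_Ar[OF rr[OF F(2)] y]
    have e: "cpt (snd G (clamp2 ?m x y, clamp2 ?m x' y')) [] =
        cpt (snd G (clamp2 ?m x' y, clamp2 ?m x' y')) [] \<odot> cpt (snd G (clamp2 ?m x y, clamp2 ?m x' y)) []"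
      using arg_cong[OF is_diagD(6)[OF dG ab], of "\<lambda>t. cpt t []"] n by (simp add: S_iter_simps)
    have h: "cpt (snd G (clamp2 ?m x' y, clamp2 ?m x' y')) [] \<in> hom C (fst (fst G (clamp2 ?m x' y)) []) (fst (fst G (clamp2 ?m x' y')) [])"
      using S_iter_hom_comp(1)[OF is_diagD(4)[OF dG ab(2)] n(1)] .
    have i: "snd (fst G (clamp2 ?m x' y')) ([], []) = Ident C (fst (fst G (clamp2 ?m x' y')) [])"
      using is_diagD(5)[OF S_iter_Obj_diag[OF is_diagD(3)[OF dG preordD(2)[OF preord_Ar ab(2)]]] n(1)] .
    show ?thesis
      using x y F n by (simp add: B_def uncurry_simps S_fo_simps mem meet_diag_simps pull_simps i Comp_Ident_left[OF h] e)
  qed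
  interpret E: category "S_iter C (replicate 2 2)" by (rule category_S_iter_C)
  define A where "A = const_diag (ord ?m) (S_iter C (replicate 2 2)) B"
  have B': "B \<in> Obj (S_iter C (replicate 2 2))" using B by (simp add: r)
  have idw: "Ident (S_iter C (replicate 2 2)) B \<in> Weq (S_iter C (replicate 2 2))"
    unfolding weq_S_iter_pointwise
    using E.Ident_simps(1)[OF B'] Weq_iso Ident_iso is_diagD(3)[OF S_iter_Obj_diag[OF B']] by (simp add: S_iter_simps)
  have A: "A \<in> Spx (K C) 2 2"
    unfolding Spx_K A_def using E.is_diag_const[OF preord_ord B'] idw by (auto simp: const_diag_def)
  have Ao: "kob A i xs = fst B xs" if "i \<le> 2" for i xs using that by (simp add: A_def kob_def const_diag_def Field_ord)
  have Aa: "kar A i xs ys = snd B (xs, ys)" if "i \<le> 2" for i xs ys using that by (simp add: A_def kar_def const_diag_def Field_ord)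
  have Aw: "kwe A i j xs = Ident C (fst B xs)" if "i \<le> j" "j \<le> 2" "xs \<in> Field (Ars (replicate 2 2))" for i j xs
    using that by (simp add: A_def kwe_def const_diag_def ord_iff S_iter_simps)
  have two: "\<exists>x y. xs = [x, y]" if "xs \<in> Field (Ars (replicate 2 2))" for xs
    using length_Ars[OF that] by (auto simp: length_Suc_conv numeral_2_eq_2)
  have re: "reindex 2 (Transposition.transpose 0 (Suc 0)) [x, y] = [y, x]" for x y :: "nat \<times> nat"
    by (simp add: reindex_def numeral_2_eq_2)
  have Zd: "fst B [x, y] = Zero C" if xy: "x \<in> Field (Ar ?m)" "y \<in> Field (Ar ?m)" "fst (clamp2 ?m x y) = snd (clamp2 ?m x y)" for x y
  proof -
    have "clamp2 ?m x y \<in> Field (Ar ?m)"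
      using mono_Field[OF preord_Ar preord_Ar Delta_Ar[OF clamp_Delta[OF xy(1)]] xy(2)] .
    then obtain i where i: "i \<le> ?m" "clamp2 ?m x y = (i, i)"
      using xy(3) by (metis Field_Ar prod.collapse)
    show ?thesis unfolding Bo[OF xy(1,2)] i(2) S_ObjD(2)[OF G(1) i(1)] using n by (simp add: S_iter_simps const_diag_def)
  qed
  have so: "fst B [y, x] = fst B [x, y]" if "x \<in> Field (Ar ?m)" "y \<in> Field (Ar ?m)" for x y
    using clamp_sym[OF preordD(4)[OF preord_Ar that(1)] preordD(4)[OF preord_Ar that(2)]]
      Bo[OF that] Bo[OF that(2,1)] Zd[OF that] Zd[OF that(2,1)] by auto
  have dB: "is_diag (Ars [?m, ?m]) C B" by (rule S_iter_Obj_diag[OF B])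
  have sa: "snd B ([y, x], [y', x']) = snd B ([x, y], [x', y'])" if x: "(x, x') \<in> Ar ?m" and y: "(y, y') \<in> Ar ?m" for x x' y y'
  proof -
    note F = preordD(1,2)[OF preord_Ar x] preordD(1,2)[OF preord_Ar y]
    have h: "snd B ([x, y], [x', y']) \<in> hom C (fst B [x, y]) (fst B [x', y'])"
      "snd B ([y, x], [y', x']) \<in> hom C (fst B [x, y]) (fst B [x', y'])"
      using is_diagD(4)[OF dB, of "[x, y]" "[x', y']"] is_diagD(4)[OF dB, of "[y, x]" "[y', x']"] x y mem so F by auto
    show ?thesis
    proof (cases "fst B [x, y] = Zero C \<or> fst B [x', y'] = Zero C")
      case True
      then show ?thesis using hom_from_Zero_eq hom_to_Zero_eq h by metis
    next
      case False
      then have "clamp2 ?m x y = clamp2 ?m y x" "clamp2 ?m x' y' = clamp2 ?m y' x'"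
        using clamp_sym[OF x y] clamp_sym[OF preordD(4)[OF preord_Ar F(2)] preordD(4)[OF preord_Ar F(4)]]
          Zd[OF F(1,3)] Zd[OF F(2,4)] by auto
      then show ?thesis using Ba[OF x y] Ba[OF y x] by simp
    qed
  qed
  have tp: "Transposition.transpose 0 1 permutes {..<2::nat}" by (rule permutes_swap_id) auto
  have "K_act 2 2 (Transposition.transpose 0 1) A = A"
  proof (rule K_eqI[OF K_closed(3)[OF tp A] A])
    show "kob (K_act 2 2 (Transposition.transpose 0 1) A) i xs = kob A i xs"
      if i: "i \<le> 2" and xs: "xs \<in> Field (Ars (replicate 2 2))" for i xs
    proof -
      obtain x y where xy: "xs = [x, y]" using two[OF xs] by blast
      show ?thesis using xs so i unfolding xy by (simp add: K_act_simps(1)[OF i xs[unfolded xy]] Ao re r mem)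
    qed
    show "kwe (K_act 2 2 (Transposition.transpose 0 1) A) i j xs = kwe A i j xs"
      if i: "i \<le> j" "j \<le> 2" and xs: "xs \<in> Field (Ars (replicate 2 2))" for i j xs
    proof -
      obtain x y where xy: "xs = [x, y]" using two[OF xs] by blast
      show ?thesis using xs so i unfolding xy by (simp add: K_act_simps(3)[OF i xs[unfolded xy]] Aw re r mem)
    qed
    show "kar (K_act 2 2 (Transposition.transpose 0 1) A) i xs ys = kar A i xs ys"
      if i: "i \<le> 2" and xs: "(xs, ys) \<in> Ars (replicate 2 2)" for i xs ys
    proof -
      obtain x y where xy: "xs = [x, y]" using two[OF preordD(1)[OF preord_Ars xs]] by blast
      obtain x' y' where xy': "ys = [x', y']" using two[OF preordD(2)[OF preord_Ars xs]] by blast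
      show ?thesis using xs sa i unfolding xy xy' by (simp add: K_act_simps(2)[OF i xs[unfolded xy xy']] Aa re r mem)
    qed
  qed
  moreover have "kob A 0 [(0, 1), (0, 1)] = c" "kob A 0 [(1, 2), (1, 2)] = c"
    using Bo[of "(0, 1)" "(0, 1)"] Bo[of "(1, 2)" "(1, 2)"] G(2,3) n
    by (simp_all add: numeral_2_eq_2[symmetric] Ao Field_Ar clamp_def const_diag_def)
  ultimately show ?thesis using that A by blast
qed

text \<open>A simplex from the latching object is concentrated at some position. Here this would force the
  intervals \<open>(0,1)\<close> and \<open>(1,2)\<close> to contain the same jump.\<close>

theorem not_projective_K:
  assumes c: "c \<in> Obj C" "c \<noteq> Zero C"
  shows "\<not> projective (K C)"
proof
  assume proj: "projective (K C)"
  obtain A where A: "A \<in> Spx (K C) 2 2" "K_act 2 2 (Transposition.transpose 0 1) A = A"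
    "kob A 0 [(0, 1), (0, 1)] = c" "kob A 0 [(1, 2), (1, 2)] = c"
    using symmetric_simplex[OF c(1)] .
  have mem: "[(0, 1), (0, 1)] \<in> Field (Ars (replicate 2 2))" "[(1, 2), (1, 2)] \<in> Field (Ars (replicate 2 2))"
    by (auto simp: Field_Ars_replicate Field_Ar less_2_cases_iff)
  have "A \<notin> latching_map (K C) 2 2 ` latching (K C) 2 2"
  proof
    assume "A \<in> latching_map (K C) 2 2 ` latching (K C) 2 2"
    then obtain t where t: "t \<in> smash_tuples (K C) tsph 2 2" "A = val (K C) 2 2 t"
      unfolding symmetric_spectrum.latching_image[OF symmetric_spectrum_K] by blast
    obtain p q \<gamma> x s where T: "t = (p, q, \<gamma>, x, s)" by (cases t)
    show False
    proof (cases s)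
      case None
      then have "A = K_pt C 2 2"
        using t K_act_pt by (auto simp: T val_K_eq sigma_K_None smash_tuples_def Sym_def)
      then show False using A(3) c(2) K_pt_simps(1)[of 0 2 _ 2 C] mem(1) by simp
    next
      case (Some ds)
      then have n: "p + q = 2" and \<gamma>: "\<gamma> permutes {..<2}" and x: "x \<in> Spx (K C) p 2" and q: "0 < q"
        and ds: "Some ds \<in> sphere q 2"
        using t(1) Some_tuple unfolding T by auto
      let ?r = "\<gamma> (p + 0)" and ?d = "ds ! 0"
      have c0: "concentrated C 2 2 A ?r ?d" using concentrated_val[OF x ds \<gamma> n q] t(2) unfolding T Some by simp
      have r: "?r < 2" using permutes_less[OF \<gamma>, of p] n q by simp
      have e: "[(0, 1), (0, 1)] ! ?r = (0, 1)" "[(1, 2), (1, 2)] ! ?r = (1, 2)"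
        using r by (auto simp: less_2_cases_iff)
      have "jumps ?d ([(0, 1), (0, 1)] ! ?r)" by (rule ccontr) (use concentratedD(1)[OF c0 _ mem(1), of 0] A(3) c(2) in simp)
      moreover have "jumps ?d ([(1, 2), (1, 2)] ! ?r)" by (rule ccontr) (use concentratedD(1)[OF c0 _ mem(2), of 0] A(4) c(2) in simp)
      ultimately show False unfolding e by (simp add: jumps_def)
    qed
  qed
  moreover have "Transposition.transpose 0 1 \<in> Sym 2"
    unfolding Sym_def by (auto intro!: permutes_swap_id)
  ultimately have "Transposition.transpose 0 (1::nat) = id"
    using proj A(1,2) unfolding projective_def K_sel by blast
  then show False by (metis id_apply transpose_apply_first zero_neq_one)
qed

end

theorem theorem1:
  fixes C :: "('o, 'm) wcat"
  assumes "waldhausen_category C"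
  shows "symmetric_spectrum (K C) \<and> flat (K C) \<and>
         (Obj C \<noteq> {Zero C} \<longrightarrow> \<not> projective (K C))"
proof -
  interpret waldhausen_category C by (rule assms)
  show ?thesis using symmetric_spectrum_K flat_K not_projective_K Zero_Obj by blast
qed

end
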